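(* The tensor $$\tilde b=\sum_{i=1}^{2^{mn}}h_i'\,g_i^{*\prime}\in T_{m(n+1)}(V)\otimes T_{(m+1)n}(V^* )$$ generates a one-dimensional $GL\,V$-module such that $$\mathcal A(\tilde b)=\mathrm{Ber}\,A\cdot\tilde b$$ for every $\mathcal A\in GL\,V$, where $A$ is the matrix of $\mathcal A$.
   Context: **Setting.** $K$ is a field of characteristic zero and $G=G_0\oplus G_1$ is the Grassmann algebra over $K$ with a countable (infinite) set of generators, with its even part $G_0$ and odd part $G_1$. $V$ is a free $\mathbb Z_2$-graded $G$-module of dimension $m|n$, with a basis $e_1,\dots,e_m$ of even elements and $\varepsilon_1,\dots,\varepsilon_n$ of odd elements. It is a $G$-bimodule with compatible left and right structures: $av=(-1)^{|a||v|}va$ for homogeneous $a\in G$, $v\in V$. Put $\Omega=\{e_1,\dots,e_m,\varepsilon_1,\dots,\varepsilon_n\}$. $GL\,V$ is the group of invertible even (right) $G$-linear operators on $V$. It is identified with the group $GL_{m,n}$ of invertible block matrices $A=\begin{pmatrix}A_{11}&A_{12}\\ A_{21}&A_{22}\end{pmatrix}$, where $A_{11}$ ($m\times m$) and $A_{22}$ ($n\times n$) have entries in $G_0$ and $A_{12},A_{21}$ have entries in $G_1$: writing $(\vartheta_1,\dots,\vartheta_{m+n})=(e_1,\dots,e_m,\varepsilon_1,\dots,\varepsilon_n)$, the matrix $A=(a_{ij})$ of $\mathcal A$ is given by $\mathcal A(\vartheta_j)=\sum_i\vartheta_i a_{ij}$. The Berezinian is $\mathrm{Ber}\,A=\det(A_{11}-A_{12}A_{22}^{-1}A_{21})\det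 A_{22}^{-1}$. **Tensors.** $T_l(V)=V\otimes\cdots\otimes V$ ($l$ factors, over $G$; $T_0(V)=G$), the tensor sign being omitted. $GL\,V$ acts by $\mathcal A(v_1\cdots v_l)=\mathcal A(v_1)\cdots\mathcal A(v_l)$. The symmetric group $S_l$ acts on the left: for homogeneous $v_i$, $\sigma(v_1\cdots v_l)=(-1)^N v_{\sigma^{-1}(1)}\cdots v_{\sigma^{-1}(l)}$, where $N$ is the number of pairs $i<j$ with $\sigma(i)>\sigma(j)$ and $v_i,v_j$ both odd. For a partition $\lambda$ of $l$, $T=T_\lambda$ is the Young tableau of shape $\lambda$ filled with $1,\dots,l$ row by row, left to right and top to bottom. $R(T)$, $C(T)\subset S_l$ are its row and column stabilizers. The Young symmetrizer is $e_T=\sum_{\sigma\in C(T),\,\tau\in R(T)}\mathrm{sgn}(\sigma)\,\tau\sigma$. Put $\lambda_h=(n+1,\dots,n+1)$ ($m$ rows) and $\lambda_g=(n,\dots,n)$ ($m+1$ rows). **Canonical tensors.** A filling of $\lambda_h$ or $\lambda_g$ by elements of $\Omega$ defines the tensor $e_Tv_1\cdots v_l$, where $v_1,\dots,v_l$ is the filling read row by row. The filling is canonical if each $e_i$ occurs only in row $i$ and each $\varepsilon_j$ occurs only in column $j$. Thus each box $(i,j)$ of the small rectangle ($1\le i\le m$, $1\le j\le n$) contains $e_i$ or $\varepsilon_j$; box $(i,n+1)$ of $\lambda_h$ contains $e_i$; box $(m+1,j)$ of $\lambda_g$ contains $\varepsilon_j$. Let $h_1,\dots,h_{2^{mn}}$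 and $g_1,\dots,g_{2^{mn}}$ be the tensors of the canonical fillings of $\lambda_h$ and $\lambda_g$, numbered so that $h_i$ and $g_i$ have the same filling of the small rectangle. For a canonical tensor $f$, let $\kappa(f)$ be the product over the columns $j\le n$ of $(\text{number of }\varepsilon_j\text{ in column }j)!$ (the cardinality of the group of permutations of odd elements preserving the filling). Let $\rho(f)$ be the number of odd basis elements in the small rectangle. Put $$\alpha(h_i)=\frac{(-1)^{n\rho(h_i)}\kappa(h_i)}{\kappa(g_i)},\qquad h_i'=\frac{h_i}{\alpha(h_i)} .$$ **Dual tensors.** $V^*$ is the dual $G$-module with dual basis $\vartheta_i^*$, $(\vartheta_i^*,\vartheta_j)=\delta_{ij}$, where $\vartheta_i^*$ has the parity of $\vartheta_i$. Write $e_i^*=\vartheta_i^*$, $\varepsilon_j^*=\vartheta_{m+j}^*$. The pairing of $T_l(V^* )$ with $T_l(V)$ is given for homogeneous elements by $(u_1^*\cdots u_l^*,w_1\cdots w_l)=(-1)^\chi(u_1^*,w_1)\cdots(u_l^*,w_l)$, where $\chi$ is the number of pairs of odd elements changing their order in passing from $u_1^*,\dots,u_l^*,w_1,\dots,w_l$ to $u_1^*,w_1,\dots,u_l^*,w_l$. $S_l$ acts on $T_l(V^* )$ on the right by $(u_1^*\cdots u_l^* )\sigma=(-1)^{N'}u_{\sigma(1)}^*\cdots u_{\sigma(l)}^*$, where $N'$ is the number of pairs $i<j$ with $\sigma(i)>\sigma(j)$ and $u^*_{\sigma(i)},u^*_{\sigma(j)}$ both odd. $\mathcal A\in GL\,V$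 acts on $V^*$ by $(\mathcal A(\vartheta_i^* ),\mathcal A(\vartheta_j))=\delta_{ij}$, i.e. the column $(\mathcal A(\vartheta_i^* ))_i$ equals $A^{-1}$ times the column $(\vartheta_i^* )_i$. It acts factorwise on $T_l(V^* )$ and on products of tensors over $V$ and $V^*$: $\mathcal A(xy)=\mathcal A(x)\mathcal A(y)$. If $g_i=e_T(w_1\cdots w_l)$ with $w_k\in\Omega$ the canonical filling, put $g_i^*=(w_1^*\cdots w_l^* )e_T$. One has $(g_i^*,g_j)=0$ for $i\ne j$, and $(g_i^*,g_i)$ is a nonzero integer. Put $g_i^{*\prime}=\frac{1}{(g_i^*,g_i)}g_i^*$. *)

theory Defs
  imports
    "HOL-Library.FSet"
    "HOL-Library.FuncSet"
    "HOL-Library.Poly_Mapping"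
    "HOL-Combinatorics.Permutations"
    "Jordan_Normal_Form.Determinant"
begin


section \<open>Products of finitely supported functions\<close>

text \<open>Bilinear extension of a product given on monomials; both the Grassmann algebra and the
  tensor algebra below are obtained in this way.\<close>

definition pm_mult ::
  "('a \<Rightarrow> 'a \<Rightarrow> 'b::comm_monoid_add \<Rightarrow> 'b \<Rightarrow> ('a \<Rightarrow>\<^sub>0 'b)) \<Rightarrow> ('a \<Rightarrow>\<^sub>0 'b) \<Rightarrow> ('a \<Rightarrow>\<^sub>0 'b) \<Rightarrow> ('a \<Rightarrow>\<^sub>0 'b)"
  where "pm_mult \<phi> f g =
    (\<Sum>a\<in>Poly_Mapping.keys f. \<Sum>b\<in>Poly_Mapping.keys g.
       \<phi> a b (Poly_Mapping.lookup f a) (Poly_Mapping.lookup g b))"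

definition biadditive_kernel ::
  "('a \<Rightarrow> 'a \<Rightarrow> 'b::comm_monoid_add \<Rightarrow> 'b \<Rightarrow> ('a \<Rightarrow>\<^sub>0 'b)) \<Rightarrow> bool"
  where "biadditive_kernel \<phi> \<longleftrightarrow>
    (\<forall>a b x. \<phi> a b 0 x = 0 \<and> \<phi> a b x 0 = 0) \<and>
    (\<forall>a b x y z. \<phi> a b (x + y) z = \<phi> a b x z + \<phi> a b y z \<and> \<phi> a b x (y + z) = \<phi> a b x y + \<phi> a b x z)"

lemma pm_sum_singles:
  "f = (\<Sum>a\<in>Poly_Mapping.keys f. Poly_Mapping.single a (Poly_Mapping.lookup f a))"
proof (rule poly_mapping_eqI)
  fix k
  show "Poly_Mapping.lookup f k = Poly_Mapping.lookup
     (\<Sum>a\<in>Poly_Mapping.keys f. Poly_Mapping.single a (Poly_Mapping.lookup f a)) k"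
    by (auto simp: lookup_sum lookup_single when_def in_keys_iff)
qed

lemma pm_add_induct [case_names zero single add]:
  fixes f :: "'a \<Rightarrow>\<^sub>0 'b::comm_monoid_add"
  assumes "P 0" "\<And>a b. P (Poly_Mapping.single a b)" "\<And>f g. P f \<Longrightarrow> P g \<Longrightarrow> P (f + g)"
  shows "P f"
proof -
  have "P (\<Sum>a\<in>A. Poly_Mapping.single a (Poly_Mapping.lookup f a))" if "finite A" for A
    using that by induction (auto intro: assms)
  then show ?thesis by (metis finite_keys pm_sum_singles)
qed

lemma pm_mult_superset:
  assumes "biadditive_kernel \<phi>" "finite A" "finite B" "Poly_Mapping.keys f \<subseteq> A" "Poly_Mapping.keys g \<subseteq> B"
  shows "pm_mult \<phi> f g = (\<Sum>a\<in>A. \<Sum>b\<in>B. \<phi> a b (Poly_Mapping.lookup f a) (Poly_Mapping.lookup g b))"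
proof -
  have "(\<Sum>b\<in>Poly_Mapping.keys g. \<phi> a b x (Poly_Mapping.lookup g b)) =
        (\<Sum>b\<in>B. \<phi> a b x (Poly_Mapping.lookup g b))" for a x
    by (rule sum.mono_neutral_left)
       (use assms in \<open>auto simp: in_keys_iff biadditive_kernel_def\<close>)
  then have "pm_mult \<phi> f g =
      (\<Sum>a\<in>Poly_Mapping.keys f. \<Sum>b\<in>B. \<phi> a b (Poly_Mapping.lookup f a) (Poly_Mapping.lookup g b))"
    by (simp add: pm_mult_def)
  also have "\<dots> = (\<Sum>a\<in>A. \<Sum>b\<in>B. \<phi> a b (Poly_Mapping.lookup f a) (Poly_Mapping.lookup g b))"
    by (rule sum.mono_neutral_left)
       (use assms in \<open>auto simp: in_keys_iff biadditive_kernel_def\<close>)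
  finally show ?thesis .
qed

lemma pm_mult_zero:
  "pm_mult \<phi> 0 g = 0" "pm_mult \<phi> f 0 = 0"
  by (simp_all add: pm_mult_def)

lemma pm_mult_add:
  assumes "biadditive_kernel \<phi>"
  shows "pm_mult \<phi> (f + f') g = pm_mult \<phi> f g + pm_mult \<phi> f' g"
    and "pm_mult \<phi> f (g + g') = pm_mult \<phi> f g + pm_mult \<phi> f g'"
proof -
  let ?A = "Poly_Mapping.keys f \<union> Poly_Mapping.keys f'" and ?B = "Poly_Mapping.keys g \<union> Poly_Mapping.keys g'"
  show "pm_mult \<phi> (f + f') g = pm_mult \<phi> f g + pm_mult \<phi> f' g"
    using assms keys_add[of f f']
    by (subst (1 2 3) pm_mult_superset[of _ ?A ?B])
       (auto simp: lookup_add biadditive_kernel_def sum.distrib)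
  show "pm_mult \<phi> f (g + g') = pm_mult \<phi> f g + pm_mult \<phi> f g'"
    using assms keys_add[of g g']
    by (subst (1 2 3) pm_mult_superset[of _ ?A ?B])
       (auto simp: lookup_add biadditive_kernel_def sum.distrib)
qed

lemma pm_mult_single:
  assumes "biadditive_kernel \<phi>"
  shows "pm_mult \<phi> (Poly_Mapping.single a x) (Poly_Mapping.single b y) = \<phi> a b x y"
  by (subst pm_mult_superset[of _ "{a}" "{b}"]) (use assms in auto)

lemma pm_mult_assoc:
  assumes \<phi>: "biadditive_kernel \<phi>"
    and ass: "\<And>a b c x y z. pm_mult \<phi> (\<phi> a b x y) (Poly_Mapping.single c z)
                = pm_mult \<phi> (Poly_Mapping.single a x) (\<phi> b c y z)"
  shows "pm_mult \<phi> (pm_mult \<phi> f g) h = pm_mult \<phi> f (pm_mult \<phi> g h)"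
proof (induction f rule: pm_add_induct)
  case (single a x)
  show ?case
  proof (induction g rule: pm_add_induct)
    case (single b y)
    show ?case
    proof (induction h rule: pm_add_induct)
      case (single c z)
      show ?case by (simp add: pm_mult_single[OF \<phi>] ass)
    qed (simp_all add: pm_mult_zero pm_mult_add[OF \<phi>])
  qed (simp_all add: pm_mult_zero pm_mult_add[OF \<phi>])
qed (simp_all add: pm_mult_zero pm_mult_add[OF \<phi>])


section \<open>The Grassmann algebra on generators indexed by \<open>nat\<close>\<close>

text \<open>The basis monomial attached to a finite set \<open>S\<close> of indices is the product of the generators
  \<open>\<xi>\<^sub>s\<close>, \<open>s \<in> S\<close>, in increasing order of \<open>s\<close>.\<close>

typedef (overloaded) 'k grassmann = "UNIV :: (nat fset \<Rightarrow>\<^sub>0 'k::zero) set"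
  morphisms rep_grassmann Grassmann ..

setup_lifting type_definition_grassmann

definition gcoeff :: "'k::zero grassmann \<Rightarrow> nat fset \<Rightarrow> 'k"
  where "gcoeff a = Poly_Mapping.lookup (rep_grassmann a)"

definition inversions :: "nat fset \<Rightarrow> nat fset \<Rightarrow> nat"
  where "inversions S T = card {(s, t). s |\<in>| S \<and> t |\<in>| T \<and> t < s}"

definition gkernel :: "nat fset \<Rightarrow> nat fset \<Rightarrow> 'k \<Rightarrow> 'k \<Rightarrow> (nat fset \<Rightarrow>\<^sub>0 'k::comm_ring_1)"
  where "gkernel S T x y =
    (if S |\<inter>| T = {||} then Poly_Mapping.single (S |\<union>| T) ((- 1) ^ inversions S T * x * y) else 0)"

lemma inversions_finite: "finite {(s, t). s |\<in>| S \<and> t |\<in>| T \<and> t < (s::nat)}"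
  by (rule finite_subset[of _ "fset S \<times> fset T"]) auto

lemma inversions_empty [simp]: "inversions {||} T = 0" "inversions S {||} = 0"
  by (auto simp: inversions_def)

lemma inversions_union_left:
  assumes "S |\<inter>| T = {||}"
  shows "inversions (S |\<union>| T) U = inversions S U + inversions T U"
proof -
  have "{(s, t). s |\<in>| S |\<union>| T \<and> t |\<in>| U \<and> t < s} =
     {(s, t). s |\<in>| S \<and> t |\<in>| U \<and> t < s} \<union> {(s, t). s |\<in>| T \<and> t |\<in>| U \<and> t < s}" by auto
  then show ?thesis unfolding inversions_def
    by (subst card_Un_disjoint[symmetric]) (use assms in \<open>auto simp: inversions_finite\<close>)
qed

lemma inversions_union_right:
  assumes "T |\<inter>| U = {||}"
  shows "inversions S (T |\<union>| U) = inversions S T + inversions S U"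
proof -
  have "{(s, t). s |\<in>| S \<and> t |\<in>| T |\<union>| U \<and> t < s} =
     {(s, t). s |\<in>| S \<and> t |\<in>| T \<and> t < s} \<union> {(s, t). s |\<in>| S \<and> t |\<in>| U \<and> t < s}" by auto
  then show ?thesis unfolding inversions_def
    by (subst card_Un_disjoint[symmetric]) (use assms in \<open>auto simp: inversions_finite\<close>)
qed

lemma inversions_swap:
  assumes "S |\<inter>| T = {||}"
  shows "inversions S T + inversions T S = fcard S * fcard T"
proof -
  let ?A = "{(s, t). s |\<in>| S \<and> t |\<in>| T \<and> t < s}"
  let ?B = "{(s, t). s |\<in>| S \<and> t |\<in>| T \<and> s < t}"
  have "{(s, t). s |\<in>| T \<and> t |\<in>| S \<and> t < s} = prod.swap ` ?B"
    by (auto simp: image_iff)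
  then have "inversions T S = card ?B"
    by (simp add: inversions_def card_image)
  moreover have finB: "finite ?B"
    by (rule finite_subset[of _ "fset S \<times> fset T"]) auto
  moreover have "?A \<inter> ?B = {}"
    by (rule equals0I) auto
  then have "card (?A \<union> ?B) = card ?A + card ?B"
    by (rule card_Un_disjoint[OF inversions_finite finB])
  ultimately have "inversions S T + inversions T S = card (?A \<union> ?B)"
    by (simp only: inversions_def)
  moreover have "?A \<union> ?B = fset S \<times> fset T"
  proof -
    have "s \<noteq> t" if "s |\<in>| S" "t |\<in>| T" for s t
      using assms that by auto
    then show ?thesis by (auto simp: neq_iff)
  qed
  ultimately show ?thesis by (simp add: card_cartesian_product fcard.rep_eq)
qed

lemma gkernel_biadditive: "biadditive_kernel gkernel"
  by (auto simp: biadditive_kernel_def gkernel_def algebra_simps simp flip: single_add)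

lemma gkernel_assoc:
  "pm_mult gkernel (gkernel S T x y) (Poly_Mapping.single U z) =
   pm_mult gkernel (Poly_Mapping.single S x) (gkernel T U y z)"
proof (cases "S |\<inter>| T = {||} \<and> S |\<inter>| U = {||} \<and> T |\<inter>| U = {||}")
  case True
  then have "(S |\<union>| T) |\<inter>| U = {||}" "S |\<inter>| (T |\<union>| U) = {||}" by auto
  with True show ?thesis
    by (simp add: gkernel_def[of S T] gkernel_def[of T U] pm_mult_single[OF gkernel_biadditive])
       (simp add: gkernel_def inversions_union_left inversions_union_right power_add sup_assoc mult_ac)
next
  case False
  have "pm_mult gkernel (gkernel S T x y) (Poly_Mapping.single U z) = 0"
  proof (cases "S |\<inter>| T = {||}")
    case True
    with False have "(S |\<union>| T) |\<inter>| U \<noteq> {||}" by auto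
    then show ?thesis using True
      by (simp add: gkernel_def[of S T] pm_mult_single[OF gkernel_biadditive]) (simp add: gkernel_def)
  qed (simp add: gkernel_def pm_mult_zero)
  moreover have "pm_mult gkernel (Poly_Mapping.single S x) (gkernel T U y z) = 0"
  proof (cases "T |\<inter>| U = {||}")
    case True
    with False have "S |\<inter>| (T |\<union>| U) \<noteq> {||}" by auto
    then show ?thesis using True
      by (simp add: gkernel_def[of T U] pm_mult_single[OF gkernel_biadditive]) (simp add: gkernel_def)
  qed (simp add: gkernel_def pm_mult_zero)
  ultimately show ?thesis by simp
qed

lemma gkernel_one:
  "pm_mult gkernel (Poly_Mapping.single {||} 1) f = f"
  "pm_mult gkernel f (Poly_Mapping.single {||} 1) = f"
proof -
  show "pm_mult gkernel (Poly_Mapping.single {||} 1) f = f"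
    by (induction f rule: pm_add_induct)
       (simp_all add: pm_mult_zero pm_mult_single[OF gkernel_biadditive] pm_mult_add[OF gkernel_biadditive],
        simp add: gkernel_def)
  show "pm_mult gkernel f (Poly_Mapping.single {||} 1) = f"
    by (induction f rule: pm_add_induct)
       (simp_all add: pm_mult_zero pm_mult_single[OF gkernel_biadditive] pm_mult_add[OF gkernel_biadditive],
        simp add: gkernel_def)
qed

instantiation grassmann :: (zero) zero
begin
lift_definition zero_grassmann :: "'a grassmann" is 0 .
instance ..
end

instantiation grassmann :: (comm_ring_1) ring_1
begin
lift_definition one_grassmann :: "'a grassmann" is "Poly_Mapping.single {||} 1" .
lift_definition plus_grassmann :: "'a grassmann \<Rightarrow> 'a grassmann \<Rightarrow> 'a grassmann" is "(+)" .
lift_definition minus_grassmann :: "'a grassmann \<Rightarrow> 'a grassmann \<Rightarrow> 'a grassmann" is "(-)" .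
lift_definition uminus_grassmann :: "'a grassmann \<Rightarrow> 'a grassmann" is uminus .
lift_definition times_grassmann :: "'a grassmann \<Rightarrow> 'a grassmann \<Rightarrow> 'a grassmann" is "pm_mult gkernel" .
instance
proof
  fix a b c :: "'a grassmann"
  show "a + b + c = a + (b + c)" "a + b = b + a" "0 + a = a" "- a + a = 0" "a - b = a + - b"
    by (transfer; simp add: ac_simps)+
  show "a * b * c = a * (b * c)"
    by transfer (rule pm_mult_assoc[OF gkernel_biadditive gkernel_assoc])
  show "1 * a = a" "a * 1 = a"
    by (transfer, rule gkernel_one)+
  show "(a + b) * c = a * c + b * c" "a * (b + c) = a * b + a * c"
    by (transfer, rule pm_mult_add[OF gkernel_biadditive])+
  show "(0::'a grassmann) \<noteq> 1"
    by transfer (metis lookup_single_eq lookup_zero zero_neq_one)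
qed
end

text \<open>\<open>G_grade p\<close> is \<open>G\<^sub>0\<close> for even \<open>p\<close> and \<open>G\<^sub>1\<close> for odd \<open>p\<close>.\<close>

definition G_grade :: "nat \<Rightarrow> 'k::zero grassmann set"
  where "G_grade p = {a. \<forall>S. gcoeff a S \<noteq> 0 \<longrightarrow> even (fcard S + p)}"

definition gconst :: "'k::zero \<Rightarrow> 'k grassmann"
  where "gconst c = Grassmann (Poly_Mapping.single {||} c)"

definition gbody :: "'k::zero grassmann \<Rightarrow> 'k"
  where "gbody a = gcoeff a {||}"

text \<open>The parity automorphism \<open>a \<mapsto> (-1)\<^bsup>|a|\<^esup> a\<close>.\<close>

definition pm_invol :: "(nat fset \<Rightarrow>\<^sub>0 'k) \<Rightarrow> (nat fset \<Rightarrow>\<^sub>0 'k::comm_ring_1)"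
  where "pm_invol = Poly_Mapping.mapp (\<lambda>S x. (- 1) ^ fcard S * x)"

lift_definition ginvol :: "'k::comm_ring_1 grassmann \<Rightarrow> 'k grassmann" is pm_invol .

lemma pm_invol_lookup: "Poly_Mapping.lookup (pm_invol f) S = (- 1) ^ fcard S * Poly_Mapping.lookup f S"
  by (auto simp: pm_invol_def lookup_mapp when_def in_keys_iff)

lemma pm_invol_add: "pm_invol (f + g) = pm_invol f + pm_invol g"
  by (rule poly_mapping_eqI) (simp add: pm_invol_lookup lookup_add distrib_left)

lemma pm_invol_zero: "pm_invol 0 = 0"
  by (rule poly_mapping_eqI) (simp add: pm_invol_lookup)

lemma pm_invol_single: "pm_invol (Poly_Mapping.single S x) = Poly_Mapping.single S ((- 1) ^ fcard S * x)"
  by (rule poly_mapping_eqI) (simp add: pm_invol_lookup lookup_single when_def)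

lemma fcard_funion_disjoint:
  assumes "S |\<inter>| T = {||}"
  shows "fcard (S |\<union>| T) = fcard S + fcard T"
  using assms by (metis card_Un_disjoint fcard.rep_eq finite_fset inf_fset.rep_eq sup_fset.rep_eq bot_fset.rep_eq)

lemma pm_invol_mult: "pm_invol (pm_mult gkernel f g) = pm_mult gkernel (pm_invol f) (pm_invol g)"
proof (induction f rule: pm_add_induct)
  case (single S x)
  show ?case
  proof (induction g rule: pm_add_induct)
    case (single T y)
    have "pm_invol (gkernel S T x y) = gkernel S T ((- 1) ^ fcard S * x) ((- 1) ^ fcard T * y)"
      by (auto simp: gkernel_def pm_invol_single pm_invol_zero fcard_funion_disjoint power_add mult_ac)
    then show ?case
      by (simp add: pm_invol_single pm_mult_single[OF gkernel_biadditive])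
  qed (simp_all add: pm_mult_zero pm_invol_zero pm_invol_add pm_mult_add[OF gkernel_biadditive])
qed (simp_all add: pm_mult_zero pm_invol_zero pm_invol_add pm_mult_add[OF gkernel_biadditive])

lemma ginvol_simps [simp]:
  "ginvol (a + b) = ginvol a + ginvol b" "ginvol 0 = 0" "ginvol 1 = 1"
  "ginvol (a * b) = ginvol a * ginvol b"
  by (transfer, simp add: pm_invol_add pm_invol_zero pm_invol_single pm_invol_mult fcard.rep_eq)+

lemma ginvol_power_simps [simp]:
  "(ginvol ^^ p) 0 = 0" "(ginvol ^^ p) 1 = 1"
  "(ginvol ^^ p) (a + b) = (ginvol ^^ p) a + (ginvol ^^ p) b"
  "(ginvol ^^ p) (a * b) = (ginvol ^^ p) a * (ginvol ^^ p) b"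
  by (induction p) simp_all


lemma gkernel_commute:
  assumes "even (fcard S)"
  shows "gkernel S T x y = gkernel T S y x"
proof (cases "S |\<inter>| T = {||}")
  case True
  have "even (inversions S T + inversions T S)"
    using assms by (simp add: inversions_swap[OF True])
  then have "(- 1) ^ inversions S T = ((- 1) ^ inversions T S :: 'a)"
    by (auto simp: minus_one_power_iff)
  with True show ?thesis
    by (simp add: gkernel_def inf_commute sup_commute mult_ac)
qed (auto simp: gkernel_def inf_commute)

lemma G_even_commute:
  assumes "a \<in> G_grade 0"
  shows "a * b = b * a"
  using assms unfolding G_grade_def gcoeff_def mem_Collect_eq
proof transfer
  fix f g :: "nat fset \<Rightarrow>\<^sub>0 'a"
  assume "\<forall>S. Poly_Mapping.lookup f S \<noteq> 0 \<longrightarrow> even (fcard S + 0)"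
  then have "pm_mult gkernel f g = (\<Sum>S\<in>Poly_Mapping.keys f. \<Sum>T\<in>Poly_Mapping.keys g.
      gkernel T S (Poly_Mapping.lookup g T) (Poly_Mapping.lookup f S))"
    unfolding pm_mult_def by (intro sum.cong gkernel_commute) (auto simp: in_keys_iff)
  also have "\<dots> = pm_mult gkernel g f"
    unfolding pm_mult_def by (rule sum.swap)
  finally show "pm_mult gkernel f g = pm_mult gkernel g f" .
qed

lemma G_even_zero: "0 \<in> G_grade 0"
  by (simp add: G_grade_def gcoeff_def zero_grassmann.rep_eq)

lemma G_even_one: "1 \<in> G_grade 0"
  by (auto simp: G_grade_def gcoeff_def one_grassmann.rep_eq lookup_single when_def fcard.rep_eq)

lemma G_even_add: "a \<in> G_grade 0 \<Longrightarrow> b \<in> G_grade 0 \<Longrightarrow> a + b \<in> G_grade 0"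
  by (simp add: G_grade_def gcoeff_def plus_grassmann.rep_eq lookup_add) (metis add_0)

lemma G_even_uminus: "a \<in> G_grade 0 \<Longrightarrow> - a \<in> G_grade 0"
  by (simp add: G_grade_def gcoeff_def uminus_grassmann.rep_eq)

lemma G_even_mult:
  assumes "a \<in> G_grade 0" "b \<in> G_grade 0"
  shows "a * b \<in> G_grade 0"
  unfolding G_grade_def gcoeff_def mem_Collect_eq
proof (intro allI impI)
  fix U
  let ?f = "rep_grassmann a" and ?g = "rep_grassmann b"
  assume "Poly_Mapping.lookup (rep_grassmann (a * b)) U \<noteq> 0"
  then have "(\<Sum>S\<in>Poly_Mapping.keys ?f. \<Sum>T\<in>Poly_Mapping.keys ?g.
      Poly_Mapping.lookup (gkernel S T (Poly_Mapping.lookup ?f S) (Poly_Mapping.lookup ?g T)) U) \<noteq> 0"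
    by (simp add: times_grassmann.rep_eq pm_mult_def lookup_sum)
  then obtain S T where ST: "S \<in> Poly_Mapping.keys ?f" "T \<in> Poly_Mapping.keys ?g"
    and "Poly_Mapping.lookup (gkernel S T (Poly_Mapping.lookup ?f S) (Poly_Mapping.lookup ?g T)) U \<noteq> 0"
    by (meson sum.not_neutral_contains_not_neutral)
  then have "S |\<inter>| T = {||}" "U = S |\<union>| T"
    by (auto simp: gkernel_def lookup_single when_def split: if_splits)
  with ST assms show "even (fcard U + 0)"
    by (simp add: G_grade_def gcoeff_def fcard_funion_disjoint in_keys_iff)
qed


section \<open>The commutative ring \<open>G\<^sub>0\<close>\<close>

text \<open>The even part as a type of its own, so that the library determinant applies to it.\<close>

typedef (overloaded) 'k geven = "G_grade 0 :: 'k::comm_ring_1 grassmann set"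
  morphisms of_geven Geven
  by (rule exI[of _ 0]) (rule G_even_zero)

setup_lifting type_definition_geven

instantiation geven :: (comm_ring_1) comm_ring_1
begin
lift_definition zero_geven :: "'a geven" is 0 by (rule G_even_zero)
lift_definition one_geven :: "'a geven" is 1 by (rule G_even_one)
lift_definition plus_geven :: "'a geven \<Rightarrow> 'a geven \<Rightarrow> 'a geven" is "(+)" by (rule G_even_add)
lift_definition uminus_geven :: "'a geven \<Rightarrow> 'a geven" is uminus by (rule G_even_uminus)
lift_definition minus_geven :: "'a geven \<Rightarrow> 'a geven \<Rightarrow> 'a geven" is "(-)"
  by (metis G_even_add G_even_uminus diff_conv_add_uminus)
lift_definition times_geven :: "'a geven \<Rightarrow> 'a geven \<Rightarrow> 'a geven" is "(*)" by (rule G_even_mult)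
instance
  by standard (transfer; simp add: algebra_simps G_even_commute)+
end



section \<open>The tensor algebra of \<open>V \<oplus> V\<^sup>*\<close> over \<open>G\<close>\<close>

text \<open>\<open>Ev i\<close> is \<open>e\<^bsub>i+1\<^esub>\<close> and \<open>Od j\<close> is \<open>\<epsilon>\<^bsub>j+1\<^esub>\<close>: all indices (of basis elements, rows, columns,
  boxes and tensor factors) start from \<open>0\<close>. \<open>Vec b\<close> is the basis element \<open>b\<close> of \<open>V\<close> and \<open>Cov b\<close> the
  element \<open>b\<^sup>*\<close> of the dual basis of \<open>V\<^sup>*\<close>.\<close>

datatype basis = Ev nat | Od nat

datatype letter = Vec basis | Cov basis

primrec is_odd :: "basis \<Rightarrow> bool" where
  "is_odd (Ev i) = False"
| "is_odd (Od j) = True"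

primrec letter_odd :: "letter \<Rightarrow> bool" where
  "letter_odd (Vec b) = is_odd b"
| "letter_odd (Cov b) = is_odd b"

definition nodd :: "letter list \<Rightarrow> nat"
  where "nodd w = length (filter letter_odd w)"

lemma nodd_simps [simp]: "nodd [] = 0" "nodd (u @ v) = nodd u + nodd v"
  by (simp_all add: nodd_def)

text \<open>An element of the tensor algebra is a finite sum of \<open>w a\<close> with \<open>w\<close> a word and \<open>a \<in> G\<close> a
  coefficient on the right. Moving \<open>a\<close> through \<open>v\<close> according to \<open>a v = (-1)\<^bsup>|a||v|\<^esup> v a\<close> gives
  \<open>(u a) (v b) = u v (ginvol\<^bsup>|v|\<^esup> a) b\<close>. The tensors over \<open>G\<close> of length \<open>0\<close> are the elements of
  \<open>G\<close> (the empty word).\<close>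

typedef (overloaded) 'k tensor = "UNIV :: (letter list \<Rightarrow>\<^sub>0 'k::zero grassmann) set"
  morphisms rep_tensor Tensor ..

setup_lifting type_definition_tensor

definition tkernel ::
  "letter list \<Rightarrow> letter list \<Rightarrow> 'k grassmann \<Rightarrow> 'k grassmann \<Rightarrow> (letter list \<Rightarrow>\<^sub>0 'k::comm_ring_1 grassmann)"
  where "tkernel u v a b = Poly_Mapping.single (u @ v) ((ginvol ^^ nodd v) a * b)"

lemma tkernel_biadditive: "biadditive_kernel tkernel"
  by (auto simp: biadditive_kernel_def tkernel_def algebra_simps simp flip: single_add)

lemma tkernel_assoc:
  "pm_mult tkernel (tkernel u v a b) (Poly_Mapping.single w c) =
   pm_mult tkernel (Poly_Mapping.single u a) (tkernel v w b c)"
proof -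
  have "(ginvol ^^ nodd w) ((ginvol ^^ nodd v) a) = (ginvol ^^ (nodd v + nodd w)) a"
    by (simp only: add.commute[of "nodd v"] funpow_add o_apply)
  then show ?thesis
    by (simp add: tkernel_def[of u v] tkernel_def[of v w] pm_mult_single[OF tkernel_biadditive])
       (simp add: tkernel_def mult.assoc)
qed

lemma tkernel_one:
  "pm_mult tkernel (Poly_Mapping.single [] 1) f = f"
  "pm_mult tkernel f (Poly_Mapping.single [] 1) = f"
  by (induction f rule: pm_add_induct)
     (simp_all add: pm_mult_zero pm_mult_single[OF tkernel_biadditive] pm_mult_add[OF tkernel_biadditive]
        tkernel_def[of "[]"] tkernel_def[of _ "[]"])

instantiation tensor :: (comm_ring_1) ring_1
begin
lift_definition zero_tensor :: "'a tensor" is 0 .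
lift_definition one_tensor :: "'a tensor" is "Poly_Mapping.single [] 1" .
lift_definition plus_tensor :: "'a tensor \<Rightarrow> 'a tensor \<Rightarrow> 'a tensor" is "(+)" .
lift_definition minus_tensor :: "'a tensor \<Rightarrow> 'a tensor \<Rightarrow> 'a tensor" is "(-)" .
lift_definition uminus_tensor :: "'a tensor \<Rightarrow> 'a tensor" is uminus .
lift_definition times_tensor :: "'a tensor \<Rightarrow> 'a tensor \<Rightarrow> 'a tensor" is "pm_mult tkernel" .
instance
proof
  fix a b c :: "'a tensor"
  show "a + b + c = a + (b + c)" "a + b = b + a" "0 + a = a" "- a + a = 0" "a - b = a + - b"
    by (transfer; simp add: ac_simps)+
  show "a * b * c = a * (b * c)"
    by transfer (rule pm_mult_assoc[OF tkernel_biadditive tkernel_assoc])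
  show "1 * a = a" "a * 1 = a"
    by (transfer, rule tkernel_one)+
  show "(a + b) * c = a * c + b * c" "a * (b + c) = a * b + a * c"
    by (transfer, rule pm_mult_add[OF tkernel_biadditive])+
  show "(0::'a tensor) \<noteq> 1"
    by transfer (metis lookup_single_eq lookup_zero zero_neq_one)
qed
end

definition tcoeff :: "'k::zero tensor \<Rightarrow> letter list \<Rightarrow> 'k grassmann"
  where "tcoeff x = Poly_Mapping.lookup (rep_tensor x)"

definition tsupp :: "'k::zero tensor \<Rightarrow> letter list set"
  where "tsupp x = Poly_Mapping.keys (rep_tensor x)"

definition scal :: "'k::comm_ring_1 grassmann \<Rightarrow> 'k tensor"
  where "scal a = Tensor (Poly_Mapping.single [] a)"

definition tword :: "letter list \<Rightarrow> 'k::comm_ring_1 tensor"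
  where "tword w = Tensor (Poly_Mapping.single w 1)"

text \<open>\<open>tensor_grade p\<close> consists of the even (\<open>p\<close> even) or odd (\<open>p\<close> odd) tensors.\<close>

definition tensor_grade :: "nat \<Rightarrow> 'k::zero tensor set"
  where "tensor_grade p = {x. \<forall>w. tcoeff x w \<in> G_grade (nodd w + p)}"

text \<open>The right \<open>G\<close>-linear map with the given values on words.\<close>

definition lin_ext :: "(letter list \<Rightarrow> 'k tensor) \<Rightarrow> 'k tensor \<Rightarrow> 'k::comm_ring_1 tensor"
  where "lin_ext F x = (\<Sum>w\<in>tsupp x. F w * scal (tcoeff x w))"

lemma tword_mult: "tword u * tword v = (tword (u @ v) :: 'k::comm_ring_1 tensor)"
  by (simp add: tword_def times_tensor.abs_eq pm_mult_single[OF tkernel_biadditive] tkernel_def)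

lemma scal_mult: "scal a * scal b = scal (a * b)"
  by (simp add: scal_def times_tensor.abs_eq pm_mult_single[OF tkernel_biadditive] tkernel_def)

lemma scal_commute: "scal a * tword w = tword w * scal ((ginvol ^^ nodd w) a)"
  by (simp add: scal_def tword_def times_tensor.abs_eq pm_mult_single[OF tkernel_biadditive] tkernel_def)

lemma lin_ext_tword: "lin_ext F (tword w) = F w"
  by (simp add: lin_ext_def tsupp_def tcoeff_def tword_def Tensor_inverse)
     (simp add: scal_def flip: one_tensor_def)


subsection \<open>The modules \<open>V\<close>, \<open>T\<^sub>l(V)\<close> and \<open>T\<^sub>p(V) \<otimes> T\<^sub>q(V\<^sup>*)\<close>\<close>

definition Omega :: "nat \<Rightarrow> nat \<Rightarrow> basis set"
  where "Omega m n = Ev ` {..<m} \<union> Od ` {..<n}"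

definition mixed_tensors :: "nat \<Rightarrow> nat \<Rightarrow> nat \<Rightarrow> nat \<Rightarrow> 'k::zero tensor set"
  where "mixed_tensors m n p q = {x. \<forall>w\<in>tsupp x. \<exists>us vs.
    w = map Vec us @ map Cov vs \<and> set us \<subseteq> Omega m n \<and> set vs \<subseteq> Omega m n \<and> length us = p \<and> length vs = q}"

definition Tpow :: "nat \<Rightarrow> nat \<Rightarrow> nat \<Rightarrow> 'k::zero tensor set"
  where "Tpow m n l = mixed_tensors m n l 0"

abbreviation Vspace :: "nat \<Rightarrow> nat \<Rightarrow> 'k::zero tensor set"
  where "Vspace m n \<equiv> Tpow m n 1"


section \<open>\<open>GL V\<close>, its matrices and the Berezinian\<close>

definition GL :: "nat \<Rightarrow> nat \<Rightarrow> ('k::comm_ring_1 tensor \<Rightarrow> 'k tensor) set"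
  where "GL m n = {\<A>. bij_betw \<A> (Vspace m n) (Vspace m n) \<and>
    (\<forall>x\<in>Vspace m n. \<forall>y\<in>Vspace m n. \<A> (x + y) = \<A> x + \<A> y) \<and>
    (\<forall>x\<in>Vspace m n. \<forall>a. \<A> (x * scal a) = \<A> x * scal a) \<and>
    (\<forall>p. \<forall>x\<in>Vspace m n \<inter> tensor_grade p. \<A> x \<in> tensor_grade p)}"

definition theta :: "nat \<Rightarrow> nat \<Rightarrow> basis"
  where "theta m i = (if i < m then Ev i else Od (i - m))"

primrec theta_index :: "nat \<Rightarrow> basis \<Rightarrow> nat" where
  "theta_index m (Ev i) = i"
| "theta_index m (Od j) = m + j"

definition matrix_of :: "nat \<Rightarrow> nat \<Rightarrow> ('k::comm_ring_1 tensor \<Rightarrow> 'k tensor) \<Rightarrow> 'k grassmann mat"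
  where "matrix_of m n \<A> =
    mat (m + n) (m + n) (\<lambda>(i, j). tcoeff (\<A> (tword [Vec (theta m j)])) [Vec (theta m i)])"

definition mat_inv :: "'a::semiring_1 mat \<Rightarrow> 'a mat"
  where "mat_inv A =
    (THE B. B \<in> carrier_mat (dim_row A) (dim_row A) \<and> inverts_mat A B \<and> inverts_mat B A)"

text \<open>The determinants are those of matrices over \<open>G\<^sub>0\<close>; \<open>Geven\<close> is applied to entries in \<open>G\<^sub>0\<close> only.\<close>

definition det_even :: "'k::comm_ring_1 grassmann mat \<Rightarrow> 'k grassmann"
  where "det_even A = of_geven (det (map_mat Geven A))"

definition Ber :: "nat \<Rightarrow> 'k::comm_ring_1 grassmann mat \<Rightarrow> 'k grassmann"
  where "Ber m A =
    (let (A11, A12, A21, A22) = split_block A m m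
     in det_even (A11 - A12 * mat_inv A22 * A21) * det_even (mat_inv A22))"

text \<open>The action on the tensor algebra is multiplicative; on \<open>V\<^sup>*\<close> it is
  \<open>\<A>(\<theta>\<^sub>i\<^sup>*) = \<Sum>\<^sub>j (A\<^sup>-\<^sup>1)\<^sub>i\<^sub>j \<theta>\<^sub>j\<^sup>*\<close>.\<close>

primrec GL_letter ::
  "nat \<Rightarrow> nat \<Rightarrow> ('k tensor \<Rightarrow> 'k tensor) \<Rightarrow> letter \<Rightarrow> 'k::comm_ring_1 tensor"
  where
  "GL_letter m n \<A> (Vec b) = \<A> (tword [Vec b])"
| "GL_letter m n \<A> (Cov b) =
     (\<Sum>j<m + n. scal (mat_inv (matrix_of m n \<A>) $$ (theta_index m b, j)) * tword [Cov (theta m j)])"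

definition GL_act ::
  "nat \<Rightarrow> nat \<Rightarrow> ('k tensor \<Rightarrow> 'k tensor) \<Rightarrow> 'k tensor \<Rightarrow> 'k::comm_ring_1 tensor"
  where "GL_act m n \<A> = lin_ext (\<lambda>w. prod_list (map (GL_letter m n \<A>) w))"

text \<open>Submodules of \<open>T\<^sub>p(V) \<otimes> T\<^sub>q(V\<^sup>*)\<close>: \<open>G\<close>-sub-bimodules stable under \<open>GL V\<close>.\<close>

definition GL_submodule :: "nat \<Rightarrow> nat \<Rightarrow> nat \<Rightarrow> nat \<Rightarrow> 'k::comm_ring_1 tensor set \<Rightarrow> bool"
  where "GL_submodule m n p q M \<longleftrightarrow>
    M \<subseteq> mixed_tensors m n p q \<and> 0 \<in> M \<and> (\<forall>x\<in>M. \<forall>y\<in>M. x + y \<in> M) \<and>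
    (\<forall>a. \<forall>x\<in>M. scal a * x \<in> M \<and> x * scal a \<in> M) \<and>
    (\<forall>\<A>\<in>GL m n. \<forall>x\<in>M. GL_act m n \<A> x \<in> M)"

definition GL_generated :: "nat \<Rightarrow> nat \<Rightarrow> nat \<Rightarrow> nat \<Rightarrow> 'k::comm_ring_1 tensor \<Rightarrow> 'k tensor set"
  where "GL_generated m n p q x = \<Inter>{M. GL_submodule m n p q M \<and> x \<in> M}"

text \<open>Free over \<open>G\<close> on one homogeneous basis element.\<close>

definition one_dimensional :: "'k::comm_ring_1 tensor set \<Rightarrow> bool"
  where "one_dimensional M \<longleftrightarrow>
    (\<exists>p. \<exists>v\<in>tensor_grade p. M = {scal a * v |a. True} \<and> (\<forall>a. scal a * v = 0 \<longrightarrow> a = 0))"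


section \<open>The symmetric group, Young symmetrizers and the pairing\<close>

definition perm_left :: "(nat \<Rightarrow> nat) \<Rightarrow> 'k::comm_ring_1 tensor \<Rightarrow> 'k tensor"
  where "perm_left \<sigma> = lin_ext (\<lambda>w.
    (- 1) ^ card {(i, j). i < j \<and> j < length w \<and> \<sigma> i > \<sigma> j \<and> letter_odd (w ! i) \<and> letter_odd (w ! j)}
    * tword (map (\<lambda>k. w ! inv_into UNIV \<sigma> k) [0..<length w]))"

definition perm_right :: "'k::comm_ring_1 tensor \<Rightarrow> (nat \<Rightarrow> nat) \<Rightarrow> 'k tensor"
  where "perm_right x \<sigma> = lin_ext (\<lambda>w.
    (- 1) ^ card {(i, j). i < j \<and> j < length w \<and> \<sigma> i > \<sigma> j \<and> letter_odd (w ! \<sigma> i) \<and> letter_odd (w ! \<sigma> j)}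
    * tword (map (\<lambda>k. w ! \<sigma> k) [0..<length w])) x"

text \<open>A partition is the list of its row lengths. In \<open>T\<^sub>\<lambda>\<close> the number \<open>k\<close> stands in the box
  \<open>boxes lam ! k\<close>.\<close>

definition boxes :: "nat list \<Rightarrow> (nat \<times> nat) list"
  where "boxes lam = concat (map (\<lambda>i. map (Pair i) [0..<lam ! i]) [0..<length lam])"

definition row_stabilizer :: "nat list \<Rightarrow> (nat \<Rightarrow> nat) set"
  where "row_stabilizer lam = {\<sigma>. \<sigma> permutes {..<length (boxes lam)} \<and>
    (\<forall>k<length (boxes lam). fst (boxes lam ! \<sigma> k) = fst (boxes lam ! k))}"

definition column_stabilizer :: "nat list \<Rightarrow> (nat \<Rightarrow> nat) set"
  where "column_stabilizer lam = {\<sigma>. \<sigma> permutes {..<length (boxes lam)} \<and>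
    (\<forall>k<length (boxes lam). snd (boxes lam ! \<sigma> k) = snd (boxes lam ! k))}"

definition young_left :: "nat list \<Rightarrow> 'k::comm_ring_1 tensor \<Rightarrow> 'k tensor"
  where "young_left lam x = (\<Sum>\<sigma>\<in>column_stabilizer lam. \<Sum>\<tau>\<in>row_stabilizer lam.
    of_int (sign \<sigma>) * perm_left (\<tau> \<circ> \<sigma>) x)"

definition young_right :: "nat list \<Rightarrow> 'k::comm_ring_1 tensor \<Rightarrow> 'k tensor"
  where "young_right lam x = (\<Sum>\<sigma>\<in>column_stabilizer lam. \<Sum>\<tau>\<in>row_stabilizer lam.
    of_int (sign \<sigma>) * perm_right x (\<tau> \<circ> \<sigma>))"

fun letter_pairing :: "letter \<Rightarrow> letter \<Rightarrow> 'k::comm_ring_1 grassmann" where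
  "letter_pairing (Cov b) (Vec c) = (if b = c then 1 else 0)"
| "letter_pairing _ _ = 0"

text \<open>In \<open>u\<^sub>0 \<dots> u\<^bsub>l-1\<^esub> w\<^sub>0 \<dots> w\<^bsub>l-1\<^esub>\<close> the elements \<open>u\<^sub>i\<close> and \<open>w\<^sub>j\<close> change their order iff \<open>j < i\<close>.\<close>

definition word_pairing :: "letter list \<Rightarrow> letter list \<Rightarrow> 'k::comm_ring_1 grassmann"
  where "word_pairing u w = (if length u = length w then
    (- 1) ^ card {(i, j). j < i \<and> i < length u \<and> letter_odd (u ! i) \<and> letter_odd (w ! j)}
    * prod_list (map2 letter_pairing u w) else 0)"

text \<open>\<open>(u a, w b) = (u, a w) b = (u, w) (ginvol\<^bsup>|w|\<^esup> a) b\<close>.\<close>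

definition pairing :: "'k::comm_ring_1 tensor \<Rightarrow> 'k tensor \<Rightarrow> 'k grassmann"
  where "pairing x y = (\<Sum>u\<in>tsupp x. \<Sum>w\<in>tsupp y.
    word_pairing u w * (ginvol ^^ nodd w) (tcoeff x u) * tcoeff y w)"


section \<open>Canonical tensors\<close>

definition lambda_h :: "nat \<Rightarrow> nat \<Rightarrow> nat list"
  where "lambda_h m n = replicate m (n + 1)"

definition lambda_g :: "nat \<Rightarrow> nat \<Rightarrow> nat list"
  where "lambda_g m n = replicate (m + 1) n"

definition canonical_fillings :: "nat \<Rightarrow> nat \<Rightarrow> nat list \<Rightarrow> (nat \<times> nat \<Rightarrow> basis) set"
  where "canonical_fillings m n lam = {\<phi> \<in> set (boxes lam) \<rightarrow>\<^sub>E Omega m n.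
    \<forall>(i, j)\<in>set (boxes lam). (\<forall>k. \<phi> (i, j) = Ev k \<longrightarrow> k = i) \<and> (\<forall>k. \<phi> (i, j) = Od k \<longrightarrow> k = j)}"

definition filling_tensor :: "nat list \<Rightarrow> (nat \<times> nat \<Rightarrow> basis) \<Rightarrow> 'k::comm_ring_1 tensor"
  where "filling_tensor lam \<phi> = young_left lam (tword (map (\<lambda>x. Vec (\<phi> x)) (boxes lam)))"

definition filling_cotensor :: "nat list \<Rightarrow> (nat \<times> nat \<Rightarrow> basis) \<Rightarrow> 'k::comm_ring_1 tensor"
  where "filling_cotensor lam \<phi> = young_right lam (tword (map (\<lambda>x. Cov (\<phi> x)) (boxes lam)))"

definition kappa :: "nat \<Rightarrow> nat list \<Rightarrow> (nat \<times> nat \<Rightarrow> basis) \<Rightarrow> nat"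
  where "kappa n lam \<phi> = (\<Prod>j<n. fact (card {i. (i, j) \<in> set (boxes lam) \<and> \<phi> (i, j) = Od j}))"

definition rho :: "nat \<Rightarrow> nat \<Rightarrow> (nat \<times> nat \<Rightarrow> basis) \<Rightarrow> nat"
  where "rho m n \<phi> = card {x \<in> {..<m} \<times> {..<n}. is_odd (\<phi> x)}"

text \<open>The pairs of fillings of \<open>(h\<^sub>i, g\<^sub>i)\<close>.\<close>

definition filling_pairs :: "nat \<Rightarrow> nat \<Rightarrow> ((nat \<times> nat \<Rightarrow> basis) \<times> (nat \<times> nat \<Rightarrow> basis)) set"
  where "filling_pairs m n =
    {(\<phi>, \<psi>). \<phi> \<in> canonical_fillings m n (lambda_h m n) \<and> \<psi> \<in> canonical_fillings m n (lambda_g m n) \<and>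
      (\<forall>x\<in>{..<m} \<times> {..<n}. \<phi> x = \<psi> x)}"

definition alpha ::
  "nat \<Rightarrow> nat \<Rightarrow> (nat \<times> nat \<Rightarrow> basis) \<Rightarrow> (nat \<times> nat \<Rightarrow> basis) \<Rightarrow> 'k::field_char_0"
  where "alpha m n \<phi> \<psi> = (- 1) ^ (n * rho m n \<phi>) * of_nat (kappa n (lambda_h m n) \<phi>)
    / of_nat (kappa n (lambda_g m n) \<psi>)"

definition h_scaled ::
  "nat \<Rightarrow> nat \<Rightarrow> (nat \<times> nat \<Rightarrow> basis) \<Rightarrow> (nat \<times> nat \<Rightarrow> basis) \<Rightarrow> 'k::field_char_0 tensor"
  where "h_scaled m n \<phi> \<psi> = scal (gconst (1 / alpha m n \<phi> \<psi>)) * filling_tensor (lambda_h m n) \<phi>"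

text \<open>\<open>(g\<^sub>i\<^sup>*, g\<^sub>i)\<close> is an integer, hence lies in the ground field and is equal to its own body.\<close>

definition g_dual_scaled :: "nat \<Rightarrow> nat \<Rightarrow> (nat \<times> nat \<Rightarrow> basis) \<Rightarrow> 'k::field_char_0 tensor"
  where "g_dual_scaled m n \<psi> =
    scal (gconst (1 / gbody (pairing (filling_cotensor (lambda_g m n) \<psi>) (filling_tensor (lambda_g m n) \<psi>))))
    * filling_cotensor (lambda_g m n) \<psi>"

definition b_tilde :: "nat \<Rightarrow> nat \<Rightarrow> 'k::field_char_0 tensor"
  where "b_tilde m n = (\<Sum>(\<phi>, \<psi>)\<in>filling_pairs m n. h_scaled m n \<phi> \<psi> * g_dual_scaled m n \<psi>)"

lemma boxes_rectangle: "set (boxes (replicate r c)) = {..<r} \<times> {..<c}"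
  by (auto simp: boxes_def)

lemma canonical_fillings_rectangle:
  "\<phi> \<in> canonical_fillings m n (replicate r c) \<longleftrightarrow> \<phi> \<in> extensional ({..<r} \<times> {..<c}) \<and>
     (\<forall>i<r. \<forall>j<c. \<phi> (i, j) = Ev i \<and> i < m \<or> \<phi> (i, j) = Od j \<and> j < n)"
  by (fastforce simp: canonical_fillings_def boxes_rectangle PiE_def Pi_def Omega_def)

lemma card_filling_pairs: "card (filling_pairs m n) = 2 ^ (m * n)"
proof -
  define B where "B = {..<m} \<times> {..<n}"
  define fill where "fill D x = (if x \<in> D \<or> fst x = m then Od (snd x) else Ev (fst x))" for D and x :: "nat \<times> nat"
  define F where "F D = (restrict (fill D) ({..<m} \<times> {..<n + 1}), restrict (fill D) ({..<m + 1} \<times> {..<n}))" for D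
  define odds where "odds p = {x \<in> B. is_odd (fst p x)}" for p :: "(nat \<times> nat \<Rightarrow> basis) \<times> (nat \<times> nat \<Rightarrow> basis)"
  have "bij_betw odds (filling_pairs m n) (Pow B)"
  proof (rule bij_betw_byWitness[where f' = F])
    show "\<forall>p\<in>filling_pairs m n. F (odds p) = p"
    proof
      fix p assume "p \<in> filling_pairs m n"
      moreover obtain \<phi> \<psi> where p: "p = (\<phi>, \<psi>)" by (cases p)
      ultimately have c: "\<phi> \<in> canonical_fillings m n (replicate m (n + 1))"
          "\<psi> \<in> canonical_fillings m n (replicate (m + 1) n)"
        and eq: "\<And>x. x \<in> B \<Longrightarrow> \<phi> x = \<psi> x"
        by (auto simp: filling_pairs_def lambda_h_def lambda_g_def B_def)
      note c = c[unfolded canonical_fillings_rectangle]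
      have "restrict (fill (odds p)) ({..<m} \<times> {..<n + 1}) = \<phi>"
      proof (rule extensionalityI[OF restrict_extensional conjunct1[OF c(1)]])
        fix x assume x: "x \<in> {..<m} \<times> {..<n + 1}"
        then obtain i j where ij: "x = (i, j)" "i < m" "j < n + 1" by auto
        from conjunct2[OF c(1)] ij have "\<phi> (i, j) = Ev i \<or> \<phi> (i, j) = Od j \<and> j < n"
          by blast
        with ij x show "restrict (fill (odds p)) ({..<m} \<times> {..<n + 1}) x = \<phi> x"
          by (auto simp: fill_def odds_def p B_def)
      qed
      moreover have "restrict (fill (odds p)) ({..<m + 1} \<times> {..<n}) = \<psi>"
      proof (rule extensionalityI[OF restrict_extensional conjunct1[OF c(2)]])
        fix x assume x: "x \<in> {..<m + 1} \<times> {..<n}"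
        then obtain i j where ij: "x = (i, j)" "i < m + 1" "j < n" by auto
        from conjunct2[OF c(2)] ij have "\<psi> (i, j) = Ev i \<and> i < m \<or> \<psi> (i, j) = Od j"
          by blast
        moreover have "i < m \<Longrightarrow> \<phi> (i, j) = \<psi> (i, j)"
          using ij by (simp add: eq B_def)
        ultimately show "restrict (fill (odds p)) ({..<m + 1} \<times> {..<n}) x = \<psi> x"
          using ij x by (cases "i < m") (auto simp: fill_def odds_def p B_def)
      qed
      ultimately show "F (odds p) = p" by (simp add: F_def p)
    qed
    show "\<forall>D\<in>Pow B. odds (F D) = D"
      by (auto simp: odds_def F_def fill_def B_def)
    show "odds ` filling_pairs m n \<subseteq> Pow B"
      by (auto simp: odds_def)
    show "F ` Pow B \<subseteq> filling_pairs m n"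
    proof (rule image_subsetI)
      fix D assume D: "D \<in> Pow B"
      have "fst (F D) \<in> canonical_fillings m n (replicate m (n + 1))"
        unfolding canonical_fillings_rectangle using D by (auto simp: F_def fill_def B_def)
      moreover have "snd (F D) \<in> canonical_fillings m n (replicate (m + 1) n)"
        unfolding canonical_fillings_rectangle using D by (auto simp: F_def fill_def B_def)
      moreover have "\<forall>x\<in>{..<m} \<times> {..<n}. fst (F D) x = snd (F D) x"
        by (auto simp: F_def)
      ultimately show "F D \<in> filling_pairs m n"
        by (simp add: filling_pairs_def lambda_h_def lambda_g_def case_prod_unfold)
    qed
  qed
  then show ?thesis
    by (simp add: bij_betw_same_card card_Pow B_def card_cartesian_product)
qed

end

theory Submission
  imports Defs
begin

text \<open>A tensor is evaluated at points with coordinates in \<open>G\<close>, and it is determined by its values.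
  Polarization reduces the points to those which are constant along the rows of \<open>\<lambda>\<^sub>h\<close> in the
  contravariant slots (coordinates \<open>X\<close> even, \<open>\<xi>\<close> odd) and along the columns of \<open>\<lambda>\<^sub>g\<close> in the covariant
  ones (coordinates \<open>Y\<close>, \<open>y\<close>), with invertible \<open>X\<close> and \<open>Y\<close>. Writing \<open>\<xi> = X \<eta>\<close> and
  \<open>y = \<zeta> Y\<close>, the Young symmetrized canonical tensor whose odd elements occupy the set \<open>J\<close> of boxes
  has the value \<open>(det X)\<^bsup>n+1\<^esup> \<Prod>\<^bsub>J\<^esub> \<eta>\<close> or \<open>(det Y)\<^bsup>m+1\<^esup> \<Prod>\<^bsub>-J\<^esub> \<zeta>\<close> up to a constant, and the
  coefficients in \<open>b_tilde\<close> are such that the sum over \<open>J\<close> becomes, up to one constant for all,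
  \<open>(det X)\<^bsup>n+1\<^esup> (det Y)\<^bsup>m+1\<^esup> \<Prod>(\<eta> + \<zeta>) = det X det Y \<Prod>p\<close> with \<open>p = X y + \<xi> Y\<close>. The matrix \<open>p\<close> is
  invariant under \<open>GL V\<close>. The product \<open>\<Prod>p\<close> annihilates the entries of \<open>p\<close>, that is, modulo it
  \<open>\<zeta> = - \<eta>\<close>, and then \<open>det X det Y\<close> is multiplied by
  \<open>det (A\<^sub>1\<^sub>1 + \<eta> A\<^sub>2\<^sub>1) det (B\<^sub>2\<^sub>2 - B\<^sub>2\<^sub>1 \<eta>) = Ber A\<close>, where \<open>B = A\<^sup>-\<^sup>1\<close>.\<close>

section \<open>The Grassmann algebra\<close>

text \<open>The value of \<open>b_tilde\<close> has a closed form at points with invertible X and Y,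
  whereas tensors are separated by coordinates which are products of fresh generators, hence
  nilpotent. A base point reconciles the two: identity matrices are added to nilpotent coordinates,
  and polarization removes them again. On covariant tensors \<open>e_T\<close> acts from the right,
  so its column alternation is the outermost operation. Coordinates of reversed parity, with one odd
  parameter per slot, turn this alternation into a symmetry, so that the same polarization applies.
  The powers n + 1 and m + 1 of det X and det Y exceed by one the powers n and m which the
  substitution p = X (\<eta> + \<zeta>) Y contributes to the product over the m n boxes. The single
  powers left over are what transforms by the Berezinian. In \<alpha>, the quotient of the \<kappa>
  cancels the multiplicities caused by equal odd elements in the value of h and in the pairing of g
  with its dual, and (-1)^(n \<rho>) is the cross term of binomial(\<rho> + n, 2), the exponent in
  the pairing of words with \<rho> + n odd elements.\<close>

lemma grassmann_eqI: "(\<And>S. gcoeff a S = gcoeff b S) \<Longrightarrow> a = b"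
  by (auto simp: gcoeff_def poly_mapping_eq_iff fun_eq_iff simp flip: rep_grassmann_inject)

lemma gcoeff_simps [simp]:
  "gcoeff 0 S = 0"
  "gcoeff (a + b) S = gcoeff a S + gcoeff b S"
  "gcoeff (a - b) S = gcoeff a S - gcoeff b S"
  "gcoeff (- a) S = - gcoeff a S"
  "gcoeff 1 S = (if S = {||} then 1 else 0)"
  "gcoeff (gconst c) S = (if S = {||} then c else 0)"
  by (auto simp: gcoeff_def zero_grassmann.rep_eq plus_grassmann.rep_eq minus_grassmann.rep_eq
      uminus_grassmann.rep_eq one_grassmann.rep_eq lookup_add lookup_minus lookup_single when_def
      gconst_def Grassmann_inverse)

lemma gcoeff_sum [simp]: "gcoeff (sum f A) S = (\<Sum>x\<in>A. gcoeff (f x) S)"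
  by (induction A rule: infinite_finite_induct) auto

lemma gcoeff_ginvol: "gcoeff (ginvol a) S = (- 1) ^ fcard S * gcoeff a S"
  by (simp add: gcoeff_def ginvol.rep_eq pm_invol_lookup)

lemma finite_gcoeff: "finite {S. gcoeff a S \<noteq> 0}"
  using finite_keys[of "rep_grassmann a"] by (simp add: gcoeff_def keys.rep_eq)

lemma gcoeff_mult:
  "gcoeff (a * b) U = (\<Sum>S\<in>{S. gcoeff a S \<noteq> 0}. \<Sum>T\<in>{T. gcoeff b T \<noteq> 0}.
     Poly_Mapping.lookup (gkernel S T (gcoeff a S) (gcoeff b T)) U)"
  by (simp add: gcoeff_def times_grassmann.rep_eq pm_mult_def lookup_sum keys.rep_eq)

lemma gcoeff_mult_nonzeroE:
  assumes "gcoeff (a * b) U \<noteq> 0"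
  obtains S T where "gcoeff a S \<noteq> 0" "gcoeff b T \<noteq> 0" "S |\<inter>| T = {||}" "U = S |\<union>| T"
proof -
  from assms obtain S T where "gcoeff a S \<noteq> 0" "gcoeff b T \<noteq> 0"
    and "Poly_Mapping.lookup (gkernel S T (gcoeff a S) (gcoeff b T)) U \<noteq> 0"
    unfolding gcoeff_mult by (metis (mono_tags, lifting) mem_Collect_eq sum.neutral)
  then show thesis
    by (intro that) (auto simp: gkernel_def lookup_single when_def split: if_splits)
qed

lemma G_grade_zero [simp]: "0 \<in> G_grade p"
  by (simp add: G_grade_def)

lemma G_grade_add: "a \<in> G_grade p \<Longrightarrow> b \<in> G_grade p \<Longrightarrow> a + b \<in> G_grade (p :: nat)"
  unfolding G_grade_def by auto (metis add_0)+

lemma G_grade_uminus: "a \<in> G_grade p \<Longrightarrow> - a \<in> G_grade (p :: nat)"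
  by (simp add: G_grade_def)

lemma G_grade_diff: "a \<in> G_grade p \<Longrightarrow> b \<in> G_grade p \<Longrightarrow> a - b \<in> G_grade (p :: nat)"
  using G_grade_add[of a p "- b"] by (simp add: G_grade_uminus)

lemma G_grade_sum: "(\<And>x. x \<in> A \<Longrightarrow> f x \<in> G_grade p) \<Longrightarrow> sum f A \<in> G_grade (p :: nat)"
  by (induction A rule: infinite_finite_induct) (auto intro: G_grade_add)

lemma G_grade_mult:
  assumes "a \<in> G_grade p" "b \<in> G_grade q"
  shows "a * b \<in> G_grade (p + q)"
  unfolding G_grade_def mem_Collect_eq
proof (intro allI impI)
  fix U assume "gcoeff (a * b) U \<noteq> 0"
  then obtain S T where "gcoeff a S \<noteq> 0" "gcoeff b T \<noteq> 0" "S |\<inter>| T = {||}" "U = S |\<union>| T"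
    by (rule gcoeff_mult_nonzeroE)
  with assms show "even (fcard U + (p + q))"
    by (auto simp: G_grade_def fcard_funion_disjoint)
qed

lemma G_grade_parity: "even (p + q) \<Longrightarrow> G_grade p = G_grade q"
  by (auto simp: G_grade_def)

lemma G_grade_one [simp]: "even p \<Longrightarrow> 1 \<in> G_grade p"
  by (auto simp: G_grade_def fcard.rep_eq split: if_splits)

lemma G_grade_gconst [simp]: "even p \<Longrightarrow> gconst c \<in> G_grade p"
  by (auto simp: G_grade_def fcard.rep_eq split: if_splits)

lemma neg_one_power_mult: "(- 1) ^ p * (a :: 'a::ring_1) = (if even p then a else - a)"
  by simp


text \<open>Absence of 2-torsion, by which anticommutation implies that squares and repeated
  alternating sums vanish.\<close>

lemma G_grade_two_eq_zero:
  fixes a :: "'k::field_char_0 grassmann"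
  assumes "a + a = 0" shows "a = 0"
proof (rule grassmann_eqI)
  fix S have "gcoeff (a + a) S = 0" using assms by simp
  then show "gcoeff a S = gcoeff 0 S" by simp
qed

lemma ginvol_uminus: "ginvol (- a) = - ginvol a"
  by (rule grassmann_eqI) (simp add: gcoeff_ginvol)

lemma ginvol_grade: "a \<in> G_grade p \<Longrightarrow> ginvol a = (- 1) ^ p * a"
proof (rule grassmann_eqI)
  fix S assume "a \<in> G_grade p"
  then show "gcoeff (ginvol a) S = gcoeff ((- 1) ^ p * a) S"
    by (cases "gcoeff a S = 0") (auto simp: gcoeff_ginvol G_grade_def neg_one_power_mult)
qed

lemma ginvol_funpow_grade: "a \<in> G_grade p \<Longrightarrow> (ginvol ^^ q) a = (- 1) ^ (p * q) * a"
  by (induction q) (auto simp: ginvol_grade ginvol_uminus neg_one_power_mult)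

lemma ginvol_funpow_inverse: "(ginvol ^^ p) ((ginvol ^^ p) a) = a"
proof -
  have *: "gcoeff ((ginvol ^^ q) b) S = (- 1) ^ (q * fcard S) * gcoeff b S" for q b S
    by (induction q) (auto simp: gcoeff_ginvol power_add)
  show ?thesis
    by (rule grassmann_eqI) (simp only: *, simp flip: mult.assoc power_add)
qed

lemma gkernel_anticommute:
  assumes "odd (fcard S)" "odd (fcard T)"
  shows "gkernel S T x y = - gkernel T S y x"
proof (cases "S |\<inter>| T = {||}")
  case True
  have "odd (inversions S T + inversions T S)"
    using assms by (simp add: inversions_swap[OF True])
  then have "(- 1) ^ inversions S T = (- ((- 1) ^ inversions T S) :: 'a)"
    by (auto simp: minus_one_power_iff)
  with True show ?thesis
    by (simp add: gkernel_def inf_commute sup_commute mult_ac flip: single_uminus)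
qed (auto simp: gkernel_def inf_commute)

lemma G_odd_anticommute:
  assumes "a \<in> G_grade p" "b \<in> G_grade q" "odd p" "odd q"
  shows "a * b = - (b * a)"
proof (rule grassmann_eqI)
  fix U
  have "gcoeff (a * b) U = (\<Sum>S\<in>{S. gcoeff a S \<noteq> 0}. \<Sum>T\<in>{T. gcoeff b T \<noteq> 0}.
     - Poly_Mapping.lookup (gkernel T S (gcoeff b T) (gcoeff a S)) U)"
    unfolding gcoeff_mult
  proof (intro sum.cong refl)
    fix S T assume "S \<in> {S. gcoeff a S \<noteq> 0}" "T \<in> {T. gcoeff b T \<noteq> 0}"
    then have "odd (fcard S)" "odd (fcard T)" using assms by (auto simp: G_grade_def)
    then show "Poly_Mapping.lookup (gkernel S T (gcoeff a S) (gcoeff b T)) U =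
       - Poly_Mapping.lookup (gkernel T S (gcoeff b T) (gcoeff a S)) U"
      by (subst gkernel_anticommute) simp_all
  qed
  also have "\<dots> = - gcoeff (b * a) U"
    unfolding gcoeff_mult by (subst sum.swap) (simp add: sum_negf)
  finally show "gcoeff (a * b) U = gcoeff (- (b * a)) U" by simp
qed

lemma G_grade_commute:
  assumes "a \<in> G_grade p" "b \<in> G_grade q"
  shows "a * b = (- 1) ^ (p * q) * (b * a)"
proof (cases "odd p \<and> odd q")
  case True
  then show ?thesis using G_odd_anticommute[OF assms] by simp
next
  case False
  then have "a \<in> G_grade 0 \<or> b \<in> G_grade 0"
    using assms G_grade_parity[of p 0] G_grade_parity[of q 0] by auto
  then have "a * b = b * a" using G_even_commute by metis
  with False show ?thesis by (auto simp: neg_one_power_mult)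
qed

lemma G_odd_square:
  fixes a :: "'k::field_char_0 grassmann"
  assumes "a \<in> G_grade p" "odd p"
  shows "a * a = 0"
proof (rule G_grade_two_eq_zero)
  show "a * a + a * a = 0"
    by (subst G_odd_anticommute[OF assms(1,1,2,2)]) simp
qed


subsection \<open>Constants and the body\<close>

lemma gconst_mult_coeff: "gcoeff (gconst c * a) S = c * gcoeff a S" (is "?L S = _")
proof (cases "c = 0")
  case True
  then have "gconst c = 0" by (intro grassmann_eqI) simp
  then show ?thesis using True by simp
next
  case False
  have "?L S = (\<Sum>T\<in>{T. gcoeff a T \<noteq> 0}. Poly_Mapping.lookup (gkernel {||} T c (gcoeff a T)) S)"
  proof -
    have "{S. gcoeff (gconst c) S \<noteq> 0} = {{||}}" using False by auto
    then show ?thesis unfolding gcoeff_mult by simp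
  qed
  also have "\<dots> = (\<Sum>T\<in>{T. gcoeff a T \<noteq> 0}. if T = S then c * gcoeff a T else 0)"
    by (intro sum.cong) (auto simp: gkernel_def lookup_single when_def)
  also have "\<dots> = c * gcoeff a S"
    by (simp add: finite_gcoeff)
  finally show ?thesis .
qed

lemma gconst_simps [simp]:
  "gconst 0 = 0" "gconst 1 = 1"
  "gconst (a + b) = gconst a + gconst b" "gconst (a * b) = gconst a * gconst b"
  "gconst (- c) = - gconst c"
  by (rule grassmann_eqI, simp add: gconst_mult_coeff)+


lemma gconst_power: "gconst (c ^ p) = gconst c ^ p"
  by (induction p) auto

lemma gconst_of_nat: "gconst (of_nat p) = of_nat p"
  by (induction p) auto

lemma gconst_of_int: "gconst (of_int p) = of_int p"
  by (cases p rule: int_cases) (auto simp: gconst_of_nat simp del: of_nat_Suc)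

lemma gconst_commute: "gconst c * a = a * gconst c"
  by (rule G_even_commute) simp


lemma gbody_simps [simp]:
  "gbody 0 = 0" "gbody 1 = 1" "gbody (a + b) = gbody a + gbody b" "gbody (- a) = - gbody a"
  "gbody (a - b) = gbody a - gbody b" "gbody (gconst c) = c"
  by (simp_all add: gbody_def)


text \<open>After the constant term of \<open>a\<close> is split off, every monomial of the rest has
  a nonempty index set, and so has its product with any monomial of \<open>b\<close>.\<close>

lemma gbody_mult [simp]: "gbody (a * b) = gbody a * gbody b"
proof -
  define a' where "a' = a - gconst (gbody a)"
  have "gbody (a' * b) = 0"
  proof (rule ccontr)
    assume "gbody (a' * b) \<noteq> 0"
    then have "gcoeff (a' * b) {||} \<noteq> 0" by (simp add: gbody_def)
    then obtain S T where "gcoeff a' S \<noteq> 0" "{||} = S |\<union>| T" by (rule gcoeff_mult_nonzeroE) auto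
    then have "gcoeff a' {||} \<noteq> 0" by (metis sup_eq_bot_iff)
    then show False by (simp add: a'_def gbody_def)
  qed
  moreover have "a * b = a' * b + gconst (gbody a) * b"
    by (simp add: a'_def algebra_simps)
  ultimately show ?thesis by (simp add: gbody_def gconst_mult_coeff)
qed

lemma gbody_odd: "a \<in> G_grade p \<Longrightarrow> odd p \<Longrightarrow> gbody a = 0"
  by (auto simp: gbody_def G_grade_def fcard.rep_eq)


subsection \<open>Elements involving only some of the generators\<close>

text \<open>The subalgebra on the generators with indices in \<open>U\<close>. Every element lies in
  one with finite \<open>U\<close>, which leaves infinitely many fresh generators for test
  points.\<close>

definition G_sub :: "nat set \<Rightarrow> 'k::zero grassmann set"
  where "G_sub U = {a. \<forall>S. gcoeff a S \<noteq> 0 \<longrightarrow> fset S \<subseteq> U}"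

lemma G_sub_mult: "a \<in> G_sub U \<Longrightarrow> b \<in> G_sub U \<Longrightarrow> a * b \<in> G_sub U"
proof -
  assume ab: "a \<in> G_sub U" "b \<in> G_sub U"
  show "a * b \<in> G_sub U"
    unfolding G_sub_def mem_Collect_eq
  proof (intro allI impI)
    fix S assume "gcoeff (a * b) S \<noteq> 0"
    then obtain S1 S2 where "gcoeff a S1 \<noteq> 0" "gcoeff b S2 \<noteq> 0" "S = S1 |\<union>| S2"
      by (rule gcoeff_mult_nonzeroE)
    with ab show "fset S \<subseteq> U" by (auto simp: G_sub_def)
  qed
qed

lemma G_sub_mono: "a \<in> G_sub U \<Longrightarrow> U \<subseteq> V \<Longrightarrow> a \<in> G_sub V"
  unfolding G_sub_def by blast

lemma G_sub_bound: "\<exists>N. a \<in> G_sub {..<N}"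
proof -
  have "finite (\<Union>S\<in>{S. gcoeff a S \<noteq> 0}. fset S)"
    by (rule finite_UN_I[OF finite_gcoeff]) simp
  then obtain N where N: "\<forall>s\<in>(\<Union>S\<in>{S. gcoeff a S \<noteq> 0}. fset S). s < N"
    unfolding finite_nat_set_iff_bounded by blast
  have "a \<in> G_sub {..<N}"
    unfolding G_sub_def mem_Collect_eq lessThan_def subset_iff using N by blast
  then show ?thesis ..
qed

lemma G_sub_one: "1 \<in> G_sub U"
  by (auto simp: G_sub_def split: if_splits)

definition gmono :: "nat fset \<Rightarrow> 'k::comm_ring_1 grassmann"
  where "gmono S = Grassmann (Poly_Mapping.single S 1)"

lemma gcoeff_gmono: "gcoeff (gmono S) T = (if S = T then 1 else 0)"
  by (simp add: gcoeff_def gmono_def Grassmann_inverse lookup_single when_def)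

lemma gmono_grade: "even (fcard S + p) \<Longrightarrow> gmono S \<in> G_grade p"
  by (auto simp: G_grade_def gcoeff_gmono split: if_splits)

lemma gmono_sub: "fset S \<subseteq> U \<Longrightarrow> gmono S \<in> G_sub U"
  by (auto simp: G_sub_def gcoeff_gmono split: if_splits)

lemma gbody_gmono: "S \<noteq> {||} \<Longrightarrow> gbody (gmono S) = 0"
  by (simp add: gbody_def gcoeff_gmono)

text \<open>A monomial in fresh generators can be cancelled: for \<open>T\<close> disjoint from
  \<open>S\<close> the union determines \<open>T\<close>, so distinct monomials of \<open>a\<close>
  stay distinct, up to sign.\<close>

lemma gmono_mult_eq_zero:
  fixes a :: "'k::comm_ring_1 grassmann"
  assumes "gmono S * a = 0" "a \<in> G_sub U" "fset S \<inter> U = {}"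
  shows "a = 0"
proof (rule grassmann_eqI)
  fix T
  show "gcoeff a T = gcoeff 0 T"
  proof (rule ccontr)
    assume T: "gcoeff a T \<noteq> gcoeff 0 T"
    have disj: "S |\<inter>| T' = {||}" if "gcoeff a T' \<noteq> 0" for T'
      using that assms unfolding G_sub_def mem_Collect_eq
      by (metis bot_fset.rep_eq fset_inject inf_commute inf_fset.rep_eq inf_mono order_refl subset_empty)
    have "gcoeff (gmono S * a) (S |\<union>| T) =
       (\<Sum>T'\<in>{T'. gcoeff a T' \<noteq> 0}. Poly_Mapping.lookup (gkernel S T' 1 (gcoeff a T')) (S |\<union>| T))"
      unfolding gcoeff_mult by (simp add: gcoeff_gmono if_distrib cong: if_cong)
    also have "\<dots> = (\<Sum>T'\<in>{T'. gcoeff a T' \<noteq> 0}. if T' = T then (- 1) ^ inversions S T * gcoeff a T else 0)"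
    proof (intro sum.cong refl)
      fix T' assume "T' \<in> {T'. gcoeff a T' \<noteq> 0}"
      then have "S |\<inter>| T' = {||}" "S |\<inter>| T = {||}" using T disj by auto
      moreover from this have "S |\<union>| T' = S |\<union>| T \<longleftrightarrow> T' = T" by blast
      ultimately show "Poly_Mapping.lookup (gkernel S T' 1 (gcoeff a T')) (S |\<union>| T) =
          (if T' = T then (- 1) ^ inversions S T * gcoeff a T else 0)"
        by (auto simp: gkernel_def lookup_single when_def)
    qed
    also have "\<dots> = (- 1) ^ inversions S T * gcoeff a T"
      using T by (simp add: finite_gcoeff)
    finally have "(- 1) ^ inversions S T * gcoeff a T = 0" using assms(1) by simp
    then show False using T by (simp add: neg_one_power_mult split: if_splits)
  qed
qed


subsection \<open>Units of \<open>G\<^sub>0\<close>\<close>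

lemma of_geven_simps [simp]:
  "of_geven 0 = 0" "of_geven 1 = 1" "of_geven (x + y) = of_geven x + of_geven y"
  "of_geven (x * y) = of_geven x * of_geven y" "of_geven (- x) = - of_geven x"
  "of_geven (x - y) = of_geven x - of_geven y"
  by (simp_all add: zero_geven.rep_eq one_geven.rep_eq plus_geven.rep_eq times_geven.rep_eq
      uminus_geven.rep_eq minus_geven.rep_eq)

lemma of_geven_sum: "of_geven (sum f A) = (\<Sum>x\<in>A. of_geven (f x))"
  by (induction A rule: infinite_finite_induct) auto


lemma of_geven_of_int: "of_geven (of_int p) = of_int p"
proof -
  have "of_geven (of_nat q) = of_nat q" for q by (induction q) auto
  then show ?thesis by (cases p rule: int_cases) (auto simp del: of_nat_Suc)
qed

lemma of_geven_grade [simp]: "even p \<Longrightarrow> of_geven x \<in> G_grade p"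
  using of_geven[of x] G_grade_parity[of p 0] by auto

lemma of_geven_commute: "of_geven x * a = a * of_geven x"
  by (rule G_even_commute[OF of_geven])

lemma Geven_of_geven [simp]: "Geven (of_geven x) = x"
  by (rule of_geven_inverse)

lemma of_geven_Geven: "a \<in> G_grade 0 \<Longrightarrow> of_geven (Geven a) = a"
  by (rule Geven_inverse)

definition ebody :: "'k::comm_ring_1 geven \<Rightarrow> 'k"
  where "ebody x = gbody (of_geven x)"

interpretation ebody: comm_ring_hom ebody
  by unfold_locales (simp_all add: ebody_def)

text \<open>Every monomial in the r-th power of an element without constant term has at least r
  generators, but only finitely many generators occur in \<open>x\<close>.\<close>

lemma geven_nilpotent:
  assumes "ebody x = 0"
  shows "\<exists>N. x ^ N = 0"
proof -
  obtain N where N: "of_geven x \<in> G_sub {..<N}" using G_sub_bound by blast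
  have deg: "r \<le> fcard S" if "gcoeff (of_geven (x ^ r)) S \<noteq> 0" for r S
    using that
  proof (induction r arbitrary: S)
    case (Suc r)
    then have "gcoeff (of_geven x * of_geven (x ^ r)) S \<noteq> 0" by simp
    then obtain S1 S2 where S: "gcoeff (of_geven x) S1 \<noteq> 0" "gcoeff (of_geven (x ^ r)) S2 \<noteq> 0"
        "S1 |\<inter>| S2 = {||}" "S = S1 |\<union>| S2" by (rule gcoeff_mult_nonzeroE)
    with assms have "S1 \<noteq> {||}" by (auto simp: ebody_def gbody_def)
    then have "0 < fcard S1" by (metis fcard_fempty fcard_0_eq gr0I)
    with S Suc.IH[of S2] show ?case by (simp add: fcard_funion_disjoint)
  qed simp
  have sub: "of_geven (x ^ r) \<in> G_sub {..<N}" for r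
    using N by (induction r) (auto simp: G_sub_one G_sub_mult)
  have "of_geven (x ^ Suc N) = of_geven 0"
  proof (rule grassmann_eqI, rule ccontr)
    fix S assume "gcoeff (of_geven (x ^ Suc N)) S \<noteq> gcoeff (of_geven 0) S"
    then have "gcoeff (of_geven (x ^ Suc N)) S \<noteq> 0" by (metis gcoeff_simps(1) of_geven_simps(1))
    with deg[of "Suc N" S] sub[of "Suc N"] have "Suc N \<le> card (fset S)" "fset S \<subseteq> {..<N}"
      by (auto simp: G_sub_def fcard.rep_eq)
    then show False by (metis card_lessThan card_mono finite_lessThan not_less_eq_eq)
  qed
  then show ?thesis by (metis of_geven_inject)
qed

lemma geven_unit:
  fixes x :: "'k::field geven"
  assumes "ebody x \<noteq> 0"
  shows "x dvd 1"
proof -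
  define c where "c = Geven (gconst (inverse (ebody x)))"
  have c: "of_geven c = gconst (inverse (ebody x))"
    by (simp add: c_def of_geven_Geven)
  \<comment> \<open>\<open>c\<close> normalizes the body of \<open>x\<close> to 1, so
    \<open>u\<close> is nilpotent and the finite geometric series inverts 1 - u.\<close>
  define u where "u = 1 - c * x"
  have "ebody u = 0"
    using assms by (simp add: u_def ebody_def c)
  then obtain N where N: "u ^ N = 0" using geven_nilpotent by blast
  have "(1 - u) * (\<Sum>i<N. u ^ i) = 1 - u ^ N"
    by (simp add: one_diff_power_eq)
  moreover have "1 - u = c * x" by (simp add: u_def)
  ultimately have "x * (c * (\<Sum>i<N. u ^ i)) = 1"
    by (simp add: N mult_ac)
  then show ?thesis by (metis dvdI)
qed

section \<open>Ordered products\<close>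

text \<open>Factors in G do not commute; the order of the product carries the Koszul signs.\<close>

definition oprod :: "(nat \<Rightarrow> 'a::monoid_mult) \<Rightarrow> nat \<Rightarrow> 'a"
  where "oprod z l = prod_list (map z [0..<l])"

lemma oprod_simps [simp]: "oprod z 0 = 1" "oprod z (Suc l) = oprod z l * z l"
  by (simp_all add: oprod_def)

lemma oprod_cong [cong]: "l = l' \<Longrightarrow> (\<And>s. s < l' \<Longrightarrow> z s = z' s) \<Longrightarrow> oprod z l = oprod z' l'"
  unfolding oprod_def by (intro arg_cong[where f = prod_list] map_cong) auto

lemma oprod_Suc_left: "oprod z (Suc l) = z 0 * oprod (\<lambda>s. z (Suc s)) l"
  by (induction l) (auto simp: mult.assoc)

lemma oprod_add: "oprod z (p + q) = oprod z p * oprod (\<lambda>s. z (p + s)) q"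
  by (induction q) (auto simp: mult.assoc)

lemma oprod_one [simp]: "oprod (\<lambda>s. 1) l = 1"
  by (induction l) auto

lemma oprod_grid: "oprod (\<lambda>s. f (s div c) (s mod c)) (r * c) = oprod (\<lambda>i. oprod (f i) c) r"
proof (cases "c = 0")
  case True
  then show ?thesis by simp
next
  case False
  show ?thesis
  proof (induction r)
    case (Suc r)
    have "oprod (\<lambda>s. f (s div c) (s mod c)) (Suc r * c) =
        oprod (\<lambda>s. f (s div c) (s mod c)) (r * c + c)" by (simp add: add.commute)
    also have "\<dots> = oprod (\<lambda>i. oprod (f i) c) r * oprod (f r) c"
      unfolding oprod_add Suc using False by simp
    finally show ?case by simp
  qed simp
qed

lemma oprod_sum:
  fixes f :: "nat \<Rightarrow> 'b \<Rightarrow> 'a::ring_1"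
  assumes "finite B"
  shows "oprod (\<lambda>s. \<Sum>r\<in>B. f s r) l = (\<Sum>g\<in>{..<l} \<rightarrow>\<^sub>E B. oprod (\<lambda>s. f s (g s)) l)"
proof (induction l)
  case (Suc l)
  have "(\<Sum>g\<in>{..<Suc l} \<rightarrow>\<^sub>E B. oprod (\<lambda>s. f s (g s)) (Suc l)) =
     (\<Sum>(r, g)\<in>B \<times> ({..<l} \<rightarrow>\<^sub>E B). oprod (\<lambda>s. f s (g s)) l * f l r)"
    unfolding lessThan_Suc PiE_insert_eq
  proof (subst sum.reindex[OF inj_combinator[of l "{..<l}" "\<lambda>_. B"]], simp, rule sum.cong, rule refl)
    fix p assume "p \<in> B \<times> ({..<l} \<rightarrow>\<^sub>E B)"
    obtain r g where p: "p = (r, g)" by (cases p)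
    have "oprod (\<lambda>s. f s ((g(l := r)) s)) l = oprod (\<lambda>s. f s (g s)) l"
      by (rule oprod_cong) auto
    then show "((\<lambda>g. oprod (\<lambda>s. f s (g s)) (Suc l)) \<circ> (\<lambda>(y, g). g(l := y))) p =
        (case p of (r, g) \<Rightarrow> oprod (\<lambda>s. f s (g s)) l * f l r)"
      by (simp only: p comp_def prod.case oprod_simps fun_upd_same)
  qed
  also have "\<dots> = (\<Sum>g\<in>{..<l} \<rightarrow>\<^sub>E B. oprod (\<lambda>s. f s (g s)) l) * (\<Sum>r\<in>B. f l r)"
    by (simp add: sum_product sum.cartesian_product[symmetric]) (rule sum.swap)
  finally show ?case using Suc by simp
qed simp

lemma oprod_scale:
  "oprod (\<lambda>s. of_geven (W s) * z s) l = of_geven (\<Prod>s<l. W s) * oprod z l"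
proof (induction l)
  case (Suc l)
  have "of_geven (\<Prod>s<l. W s) * oprod z l * (of_geven (W l) * z l) =
    of_geven (\<Prod>s<l. W s) * (oprod z l * of_geven (W l)) * z l"
    by (simp only: mult.assoc)
  also have "oprod z l * of_geven (W l) = of_geven (W l) * oprod z l"
    by (rule of_geven_commute[symmetric])
  finally show ?case using Suc by (simp add: mult.assoc)
qed simp

lemma oprod_fun_upd_add:
  fixes z :: "nat \<Rightarrow> 'a::ring_1"
  assumes "i < l"
  shows "oprod (z(i := u + v)) l = oprod (z(i := u)) l + oprod (z(i := v)) l"
  using assms
proof (induction l)
  case (Suc l)
  show ?case
  proof (cases "i = l")
    case True
    have "oprod (z(i := w)) l = oprod z l" for w using True by (intro oprod_cong) auto
    with True show ?thesis by (simp add: distrib_left)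
  next
    case False
    with Suc show ?thesis by (simp add: distrib_right)
  qed
qed simp

lemma oprod_zero:
  fixes z :: "nat \<Rightarrow> 'a::ring_1"
  assumes "z i = 0" "i < l"
  shows "oprod z l = 0"
  using assms by (induction l) (auto simp: less_Suc_eq)

lemma oprod_grade:
  "(\<And>s. s < l \<Longrightarrow> z s \<in> G_grade (d s)) \<Longrightarrow> oprod z l \<in> G_grade (\<Sum>s<l. d s)"
  by (induction l) (auto intro: G_grade_mult)

text \<open>The extra factor is moved to the left, at the cost of signs, until it meets its own
  copy, where the square of an odd element vanishes.\<close>

lemma oprod_mult_odd_factor:
  fixes z :: "nat \<Rightarrow> 'k::field_char_0 grassmann"
  assumes "i < l" "z i \<in> G_grade 1" "\<And>s. s < l \<Longrightarrow> z s \<in> G_grade (d s)"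
  shows "oprod z l * z i = 0"
  using assms
proof (induction l)
  case (Suc l)
  show ?case
  proof (cases "i = l")
    case True
    with Suc.prems show ?thesis by (simp add: mult.assoc G_odd_square)
  next
    case False
    with Suc have *: "oprod z l * z i = 0" by simp
    have "z l * z i = (- 1) ^ (d l * 1) * (z i * z l)"
      using Suc.prems by (intro G_grade_commute) auto
    then have "oprod z l * (z l * z i) = (- 1) ^ d l * (oprod z l * z i * z l)"
      by (auto simp: neg_one_power_mult mult.assoc)
    with * show ?thesis by (simp add: mult.assoc)
  qed
qed simp

lemma oprod_equal_odd_factors:
  fixes z :: "nat \<Rightarrow> 'k::field_char_0 grassmann"
  assumes "i < j" "j < l" "z i = z j" "z i \<in> G_grade 1" "\<And>s. s < l \<Longrightarrow> z s \<in> G_grade (d s)"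
  shows "oprod z l = 0"
  using assms
proof (induction l)
  case (Suc l)
  show ?case
  proof (cases "j = l")
    case True
    with Suc.prems oprod_mult_odd_factor[of i l z d] show ?thesis by simp
  next
    case False
    with Suc show ?thesis by simp
  qed
qed simp

text \<open>As a function of the entries in places \<open>i\<close> and \<open>j\<close> the product
  is biadditive and vanishes on equal odd entries, hence it is alternating on odd entries.\<close>

lemma oprod_swap_odd:
  fixes z :: "nat \<Rightarrow> 'k::field_char_0 grassmann"
  assumes "i < l" "j < l" "i \<noteq> j" "z i \<in> G_grade 1" "z j \<in> G_grade 1"
    and d: "\<And>s. s < l \<Longrightarrow> z s \<in> G_grade (d s)"
  shows "oprod (z \<circ> transpose i j) l = - oprod z l"
proof -
  define f where "f u v = oprod (z(i := u, j := v)) l" for u v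
  have addr: "f u (v + v') = f u v + f u v'" for u v v'
    using assms oprod_fun_upd_add[of j l "z(i := u)"] by (simp add: f_def)
  have addl: "f (u + u') v = f u v + f u' v" for u u' v
    using assms oprod_fun_upd_add[of i l "z(j := v)"] by (simp add: f_def fun_upd_twist)
  have alt: "f w w = 0" if "w \<in> G_grade 1" for w
  proof -
    let ?z = "z(i := w, j := w)" and ?d = "d(i := 1, j := 1)"
    have d': "?z s \<in> G_grade (?d s)" if "s < l" for s
      using d[OF that] \<open>w \<in> G_grade 1\<close> by auto
    have "i < j \<or> j < i" using \<open>i \<noteq> j\<close> by auto
    then show ?thesis
    proof
      assume "i < j"
      then show ?thesis unfolding f_def
        by (intro oprod_equal_odd_factors[of i j l ?z ?d] d') (use assms that in auto)
    next
      assume "j < i"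
      then show ?thesis unfolding f_def
        by (intro oprod_equal_odd_factors[of j i l ?z ?d] d') (use assms that in auto)
    qed
  qed
  have "f (z i + z j) (z i + z j) = 0"
    using assms by (intro alt G_grade_add)
  then have "f (z j) (z i) = - f (z i) (z j)"
    using alt[OF assms(4)] alt[OF assms(5)] by (simp add: addl addr eq_neg_iff_add_eq_0 add.commute)
  moreover have "z(i := z j, j := z i) = z \<circ> transpose i j"
    using \<open>i \<noteq> j\<close> by (auto simp: fun_eq_iff transpose_def)
  ultimately show ?thesis by (simp add: f_def)
qed

text \<open>The factors outside \<open>J\<close> may have any parity: when two odd factors are
  exchanged, each factor between them is passed twice.\<close>

lemma oprod_permute_odd:
  fixes z :: "nat \<Rightarrow> 'k::field_char_0 grassmann"
  assumes "\<sigma> permutes J" "J \<subseteq> {..<l}" "\<And>s. s \<in> J \<Longrightarrow> z s \<in> G_grade 1"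
    and d: "\<And>s. s < l \<Longrightarrow> z s \<in> G_grade (d s)"
  shows "oprod (\<lambda>s. z (\<sigma> s)) l = of_int (sign \<sigma>) * oprod z l"
proof -
  have "finite J" using assms(2) finite_subset by blast
  from this assms(1) show ?thesis
  proof (induction rule: permutes_rev_induct)
    case (swap i j p)
    have p_lt: "p s < l" if "s < l" for s
      using swap assms(2) that by (metis permutes_in_image permutes_not_in subsetD lessThan_iff)
    have "oprod ((\<lambda>s. z (p s)) \<circ> transpose i j) l = - oprod (\<lambda>s. z (p s)) l"
      by (rule oprod_swap_odd[where d = "\<lambda>s. d (p s)"])
         (use swap assms p_lt in \<open>auto simp: permutes_in_image\<close>)
    moreover have "permutation p"
      using swap \<open>finite J\<close> by (auto simp: permutation_permutes)
    then have "sign (p \<circ> transpose i j) = - sign p"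
      using swap by (simp add: sign_compose permutation_swap_id sign_swap_id)
    ultimately show ?case using swap by (simp add: comp_def)
  qed simp
qed


subsection \<open>Reordering with Koszul signs\<close>

text \<open>The exponent N in the action of the symmetric group on tensors.\<close>

definition koszul :: "(nat \<Rightarrow> nat) \<Rightarrow> (nat \<Rightarrow> bool) \<Rightarrow> nat \<Rightarrow> nat"
  where "koszul \<sigma> od l = card {(i, j). i < j \<and> j < l \<and> \<sigma> i > \<sigma> j \<and> od i \<and> od j}"

lemma koszul_Suc:
  "koszul \<sigma> od (Suc l) = koszul \<sigma> od l + of_bool (od l) * card {i. i < l \<and> \<sigma> l < \<sigma> i \<and> od i}"
proof -
  let ?A = "{(i, j). i < j \<and> j < l \<and> \<sigma> i > \<sigma> j \<and> od i \<and> od j}"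
  let ?B = "(\<lambda>i. (i, l)) ` {i. i < l \<and> \<sigma> l < \<sigma> i \<and> od i \<and> od l}"
  have "{(i, j). i < j \<and> j < Suc l \<and> \<sigma> i > \<sigma> j \<and> od i \<and> od j} = ?A \<union> ?B"
    by (auto simp: less_Suc_eq image_iff)
  moreover have "finite ?A" by (rule finite_subset[of _ "{..<l} \<times> {..<l}"]) auto
  then have "card (?A \<union> ?B) = card ?A + card ?B"
    by (intro card_Un_disjoint) auto
  moreover have "card ?B = of_bool (od l) * card {i. i < l \<and> \<sigma> l < \<sigma> i \<and> od i}"
    by (cases "od l") (simp_all add: card_image inj_on_def)
  ultimately show ?thesis by (simp add: koszul_def)
qed

text \<open>Insertion sort by the values of \<sigma>. Inserting \<open>l\<close> moves the last
  factor of a product past exactly the factors with larger value, which is the increment in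
  \<open>koszul_Suc\<close>; so the sign of a reordering is found by induction on the number of
  factors.\<close>

primrec sorted_by :: "(nat \<Rightarrow> nat) \<Rightarrow> nat \<Rightarrow> nat list" where
  "sorted_by \<sigma> 0 = []"
| "sorted_by \<sigma> (Suc l) = insort_key \<sigma> l (sorted_by \<sigma> l)"

lemma set_sorted_by: "set (sorted_by \<sigma> l) = {..<l}"
  by (induction l) (simp_all add: set_insort_key lessThan_Suc)

lemma distinct_sorted_by: "distinct (sorted_by \<sigma> l)"
  by (induction l) (simp_all add: distinct_insort set_sorted_by)

lemma sorted_sorted_by: "sorted (map \<sigma> (sorted_by \<sigma> l))"
  by (induction l) (simp_all add: sorted_insort_key)

lemmas sorted_by_props = set_sorted_by distinct_sorted_by sorted_sorted_by

lemma prod_list_grade: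
  assumes "\<And>s. s \<in> set xs \<Longrightarrow> z s \<in> G_grade (of_bool (od s))"
  shows "prod_list (map z xs) \<in> G_grade (length (filter od xs))"
  using assms
proof (induction xs)
  case (Cons x xs)
  then have "z x * prod_list (map z xs) \<in> G_grade (of_bool (od x) + length (filter od xs))"
    by (intro G_grade_mult) auto
  then show ?case by (auto split: if_splits)
qed simp

lemma prod_list_insort_key:
  fixes z :: "nat \<Rightarrow> 'k::comm_ring_1 grassmann" and \<sigma> :: "nat \<Rightarrow> nat"
  assumes "sorted (map \<sigma> xs)" "\<And>s. s \<in> set xs \<Longrightarrow> \<sigma> s \<noteq> \<sigma> l"
    and "\<And>s. s \<in> insert l (set xs) \<Longrightarrow> z s \<in> G_grade (of_bool (od s))"
  shows "prod_list (map z (insort_key \<sigma> l xs)) =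
    (- 1) ^ (of_bool (od l) * length (filter (\<lambda>i. \<sigma> l < \<sigma> i \<and> od i) xs)) * (prod_list (map z xs) * z l)"
  using assms
proof (induction xs)
  case (Cons x xs)
  show ?case
  proof (cases "\<sigma> l \<le> \<sigma> x")
    case True
    have "\<sigma> l < \<sigma> i" if "i \<in> set (x # xs)" for i
    proof -
      have "\<sigma> x \<le> \<sigma> i" using that Cons.prems(1) by auto
      moreover have "\<sigma> i \<noteq> \<sigma> l" using that by (rule Cons.prems(2))
      ultimately show ?thesis using True by simp
    qed
    then have "filter (\<lambda>i. \<sigma> l < \<sigma> i \<and> od i) (x # xs) = filter od (x # xs)"
      by (intro filter_cong refl) blast
    moreover have "z l * prod_list (map z (x # xs)) =
       (- 1) ^ (of_bool (od l) * length (filter od (x # xs))) * (prod_list (map z (x # xs)) * z l)"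
      using Cons.prems by (intro G_grade_commute prod_list_grade) auto
    ultimately show ?thesis using True by simp
  next
    case False
    have IH: "prod_list (map z (insort_key \<sigma> l xs)) =
      (- 1) ^ (of_bool (od l) * length (filter (\<lambda>i. \<sigma> l < \<sigma> i \<and> od i) xs)) * (prod_list (map z xs) * z l)"
    proof (rule Cons.IH)
      show "z s \<in> G_grade (of_bool (od s))" if "s \<in> insert l (set xs)" for s
        using that by (intro Cons.prems) auto
    qed (use Cons.prems in auto)
    have "z x * ((- 1) ^ e * (prod_list (map z xs) * z l)) = (- 1) ^ e * (z x * prod_list (map z xs) * z l)" for e
      by (simp add: neg_one_power_mult mult.assoc)
    with False show ?thesis by (simp add: IH)
  qed
qed simp

lemma oprod_koszul:
  fixes z :: "nat \<Rightarrow> 'k::comm_ring_1 grassmann"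
  assumes \<sigma>: "\<sigma> permutes {..<l}" and z: "\<And>s. s < l \<Longrightarrow> z s \<in> G_grade (of_bool (od s))"
  shows "oprod (\<lambda>s. z (inv_into UNIV \<sigma> s)) l = (- 1) ^ koszul \<sigma> od l * oprod z l"
proof -
  have sorted: "prod_list (map z (sorted_by \<sigma> k)) = (- 1) ^ koszul \<sigma> od k * oprod z k" if "k \<le> l" for k
    using that
  proof (induction k)
    case 0
    then show ?case by (simp add: koszul_def)
  next
    case (Suc k)
    have "length (filter (\<lambda>i. \<sigma> k < \<sigma> i \<and> od i) (sorted_by \<sigma> k)) = card {i. i < k \<and> \<sigma> k < \<sigma> i \<and> od i}"
      by (auto simp: distinct_length_filter sorted_by_props intro!: arg_cong[where f = card])
    moreover have "\<sigma> s \<noteq> \<sigma> k" if "s < k" for s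
      using permutes_inj[OF \<sigma>] that by (metis injD less_irrefl)
    ultimately have "prod_list (map z (sorted_by \<sigma> (Suc k))) =
       (- 1) ^ (of_bool (od k) * card {i. i < k \<and> \<sigma> k < \<sigma> i \<and> od i}) * (prod_list (map z (sorted_by \<sigma> k)) * z k)"
      using prod_list_insort_key[where od = od and z = z and l = k, OF sorted_sorted_by, of \<sigma> k] Suc.prems
      by (simp only: sorted_by.simps set_sorted_by insert_iff lessThan_iff)
        (metis z Suc_le_lessD less_trans)
    then show ?case using Suc by (simp add: koszul_Suc power_add mult.assoc neg_one_power_mult)
  qed
  \<comment> \<open>Both lists have the same elements and \<sigma> maps both to increasing lists; as
    \<sigma> is injective they agree.\<close>
  have eq: "sorted_by \<sigma> l = map (inv_into UNIV \<sigma>) [0..<l]"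
  proof (rule map_sorted_distinct_set_unique[where f = \<sigma>])
    have inv: "\<sigma> (inv_into UNIV \<sigma> s) = s" for s using \<sigma> by (simp add: permutes_inverses)
    then have eq: "map \<sigma> (map (inv_into UNIV \<sigma>) [0..<l]) = [0..<l]" by (simp add: map_idI)
    show "sorted (map \<sigma> (map (inv_into UNIV \<sigma>) [0..<l]))" "distinct (map \<sigma> (map (inv_into UNIV \<sigma>) [0..<l]))"
      unfolding eq by simp_all
    show "inj_on \<sigma> (set (sorted_by \<sigma> l) \<union> set (map (inv_into UNIV \<sigma>) [0..<l]))"
      using permutes_inj[OF \<sigma>] by (rule inj_on_subset) simp
    show "sorted (map \<sigma> (sorted_by \<sigma> l))" by (rule sorted_by_props)
    show "distinct (map \<sigma> (sorted_by \<sigma> l))"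
      using permutes_inj[OF \<sigma>] by (auto simp: distinct_map sorted_by_props intro: inj_on_subset)
    show "set (sorted_by \<sigma> l) = set (map (inv_into UNIV \<sigma>) [0..<l])"
      using permutes_image[OF permutes_inv[OF \<sigma>]] by (simp add: sorted_by_props atLeast0LessThan)
  qed
  from sorted[of l] show ?thesis by (simp add: eq oprod_def comp_def)
qed

section \<open>Rectangular grids and their column groups\<close>

lemma bij_betw_lessThanI:
  assumes "inj_on f {..<l::nat}" "\<And>s. s < l \<Longrightarrow> f s < l"
  shows "bij_betw f {..<l} {..<l}"
proof -
  have "f ` {..<l} \<subseteq> {..<l}" using assms(2) by blast
  then have "f ` {..<l} = {..<l}" by (intro endo_inj_surj assms(1)) simp_all
  with assms(1) show ?thesis by (simp add: bij_betw_def)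
qed

text \<open>A numbering of the boxes of a rectangle. The group \<open>C\<close> below preserves the
  second coordinate, so with (row, column) as coordinates it is the column group of the tableau and
  with (column, row) the row group. Everything is proved once and used for both.\<close>

locale grid =
  fixes u v :: "nat \<Rightarrow> nat" and a b l :: nat
  assumes bij: "bij_betw (\<lambda>s. (u s, v s)) {..<l} ({..<a} \<times> {..<b})"
begin

definition enc :: "nat \<Rightarrow> nat \<Rightarrow> nat"
  where "enc i j = inv_into {..<l} (\<lambda>s. (u s, v s)) (i, j)"

lemma enc:
  assumes "i < a" "j < b"
  shows "enc i j < l" "u (enc i j) = i" "v (enc i j) = j"
proof -
  have ij: "(i, j) \<in> (\<lambda>s. (u s, v s)) ` {..<l}"
    using bij assms by (auto simp: bij_betw_def)
  show "enc i j < l" using inv_into_into[OF ij] by (simp add: enc_def)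
  show "u (enc i j) = i" "v (enc i j) = j" using f_inv_into_f[OF ij] by (simp_all add: enc_def)
qed

lemma coord:
  assumes "s < l"
  shows "u s < a" "v s < b" "enc (u s) (v s) = s"
proof -
  show "u s < a" "v s < b" using bij assms by (auto simp: bij_betw_def)
  show "enc (u s) (v s) = s"
    using bij assms inv_into_f_f[of "\<lambda>s. (u s, v s)" "{..<l}" s] by (simp add: enc_def bij_betw_def)
qed

lemma coord_inject: "s < l \<Longrightarrow> t < l \<Longrightarrow> u s = u t \<Longrightarrow> v s = v t \<Longrightarrow> s = t"
  by (metis coord(3))

definition C :: "(nat \<Rightarrow> nat) set"
  where "C = {\<sigma>. \<sigma> permutes {..<l} \<and> (\<forall>s<l. v (\<sigma> s) = v s)}"

lemma C_permutes: "\<sigma> \<in> C \<Longrightarrow> \<sigma> permutes {..<l}"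
  by (simp add: C_def)

lemma C_lt: "\<sigma> \<in> C \<Longrightarrow> s < l \<Longrightarrow> \<sigma> s < l"
  using permutes_in_image[of \<sigma> "{..<l}" s] by (simp add: C_def)

lemma C_v: "\<sigma> \<in> C \<Longrightarrow> s < l \<Longrightarrow> v (\<sigma> s) = v s"
  by (simp add: C_def)

lemma finite_C: "finite C"
  unfolding C_def by (rule finite_subset[OF _ finite_permutations[of "{..<l}"]]) auto

lemma C_permutation: "\<sigma> \<in> C \<Longrightarrow> permutation \<sigma>"
  using permutation_permutes C_permutes by blast

lemma id_C: "id \<in> C"
  by (simp add: C_def permutes_id)

lemma C_compose: "\<sigma> \<in> C \<Longrightarrow> \<tau> \<in> C \<Longrightarrow> \<sigma> \<circ> \<tau> \<in> C"
  using C_lt[of \<tau>] by (auto simp: C_def intro: permutes_compose)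

lemma C_inv: "\<sigma> \<in> C \<Longrightarrow> inv_into UNIV \<sigma> \<in> C"
proof -
  assume \<sigma>: "\<sigma> \<in> C"
  then have p: "inv_into UNIV \<sigma> permutes {..<l}" by (intro permutes_inv C_permutes)
  have "v (inv_into UNIV \<sigma> s) = v s" if "s < l" for s
  proof -
    have "inv_into UNIV \<sigma> s < l" using p that permutes_in_image by fastforce
    then have "v (\<sigma> (inv_into UNIV \<sigma> s)) = v (inv_into UNIV \<sigma> s)" using C_v[OF \<sigma>] by blast
    then show ?thesis using permutes_inverses(1)[OF C_permutes[OF \<sigma>]] by simp
  qed
  with p show ?thesis by (simp add: C_def)
qed

lemma transpose_C: "s < l \<Longrightarrow> t < l \<Longrightarrow> v s = v t \<Longrightarrow> transpose s t \<in> C"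
  unfolding C_def using permutes_swap_id[of s "{..<l}" t] by (auto simp: transpose_def)

lemma bij_C_right: "\<tau> \<in> C \<Longrightarrow> bij_betw (\<lambda>\<sigma>. \<sigma> \<circ> \<tau>) C C"
  by (rule bij_betw_byWitness[where f' = "\<lambda>\<sigma>. \<sigma> \<circ> inv_into UNIV \<tau>"])
     (auto simp: C_compose C_inv comp_assoc permutes_inv_o[OF C_permutes])

lemma bij_C_left: "\<tau> \<in> C \<Longrightarrow> bij_betw (\<lambda>\<sigma>. \<tau> \<circ> \<sigma>) C C"
  by (rule bij_betw_byWitness[where f' = "\<lambda>\<sigma>. inv_into UNIV \<tau> \<circ> \<sigma>"])
     (auto simp: C_compose C_inv comp_assoc[symmetric] permutes_inv_o[OF C_permutes])

lemma bij_C_inv: "bij_betw (inv_into UNIV) C C"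
  by (rule bij_betw_byWitness[where f' = "inv_into UNIV"])
     (auto simp: C_inv permutes_inv_inv[OF C_permutes])


subsection \<open>Expanding over the column group\<close>

text \<open>The element of \<open>C\<close> which gives slot \<open>s\<close> the first coordinate
  \<open>g s\<close>; it is a permutation if \<open>g\<close> is injective on each fibre of
  \<open>v\<close>.\<close>

definition of_fun :: "(nat \<Rightarrow> nat) \<Rightarrow> nat \<Rightarrow> nat"
  where "of_fun g s = (if s < l then enc (g s) (v s) else s)"

lemma of_fun:
  assumes "g \<in> {..<l} \<rightarrow>\<^sub>E {..<a}" "inj_on (\<lambda>s. (g s, v s)) {..<l}"
  shows "of_fun g \<in> C" "\<And>s. s < l \<Longrightarrow> u (of_fun g s) = g s"
proof -
  have g: "g s < a" if "s < l" for s using assms(1) that by auto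
  have lt: "of_fun g s < l" "u (of_fun g s) = g s" "v (of_fun g s) = v s" if "s < l" for s
    using that g by (simp_all add: of_fun_def enc coord)
  have "inj_on (of_fun g) {..<l}"
    using assms(2) lt unfolding inj_on_def by (metis lessThan_iff)
  then have "bij_betw (of_fun g) {..<l} {..<l}"
    using lt(1) by (rule bij_betw_lessThanI)
  then have "of_fun g permutes {..<l}"
    by (rule bij_imp_permutes) (simp add: of_fun_def)
  with lt show "of_fun g \<in> C" by (simp add: C_def)
  show "\<And>s. s < l \<Longrightarrow> u (of_fun g s) = g s" by (rule lt)
qed

lemma bij_betw_C_injections:
  "bij_betw (\<lambda>\<sigma>. restrict (u \<circ> \<sigma>) {..<l}) C {g \<in> {..<l} \<rightarrow>\<^sub>E {..<a}. inj_on (\<lambda>s. (g s, v s)) {..<l}}"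
proof (rule bij_betw_byWitness[where f' = of_fun])
  show "\<forall>\<sigma>\<in>C. of_fun (restrict (u \<circ> \<sigma>) {..<l}) = \<sigma>"
  proof (intro ballI ext)
    fix \<sigma> s assume \<sigma>: "\<sigma> \<in> C"
    show "of_fun (restrict (u \<circ> \<sigma>) {..<l}) s = \<sigma> s"
    proof (cases "s < l")
      case True
      then show ?thesis using coord(3)[of "\<sigma> s"] C_v[OF \<sigma> True] C_lt[OF \<sigma> True] by (simp add: of_fun_def)
    next
      case False
      then show ?thesis using permutes_not_in[OF C_permutes[OF \<sigma>]] by (simp add: of_fun_def)
    qed
  qed
  show "\<forall>g\<in>{g \<in> {..<l} \<rightarrow>\<^sub>E {..<a}. inj_on (\<lambda>s. (g s, v s)) {..<l}}. restrict (u \<circ> of_fun g) {..<l} = g"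
  proof
    fix g assume g: "g \<in> {g \<in> {..<l} \<rightarrow>\<^sub>E {..<a}. inj_on (\<lambda>s. (g s, v s)) {..<l}}"
    show "restrict (u \<circ> of_fun g) {..<l} = g"
    proof
      fix s show "restrict (u \<circ> of_fun g) {..<l} s = g s"
        using g of_fun[of g] by (cases "s < l") (auto simp: PiE_def extensional_def)
    qed
  qed
  show "(\<lambda>\<sigma>. restrict (u \<circ> \<sigma>) {..<l}) ` C \<subseteq> {g \<in> {..<l} \<rightarrow>\<^sub>E {..<a}. inj_on (\<lambda>s. (g s, v s)) {..<l}}"
  proof (rule image_subsetI)
    fix \<sigma> assume \<sigma>: "\<sigma> \<in> C"
    have "s = t" if "s < l" "t < l" "u (\<sigma> s) = u (\<sigma> t)" "v s = v t" for s t
      using that coord_inject[of "\<sigma> s" "\<sigma> t"] C_v[OF \<sigma>] C_lt[OF \<sigma>] permutes_inj[OF C_permutes[OF \<sigma>]]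
      by (metis injD)
    then show "restrict (u \<circ> \<sigma>) {..<l} \<in> {g \<in> {..<l} \<rightarrow>\<^sub>E {..<a}. inj_on (\<lambda>s. (g s, v s)) {..<l}}"
      using C_lt[OF \<sigma>] by (auto simp: coord inj_on_def)
  qed
  show "of_fun ` {g \<in> {..<l} \<rightarrow>\<^sub>E {..<a}. inj_on (\<lambda>s. (g s, v s)) {..<l}} \<subseteq> C"
    using of_fun by auto
qed

text \<open>Expanding a product over the slots gives one term for each choice of an index in each
  slot. If the terms with a repeated index in a fibre of \<open>v\<close> vanish, the remaining
  choices are the elements of \<open>C\<close>.\<close>

lemma sum_over_C:
  assumes "\<And>g. g \<in> {..<l} \<rightarrow>\<^sub>E {..<a} \<Longrightarrow> \<not> inj_on (\<lambda>s. (g s, v s)) {..<l} \<Longrightarrow> F g = 0"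
  shows "(\<Sum>g\<in>{..<l} \<rightarrow>\<^sub>E {..<a}. F g) = (\<Sum>\<sigma>\<in>C. F (restrict (u \<circ> \<sigma>) {..<l}))"
proof -
  have "(\<Sum>g\<in>{..<l} \<rightarrow>\<^sub>E {..<a}. F g) =
     (\<Sum>g\<in>{g \<in> {..<l} \<rightarrow>\<^sub>E {..<a}. inj_on (\<lambda>s. (g s, v s)) {..<l}}. F g)"
    using assms by (intro sum.mono_neutral_right) (auto intro: finite_PiE)
  also have "\<dots> = (\<Sum>\<sigma>\<in>C. F (restrict (u \<circ> \<sigma>) {..<l}))"
    by (rule sum.reindex_bij_betw[OF bij_betw_C_injections, symmetric])
  finally show ?thesis .
qed

text \<open>A power of the determinant of \<open>W\<close>, as \<open>D_eq_det\<close> shows, in the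
  form in which it comes out of alternation over \<open>C\<close>.\<close>

definition D :: "(nat \<Rightarrow> nat \<Rightarrow> 'r::comm_ring_1) \<Rightarrow> 'r"
  where "D W = (\<Sum>\<sigma>\<in>C. of_int (sign \<sigma>) * (\<Prod>s<l. W (u (\<sigma> s)) (u s)))"

lemma D_eq_inverse: "D W = (\<Sum>\<sigma>\<in>C. of_int (sign \<sigma>) * (\<Prod>s<l. W (u s) (u (\<sigma> s))))"
proof -
  have "D W = (\<Sum>\<sigma>\<in>C. of_int (sign (inv_into UNIV \<sigma>)) * (\<Prod>s<l. W (u (inv_into UNIV \<sigma> s)) (u s)))"
    unfolding D_def by (rule sum.reindex_bij_betw[OF bij_C_inv, symmetric])
  also have "\<dots> = (\<Sum>\<sigma>\<in>C. of_int (sign \<sigma>) * (\<Prod>s<l. W (u s) (u (\<sigma> s))))"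
  proof (rule sum.cong[OF refl])
    fix \<sigma> assume \<sigma>: "\<sigma> \<in> C"
    have "(\<Prod>s<l. W (u s) (u (\<sigma> s))) = (\<Prod>s<l. W (u (inv_into UNIV \<sigma> s)) (u (\<sigma> (inv_into UNIV \<sigma> s))))"
      by (rule prod.permute[OF permutes_inv[OF C_permutes[OF \<sigma>]], unfolded comp_def])
    then show "of_int (sign (inv_into UNIV \<sigma>)) * (\<Prod>s<l. W (u (inv_into UNIV \<sigma> s)) (u s)) =
        of_int (sign \<sigma>) * (\<Prod>s<l. W (u s) (u (\<sigma> s)))"
      by (simp add: permutes_inverses[OF C_permutes[OF \<sigma>]] sign_inverse[OF C_permutation[OF \<sigma>]])
  qed
  finally show ?thesis .
qed

text \<open>If \<open>g\<close> takes the same value twice in a fibre, exchanging these two slots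
  reverses the sign of every term without changing the product. Otherwise \<open>g\<close> is
  \<open>u\<close> composed with an element of \<open>C\<close>, which is absorbed by
  reindexing.\<close>

lemma alternating_sum:
  fixes W :: "nat \<Rightarrow> nat \<Rightarrow> 'k::field_char_0 geven"
  assumes g: "g \<in> {..<l} \<rightarrow>\<^sub>E {..<a}"
  shows "(\<Sum>\<sigma>\<in>C. of_int (sign \<sigma>) * (\<Prod>s<l. W (u (\<sigma> s)) (g s))) =
    (if inj_on (\<lambda>s. (g s, v s)) {..<l} then of_int (sign (of_fun g)) * D W else 0)" (is "?S = _")
proof (cases "inj_on (\<lambda>s. (g s, v s)) {..<l}")
  case True
  define \<rho> where "\<rho> = of_fun g"
  have \<rho>: "\<rho> \<in> C" "\<And>s. s < l \<Longrightarrow> g s = u (\<rho> s)"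
    using of_fun[OF g True] by (simp_all add: \<rho>_def)
  have "?S = (\<Sum>\<sigma>\<in>C. of_int (sign (\<sigma> \<circ> \<rho>)) * (\<Prod>s<l. W (u ((\<sigma> \<circ> \<rho>) s)) (g s)))"
    by (rule sum.reindex_bij_betw[OF bij_C_right[OF \<rho>(1)], symmetric])
  also have "\<dots> = (\<Sum>\<sigma>\<in>C. of_int (sign \<rho>) * (of_int (sign \<sigma>) * (\<Prod>s<l. W (u (\<sigma> s)) (u s))))"
  proof (rule sum.cong[OF refl])
    fix \<sigma> assume \<sigma>: "\<sigma> \<in> C"
    have "(\<Prod>s<l. W (u (\<sigma> s)) (u s)) = (\<Prod>s<l. W (u (\<sigma> (\<rho> s))) (u (\<rho> s)))"
      by (rule prod.permute[OF C_permutes[OF \<rho>(1)], unfolded comp_def])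
    then show "of_int (sign (\<sigma> \<circ> \<rho>)) * (\<Prod>s<l. W (u ((\<sigma> \<circ> \<rho>) s)) (g s)) =
        of_int (sign \<rho>) * (of_int (sign \<sigma>) * (\<Prod>s<l. W (u (\<sigma> s)) (u s)))"
      by (simp add: sign_compose[OF C_permutation[OF \<sigma>] C_permutation[OF \<rho>(1)]] \<rho>(2) mult_ac)
  qed
  finally show ?thesis using True by (simp add: D_def sum_distrib_left \<rho>_def)
next
  case False
  then obtain s t where st: "s < l" "t < l" "s \<noteq> t" "g s = g t" "v s = v t"
    by (auto simp: inj_on_def)
  define \<tau> where "\<tau> = transpose s t"
  have \<tau>: "\<tau> \<in> C" using st by (simp add: \<tau>_def transpose_C)
  have "?S = (\<Sum>\<sigma>\<in>C. of_int (sign (\<sigma> \<circ> \<tau>)) * (\<Prod>s<l. W (u ((\<sigma> \<circ> \<tau>) s)) (g s)))"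
    by (rule sum.reindex_bij_betw[OF bij_C_right[OF \<tau>], symmetric])
  also have "\<dots> = (\<Sum>\<sigma>\<in>C. - (of_int (sign \<sigma>) * (\<Prod>s<l. W (u (\<sigma> s)) (g s))))"
  proof (rule sum.cong[OF refl])
    fix \<sigma> assume \<sigma>: "\<sigma> \<in> C"
    have "(\<Prod>s<l. W (u (\<sigma> s)) (g s)) = (\<Prod>s<l. W (u (\<sigma> (\<tau> s))) (g (\<tau> s)))"
      by (rule prod.permute[OF C_permutes[OF \<tau>], unfolded comp_def])
    moreover have "g (\<tau> s') = g s'" for s' using st by (simp add: \<tau>_def transpose_def)
    moreover have "sign \<tau> = -1" using st by (simp add: \<tau>_def sign_swap_id)
    ultimately show "of_int (sign (\<sigma> \<circ> \<tau>)) * (\<Prod>s<l. W (u ((\<sigma> \<circ> \<tau>) s)) (g s)) =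
        - (of_int (sign \<sigma>) * (\<Prod>s<l. W (u (\<sigma> s)) (g s)))"
      by (simp add: sign_compose[OF C_permutation[OF \<sigma>] C_permutation[OF \<tau>]])
  qed
  finally have eq: "?S = - ?S" by (simp only: sum_negf)
  have "of_geven S = of_geven 0" if "S = - S" for S :: "'k geven"
  proof -
    have "of_geven S = - of_geven S" by (rule trans[OF arg_cong[OF that, of of_geven] of_geven_simps(5)])
    then have "of_geven S + of_geven S = 0" by (rule eq_neg_iff_add_eq_0[THEN iffD1])
    then have "of_geven S = 0" by (rule G_grade_two_eq_zero)
    then show ?thesis by simp
  qed
  from this[OF eq] have "of_geven ?S = of_geven 0" .
  then have "?S = 0" by (rule of_geven_inject[THEN iffD1])
  then show ?thesis unfolding if_not_P[OF False] .
qed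

text \<open>Multiplicativity of determinants, fibre by fibre: the even matrix \<open>W\<close> is
  expanded in every slot and its coefficients are collected. The factors \<open>N\<close> stay in
  the order of the slots and need not commute.\<close>

lemma alternating_oprod:
  fixes W :: "nat \<Rightarrow> nat \<Rightarrow> 'k::field_char_0 geven"
  shows "(\<Sum>\<sigma>\<in>C. of_int (sign \<sigma>) * oprod (\<lambda>s. \<Sum>i<a. of_geven (W (u (\<sigma> s)) i) * N s i) l) =
    of_geven (D W) * (\<Sum>\<sigma>\<in>C. of_int (sign \<sigma>) * oprod (\<lambda>s. N s (u (\<sigma> s))) l)"
proof -
  have "(\<Sum>\<sigma>\<in>C. of_int (sign \<sigma>) * oprod (\<lambda>s. \<Sum>i<a. of_geven (W (u (\<sigma> s)) i) * N s i) l) =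
     (\<Sum>\<sigma>\<in>C. \<Sum>g\<in>{..<l} \<rightarrow>\<^sub>E {..<a}.
        of_geven (of_int (sign \<sigma>) * (\<Prod>s<l. W (u (\<sigma> s)) (g s))) * oprod (\<lambda>s. N s (g s)) l)"
    by (simp add: oprod_sum oprod_scale sum_distrib_left mult.assoc of_geven_of_int)
  also have "\<dots> = (\<Sum>g\<in>{..<l} \<rightarrow>\<^sub>E {..<a}.
      of_geven (\<Sum>\<sigma>\<in>C. of_int (sign \<sigma>) * (\<Prod>s<l. W (u (\<sigma> s)) (g s))) * oprod (\<lambda>s. N s (g s)) l)"
    by (subst sum.swap) (simp add: of_geven_sum sum_distrib_right)
  also have "\<dots> = (\<Sum>g\<in>{..<l} \<rightarrow>\<^sub>E {..<a}.
      of_geven (if inj_on (\<lambda>s. (g s, v s)) {..<l} then of_int (sign (of_fun g)) * D W else 0) * oprod (\<lambda>s. N s (g s)) l)"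
    by (rule sum.cong[OF refl]) (simp only: alternating_sum)
  also have "\<dots> = (\<Sum>\<sigma>\<in>C. of_geven (of_int (sign \<sigma>) * D W) * oprod (\<lambda>s. N s (u (\<sigma> s))) l)"
  proof (subst sum_over_C, simp, rule sum.cong[OF refl])
    fix \<sigma> assume \<sigma>: "\<sigma> \<in> C"
    let ?g = "restrict (u \<circ> \<sigma>) {..<l}"
    from \<sigma> have "inj_on (\<lambda>s. (?g s, v s)) {..<l}"
      using bij_betw_C_injections unfolding bij_betw_def by blast
    moreover have "of_fun ?g = \<sigma>"
    proof
      fix s show "of_fun ?g s = \<sigma> s"
        using coord(3)[of "\<sigma> s"] C_v[OF \<sigma>, of s] C_lt[OF \<sigma>, of s] permutes_not_in[OF C_permutes[OF \<sigma>], of s]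
        by (auto simp: of_fun_def)
    qed
    moreover have "oprod (\<lambda>s. N s (?g s)) l = oprod (\<lambda>s. N s (u (\<sigma> s))) l"
      by (rule oprod_cong) auto
    ultimately show "of_geven (if inj_on (\<lambda>s. (?g s, v s)) {..<l} then of_int (sign (of_fun ?g)) * D W else 0) *
        oprod (\<lambda>s. N s (?g s)) l = of_geven (of_int (sign \<sigma>) * D W) * oprod (\<lambda>s. N s (u (\<sigma> s))) l"
      by (simp only: if_True)
  qed
  also have "\<dots> = of_geven (D W) * (\<Sum>\<sigma>\<in>C. of_int (sign \<sigma>) * oprod (\<lambda>s. N s (u (\<sigma> s))) l)"
    unfolding sum_distrib_left
    by (rule sum.cong[OF refl]) (simp add: of_geven_of_int mult.assoc[symmetric] of_geven_commute)
  finally show ?thesis .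
qed

text \<open>Once \<open>W\<close> is extracted, a slot outside \<open>B\<close> contributes a
  Kronecker delta, so only the \<sigma> which fix all these slots survive. Such a \<sigma> permutes
  the odd factors in \<open>B\<close>, and the resulting sign cancels \<open>sign \<sigma>\<close>.
  All surviving terms are therefore equal, and their number is the multiplicity which \<kappa>
  records.\<close>

lemma alternating_oprod_odd:
  fixes W :: "nat \<Rightarrow> nat \<Rightarrow> 'k::field_char_0 geven"
  assumes B: "B \<subseteq> {..<l}" and odd: "\<And>i j. z i j \<in> G_grade 1"
    and f: "\<And>k s. k < a \<Longrightarrow> s < l \<Longrightarrow>
      f k s = (if s \<in> B then \<Sum>i<a. of_geven (W k i) * z i (v s) else of_geven (W k (u s)))"
  shows "(\<Sum>\<sigma>\<in>C. of_int (sign \<sigma>) * oprod (\<lambda>s. f (u (\<sigma> s)) s) l) =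
    of_geven (D W) * of_nat (card {\<sigma> \<in> C. \<forall>s<l. s \<notin> B \<longrightarrow> \<sigma> s = s}) *
    oprod (\<lambda>s. if s \<in> B then z (u s) (v s) else 1) l"
proof -
  \<comment> \<open>Both kinds of slot become \<open>W\<close> applied to a vector; outside
    \<open>B\<close> it is the unit vector with index \<open>u s\<close>.\<close>
  define N where "N s i = (if s \<in> B then z i (v s) else of_bool (i = u s))" for s i
  let ?z = "\<lambda>s. if s \<in> B then z (u s) (v s) else 1"
  have "(\<Sum>\<sigma>\<in>C. of_int (sign \<sigma>) * oprod (\<lambda>s. f (u (\<sigma> s)) s) l) =
     (\<Sum>\<sigma>\<in>C. of_int (sign \<sigma>) * oprod (\<lambda>s. \<Sum>i<a. of_geven (W (u (\<sigma> s)) i) * N s i) l)"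
  proof (intro sum.cong refl arg_cong2[where f = "(*)"] oprod_cong)
    fix \<sigma> s assume "\<sigma> \<in> C" "s < l"
    then show "f (u (\<sigma> s)) s = (\<Sum>i<a. of_geven (W (u (\<sigma> s)) i) * N s i)"
      using C_lt by (simp add: f N_def coord)
  qed
  also have "\<dots> = of_geven (D W) * (\<Sum>\<sigma>\<in>C. of_int (sign \<sigma>) * oprod (\<lambda>s. N s (u (\<sigma> s))) l)"
    by (rule alternating_oprod)
  also have "(\<Sum>\<sigma>\<in>C. of_int (sign \<sigma>) * oprod (\<lambda>s. N s (u (\<sigma> s))) l) =
      (\<Sum>\<sigma>\<in>C. if \<forall>s<l. s \<notin> B \<longrightarrow> \<sigma> s = s then oprod ?z l else 0)"
  proof (rule sum.cong[OF refl])
    fix \<sigma> assume \<sigma>: "\<sigma> \<in> C"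
    show "of_int (sign \<sigma>) * oprod (\<lambda>s. N s (u (\<sigma> s))) l =
        (if \<forall>s<l. s \<notin> B \<longrightarrow> \<sigma> s = s then oprod ?z l else 0)"
    proof (cases "\<forall>s<l. s \<notin> B \<longrightarrow> \<sigma> s = s")
      case False
      then obtain s where s: "s < l" "s \<notin> B" "\<sigma> s \<noteq> s" by blast
      then have "u (\<sigma> s) \<noteq> u s"
        using coord_inject[of "\<sigma> s" s] C_lt[OF \<sigma>] C_v[OF \<sigma>] by auto
      then have "oprod (\<lambda>s. N s (u (\<sigma> s))) l = 0"
        using s by (intro oprod_zero[of _ s]) (simp_all add: N_def)
      then show ?thesis by (simp only: False if_False mult_zero_right)
    next
      case True
      have "\<sigma> permutes B"
      proof (rule bij_imp_permutes)
        have fix_out: "\<sigma> s = s" if "s \<notin> B" for s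
          using that True permutes_not_in[OF C_permutes[OF \<sigma>], of s] by (cases "s < l") auto
        then show "\<And>s. s \<notin> B \<Longrightarrow> \<sigma> s = s" .
        have inj: "inj \<sigma>" by (rule permutes_inj[OF C_permutes[OF \<sigma>]])
        have "\<sigma> s \<in> B" if "s \<in> B" for s
          using fix_out[of "\<sigma> s"] that inj by (metis injD)
        then have "\<sigma> ` B \<subseteq> B" by blast
        moreover have "finite B" using B finite_subset by blast
        moreover have "inj_on \<sigma> B" using inj by (rule inj_on_subset) simp
        ultimately show "bij_betw \<sigma> B B"
          by (simp add: bij_betw_def endo_inj_surj)
      qed
      then have "oprod (\<lambda>s. ?z (\<sigma> s)) l = of_int (sign \<sigma>) * oprod ?z l"
        using odd B by (intro oprod_permute_odd[where d = "\<lambda>s. of_bool (s \<in> B)"]) auto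
      moreover have "oprod (\<lambda>s. N s (u (\<sigma> s))) l = oprod (\<lambda>s. ?z (\<sigma> s)) l"
      proof (rule oprod_cong[OF refl])
        fix s assume "s < l"
        then show "N s (u (\<sigma> s)) = ?z (\<sigma> s)"
          using permutes_in_image[OF \<open>\<sigma> permutes B\<close>, of s] C_v[OF \<sigma>, of s] True by (auto simp: N_def)
      qed
      ultimately show ?thesis using True
        by (simp only: mult.assoc[symmetric] of_int_mult[symmetric] sign_idempotent) simp
    qed
  qed
  also have "\<dots> = of_nat (card {\<sigma> \<in> C. \<forall>s<l. s \<notin> B \<longrightarrow> \<sigma> s = s}) * oprod ?z l"
    using finite_C by (simp flip: sum.inter_filter)
  finally show ?thesis by (simp add: mult.assoc)
qed

text \<open>The product of all entries of an odd matrix is a top form in each column, so a linear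
  substitution multiplies it by one determinant per column. Here the alternation is supplied by the
  anticommuting factors themselves.\<close>

lemma oprod_linear_odd:
  fixes W :: "nat \<Rightarrow> nat \<Rightarrow> 'k::field_char_0 geven"
  assumes odd: "\<And>i j. z i j \<in> G_grade 1"
  shows "oprod (\<lambda>s. \<Sum>i<a. of_geven (W (u s) i) * z i (v s)) l =
    of_geven (D W) * oprod (\<lambda>s. z (u s) (v s)) l"
proof -
  have "oprod (\<lambda>s. \<Sum>i<a. of_geven (W (u s) i) * z i (v s)) l =
      (\<Sum>g\<in>{..<l} \<rightarrow>\<^sub>E {..<a}. of_geven (\<Prod>s<l. W (u s) (g s)) * oprod (\<lambda>s. z (g s) (v s)) l)"
    by (simp add: oprod_sum oprod_scale)
  also have "\<dots> = (\<Sum>\<sigma>\<in>C. of_geven (of_int (sign \<sigma>) * (\<Prod>s<l. W (u s) (u (\<sigma> s)))) * oprod (\<lambda>s. z (u s) (v s)) l)"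
  proof (subst sum_over_C)
    fix g assume "g \<in> {..<l} \<rightarrow>\<^sub>E {..<a}" "\<not> inj_on (\<lambda>s. (g s, v s)) {..<l}"
    then obtain s t where st: "s < t" "t < l" "g s = g t" "v s = v t"
      unfolding inj_on_def by (metis (full_types) lessThan_iff linorder_neqE_nat prod.inject)
    then have "oprod (\<lambda>s. z (g s) (v s)) l = 0"
      using odd by (intro oprod_equal_odd_factors[of s t l _ "\<lambda>_. 1"]) auto
    then show "of_geven (\<Prod>s<l. W (u s) (g s)) * oprod (\<lambda>s. z (g s) (v s)) l = 0" by simp
  next
    show "(\<Sum>\<sigma>\<in>C. of_geven (\<Prod>s<l. W (u s) (restrict (u \<circ> \<sigma>) {..<l} s)) *
          oprod (\<lambda>s. z (restrict (u \<circ> \<sigma>) {..<l} s) (v s)) l) =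
       (\<Sum>\<sigma>\<in>C. of_geven (of_int (sign \<sigma>) * (\<Prod>s<l. W (u s) (u (\<sigma> s)))) * oprod (\<lambda>s. z (u s) (v s)) l)"
    proof (rule sum.cong[OF refl])
      fix \<sigma> assume \<sigma>: "\<sigma> \<in> C"
      have "oprod (\<lambda>s. z (restrict (u \<circ> \<sigma>) {..<l} s) (v s)) l = oprod (\<lambda>s. z (u (\<sigma> s)) (v (\<sigma> s))) l"
        using C_v[OF \<sigma>] by (intro oprod_cong) auto
      also have "\<dots> = of_int (sign \<sigma>) * oprod (\<lambda>s. z (u s) (v s)) l"
        using odd by (intro oprod_permute_odd[OF C_permutes[OF \<sigma>], where d = "\<lambda>_. 1"]) auto
      finally show "of_geven (\<Prod>s<l. W (u s) (restrict (u \<circ> \<sigma>) {..<l} s)) *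
          oprod (\<lambda>s. z (restrict (u \<circ> \<sigma>) {..<l} s) (v s)) l =
        of_geven (of_int (sign \<sigma>) * (\<Prod>s<l. W (u s) (u (\<sigma> s)))) * oprod (\<lambda>s. z (u s) (v s)) l"
        by (simp add: mult.assoc[symmetric] of_geven_of_int mult.commute[of "of_int _"] del: of_geven_simps(4))
           (simp only: mult.commute[of "of_int _"] of_geven_simps(4) of_geven_of_int)
    qed
  qed
  also have "\<dots> = of_geven (D W) * oprod (\<lambda>s. z (u s) (v s)) l"
    by (simp add: D_eq_inverse of_geven_sum sum_distrib_right)
  finally show ?thesis .
qed


subsection \<open>The column group as a product of symmetric groups\<close>

definition emb :: "(nat \<Rightarrow> nat \<Rightarrow> nat) \<Rightarrow> nat \<Rightarrow> nat"
  where "emb p s = (if s < l then enc (p (v s) (u s)) (v s) else s)"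

text \<open>The permutation \<open>q\<close> acting in the single fibre \<open>j\<close>; a
  transposition remains a transposition, so the sign of \<open>q\<close> is preserved.\<close>

definition emb1 :: "nat \<Rightarrow> (nat \<Rightarrow> nat) \<Rightarrow> nat \<Rightarrow> nat"
  where "emb1 j q s = (if s < l \<and> v s = j then enc (q (u s)) j else s)"

lemma emb_props:
  assumes "\<forall>j<b. p j permutes {..<a}" "s < l"
  shows "emb p s < l" "u (emb p s) = p (v s) (u s)" "v (emb p s) = v s"
proof -
  have "p (v s) (u s) < a"
    using assms(1) permutes_in_image[of "p (v s)" "{..<a}" "u s"] coord[OF assms(2)] by simp
  then show "emb p s < l" "u (emb p s) = p (v s) (u s)" "v (emb p s) = v s"
    using assms(2) by (simp_all add: emb_def enc coord)
qed

lemma emb_C: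
  assumes p: "\<forall>j<b. p j permutes {..<a}"
  shows "emb p \<in> C"
proof -
  have "inj_on (emb p) {..<l}"
  proof (rule inj_onI)
    fix s t assume st: "s \<in> {..<l}" "t \<in> {..<l}" "emb p s = emb p t"
    then have lt: "s < l" "t < l" by auto
    have "v (emb p s) = v (emb p t)" "u (emb p s) = u (emb p t)" by (simp_all only: st(3))
    note eq = this[unfolded emb_props(3)[OF p lt(1)] emb_props(3)[OF p lt(2)]
        emb_props(2)[OF p lt(1)] emb_props(2)[OF p lt(2)]]
    have v: "v s = v t" by (rule eq(1))
    have "p (v t) (u s) = p (v t) (u t)" using eq(2) unfolding v .
    then have "u s = u t" using permutes_inj[OF p[rule_format, OF coord(2)[OF lt(2)]]] by (rule injD[rotated])
    with v lt show "s = t" by (simp add: coord_inject)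
  qed
  then have "bij_betw (emb p) {..<l} {..<l}"
    using emb_props(1)[OF p] by (rule bij_betw_lessThanI)
  then have "emb p permutes {..<l}"
    by (rule bij_imp_permutes) (simp add: emb_def)
  then show ?thesis using emb_props[OF p] by (simp add: C_def)
qed

lemma sign_emb1:
  assumes "j < b" "q permutes {..<a}"
  shows "sign (emb1 j q) = sign q \<and> permutation (emb1 j q)"
proof -
  from assms(2) have "q permutes {..<a}" "finite {..<a}" by auto
  then show ?thesis
  proof (induction rule: permutes_induct)
    case id
    have "emb1 j id = id" by (auto simp: emb1_def fun_eq_iff coord)
    then show ?case by (simp only: permutation_id)
  next
    case (swap x y q)
    have "emb1 j (transpose x y \<circ> q) = transpose (enc x j) (enc y j) \<circ> emb1 j q"
    proof
      fix s
      show "emb1 j (transpose x y \<circ> q) s = (transpose (enc x j) (enc y j) \<circ> emb1 j q) s"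
      proof (cases "s < l \<and> v s = j")
        case True
        then have "q (u s) < a"
          using permutes_in_image[OF swap(4), of "u s"] coord[of s] by simp
        with True swap(1,2) assms(1) show ?thesis
          by (simp add: emb1_def transpose_def) (metis enc(2) lessThan_iff)
      next
        case False
        then have "s \<noteq> enc x j" "s \<noteq> enc y j"
          using swap(1,2) assms(1) enc by auto
        then show ?thesis using False by (auto simp: emb1_def)
      qed
    qed
    moreover have "enc x j \<noteq> enc y j"
      using swap(1-3) assms(1) by (metis enc(2) lessThan_iff)
    moreover have "permutation q"
      using swap(4) by (meson finite_lessThan permutation_permutes)
    ultimately show ?case
      using swap(3,5)
      by (simp only: sign_compose permutation_swap_id sign_swap_id permutation_compose if_False simp_thms)
  qed
qed

lemma sign_emb:
  assumes p: "\<forall>j<b. p j permutes {..<a}"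
  shows "sign (emb p) = (\<Prod>j<b. sign (p j))"
proof -
  \<comment> \<open>The family is cut off by identities from \<open>k\<close> on, so that each
    induction step composes with a permutation of a single fibre.\<close>
  have "sign (emb (\<lambda>j. if j < k then p j else id)) = (\<Prod>j<k. sign (p j))" if "k \<le> b" for k
    using that
  proof (induction k)
    case 0
    have "emb (\<lambda>j. id) = id" by (auto simp: emb_def fun_eq_iff coord)
    then show ?case by (simp add: id_def)
  next
    case (Suc k)
    let ?p = "\<lambda>k j. if j < k then p j else id"
    have eq: "emb (?p (Suc k)) = emb (?p k) \<circ> emb1 k (p k)"
    proof
      fix s
      show "emb (?p (Suc k)) s = (emb (?p k) \<circ> emb1 k (p k)) s"
      proof (cases "s < l \<and> v s = k")
        case True
        then have "p k (u s) < a"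
          using p permutes_in_image[of "p k" "{..<a}" "u s"] Suc.prems coord[of s] by simp
        then show ?thesis using True Suc.prems enc[of "p k (u s)" k] by (simp add: emb_def emb1_def)
      next
        case False
        then show ?thesis by (auto simp: emb_def emb1_def less_Suc_eq)
      qed
    qed
    have "permutation (emb (?p k))"
      using p by (intro C_permutation emb_C) (auto simp: permutes_id)
    then have "sign (emb (?p (Suc k))) = sign (emb (?p k)) * sign (emb1 k (p k))"
      unfolding eq using sign_emb1[of k "p k"] p Suc.prems by (intro sign_compose) auto
    then show ?case
      using Suc sign_emb1[of k "p k"] p by (simp add: mult.commute)
  qed
  from this[of b] have "sign (emb (\<lambda>j. if j < b then p j else id)) = (\<Prod>j<b. sign (p j))" by simp
  moreover have "emb (\<lambda>j. if j < b then p j else id) = emb p"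
    by (auto simp: emb_def fun_eq_iff coord)
  ultimately show ?thesis by simp
qed

lemma bij_betw_emb:
  "bij_betw emb ({..<b} \<rightarrow>\<^sub>E {q. q permutes {..<a}}) C"
proof (rule bij_betw_byWitness[where f' =
      "\<lambda>\<sigma>. restrict (\<lambda>j i. if i < a then u (\<sigma> (enc i j)) else i) {..<b}"])
  show "\<forall>p\<in>{..<b} \<rightarrow>\<^sub>E {q. q permutes {..<a}}.
     restrict (\<lambda>j i. if i < a then u (emb p (enc i j)) else i) {..<b} = p"
  proof
    fix p assume p: "p \<in> {..<b} \<rightarrow>\<^sub>E {q. q permutes {..<a}}"
    then have p': "\<forall>j<b. p j permutes {..<a}" by auto
    show "restrict (\<lambda>j i. if i < a then u (emb p (enc i j)) else i) {..<b} = p"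
    proof
      fix j
      show "restrict (\<lambda>j i. if i < a then u (emb p (enc i j)) else i) {..<b} j = p j"
      proof (cases "j < b")
        case True
        have "(if i < a then u (emb p (enc i j)) else i) = p j i" for i
        proof (cases "i < a")
          case i: True
          then show ?thesis using emb_props(2)[OF p' enc(1)[OF i True]] enc[OF i True] by simp
        next
          case False
          then show ?thesis using permutes_not_in[OF p'[rule_format, OF True], of i] by simp
        qed
        with True show ?thesis by simp
      next
        case False
        with p show ?thesis by (simp add: PiE_def extensional_def)
      qed
    qed
  qed
  have perm: "(\<lambda>i. if i < a then u (\<sigma> (enc i j)) else i) permutes {..<a}" if "\<sigma> \<in> C" "j < b" for \<sigma> j
  proof (rule bij_imp_permutes)
    let ?q = "\<lambda>i. if i < a then u (\<sigma> (enc i j)) else i"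
    have "inj_on ?q {..<a}"
    proof (rule inj_onI)
      fix i i' assume i: "i \<in> {..<a}" "i' \<in> {..<a}" "?q i = ?q i'"
      have "\<sigma> (enc i j) = \<sigma> (enc i' j)"
        by (rule coord_inject) (use i that in \<open>auto simp: C_lt C_v enc\<close>)
      then have "enc i j = enc i' j"
        using permutes_inj[OF C_permutes[OF that(1)]] by (metis injD)
      with i that show "i = i'" by (metis enc(2) lessThan_iff)
    qed
    moreover have "?q ` {..<a} \<subseteq> {..<a}"
      using that by (auto simp: coord C_lt enc)
    ultimately show "bij_betw ?q {..<a} {..<a}"
      by (intro bij_betw_lessThanI) blast+
  qed simp
  show "\<forall>\<sigma>\<in>C. emb (restrict (\<lambda>j i. if i < a then u (\<sigma> (enc i j)) else i) {..<b}) = \<sigma>"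
  proof (intro ballI ext)
    fix \<sigma> s assume \<sigma>: "\<sigma> \<in> C"
    show "emb (restrict (\<lambda>j i. if i < a then u (\<sigma> (enc i j)) else i) {..<b}) s = \<sigma> s"
    proof (cases "s < l")
      case True
      then show ?thesis
        using coord(3)[of "\<sigma> s"] C_lt[OF \<sigma> True] C_v[OF \<sigma> True] by (simp add: emb_def coord)
    next
      case False
      then show ?thesis using permutes_not_in[OF C_permutes[OF \<sigma>]] by (simp add: emb_def)
    qed
  qed
  show "emb ` ({..<b} \<rightarrow>\<^sub>E {q. q permutes {..<a}}) \<subseteq> C"
    by (auto intro!: emb_C)
  show "(\<lambda>\<sigma>. restrict (\<lambda>j i. if i < a then u (\<sigma> (enc i j)) else i) {..<b}) ` C
     \<subseteq> {..<b} \<rightarrow>\<^sub>E {q. q permutes {..<a}}"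
    using perm by auto
qed

text \<open>\<open>C\<close> consists of the families of permutations, one for each fibre, and signs
  are multiplicative; hence the sum over \<open>C\<close> is a product of Leibniz formulas.\<close>

lemma D_eq_det: "D W = det (mat a a (\<lambda>(i, j). W i j)) ^ b"
proof -
  have prod_eq: "(\<Prod>s<l. f (u s) (v s)) = (\<Prod>j<b. \<Prod>i<a. f i j)" for f :: "nat \<Rightarrow> nat \<Rightarrow> 'a"
  proof -
    have "(\<Prod>s<l. case (u s, v s) of (i, j) \<Rightarrow> f i j) = (\<Prod>(i, j)\<in>{..<a} \<times> {..<b}. f i j)"
      by (rule prod.reindex_bij_betw[OF bij])
    then show ?thesis by (simp add: prod.cartesian_product[symmetric] prod.swap[of _ "{..<b}"])
  qed
  have "det (mat a a (\<lambda>(i, j). W i j)) = (\<Sum>q | q permutes {..<a}. of_int (sign q) * (\<Prod>i<a. W (q i) i))"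
  proof -
    have "det (mat a a (\<lambda>(i, j). W i j)) = (\<Sum>q | q permutes {0..<a}. signof q *
        (\<Prod>j<a. mat a a (\<lambda>(i, j). W i j) $$ (q j, j)))"
      by (rule det_col) simp
    also have "\<dots> = (\<Sum>q | q permutes {..<a}. of_int (sign q) * (\<Prod>i<a. W (q i) i))"
      unfolding atLeast0LessThan
    proof (intro sum.cong refl arg_cong2[where f = "(*)"] prod.cong)
      fix q i assume "q \<in> {q. q permutes {..<a}}" "i \<in> {..<a}"
      then have "q i < a" "i < a" using permutes_in_image[of q "{..<a}" i] by auto
      then show "mat a a (\<lambda>(i, j). W i j) $$ (q i, i) = W (q i) i" by simp
    qed
    finally show ?thesis .
  qed
  then have "det (mat a a (\<lambda>(i, j). W i j)) ^ b =
      (\<Prod>j<b. \<Sum>q | q permutes {..<a}. of_int (sign q) * (\<Prod>i<a. W (q i) i))"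
    by simp
  also have "\<dots> = (\<Sum>p\<in>{..<b} \<rightarrow>\<^sub>E {q. q permutes {..<a}}. \<Prod>j<b. of_int (sign (p j)) * (\<Prod>i<a. W (p j i) i))"
    by (subst prod_sum_PiE) (auto simp: finite_permutations)
  also have "\<dots> = (\<Sum>p\<in>{..<b} \<rightarrow>\<^sub>E {q. q permutes {..<a}}.
      of_int (sign (emb p)) * (\<Prod>s<l. W (u (emb p s)) (u s)))"
  proof (rule sum.cong[OF refl])
    fix p assume p: "p \<in> {..<b} \<rightarrow>\<^sub>E {q. q permutes {..<a}}"
    then have p': "\<forall>j<b. p j permutes {..<a}" by auto
    have "(\<Prod>s<l. W (u (emb p s)) (u s)) = (\<Prod>s<l. W (p (v s) (u s)) (u s))"
      using emb_props[OF p'] by (intro prod.cong) auto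
    also have "\<dots> = (\<Prod>j<b. \<Prod>i<a. W (p j i) i)"
      by (rule prod_eq)
    finally show "(\<Prod>j<b. of_int (sign (p j)) * (\<Prod>i<a. W (p j i) i)) =
        of_int (sign (emb p)) * (\<Prod>s<l. W (u (emb p s)) (u s))"
      using sign_emb[OF p'] by (simp add: prod.distrib)
  qed
  also have "\<dots> = D W"
    unfolding D_def by (rule sum.reindex_bij_betw[OF bij_betw_emb])
  finally show ?thesis by simp
qed

lemma card_C_fixing:
  "card {\<sigma> \<in> C. \<forall>s<l. s \<notin> B \<longrightarrow> \<sigma> s = s} = (\<Prod>j<b. fact (card {i. i < a \<and> enc i j \<in> B}))"
proof -
  let ?P = "{..<b} \<rightarrow>\<^sub>E {q. q permutes {..<a}}"
  let ?Q = "PiE {..<b} (\<lambda>j. {q. q permutes {i. i < a \<and> enc i j \<in> B}})"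
  have sub: "?Q \<subseteq> ?P"
    by (rule PiE_mono) (auto intro: permutes_subset)
  have "{\<sigma> \<in> C. \<forall>s<l. s \<notin> B \<longrightarrow> \<sigma> s = s} = emb ` ?Q"
  proof (intro equalityI subsetI)
    fix \<sigma> assume \<sigma>: "\<sigma> \<in> {\<sigma> \<in> C. \<forall>s<l. s \<notin> B \<longrightarrow> \<sigma> s = s}"
    then obtain p where p: "p \<in> ?P" "\<sigma> = emb p"
      using bij_betw_emb unfolding bij_betw_def by blast
    have "p j permutes {i. i < a \<and> enc i j \<in> B}" if "j < b" for j
    proof (rule permutes_superset)
      show "p j permutes {..<a}" using p that by auto
      fix i assume "i \<in> {..<a} - {i. i < a \<and> enc i j \<in> B}"
      then have i: "i < a" "enc i j \<notin> B" by auto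
      with \<sigma> that have "emb p (enc i j) = enc i j" using p(2) enc[of i j] by auto
      then have "u (emb p (enc i j)) = i" using i that enc by simp
      moreover have "u (emb p (enc i j)) = p j i"
        using i that p(1) enc[of i j] by (subst emb_props(2)) auto
      ultimately show "p j i = i" by simp
    qed
    with p show "\<sigma> \<in> emb ` ?Q" by (auto simp: PiE_def Pi_def)
  next
    fix \<sigma> assume "\<sigma> \<in> emb ` ?Q"
    then obtain p where p: "p \<in> ?Q" "\<sigma> = emb p" by blast
    have "emb p s = s" if "s < l" "s \<notin> B" for s
    proof -
      have "p (v s) permutes {i. i < a \<and> enc i (v s) \<in> B}" using p coord[OF that(1)] by auto
      then have "p (v s) (u s) = u s"
        by (rule permutes_not_in) (use that coord in auto)
      then show ?thesis using that coord by (simp add: emb_def)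
    qed
    moreover have "emb p \<in> C" using bij_betw_emb p sub unfolding bij_betw_def by blast
    ultimately show "\<sigma> \<in> {\<sigma> \<in> C. \<forall>s<l. s \<notin> B \<longrightarrow> \<sigma> s = s}" using p by blast
  qed
  then have "card {\<sigma> \<in> C. \<forall>s<l. s \<notin> B \<longrightarrow> \<sigma> s = s} = card ?Q"
    using bij_betw_emb sub by (metis (no_types, lifting) bij_betw_def card_image inj_on_subset)
  also have "\<dots> = (\<Prod>j<b. fact (card {i. i < a \<and> enc i j \<in> B}))"
    by (subst card_PiE) (auto simp: card_permutations)
  finally show ?thesis .
qed

end

lemma grid_rows: "grid (\<lambda>s. s div c) (\<lambda>s. s mod c) r c (r * c)"
proof
  show "bij_betw (\<lambda>s. (s div c, s mod c)) {..<r * c} ({..<r} \<times> {..<c})"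
  proof (rule bij_betw_byWitness[where f' = "\<lambda>(i, j). i * c + j"])
    show "(\<lambda>(i, j). i * c + j) ` ({..<r} \<times> {..<c}) \<subseteq> {..<r * c}"
    proof -
      have "i * c + j < r * c" if "i < r" "j < c" for i j
      proof -
        have "Suc i * c \<le> r * c" using that by (intro mult_le_mono1) simp
        with that show ?thesis by simp
      qed
      then show ?thesis by auto
    qed
  qed (cases "c = 0"; auto simp: less_mult_imp_div_less)+
qed

lemma grid_columns: "grid (\<lambda>s. s mod c) (\<lambda>s. s div c) c r (r * c)"
proof
  have "bij_betw (prod.swap \<circ> (\<lambda>s. (s div c, s mod c))) {..<r * c} ({..<c} \<times> {..<r})"
    by (rule bij_betw_trans[OF grid.bij[OF grid_rows]])
       (auto intro!: bij_betw_byWitness[where f' = prod.swap])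
  then show "bij_betw (\<lambda>s. (s mod c, s div c)) {..<r * c} ({..<c} \<times> {..<r})"
    by (simp add: comp_def)
qed

section \<open>Coefficients of tensors\<close>

lemma tensor_eqI: "(\<And>w. tcoeff x w = tcoeff y w) \<Longrightarrow> x = y"
  by (auto simp: tcoeff_def poly_mapping_eq_iff fun_eq_iff simp flip: rep_tensor_inject)

lemma tcoeff_simps [simp]:
  "tcoeff 0 w = 0"
  "tcoeff (x + y) w = tcoeff x w + tcoeff y w"
  "tcoeff (x - y) w = tcoeff x w - tcoeff y w"
  "tcoeff (- x) w = - tcoeff x w"
  by (auto simp: tcoeff_def zero_tensor.rep_eq plus_tensor.rep_eq minus_tensor.rep_eq
      uminus_tensor.rep_eq lookup_add lookup_minus)

lemma tcoeff_sum: "tcoeff (sum f A) w = (\<Sum>x\<in>A. tcoeff (f x) w)"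
  by (induction A rule: infinite_finite_induct) auto

lemma tsupp_iff: "w \<in> tsupp x \<longleftrightarrow> tcoeff x w \<noteq> 0"
  by (simp add: tsupp_def tcoeff_def in_keys_iff)

lemma finite_tsupp [simp]: "finite (tsupp x)"
  by (simp add: tsupp_def)

lemma tword_scal_mult:
  "(tword u * scal a) * (tword v * scal b) = tword (u @ v) * scal ((ginvol ^^ nodd v) a * b)"
proof -
  have "(tword u * scal a) * (tword v * scal b) = tword u * (scal a * tword v) * scal b"
    by (simp only: mult.assoc)
  also have "\<dots> = tword (u @ v) * scal ((ginvol ^^ nodd v) a * b)"
    by (simp only: scal_commute mult.assoc scal_mult[symmetric] tword_mult[symmetric])
  finally show ?thesis .
qed

lemma tcoeff_tword_scal: "tcoeff (tword w * scal a) v = (if v = w then a else 0)"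
  by (simp add: tcoeff_def tword_def scal_def times_tensor.abs_eq pm_mult_single[OF tkernel_biadditive]
      tkernel_def Tensor_inverse lookup_single when_def)

lemma scal_simps [simp]: "scal 0 = 0" "scal 1 = 1" "scal (a + b) = scal a + scal b" "scal (- a) = - scal a"
  by (simp_all add: scal_def zero_tensor_def one_tensor_def plus_tensor.abs_eq uminus_tensor.abs_eq
      single_add single_uminus)

lemma tcoeff_tword: "tcoeff (tword w) v = (if v = w then 1 else 0)"
  using tcoeff_tword_scal[of w 1 v] by simp

lemma tensor_expand: "x = (\<Sum>w\<in>tsupp x. tword w * scal (tcoeff x w))"
  by (rule tensor_eqI) (auto simp: tcoeff_sum tcoeff_tword_scal tsupp_iff[symmetric] if_distrib
      cong: if_cong dest: tsupp_iff[THEN iffD2])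

lemma tensor_induct [case_names single zero add]:
  assumes "\<And>w a. w \<in> tsupp x \<Longrightarrow> P (tword w * scal a)" "P 0" "\<And>x y. P x \<Longrightarrow> P y \<Longrightarrow> P (x + y)"
  shows "P x"
proof -
  have "P (\<Sum>w\<in>W. tword w * scal (tcoeff x w))" if "finite W" "W \<subseteq> tsupp x" for W
    using that by (induction W) (auto intro: assms)
  from this[of "tsupp x"] show ?thesis by (simp flip: tensor_expand)
qed

lemma tcoeff_mult_scal: "tcoeff (x * scal a) w = tcoeff x w * a"
proof (induction x rule: tensor_induct)
  case (single v b)
  have "tword v * scal b * scal a = tword v * scal (b * a)" by (simp add: mult.assoc scal_mult)
  then show ?case by (simp add: tcoeff_tword_scal)
qed (simp_all add: distrib_right)

lemma tcoeff_scal_mult: "tcoeff (scal a * x) w = (ginvol ^^ nodd w) a * tcoeff x w"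
proof (induction x rule: tensor_induct)
  case (single v b)
  have "scal a * (tword v * scal b) = tword v * scal ((ginvol ^^ nodd v) a * b)"
    by (simp add: scal_commute mult.assoc[symmetric]) (simp add: mult.assoc scal_mult)
  then show ?case by (simp add: tcoeff_tword_scal)
qed (simp_all add: distrib_left)

lemma lin_ext_superset:
  assumes "finite W" "tsupp x \<subseteq> W"
  shows "lin_ext F x = (\<Sum>w\<in>W. F w * scal (tcoeff x w))"
  unfolding lin_ext_def using assms by (intro sum.mono_neutral_left) (auto simp: tsupp_iff)

lemma lin_ext_add: "lin_ext F (x + y) = lin_ext F x + lin_ext F y"
proof -
  have "tsupp (x + y) \<subseteq> tsupp x \<union> tsupp y" by (auto simp: tsupp_iff)
  then show ?thesis
    by (simp add: lin_ext_superset[of "tsupp x \<union> tsupp y"] distrib_left sum.distrib)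
qed

lemma lin_ext_zero [simp]: "lin_ext F 0 = 0"
  by (simp add: lin_ext_def tsupp_iff[of _ 0, simplified] tsupp_def zero_tensor.rep_eq)

lemma lin_ext_tword_scal: "lin_ext F (tword w * scal a) = F w * scal a"
  by (subst lin_ext_superset[of "{w}"]) (auto simp: tsupp_iff tcoeff_tword_scal split: if_splits)

lemma lin_ext_mult_scal: "lin_ext F (x * scal a) = lin_ext F x * scal a"
proof (induction x rule: tensor_induct)
  case (single w b)
  have "tword w * scal b * scal a = tword w * scal (b * a)" by (simp add: mult.assoc scal_mult)
  then show ?case by (simp add: lin_ext_tword_scal mult.assoc scal_mult)
qed (simp_all add: distrib_right lin_ext_add)


section \<open>Evaluation of tensors at points with coordinates in \<open>G\<close>\<close>

text \<open>A word is evaluated by applying an even linear functional in each of its slots. The values are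
  multiplied in the order of the slots, so that the Koszul signs in the action of the symmetric
  group are those of reordering the product.\<close>

definition evw :: "(nat \<Rightarrow> letter \<Rightarrow> 'k grassmann) \<Rightarrow> letter list \<Rightarrow> 'k::comm_ring_1 grassmann"
  where "evw \<phi> w = oprod (\<lambda>s. \<phi> s (w ! s)) (length w)"

definition ev :: "(nat \<Rightarrow> letter \<Rightarrow> 'k grassmann) \<Rightarrow> 'k tensor \<Rightarrow> 'k::comm_ring_1 grassmann"
  where "ev \<phi> x = (\<Sum>w\<in>tsupp x. evw \<phi> w * tcoeff x w)"

definition graded :: "(nat \<Rightarrow> letter \<Rightarrow> 'k::comm_ring_1 grassmann) \<Rightarrow> bool"
  where "graded \<phi> \<longleftrightarrow> (\<forall>s c. \<phi> s c \<in> G_grade (of_bool (letter_odd c)))"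

definition tlen :: "nat \<Rightarrow> 'k::comm_ring_1 tensor \<Rightarrow> bool"
  where "tlen l x \<longleftrightarrow> (\<forall>w\<in>tsupp x. length w = l)"

lemma gradedD: "graded \<phi> \<Longrightarrow> \<phi> s c \<in> G_grade (of_bool (letter_odd c))"
  by (simp add: graded_def)

lemma evw_append: "evw \<phi> (u @ v) = evw \<phi> u * evw (\<lambda>s. \<phi> (length u + s)) v"
  by (simp add: evw_def oprod_add nth_append)

lemma evw_Nil [simp]: "evw \<phi> [] = 1"
  by (simp add: evw_def)

lemma evw_Cons: "evw \<phi> (c # w) = \<phi> 0 c * evw (\<lambda>s. \<phi> (Suc s)) w"
  by (simp add: evw_def oprod_Suc_left del: oprod_simps)

lemma evw_cong: "(\<And>s. s < length w \<Longrightarrow> \<phi> s (w ! s) = \<psi> s (w ! s)) \<Longrightarrow> evw \<phi> w = evw \<psi> w"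
  unfolding evw_def by (rule oprod_cong) simp_all

lemma evw_grade:
  assumes "graded \<phi>"
  shows "evw \<phi> w \<in> G_grade (nodd w)"
  using assms
proof (induction w arbitrary: \<phi>)
  case (Cons c w)
  have "\<phi> 0 c * evw (\<lambda>s. \<phi> (Suc s)) w \<in> G_grade (of_bool (letter_odd c) + nodd w)"
    using Cons.prems by (intro G_grade_mult Cons.IH) (simp_all add: graded_def)
  moreover have "of_bool (letter_odd c) + nodd w = nodd (c # w)" by (simp add: nodd_def)
  ultimately show ?case by (simp only: evw_Cons)
qed simp

lemma ev_superset:
  assumes "finite W" "tsupp x \<subseteq> W"
  shows "ev \<phi> x = (\<Sum>w\<in>W. evw \<phi> w * tcoeff x w)"
  unfolding ev_def using assms by (intro sum.mono_neutral_left) (auto simp: tsupp_iff)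

lemma ev_add: "ev \<phi> (x + y) = ev \<phi> x + ev \<phi> y"
proof -
  have "tsupp (x + y) \<subseteq> tsupp x \<union> tsupp y" by (auto simp: tsupp_iff)
  then show ?thesis
    by (simp add: ev_superset[of "tsupp x \<union> tsupp y"] distrib_left sum.distrib)
qed

lemma ev_uminus: "ev \<phi> (- x) = - ev \<phi> x"
proof -
  have "tsupp (- x) = tsupp x" by (auto simp: tsupp_iff)
  then show ?thesis by (simp add: ev_def sum_negf)
qed

lemma ev_diff: "ev \<phi> (x - y) = ev \<phi> x - ev \<phi> y"
  using ev_add[of \<phi> x "- y"] by (simp add: ev_uminus)

lemma ev_zero [simp]: "ev \<phi> 0 = 0"
  by (simp add: ev_def)

lemma ev_sum: "ev \<phi> (sum f A) = (\<Sum>x\<in>A. ev \<phi> (f x))"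
  by (induction A rule: infinite_finite_induct) (auto simp: ev_add)

lemma ev_tword_scal: "ev \<phi> (tword w * scal a) = evw \<phi> w * a"
  by (subst ev_superset[of "{w}"]) (auto simp: tsupp_iff tcoeff_tword_scal split: if_splits)

lemma ev_tword: "ev \<phi> (tword w) = evw \<phi> w"
  using ev_tword_scal[of \<phi> w 1] by simp

lemma ev_mult_scal: "ev \<phi> (x * scal a) = ev \<phi> x * a"
proof (induction x rule: tensor_induct)
  case (single w b)
  have "tword w * scal b * scal a = tword w * scal (b * a)" by (simp add: mult.assoc scal_mult)
  then show ?case by (simp add: ev_tword_scal mult.assoc)
qed (simp_all add: distrib_right ev_add)

lemma ev_of_int: "ev \<phi> (of_int k * x) = of_int k * ev \<phi> x"
proof -
  have "ev \<phi> (of_nat q * x) = of_nat q * ev \<phi> x" for q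
    by (induction q) (simp_all add: distrib_right ev_add)
  then show ?thesis by (cases k rule: int_cases) (simp_all add: ev_uminus del: of_nat_Suc)
qed

lemma ev_sign: "ev \<phi> ((- 1) ^ q * x) = (- 1) ^ q * ev \<phi> x"
  by (simp add: neg_one_power_mult ev_uminus)

lemma ev_lin_ext: "ev \<phi> (lin_ext F x) = (\<Sum>w\<in>tsupp x. ev \<phi> (F w) * tcoeff x w)"
  by (simp add: lin_ext_def ev_sum ev_mult_scal)

lemma ev_cong:
  assumes "tlen l x" "\<And>s c. s < l \<Longrightarrow> \<phi> s c = \<psi> s c"
  shows "ev \<phi> x = ev \<psi> x"
  unfolding ev_def using assms
  by (intro sum.cong arg_cong2[where f = "(*)"] evw_cong) (auto simp: tlen_def)

lemma grassmann_induct [case_names single add]: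
  assumes "\<And>S x. P (Grassmann (Poly_Mapping.single S x))" "\<And>a b. P a \<Longrightarrow> P b \<Longrightarrow> P (a + b)"
  shows "P (a :: 'k::comm_ring_1 grassmann)"
proof -
  have "P (Grassmann f)" for f :: "nat fset \<Rightarrow>\<^sub>0 'k"
  proof (induction f rule: pm_add_induct)
    case zero
    show ?case using assms(1)[of "{||}" 0] by simp
  next
    case (add f g)
    then show ?case using assms(2)[of "Grassmann f" "Grassmann g"] by (simp add: plus_grassmann.abs_eq)
  qed (rule assms)
  then show ?thesis by (metis rep_grassmann_inverse)
qed

text \<open>The Koszul rule if \<open>a\<close> is a monomial; both sides are additive in
  \<open>a\<close>.\<close>

lemma mult_homogeneous: 
  assumes "b \<in> G_grade p"
  shows "a * b = b * (ginvol ^^ p) a"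
proof (induction a rule: grassmann_induct)
  case (single S x)
  define a where "a = Grassmann (Poly_Mapping.single S x)"
  have a: "a \<in> G_grade (fcard S)"
    by (auto simp: a_def G_grade_def gcoeff_def Grassmann_inverse lookup_single when_def)
  have "a * b = (- 1) ^ (fcard S * p) * (b * a)"
    by (rule G_grade_commute[OF a assms])
  also have "\<dots> = b * (ginvol ^^ p) a"
    by (simp add: ginvol_funpow_grade[OF a] neg_one_power_mult)
  finally show ?case by (simp add: a_def)
qed (simp_all add: distrib_left distrib_right)

text \<open>In the tensor algebra a coefficient of \<open>x\<close> passes the word of
  \<open>y\<close>, in the product of the values it passes the value of that word. The two have the
  same parity because the point is graded, so the signs agree.\<close>

lemma ev_mult:
  assumes \<phi>: "graded \<phi>" and x: "tlen p x"
  shows "ev \<phi> (x * y) = ev \<phi> x * ev (\<lambda>s. \<phi> (p + s)) y"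
proof (induction x rule: tensor_induct)
  case (single u a)
  let ?\<psi> = "\<lambda>s. \<phi> (length u + s)"
  have "graded ?\<psi>" using \<phi> by (simp add: graded_def)
  have "ev \<phi> (tword u * scal a * y) = ev \<phi> (tword u * scal a) * ev ?\<psi> y"
  proof (induction y rule: tensor_induct)
    case (single v b)
    have "ev \<phi> (tword u * scal a * (tword v * scal b)) = evw \<phi> u * evw ?\<psi> v * ((ginvol ^^ nodd v) a * b)"
      by (simp only: tword_scal_mult ev_tword_scal evw_append)
    also have "\<dots> = evw \<phi> u * (evw ?\<psi> v * (ginvol ^^ nodd v) a) * b"
      by (simp only: mult.assoc)
    also have "evw ?\<psi> v * (ginvol ^^ nodd v) a = a * evw ?\<psi> v"
      by (rule mult_homogeneous[OF evw_grade[OF \<open>graded ?\<psi>\<close>], symmetric])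
    finally show ?case
      by (simp only: ev_tword_scal mult.assoc)
  qed (simp_all add: distrib_left ev_add)
  moreover have "length u = p" using single assms(2) by (simp add: tlen_def)
  ultimately show ?case by simp
qed (simp_all add: distrib_right ev_add)

lemma tlen_scal: "tlen 0 (scal a)"
proof -
  have "scal a = tword [] * scal a" by (simp add: tword_def flip: one_tensor_def)
  then show ?thesis by (metis tlen_def tsupp_iff tcoeff_tword_scal list.size(3))
qed

lemma ev_scal: "ev \<phi> (scal a) = a"
proof -
  have "scal a = tword [] * scal a" by (simp add: tword_def flip: one_tensor_def)
  then show ?thesis by (metis ev_tword_scal evw_Nil mult_1)
qed

lemma ev_scal_mult: "graded \<phi> \<Longrightarrow> ev \<phi> (scal a * x) = a * ev \<phi> x"
  using ev_mult[of \<phi> 0 "scal a" x] by (simp add: tlen_scal ev_scal)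

lemma tlen_sum: "(\<And>a. a \<in> A \<Longrightarrow> tlen l (f a)) \<Longrightarrow> tlen l (sum f A)"
  unfolding tlen_def
proof
  fix w
  assume f: "\<And>a. a \<in> A \<Longrightarrow> \<forall>w\<in>tsupp (f a). length w = l" and "w \<in> tsupp (sum f A)"
  then have "(\<Sum>a\<in>A. tcoeff (f a) w) \<noteq> 0" by (simp add: tsupp_iff tcoeff_sum)
  then obtain a where "a \<in> A" "tcoeff (f a) w \<noteq> 0" by (rule sum.not_neutral_contains_not_neutral)
  with f show "length w = l" by (simp add: tsupp_iff)
qed

lemma tlen_mult_scal: "tlen l x \<Longrightarrow> tlen l (x * scal a)"
  by (auto simp: tlen_def tsupp_iff tcoeff_mult_scal)

lemma tlen_scal_mult: "tlen l x \<Longrightarrow> tlen l (scal a * x)"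
  by (auto simp: tlen_def tsupp_iff tcoeff_scal_mult)

lemma tlen_tword: "tlen (length w) (tword w)"
  by (auto simp: tlen_def tsupp_iff tcoeff_tword split: if_splits)

lemma of_int_eq_scal: "of_int k = scal (gconst (of_int k))"
proof -
  have "of_nat q = scal (of_nat q)" for q by (induction q) simp_all
  then show ?thesis
    by (cases k rule: int_cases) (simp_all add: gconst_of_int gconst_of_nat del: of_nat_Suc)
qed

lemma sign_eq_scal: "(- 1) ^ q = scal ((- 1) ^ q)"
  by (cases "even q") simp_all

lemma tlen_of_int: "tlen l x \<Longrightarrow> tlen l (of_int k * x)"
  by (simp add: of_int_eq_scal tlen_scal_mult)

lemma tlen_lin_ext: "(\<And>w. w \<in> tsupp x \<Longrightarrow> tlen l (F w)) \<Longrightarrow> tlen l (lin_ext F x)"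
  unfolding lin_ext_def by (intro tlen_sum tlen_mult_scal)


subsection \<open>The symmetric group\<close>

text \<open>The sign in the action on words is exactly the one which reorders the values; permuting
  a tensor amounts to permuting the points, without any sign.\<close>

lemma ev_perm_left:
  assumes \<phi>: "graded \<phi>" and x: "tlen l x" and \<sigma>: "\<sigma> permutes {..<l}"
  shows "ev \<phi> (perm_left \<sigma> x) = ev (\<lambda>s. \<phi> (\<sigma> s)) x"
  unfolding perm_left_def ev_lin_ext ev_def[of _ x]
proof (intro sum.cong refl arg_cong2[where f = "(*)"])
  fix w assume "w \<in> tsupp x"
  then have l: "length w = l" using x by (simp add: tlen_def)
  let ?e = "card {(i, j). i < j \<and> j < length w \<and> \<sigma> i > \<sigma> j \<and> letter_odd (w ! i) \<and> letter_odd (w ! j)}"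
  have "evw \<phi> (map (\<lambda>k. w ! inv_into UNIV \<sigma> k) [0..<length w]) =
      oprod (\<lambda>s. (\<lambda>r. \<phi> (\<sigma> r) (w ! r)) (inv_into UNIV \<sigma> s)) l"
    unfolding evw_def using permutes_inverses(1)[OF \<sigma>] by (intro oprod_cong) (simp_all add: l)
  also have "\<dots> = (- 1) ^ koszul \<sigma> (\<lambda>s. letter_odd (w ! s)) l * evw (\<lambda>s. \<phi> (\<sigma> s)) w"
    unfolding evw_def l by (rule oprod_koszul[OF \<sigma>]) (rule gradedD[OF \<phi>])
  also have "koszul \<sigma> (\<lambda>s. letter_odd (w ! s)) l = ?e"
    by (simp add: koszul_def l)
  finally have "ev \<phi> (tword (map (\<lambda>k. w ! inv_into UNIV \<sigma> k) [0..<length w])) = (- 1) ^ ?e * evw (\<lambda>s. \<phi> (\<sigma> s)) w"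
    by (simp only: ev_tword)
  then show "ev \<phi> ((- 1) ^ ?e * tword (map (\<lambda>k. w ! inv_into UNIV \<sigma> k) [0..<length w])) = evw (\<lambda>s. \<phi> (\<sigma> s)) w"
    by (simp only: ev_sign) (simp add: neg_one_power_mult)
qed

lemma ev_perm_right:
  assumes \<phi>: "graded \<phi>" and x: "tlen l x" and \<sigma>: "\<sigma> permutes {..<l}"
  shows "ev \<phi> (perm_right x \<sigma>) = ev (\<lambda>s. \<phi> (inv_into UNIV \<sigma> s)) x"
  unfolding perm_right_def ev_lin_ext ev_def[of _ x]
proof (intro sum.cong refl arg_cong2[where f = "(*)"])
  fix w assume "w \<in> tsupp x"
  then have l: "length w = l" using x by (simp add: tlen_def)
  let ?A = "{(i, j). i < j \<and> j < length w \<and> \<sigma> i > \<sigma> j \<and> letter_odd (w ! \<sigma> i) \<and> letter_odd (w ! \<sigma> j)}"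
  let ?\<tau> = "inv_into UNIV \<sigma>"
  let ?B = "{(i, j). i < j \<and> j < l \<and> ?\<tau> i > ?\<tau> j \<and> letter_odd (w ! i) \<and> letter_odd (w ! j)}"
  have \<tau>: "?\<tau> permutes {..<l}" by (rule permutes_inv[OF \<sigma>])
  note inv = permutes_inverses[OF \<sigma>]
  have lt: "\<sigma> i < l \<longleftrightarrow> i < l" "?\<tau> i < l \<longleftrightarrow> i < l" for i
    using permutes_in_image[OF \<sigma>, of i] permutes_in_image[OF \<tau>, of i] by simp_all
  \<comment> \<open>Inversions of \<sigma>, counted by the parities of the permuted word, correspond
    to inversions of its inverse, counted by those of the original word.\<close>
  have "bij_betw (\<lambda>(i, j). (\<sigma> j, \<sigma> i)) ?A ?B"
    by (rule bij_betw_byWitness[where f' = "\<lambda>(i, j). (?\<tau> j, ?\<tau> i)"])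
       (use lt in \<open>auto simp: inv l intro: less_trans\<close>)
  then have card: "card ?A = koszul ?\<tau> (\<lambda>s. letter_odd (w ! s)) l"
    by (simp add: koszul_def bij_betw_same_card)
  have "evw \<phi> (map (\<lambda>k. w ! \<sigma> k) [0..<length w]) =
      oprod (\<lambda>s. (\<lambda>r. \<phi> (?\<tau> r) (w ! r)) (inv_into UNIV ?\<tau> s)) l"
    unfolding evw_def permutes_inv_inv[OF \<sigma>] by (intro oprod_cong) (simp_all add: l inv)
  also have "\<dots> = (- 1) ^ koszul ?\<tau> (\<lambda>s. letter_odd (w ! s)) l * evw (\<lambda>s. \<phi> (?\<tau> s)) w"
    unfolding evw_def l by (rule oprod_koszul[OF \<tau>]) (rule gradedD[OF \<phi>])
  finally have "ev \<phi> (tword (map (\<lambda>k. w ! \<sigma> k) [0..<length w])) = (- 1) ^ card ?A * evw (\<lambda>s. \<phi> (?\<tau> s)) w"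
    by (simp only: ev_tword card)
  then show "ev \<phi> ((- 1) ^ card ?A * tword (map (\<lambda>k. w ! \<sigma> k) [0..<length w])) = evw (\<lambda>s. \<phi> (?\<tau> s)) w"
    by (simp only: ev_sign) (simp add: neg_one_power_mult)
qed

lemma tlen_perm_left:
  assumes "tlen l x"
  shows "tlen l (perm_left \<sigma> x)"
  unfolding perm_left_def
proof (rule tlen_lin_ext)
  fix w assume "w \<in> tsupp x"
  with assms have "length w = l" by (simp add: tlen_def)
  then show "tlen l ((- 1) ^ card {(i, j). i < j \<and> j < length w \<and> \<sigma> i > \<sigma> j \<and> letter_odd (w ! i) \<and> letter_odd (w ! j)}
      * tword (map (\<lambda>k. w ! inv_into UNIV \<sigma> k) [0..<length w]))"
    using tlen_tword[of "map (\<lambda>k. w ! inv_into UNIV \<sigma> k) [0..<length w]"]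
    unfolding sign_eq_scal by (intro tlen_scal_mult) simp
qed



subsection \<open>Tensors are determined by their values\<close>

lemma gmono_empty [simp]: "gmono {||} = 1"
  by (rule grassmann_eqI) (auto simp: gcoeff_gmono)

text \<open>Monomials in disjoint sets of fresh generators are cancelled one after the other. There
  are two in each slot: a coordinate and, for the covariant slots of mixed tensors, an odd
  parameter.\<close>

lemma oprod_gmono_mult_eq_zero:
  fixes a :: "'k::comm_ring_1 grassmann"
  assumes "oprod (\<lambda>s. gmono (S s) * gmono (T s)) l * a = 0" "a \<in> G_sub U"
    and "\<And>s. s < l \<Longrightarrow> fset (S s) \<inter> fset (T s) = {}"
    and "\<And>s. s < l \<Longrightarrow> (fset (S s) \<union> fset (T s)) \<inter> U = {}"
    and "\<And>s t. s < t \<Longrightarrow> t < l \<Longrightarrow> (fset (S s) \<union> fset (T s)) \<inter> (fset (S t) \<union> fset (T t)) = {}"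
  shows "a = 0"
  using assms
proof (induction l arbitrary: a U)
  case (Suc l)
  \<comment> \<open>The last two monomials are absorbed into the element, so the induction
    hypothesis is applied with their generators added to \<open>U\<close>.\<close>
  let ?V = "U \<union> (fset (S l) \<union> fset (T l))"
  have a: "a \<in> G_sub (U \<union> fset (T l))" using Suc.prems(2) by (rule G_sub_mono) simp
  then have Ta: "gmono (T l) * a \<in> G_sub (U \<union> fset (T l))"
    by (intro G_sub_mult gmono_sub) auto
  then have Ta': "gmono (T l) * a \<in> G_sub ?V" by (rule G_sub_mono) auto
  have STa: "gmono (S l) * (gmono (T l) * a) \<in> G_sub ?V"
    by (rule G_sub_mult[OF gmono_sub Ta']) auto
  have "oprod (\<lambda>s. gmono (S s) * gmono (T s)) l * (gmono (S l) * (gmono (T l) * a)) = 0"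
    using Suc.prems(1) by (simp add: mult.assoc)
  then have "gmono (S l) * (gmono (T l) * a) = 0"
  proof (rule Suc.IH[OF _ STa])
    fix s assume "s < l"
    then show "(fset (S s) \<union> fset (T s)) \<inter> ?V = {}"
      using Suc.prems(4)[of s] Suc.prems(5)[of s l] by (simp add: Int_Un_distrib)
  qed (use Suc.prems in auto)
  then have "gmono (T l) * a = 0"
    by (rule gmono_mult_eq_zero[OF _ Ta]) (use Suc.prems(3)[of l] Suc.prems(4)[of l] in auto)
  then show ?case
    by (rule gmono_mult_eq_zero[OF _ Suc.prems(2)]) (use Suc.prems(4)[of l] in auto)
qed simp

text \<open>At the point dual to the letters of \<open>w\<close> every other word of the same length
  has a zero factor, which isolates one coefficient.\<close>

lemma ev_dual_word:
  assumes "tlen (length w) x"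
  shows "ev (\<lambda>s c. if c = w ! s then z s else 0) x = oprod z (length w) * tcoeff x w"
proof -
  let ?\<phi> = "\<lambda>s c. if c = w ! s then z s else 0"
  have "ev ?\<phi> x = (\<Sum>v\<in>insert w (tsupp x). evw ?\<phi> v * tcoeff x v)"
    by (rule ev_superset) auto
  also have "\<dots> = (\<Sum>v\<in>insert w (tsupp x). if v = w then oprod z (length w) * tcoeff x w else 0)"
  proof (intro sum.cong refl)
    fix v assume v: "v \<in> insert w (tsupp x)"
    have "evw ?\<phi> v = 0" if neq: "v \<noteq> w"
    proof -
      have "length v = length w" using v assms neq by (auto simp: tlen_def)
      then obtain s where "s < length v" "v ! s \<noteq> w ! s" using neq nth_equalityI by blast
      then show ?thesis unfolding evw_def by (intro oprod_zero[of _ s]) simp_all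
    qed
    moreover have "evw ?\<phi> w = oprod z (length w)" unfolding evw_def by (rule oprod_cong) simp_all
    ultimately show "evw ?\<phi> v * tcoeff x v = (if v = w then oprod z (length w) * tcoeff x w else 0)"
      by simp
  qed
  also have "\<dots> = oprod z (length w) * tcoeff x w" by simp
  finally show ?thesis .
qed

lemma tensor_eq_zeroI:
  fixes x :: "'k::comm_ring_1 tensor"
  assumes x: "tlen l x" and ev: "\<And>\<phi>. graded \<phi> \<Longrightarrow> ev \<phi> x = 0"
  shows "x = 0"
proof (rule tensor_eqI, rule ccontr)
  fix w assume "tcoeff x w \<noteq> tcoeff 0 w"
  then have w: "tcoeff x w \<noteq> 0" by simp
  then have l: "length w = l" using x by (simp add: tlen_def tsupp_iff)
  obtain N where N: "tcoeff x w \<in> G_sub {..<N}" using G_sub_bound by blast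
  \<comment> \<open>One fresh generator for an odd letter and two for an even one give the parity of
    the letter. Two indices are reserved for each slot, beyond all indices occurring in the
    coefficient.\<close>
  define S where "S s = (if letter_odd (w ! s) then {|N + 2 * s|} else {|N + 2 * s, N + 2 * s + 1|})" for s
  define \<phi> :: "nat \<Rightarrow> letter \<Rightarrow> 'k grassmann" where "\<phi> = (\<lambda>s c. if c = w ! s then gmono (S s) else 0)"
  have "graded \<phi>" by (auto simp: graded_def \<phi>_def S_def gmono_grade fcard.rep_eq)
  then have "ev \<phi> x = 0" by (rule ev)
  then have "oprod (\<lambda>s. gmono (S s) * gmono {||}) l * tcoeff x w = 0"
    using ev_dual_word[of w x "\<lambda>s. gmono (S s)"] x by (simp add: \<phi>_def l)
  then have "tcoeff x w = 0"
    by (rule oprod_gmono_mult_eq_zero[OF _ N]) (auto simp: S_def)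
  with w show False ..
qed


subsection \<open>The general linear group\<close>

lemma mixed_tensors_word:
  assumes "x \<in> mixed_tensors m n p q" "w \<in> tsupp x"
  obtains us vs where "w = map Vec us @ map Cov vs" "set us \<subseteq> Omega m n" "set vs \<subseteq> Omega m n"
    "length us = p" "length vs = q"
  using assms unfolding mixed_tensors_def by blast

lemma mixed_tlen: "x \<in> mixed_tensors m n p q \<Longrightarrow> tlen (p + q) x"
  unfolding tlen_def by (auto elim!: mixed_tensors_word)

lemma theta_Omega: "j < m + n \<Longrightarrow> theta m j \<in> Omega m n"
  by (auto simp: theta_def Omega_def)

lemma theta_index: "b \<in> Omega m n \<Longrightarrow> theta_index m b < m + n \<and> theta m (theta_index m b) = b"
  by (auto simp: theta_def Omega_def)

lemma theta_index_theta: "theta_index m (theta m j) = j"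
  by (simp add: theta_def)

lemma theta_inject: "theta m i = theta m j \<longleftrightarrow> i = j"
  by (metis theta_index_theta)

lemma Omega_eq_theta: "Omega m n = theta m ` {..<m + n}"
proof (intro equalityI subsetI)
  fix b assume "b \<in> Omega m n"
  from theta_index[OF this] show "b \<in> theta m ` {..<m + n}"
    by (intro image_eqI[of _ _ "theta_index m b"]) auto
qed (auto intro: theta_Omega)

lemma Vspace_tword: "b \<in> Omega m n \<Longrightarrow> tword [Vec b] \<in> Vspace m n"
  unfolding Tpow_def mixed_tensors_def
  by (auto simp: tsupp_iff tcoeff_tword split: if_splits intro: exI[of _ "[b]"])

lemma Vspace_word:
  assumes "x \<in> Vspace m n" "w \<in> tsupp x"
  shows "w \<in> (\<lambda>i. [Vec (theta m i)]) ` {..<m + n}"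
proof -
  from assms obtain us where "w = map Vec us" "set us \<subseteq> Omega m n" "length us = 1"
    unfolding Tpow_def by (auto elim!: mixed_tensors_word)
  then show ?thesis
    unfolding Omega_eq_theta by (auto simp: length_Suc_conv)
qed

lemma ev_Vspace:
  assumes "x \<in> Vspace m n"
  shows "ev \<phi> x = (\<Sum>i<m + n. \<phi> 0 (Vec (theta m i)) * tcoeff x [Vec (theta m i)])"
proof -
  have "ev \<phi> x = (\<Sum>w\<in>(\<lambda>i. [Vec (theta m i)]) ` {..<m + n}. evw \<phi> w * tcoeff x w)"
    using Vspace_word[OF assms] by (intro ev_superset) auto
  also have "\<dots> = (\<Sum>i<m + n. \<phi> 0 (Vec (theta m i)) * tcoeff x [Vec (theta m i)])"
    by (subst sum.reindex) (auto simp: inj_on_def theta_inject evw_Cons)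
  finally show ?thesis .
qed

text \<open>The point pulled back along \<A>. The image of a letter is a tensor of length one whose
  only slot has number 0, hence the constant family \<open>\<lambda>_. \<phi> s\<close>.\<close>

definition GL_point :: "nat \<Rightarrow> nat \<Rightarrow> ('k tensor \<Rightarrow> 'k tensor) \<Rightarrow>
    (nat \<Rightarrow> letter \<Rightarrow> 'k grassmann) \<Rightarrow> nat \<Rightarrow> letter \<Rightarrow> 'k::comm_ring_1 grassmann"
  where "GL_point m n \<A> \<phi> s c = ev (\<lambda>_. \<phi> s) (GL_letter m n \<A> c)"

lemma GL_Vspace: "\<A> \<in> GL m n \<Longrightarrow> x \<in> Vspace m n \<Longrightarrow> \<A> x \<in> Vspace m n"
  by (auto simp: GL_def bij_betw_def)

lemma ev_scal_mult_tword1: "graded \<phi> \<Longrightarrow> ev \<phi> (scal a * tword [c]) = a * \<phi> 0 c"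
  by (simp add: ev_scal_mult ev_tword evw_Cons)

lemma GL_point_Vec:
  assumes "\<A> \<in> GL m n" "j < m + n"
  shows "GL_point m n \<A> \<phi> s (Vec (theta m j)) = (\<Sum>i<m + n. \<phi> s (Vec (theta m i)) * matrix_of m n \<A> $$ (i, j))"
  unfolding GL_point_def using assms
  by (simp add: ev_Vspace[OF GL_Vspace[OF assms(1) Vspace_tword[OF theta_Omega[OF assms(2)]]]] matrix_of_def)

lemma GL_point_Cov:
  assumes "graded \<phi>"
  shows "GL_point m n \<A> \<phi> s (Cov (theta m i)) =
    (\<Sum>j<m + n. mat_inv (matrix_of m n \<A>) $$ (i, j) * \<phi> s (Cov (theta m j)))"
proof -
  have "graded (\<lambda>_. \<phi> s)" using assms by (simp add: graded_def)
  then show ?thesis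
    unfolding GL_point_def by (simp add: ev_sum ev_scal_mult_tword1 theta_index_theta)
qed

lemma tlen_GL_letter:
  assumes "\<A> \<in> GL m n" "c \<in> Vec ` Omega m n \<union> Cov ` Omega m n"
  shows "tlen 1 (GL_letter m n \<A> c)"
proof (cases c)
  case (Vec b)
  then have "\<A> (tword [Vec b]) \<in> Vspace m n"
    using assms by (intro GL_Vspace[OF assms(1)] Vspace_tword) auto
  then show ?thesis
    using Vspace_word by (fastforce simp: Vec tlen_def)
next
  case (Cov b)
  have "tlen 1 (scal a * tword [Cov (theta m j)])" for a j
    using tlen_tword[of "[Cov (theta m j)]"] by (intro tlen_scal_mult) simp
  then show ?thesis unfolding Cov GL_letter.simps by (intro tlen_sum)
qed

lemma ev_GL_act:
  assumes \<A>: "\<A> \<in> GL m n" and \<phi>: "graded \<phi>" and x: "x \<in> mixed_tensors m n p q"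
  shows "ev \<phi> (GL_act m n \<A> x) = ev (GL_point m n \<A> \<phi>) x"
  unfolding GL_act_def ev_lin_ext ev_def[of _ x]
proof (intro sum.cong refl arg_cong2[where f = "(*)"])
  fix w assume "w \<in> tsupp x"
  with x obtain us vs where "w = map Vec us @ map Cov vs" "set us \<subseteq> Omega m n" "set vs \<subseteq> Omega m n"
    by (rule mixed_tensors_word)
  then have "set w = Vec ` set us \<union> Cov ` set vs" "set us \<subseteq> Omega m n" "set vs \<subseteq> Omega m n"
    by simp_all
  then have "set w \<subseteq> Vec ` Omega m n \<union> Cov ` Omega m n" by blast
  then show "ev \<phi> (prod_list (map (GL_letter m n \<A>) w)) = evw (GL_point m n \<A> \<phi>) w"
    using \<phi>
  proof (induction w arbitrary: \<phi>)
    case Nil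
    show ?case using ev_scal[of \<phi> 1] by simp
  next
    case (Cons c w)
    have c: "tlen 1 (GL_letter m n \<A> c)" using Cons.prems by (intro tlen_GL_letter[OF \<A>]) simp
    have shift: "graded (\<lambda>s. \<phi> (Suc s))" using Cons.prems by (simp add: graded_def)
    have "ev \<phi> (prod_list (map (GL_letter m n \<A>) (c # w))) =
        ev \<phi> (GL_letter m n \<A> c) * ev (\<lambda>s. \<phi> (Suc s)) (prod_list (map (GL_letter m n \<A>) w))"
      using ev_mult[OF Cons.prems(2) c] by simp
    also have "ev \<phi> (GL_letter m n \<A> c) = GL_point m n \<A> \<phi> 0 c"
      unfolding GL_point_def by (rule ev_cong[OF c]) simp
    also have "ev (\<lambda>s. \<phi> (Suc s)) (prod_list (map (GL_letter m n \<A>) w)) = evw (GL_point m n \<A> (\<lambda>s. \<phi> (Suc s))) w"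
      using Cons.prems shift by (intro Cons.IH) auto
    also have "GL_point m n \<A> (\<lambda>s. \<phi> (Suc s)) = (\<lambda>s. GL_point m n \<A> \<phi> (Suc s))"
      by (simp add: GL_point_def fun_eq_iff)
    finally show ?case by (simp add: evw_Cons)
  qed
qed

section \<open>The Berezinian\<close>

text \<open>The laws of rectangular matrices over a ring which need not be commutative, with
  equations between dimensions as premises so that they serve as conditional rewrite rules.\<close>

lemma mat_ring_simps:
  fixes A B C :: "'a::ring_1 mat"
  shows "dim_col A = dim_row B \<Longrightarrow> dim_col B = dim_row C \<Longrightarrow> A * B * C = A * (B * C)"
    and "dim_col A = dim_row B \<Longrightarrow> dim_row B = dim_row C \<Longrightarrow> dim_col B = dim_col C \<Longrightarrow> A * (B + C) = A * B + A * C"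
    and "dim_col B = dim_row A \<Longrightarrow> dim_row B = dim_row C \<Longrightarrow> dim_col B = dim_col C \<Longrightarrow> (B + C) * A = B * A + C * A"
    and "dim_col A = dim_row B \<Longrightarrow> dim_row B = dim_row C \<Longrightarrow> dim_col B = dim_col C \<Longrightarrow> A * (B - C) = A * B - A * C"
    and "dim_col B = dim_row A \<Longrightarrow> dim_row B = dim_row C \<Longrightarrow> dim_col B = dim_col C \<Longrightarrow> (B - C) * A = B * A - C * A"
    and "dim_col A = k \<Longrightarrow> A * 1\<^sub>m k = A" "dim_row A = k \<Longrightarrow> 1\<^sub>m k * A = A"
    and "dim_col A = dim_row B \<Longrightarrow> A * (- B) = - (A * B)" "dim_col A = dim_row B \<Longrightarrow> (- A) * B = - (A * B)"
proof -
  show "dim_col A = dim_row B \<Longrightarrow> dim_col B = dim_row C \<Longrightarrow> A * B * C = A * (B * C)"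
    by (rule assoc_mult_mat[of _ "dim_row A" "dim_col A" _ "dim_row C" _ "dim_col C"]) auto
  show "dim_col A = dim_row B \<Longrightarrow> dim_row B = dim_row C \<Longrightarrow> dim_col B = dim_col C \<Longrightarrow> A * (B + C) = A * B + A * C"
    by (rule mult_add_distrib_mat[of _ "dim_row A" "dim_col A" _ "dim_col C"]) auto
  show "dim_col B = dim_row A \<Longrightarrow> dim_row B = dim_row C \<Longrightarrow> dim_col B = dim_col C \<Longrightarrow> (B + C) * A = B * A + C * A"
    by (rule add_mult_distrib_mat[of _ "dim_row B" "dim_row A" _ _ "dim_col A"]) auto
  show "dim_col A = dim_row B \<Longrightarrow> dim_row B = dim_row C \<Longrightarrow> dim_col B = dim_col C \<Longrightarrow> A * (B - C) = A * B - A * C"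
    by (rule mult_minus_distrib_mat[of _ "dim_row A" "dim_col A" _ "dim_col C"]) auto
  show "dim_col B = dim_row A \<Longrightarrow> dim_row B = dim_row C \<Longrightarrow> dim_col B = dim_col C \<Longrightarrow> (B - C) * A = B * A - C * A"
    by (rule minus_mult_distrib_mat[of _ "dim_row B" "dim_row A" _ _ "dim_col A"]) auto
  show "dim_col A = k \<Longrightarrow> A * 1\<^sub>m k = A" "dim_row A = k \<Longrightarrow> 1\<^sub>m k * A = A"
    by (auto intro!: right_mult_one_mat[of _ "dim_row A"] left_mult_one_mat[of _ _ "dim_col A"])
  show "dim_col A = dim_row B \<Longrightarrow> A * (- B) = - (A * B)" "dim_col A = dim_row B \<Longrightarrow> (- A) * B = - (A * B)"
    by (auto intro!: eq_matI simp: scalar_prod_def sum_negf)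
qed

lemma mat_add_assoc_dim:
  fixes A B C :: "'a::ring_1 mat"
  shows "dim_row A = dim_row B \<Longrightarrow> dim_col A = dim_col B \<Longrightarrow> dim_row B = dim_row C \<Longrightarrow> dim_col B = dim_col C \<Longrightarrow>
    A + B + C = A + (B + C)"
  by (rule eq_matI) (auto simp: add.assoc)

lemma index_mult_mat_sum:
  "i < dim_row A \<Longrightarrow> j < dim_col B \<Longrightarrow> dim_col A = dim_row B \<Longrightarrow>
    (A * B) $$ (i, j) = (\<Sum>k<dim_row B. A $$ (i, k) * B $$ (k, j))"
  by (auto simp: scalar_prod_def atLeast0LessThan intro!: sum.cong)

section \<open>Matrices with entries of one parity and determinants over the even part\<close>

definition mat_grade :: "nat \<Rightarrow> 'k::comm_ring_1 grassmann mat \<Rightarrow> bool"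
  where "mat_grade p A \<longleftrightarrow> (\<forall>i<dim_row A. \<forall>j<dim_col A. A $$ (i, j) \<in> G_grade p)"

lemma mat_gradeD: "mat_grade p A \<Longrightarrow> i < dim_row A \<Longrightarrow> j < dim_col A \<Longrightarrow> A $$ (i, j) \<in> G_grade p"
  by (simp add: mat_grade_def)

lemma mat_grade_mult:
  "mat_grade p A \<Longrightarrow> mat_grade q B \<Longrightarrow> dim_col A = dim_row B \<Longrightarrow> even (p + q + r) \<Longrightarrow> mat_grade r (A * B)"
  unfolding mat_grade_def index_mult_mat(2,3)
proof (intro allI impI)
  fix i j
  assume *: "\<forall>i<dim_row A. \<forall>j<dim_col A. A $$ (i, j) \<in> G_grade p"
    "\<forall>i<dim_row B. \<forall>j<dim_col B. B $$ (i, j) \<in> G_grade q"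
    "dim_col A = dim_row B" "even (p + q + r)" "i < dim_row A" "j < dim_col B"
  then have "(\<Sum>k<dim_row B. A $$ (i, k) * B $$ (k, j)) \<in> G_grade (p + q)"
    by (intro G_grade_sum G_grade_mult) auto
  then have "(A * B) $$ (i, j) \<in> G_grade (p + q)"
    using * by (simp only: index_mult_mat_sum)
  moreover have "G_grade (p + q) = (G_grade r :: 'a grassmann set)"
    using * by (intro G_grade_parity) simp
  ultimately show "(A * B) $$ (i, j) \<in> G_grade r" by simp
qed

lemma mat_grade_add:
  "mat_grade p A \<Longrightarrow> mat_grade p B \<Longrightarrow> dim_row A = dim_row B \<Longrightarrow> dim_col A = dim_col B \<Longrightarrow> mat_grade p (A + B)"
  by (auto simp: mat_grade_def G_grade_add)

lemma mat_grade_diff: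
  "mat_grade p A \<Longrightarrow> mat_grade p B \<Longrightarrow> dim_row A = dim_row B \<Longrightarrow> dim_col A = dim_col B \<Longrightarrow> mat_grade p (A - B)"
  by (auto simp: mat_grade_def G_grade_diff)

lemma mat_grade_one: "mat_grade 0 (1\<^sub>m k)"
  by (auto simp: mat_grade_def)

interpretation of_geven: semiring_hom of_geven
  by unfold_locales simp_all

interpretation gbody: semiring_hom "gbody :: 'k::comm_ring_1 grassmann \<Rightarrow> 'k"
  by unfold_locales simp_all

lemma of_geven_mat_Geven: "mat_grade 0 A \<Longrightarrow> map_mat of_geven (map_mat Geven A) = A"
  by (rule eq_matI) (auto simp: of_geven_Geven mat_grade_def)

lemma Geven_mat_of_geven: "map_mat Geven (map_mat of_geven A) = A"
  by (rule eq_matI) auto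

lemma mat_grade_of_geven: "mat_grade 0 (map_mat of_geven A)"
  by (auto simp: mat_grade_def)

lemma Geven_mat_mult:
  assumes "mat_grade 0 A" "mat_grade 0 B" "dim_col A = dim_row B"
  shows "map_mat Geven (A * B) = map_mat Geven A * map_mat Geven B"
proof -
  let ?A = "map_mat Geven A" and ?B = "map_mat Geven B"
  have "map_mat of_geven (?A * ?B) = A * B"
  proof -
    have "map_mat of_geven (?A * ?B) = map_mat of_geven ?A * map_mat of_geven ?B"
      by (rule of_geven.mat_hom_mult[of _ "dim_row A" "dim_col A" _ "dim_col B"]) (use assms(3) in auto)
    then show ?thesis by (simp only: of_geven_mat_Geven[OF assms(1)] of_geven_mat_Geven[OF assms(2)])
  qed
  then have "map_mat Geven (map_mat of_geven (?A * ?B)) = map_mat Geven (A * B)" by (rule arg_cong)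
  then show ?thesis unfolding Geven_mat_of_geven by (rule sym)
qed

lemma Geven_mat_one: "map_mat Geven (1\<^sub>m k) = 1\<^sub>m k"
  by (subst of_geven.mat_hom_one[symmetric]) (rule Geven_mat_of_geven)

lemma det_even_mult:
  assumes "mat_grade 0 A" "mat_grade 0 B" "A \<in> carrier_mat k k" "B \<in> carrier_mat k k"
  shows "det_even (A * B) = det_even A * det_even B"
  using assms by (simp add: det_even_def Geven_mat_mult det_mult[of _ k])

lemma det_even_one: "det_even (1\<^sub>m k) = 1"
  by (simp add: det_even_def Geven_mat_one)

lemma det_even_grade: "det_even A \<in> G_grade 0"
  by (simp add: det_even_def)

lemma det_even_commute: "det_even A * a = a * det_even A"
  by (simp add: det_even_def of_geven_commute)

lemma gbody_det_even:
  assumes "mat_grade 0 A"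
  shows "gbody (det_even A) = det (map_mat gbody A)"
proof -
  have "gbody (det_even A) = det (map_mat ebody (map_mat Geven A))"
    by (simp add: det_even_def ebody_def[symmetric])
  also have "map_mat ebody (map_mat Geven A) = map_mat gbody A"
    using assms by (auto intro!: eq_matI simp: ebody_def of_geven_Geven mat_grade_def)
  finally show ?thesis .
qed

text \<open>Cramer's rule over the commutative ring of even elements.\<close>

lemma unit_det_inverse:
  assumes A: "mat_grade 0 A" "A \<in> carrier_mat k k" and u: "det_even A * u = 1" "u \<in> G_grade 0"
  obtains B where "B \<in> carrier_mat k k" "mat_grade 0 B" "A * B = 1\<^sub>m k" "B * A = 1\<^sub>m k"
proof -
  let ?A = "map_mat Geven A"
  have c: "?A \<in> carrier_mat k k" using A by simp
  define x where "x = Geven u"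
  have "of_geven (det ?A * x) = of_geven 1"
    using u by (simp add: x_def of_geven_Geven det_even_def)
  then have x: "det ?A * x = 1" by (simp only: of_geven_inject)
  note adj = adj_mat[OF c]
  let ?B = "x \<cdot>\<^sub>m adj_mat ?A"
  have B: "?B \<in> carrier_mat k k" using adj by simp
  have "?A * ?B = x \<cdot>\<^sub>m (det ?A \<cdot>\<^sub>m 1\<^sub>m k)" "?B * ?A = x \<cdot>\<^sub>m (det ?A \<cdot>\<^sub>m 1\<^sub>m k)"
    using mult_smult_distrib[OF c adj(1), of x] mult_smult_assoc_mat[OF adj(1) c, of x] adj by simp_all
  moreover have "x \<cdot>\<^sub>m (det ?A \<cdot>\<^sub>m 1\<^sub>m k) = 1\<^sub>m k"
    using x by (auto intro!: eq_matI simp: mult.commute)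
  ultimately have "?A * ?B = 1\<^sub>m k" "?B * ?A = 1\<^sub>m k" by simp_all
  then have "map_mat of_geven ?A * map_mat of_geven ?B = 1\<^sub>m k" "map_mat of_geven ?B * map_mat of_geven ?A = 1\<^sub>m k"
    using of_geven.mat_hom_mult[OF c B] of_geven.mat_hom_mult[OF B c] by (simp_all add: of_geven.mat_hom_one)
  then show thesis
    using B by (intro that[of "map_mat of_geven ?B"]) (simp_all add: mat_grade_of_geven of_geven_mat_Geven A)
qed

lemma body_det_inverse:
  fixes A :: "'k::field grassmann mat"
  assumes A: "mat_grade 0 A" "A \<in> carrier_mat k k" and "det (map_mat gbody A) \<noteq> 0"
  obtains B where "B \<in> carrier_mat k k" "mat_grade 0 B" "A * B = 1\<^sub>m k" "B * A = 1\<^sub>m k"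
proof -
  have "ebody (det (map_mat Geven A)) \<noteq> 0"
    using assms gbody_det_even[OF A(1)] by (simp add: ebody_def det_even_def)
  then obtain x where "1 = det (map_mat Geven A) * x" using geven_unit by (blast elim: dvdE)
  then have "det_even A * of_geven x = 1"
    by (metis det_even_def of_geven_simps(2,4))
  then show thesis by (rule unit_det_inverse[OF A _ of_geven]) (rule that)
qed

lemma mat_inv_eq:
  fixes A :: "'a::ring_1 mat"
  assumes "A \<in> carrier_mat k k" "B \<in> carrier_mat k k" "A * B = 1\<^sub>m k" "B * A = 1\<^sub>m k"
  shows "mat_inv A = B"
  unfolding mat_inv_def
proof (rule the_equality)
  show "B \<in> carrier_mat (dim_row A) (dim_row A) \<and> inverts_mat A B \<and> inverts_mat B A"
    using assms by (simp add: inverts_mat_def)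
next
  fix B' assume "B' \<in> carrier_mat (dim_row A) (dim_row A) \<and> inverts_mat A B' \<and> inverts_mat B' A"
  then have B': "B' \<in> carrier_mat k k" "B' * A = 1\<^sub>m k" using assms by (auto simp: inverts_mat_def)
  have "B' = B' * (A * B)" using assms B' by simp
  also have "\<dots> = B' * A * B" using assoc_mult_mat[OF B'(1) assms(1,2)] by simp
  also have "\<dots> = B" using assms B' by simp
  finally show "B' = B" .
qed

text \<open>A permutation which fixes every index other than \<open>i\<close> also fixes
  \<open>i\<close>; so every other permutation meets a zero in a row of the identity matrix.\<close>

lemma det_single_row:
  fixes M :: "'a::comm_ring_1 mat"
  assumes M: "M \<in> carrier_mat k k" and "i < k"
    and rows: "\<And>a b. a < k \<Longrightarrow> b < k \<Longrightarrow> a \<noteq> i \<Longrightarrow> M $$ (a, b) = (if a = b then 1 else 0)"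
  shows "det M = M $$ (i, i)"
proof -
  have "det M = (\<Sum>p | p permutes {0..<k}. of_int (sign p) * (\<Prod>a=0..<k. M $$ (a, p a)))"
    using det_def'[OF M] by simp
  also have "\<dots> = (\<Sum>p\<in>{id}. of_int (sign p) * (\<Prod>a=0..<k. M $$ (a, p a)))"
  proof (rule sum.mono_neutral_right)
    show "\<forall>p\<in>{p. p permutes {0..<k}} - {id}. of_int (sign p) * (\<Prod>a=0..<k. M $$ (a, p a)) = 0"
    proof
      fix p assume "p \<in> {p. p permutes {0..<k}} - {id}"
      then have p: "p permutes {0..<k}" "p \<noteq> id" by auto
      have "\<exists>a<k. a \<noteq> i \<and> p a \<noteq> a"
      proof (rule ccontr)
        assume "\<not> (\<exists>a<k. a \<noteq> i \<and> p a \<noteq> a)"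
        then have fixed: "p a = a" if "a \<noteq> i" for a
          using that permutes_not_in[OF p(1), of a] by (cases "a < k") auto
        moreover have "p i = i"
          using fixed[of "p i"] permutes_inj[OF p(1)] by (metis injD)
        ultimately show False using p(2) by (metis eq_id_iff)
      qed
      then obtain a where a: "a < k" "a \<noteq> i" "p a \<noteq> a" by blast
      moreover have "p a < k" using permutes_in_image[OF p(1), of a] a by simp
      ultimately have "M $$ (a, p a) = 0" by (simp add: rows)
      then have "(\<Prod>a=0..<k. M $$ (a, p a)) = 0" using a by (intro prod_zero) auto
      then show "of_int (sign p) * (\<Prod>a=0..<k. M $$ (a, p a)) = 0" by simp
    qed
  qed (auto simp: finite_permutations permutes_id)
  also have "\<dots> = (\<Prod>a=0..<k. M $$ (a, a))" by simp
  also have "\<dots> = (\<Prod>a=0..<k. if a = i then M $$ (i, i) else 1)"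
    by (rule prod.cong) (simp_all add: rows)
  also have "\<dots> = M $$ (i, i)" using \<open>i < k\<close> by simp
  finally show ?thesis .
qed

lemma det_even_single_row:
  assumes M: "M \<in> carrier_mat k k" "mat_grade 0 M" and "i < k"
    and rows: "\<And>a b. a < k \<Longrightarrow> b < k \<Longrightarrow> a \<noteq> i \<Longrightarrow> M $$ (a, b) = (if a = b then 1 else 0)"
  shows "det_even M = M $$ (i, i)"
proof -
  have "Geven 1 = 1" "Geven 0 = 0" by (metis Geven_of_geven of_geven_simps)+
  then have "det (map_mat Geven M) = map_mat Geven M $$ (i, i)"
    using assms by (intro det_single_row) auto
  then show ?thesis using assms by (simp add: det_even_def of_geven_Geven mat_grade_def)
qed

lemma det_even_transpose: "A \<in> carrier_mat k k \<Longrightarrow> det_even (transpose_mat A) = det_even A"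
  using det_transpose[of "map_mat Geven A" k] by (simp add: det_even_def map_mat_transpose)

text \<open>For odd matrices the determinants of \<open>1 + C D\<close> and \<open>1 + D C\<close> are inverse to each other. One
  entry of \<open>C\<close> is added at a time: the two rank one factors are \<open>1 + c d\<close> and \<open>1 + d c\<close> with odd
  \<open>c\<close>, \<open>d\<close>, and \<open>(1 + c d) (1 + d c) = 1\<close>.\<close>

lemma det_even_odd_product_step:
  fixes C D :: "'k::field_char_0 grassmann mat"
  assumes C: "C \<in> carrier_mat m n" "mat_grade 1 C" and D: "D \<in> carrier_mat n m" "mat_grade 1 D"
    and IH: "det_even (1\<^sub>m m + C * D) * det_even (1\<^sub>m n + D * C) = 1"
    and c: "c \<in> G_grade 1" and ij: "i < m" "j < n"
    and E: "E = mat m n (\<lambda>(a, b). if a = i \<and> b = j then c else 0)"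
  shows "det_even (1\<^sub>m m + (C + E) * D) * det_even (1\<^sub>m n + D * (C + E)) = 1"
proof -
  note dims = carrier_matD[OF C(1)] carrier_matD[OF D(1)]
  define W where "W = 1\<^sub>m m + C * D"
  define V where "V = 1\<^sub>m n + D * C"
  have W: "W \<in> carrier_mat m m" "mat_grade 0 W"
    using dims mat_grade_mult[OF C(2) D(2), of 0] by (auto simp: W_def intro!: mat_grade_add mat_grade_one)
  have V: "V \<in> carrier_mat n n" "mat_grade 0 V"
    using dims mat_grade_mult[OF D(2) C(2), of 0] by (auto simp: V_def intro!: mat_grade_add mat_grade_one)
  have WV: "det_even W * det_even V = 1" using IH by (simp add: W_def V_def)
  have VW: "det_even V * det_even W = 1" by (rule trans[OF det_even_commute WV])
  obtain Wi where Wi: "Wi \<in> carrier_mat m m" "mat_grade 0 Wi" "W * Wi = 1\<^sub>m m" "Wi * W = 1\<^sub>m m"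
    by (rule unit_det_inverse[OF W(2,1) WV det_even_grade])
  obtain Vi where Vi: "Vi \<in> carrier_mat n n" "mat_grade 0 Vi" "V * Vi = 1\<^sub>m n" "Vi * V = 1\<^sub>m n"
    by (rule unit_det_inverse[OF V(2,1) VW det_even_grade])
  note dims = dims carrier_matD[OF W(1)] carrier_matD[OF V(1)] carrier_matD[OF Wi(1)] carrier_matD[OF Vi(1)]
  have Ec: "dim_row E = m" "dim_col E = n" by (simp_all add: E)
  have Eg: "mat_grade 1 E" using c by (auto simp: E mat_grade_def)
  \<comment> \<open>From V D = D W it follows that \<open>D\<close> times the inverse of
    \<open>W\<close> equals the inverse of \<open>V\<close> times \<open>D\<close>. This common
    matrix \<open>R\<close> governs the change of both determinants.\<close>
  define R where "R = D * Wi"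
  have Rd: "dim_row R = n" "dim_col R = m" by (simp_all add: R_def dims)
  have R: "mat_grade 1 R" unfolding R_def by (rule mat_grade_mult[OF D(2) Wi(2)]) (simp_all add: dims)
  have "V * D = D * W" by (simp add: V_def W_def mat_ring_simps dims)
  then have "Vi * (V * D) * Wi = Vi * (D * W) * Wi" by simp
  moreover have "Vi * (V * D) * Wi = D * Wi"
    using Vi(4) by (simp add: mat_ring_simps(1)[symmetric] dims mat_ring_simps(7))
  moreover have "Vi * (D * W) * Wi = Vi * D"
    using Wi(3) by (simp add: mat_ring_simps(1,6) dims)
  ultimately have R': "R = Vi * D" by (simp add: R_def)
  define d where "d = R $$ (j, i)"
  have d: "d \<in> G_grade 1" using R ij by (simp add: d_def mat_grade_def Rd)
  have ER: "(E * R) $$ (a, b) = (if a = i then c * R $$ (j, b) else 0)" if "a < m" "b < m" for a b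
  proof -
    have "(E * R) $$ (a, b) = (\<Sum>k<n. E $$ (a, k) * R $$ (k, b))"
      using that by (subst index_mult_mat_sum) (simp_all add: Ec Rd)
    also have "\<dots> = (\<Sum>k<n. if k = j then (if a = i then c * R $$ (j, b) else 0) else 0)"
      using that by (intro sum.cong) (auto simp: E)
    finally show ?thesis using ij by simp
  qed
  have RE: "(R * E) $$ (a, b) = (if b = j then R $$ (a, i) * c else 0)" if "a < n" "b < n" for a b
  proof -
    have "(R * E) $$ (a, b) = (\<Sum>k<m. R $$ (a, k) * E $$ (k, b))"
      using that by (subst index_mult_mat_sum) (simp_all add: Ec Rd)
    also have "\<dots> = (\<Sum>k<m. if k = i then (if b = j then R $$ (a, i) * c else 0) else 0)"
      using that by (intro sum.cong) (auto simp: E)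
    finally show ?thesis using ij by simp
  qed
  have g1: "mat_grade 0 (1\<^sub>m m + E * R)" "mat_grade 0 (1\<^sub>m n + R * E)"
    by (intro mat_grade_add mat_grade_one mat_grade_mult[OF Eg R] mat_grade_mult[OF R Eg]; simp add: Ec Rd)+
  \<comment> \<open>Adding \<open>E\<close> multiplies \<open>W\<close> on the left by 1 + E R,
    which differs from the identity only in row \<open>i\<close>, and \<open>V\<close> on the right
    by 1 + R E, which differs from it only in column \<open>j\<close>. Either determinant is a
    diagonal entry.\<close>
  have W_eq: "1\<^sub>m m + (C + E) * D = (1\<^sub>m m + E * R) * W"
    using Wi(4) by (simp add: mat_ring_simps dims Ec Rd R_def)
      (simp add: W_def mat_ring_simps dims Ec mat_add_assoc_dim)
  have cER: "1\<^sub>m m + E * R \<in> carrier_mat m m" and cRE: "1\<^sub>m n + R * E \<in> carrier_mat n n"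
    by (auto simp: Ec Rd)
  have "det_even (1\<^sub>m m + E * R) = (1\<^sub>m m + E * R) $$ (i, i)"
    by (rule det_even_single_row[OF cER g1(1) ij(1)]) (simp add: Ec Rd ER del: index_mult_mat(1))
  also have "\<dots> = 1 + c * d"
    using ij by (simp add: Ec Rd ER d_def del: index_mult_mat(1))
  finally have eq1: "det_even (1\<^sub>m m + (C + E) * D) = (1 + c * d) * det_even W"
    unfolding W_eq by (simp only: det_even_mult[OF g1(1) W(2) cER W(1)])
  have V_eq: "1\<^sub>m n + D * (C + E) = V * (1\<^sub>m n + R * E)"
  proof -
    have "V * (R * E) = D * E"
      using Vi(3) by (simp add: R' mat_ring_simps(1)[symmetric] dims Ec mat_ring_simps(7))
    then show ?thesis
      by (simp add: mat_ring_simps dims Ec Rd) (simp add: V_def mat_ring_simps dims Ec mat_add_assoc_dim)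
  qed
  have "det_even (1\<^sub>m n + R * E) = 1 + d * c"
  proof -
    let ?T = "transpose_mat (1\<^sub>m n + R * E)"
    have "det_even ?T = ?T $$ (j, j)"
    proof (rule det_even_single_row[of _ n])
      show "mat_grade 0 ?T" using g1(2) by (auto simp: mat_grade_def Ec Rd)
    qed (use ij in \<open>auto simp: Ec Rd RE simp del: index_mult_mat(1)\<close>)
    moreover have "?T $$ (j, j) = 1 + d * c"
      using ij by (simp add: Ec Rd RE d_def del: index_mult_mat(1))
    ultimately show ?thesis by (simp only: det_even_transpose[OF cRE])
  qed
  then have eq2: "det_even (1\<^sub>m n + D * (C + E)) = det_even V * (1 + d * c)"
    unfolding V_eq by (simp only: det_even_mult[OF V(2) g1(2) V(1) cRE])
  \<comment> \<open>This removes the term of degree four; the two terms of degree two cancel by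
    anticommutation.\<close>
  have "d * (d * c) = 0" using G_odd_square[OF d] by (simp add: mult.assoc[symmetric])
  then have "(1 + c * d) * (1 + d * c) = 1 + (c * d + d * c)"
    by (simp add: distrib_left distrib_right mult.assoc add.assoc)
  also have "\<dots> = 1" using G_odd_anticommute[OF c d] by simp
  finally have cd: "(1 + c * d) * (1 + d * c) = 1" .
  have "det_even (1\<^sub>m m + (C + E) * D) * det_even (1\<^sub>m n + D * (C + E)) =
      (1 + c * d) * ((det_even W * det_even V) * (1 + d * c))"
    by (simp only: eq1 eq2 mult.assoc)
  also have "\<dots> = 1" using IH cd by (simp add: W_def V_def)
  finally show ?thesis .
qed

lemma det_even_odd_product:
  fixes C D :: "'k::field_char_0 grassmann mat"
  assumes C: "C \<in> carrier_mat m n" "mat_grade 1 C" and D: "D \<in> carrier_mat n m" "mat_grade 1 D"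
  shows "det_even (1\<^sub>m m + C * D) * det_even (1\<^sub>m n + D * C) = 1"
proof -
  define P where "P S = mat m n (\<lambda>ij. if ij \<in> S then C $$ ij else 0)" for S
  have "det_even (1\<^sub>m m + P S * D) * det_even (1\<^sub>m n + D * P S) = 1"
    if "finite S" "S \<subseteq> {..<m} \<times> {..<n}" for S
    using that
  proof (induction S)
    case empty
    have "P {} = 0\<^sub>m m n" by (auto simp: P_def)
    then show ?case using D by (simp add: det_even_one)
  next
    case (insert ij S)
    obtain i j where ij: "ij = (i, j)" "i < m" "j < n" using insert.prems by (cases ij) auto
    let ?E = "mat m n (\<lambda>(a, b). if a = i \<and> b = j then C $$ (i, j) else 0)"
    have "P (insert ij S) = P S + ?E"
      using insert.hyps by (intro eq_matI) (auto simp: P_def ij)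
    moreover have "mat_grade 1 (P S)" using C by (auto simp: mat_grade_def P_def)
    ultimately show ?case
      using det_even_odd_product_step[OF _ _ D, of "P S" "C $$ (i, j)" i j ?E] insert C ij
      by (simp add: P_def mat_gradeD)
  qed
  from this[of "{..<m} \<times> {..<n}"] show ?thesis
  proof -
    have "P ({..<m} \<times> {..<n}) = C" using C by (auto simp: P_def)
    then show ?thesis using \<open>\<And>S. finite S \<Longrightarrow> S \<subseteq> {..<m} \<times> {..<n} \<Longrightarrow> _ S = 1\<close>[of "{..<m} \<times> {..<n}"] by simp
  qed
qed

section \<open>The Berezinian from the blocks of a matrix and of its inverse\<close>

locale super_inverse =
  fixes m n :: nat and A11 A12 A21 A22 B11 B12 B21 B22 :: "'k::field_char_0 grassmann mat"
  assumes carrier: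
      "A11 \<in> carrier_mat m m" "A12 \<in> carrier_mat m n" "A21 \<in> carrier_mat n m" "A22 \<in> carrier_mat n n"
      "B11 \<in> carrier_mat m m" "B12 \<in> carrier_mat m n" "B21 \<in> carrier_mat n m" "B22 \<in> carrier_mat n n"
    and grades:
      "mat_grade 0 A11" "mat_grade 1 A12" "mat_grade 1 A21" "mat_grade 0 A22"
      "mat_grade 0 B11" "mat_grade 1 B12" "mat_grade 1 B21" "mat_grade 0 B22"
    and AB: "A11 * B11 + A12 * B21 = 1\<^sub>m m" "A11 * B12 + A12 * B22 = 0\<^sub>m m n"
      "A21 * B11 + A22 * B21 = 0\<^sub>m n m" "A21 * B12 + A22 * B22 = 1\<^sub>m n"
    and BA: "B11 * A11 + B12 * A21 = 1\<^sub>m m" "B11 * A12 + B12 * A22 = 0\<^sub>m m n"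
      "B21 * A11 + B22 * A21 = 0\<^sub>m n m" "B21 * A12 + B22 * A22 = 1\<^sub>m n"
begin

lemma dims [simp]:
  "dim_row A11 = m" "dim_col A11 = m" "dim_row A12 = m" "dim_col A12 = n"
  "dim_row A21 = n" "dim_col A21 = m" "dim_row A22 = n" "dim_col A22 = n"
  "dim_row B11 = m" "dim_col B11 = m" "dim_row B12 = m" "dim_col B12 = n"
  "dim_row B21 = n" "dim_col B21 = m" "dim_row B22 = n" "dim_col B22 = n"
  using carrier by auto

text \<open>The odd blocks have body zero, so the bodies of the diagonal blocks of \<open>A\<close>
  and \<open>B\<close> are inverse to each other.\<close>

lemma body_blocks: "det (map_mat gbody A11) * det (map_mat gbody B11) = 1"
  "det (map_mat gbody A22) * det (map_mat gbody B22) = 1"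
proof -
  have add: "map_mat gbody (X + Y) = map_mat gbody X + map_mat gbody Y"
    if "dim_row X = dim_row Y" "dim_col X = dim_col Y" for X Y :: "'k grassmann mat"
    using that by (intro eq_matI) auto
  have odd: "map_mat gbody X = 0\<^sub>m (dim_row X) (dim_col X)" if "mat_grade 1 X" for X :: "'k grassmann mat"
    using that by (intro eq_matI) (auto simp: mat_grade_def gbody_odd[of _ "Suc 0"])
  have "map_mat gbody A11 * map_mat gbody B11 + map_mat gbody A12 * map_mat gbody B21 = 1\<^sub>m m"
    using arg_cong[OF AB(1), of "map_mat gbody"]
    by (simp add: add gbody.mat_hom_mult[OF carrier(1,5)] gbody.mat_hom_mult[OF carrier(2,7)] gbody.mat_hom_one)
  moreover have "map_mat gbody A12 * map_mat gbody B21 = 0\<^sub>m m m"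
    using odd[OF grades(2)] left_mult_zero_mat[of "map_mat gbody B21" n m m] carrier by simp
  ultimately have "map_mat gbody A11 * map_mat gbody B11 = 1\<^sub>m m"
    using carrier by simp
  from arg_cong[OF this, of det] show "det (map_mat gbody A11) * det (map_mat gbody B11) = 1"
    using carrier by (simp add: det_mult[of _ m])
  have "map_mat gbody A21 * map_mat gbody B12 + map_mat gbody A22 * map_mat gbody B22 = 1\<^sub>m n"
    using arg_cong[OF AB(4), of "map_mat gbody"]
    by (simp add: add gbody.mat_hom_mult[OF carrier(3,6)] gbody.mat_hom_mult[OF carrier(4,8)] gbody.mat_hom_one)
  moreover have "map_mat gbody A21 * map_mat gbody B12 = 0\<^sub>m n n"
    using odd[OF grades(3)] left_mult_zero_mat[of "map_mat gbody B12" m n n] carrier by simp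
  ultimately have "map_mat gbody A22 * map_mat gbody B22 = 1\<^sub>m n"
    using carrier by simp
  from arg_cong[OF this, of det] show "det (map_mat gbody A22) * det (map_mat gbody B22) = 1"
    using carrier by (simp add: det_mult[of _ n])
qed

text \<open>Each factor depends on \<eta>, the product does not. Let S be the Schur complement A11 -
  A12 A22^-1 A21, whose inverse is B11, and let C = B11 (A12 + \<eta> A22) A22^-1. Then A11 + \<eta>
  A21 = S (1 + C A21) and B22 - B21 \<eta> = A22^-1 (1 + A21 C). By
  \<open>det_even_odd_product\<close> the factors with C cancel, which leaves det S det
  A22^-1.\<close>

lemma Ber_eq:
  assumes \<eta>: "\<eta> \<in> carrier_mat m n" "mat_grade 1 \<eta>"
  shows "det_even (A11 + \<eta> * A21) * det_even (B22 - B21 * \<eta>) = Ber m (four_block_mat A11 A12 A21 A22)"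
proof -
  obtain I where I: "I \<in> carrier_mat n n" "mat_grade 0 I" "A22 * I = 1\<^sub>m n" "I * A22 = 1\<^sub>m n"
  proof (rule body_det_inverse[OF grades(4) carrier(4)])
    show "det (map_mat gbody A22) \<noteq> 0" using body_blocks(2) by auto
  qed
  note d [simp] = carrier_matD[OF I(1)] carrier_matD[OF \<eta>(1)]
  define S where "S = A11 - A12 * I * A21"
  define Q where "Q = A12 + \<eta> * A22"
  define C where "C = B11 * (Q * I)"
  have Sd [simp]: "dim_row S = m" "dim_col S = m" and Qd [simp]: "dim_row Q = m" "dim_col Q = n"
    and Cd [simp]: "dim_row C = m" "dim_col C = n"
    by (simp_all add: S_def Q_def C_def)
  have gS: "mat_grade 0 S"
    unfolding S_def by (intro mat_grade_diff grades mat_grade_mult[OF mat_grade_mult[OF grades(2) I(2), where r = 1] grades(3)]) auto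
  have gQ: "mat_grade 1 Q"
    unfolding Q_def by (intro mat_grade_add grades mat_grade_mult[OF \<eta>(2) grades(4)]) auto
  have gC: "mat_grade 1 C"
    unfolding C_def by (intro mat_grade_mult[OF grades(5) mat_grade_mult[OF gQ I(2), where r = 1]]) auto
  have IA: "I * (A22 * Z) = Z" if "dim_row Z = n" for Z
    using I(4) that by (simp add: mat_ring_simps(1)[symmetric] mat_ring_simps(7))
  have A21B11: "A21 * B11 = - (A22 * B21)"
  proof (rule eq_matI)
    fix i j assume ij: "i < dim_row (- (A22 * B21))" "j < dim_col (- (A22 * B21))"
    then have "(A21 * B11 + A22 * B21) $$ (i, j) = 0" by (simp add: AB(3))
    with ij show "(A21 * B11) $$ (i, j) = (- (A22 * B21)) $$ (i, j)"
      by (simp add: eq_neg_iff_add_eq_0 del: index_mult_mat(1))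
  qed simp_all
  have SB: "S * B11 = 1\<^sub>m m"
  proof -
    have "S * B11 = A11 * B11 - A12 * (I * (A21 * B11))"
      by (simp add: S_def mat_ring_simps)
    also have "I * (A21 * B11) = - B21"
      by (simp add: A21B11 mat_ring_simps IA)
    also have "A11 * B11 - A12 * (- B21) = A11 * B11 + A12 * B21"
      by (rule eq_matI) (simp_all add: mat_ring_simps del: index_mult_mat(1))
    finally show ?thesis by (simp add: AB)
  qed
  have SC: "S * C = Q * I"
    using SB by (simp add: C_def mat_ring_simps(1)[symmetric] mat_ring_simps(7) del: mat_ring_simps(1))
  have eq1: "S * (1\<^sub>m m + C * A21) = A11 + \<eta> * A21"
  proof -
    have "S * (1\<^sub>m m + C * A21) = S + (S * C) * A21"
      by (simp add: mat_ring_simps)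
    also have "\<dots> = A11 - A12 * (I * A21) + (A12 * (I * A21) + \<eta> * (A22 * (I * A21)))"
      unfolding SC by (simp add: S_def Q_def mat_ring_simps)
    also have "A22 * (I * A21) = A21"
      using I(3) by (simp add: mat_ring_simps(1)[symmetric] mat_ring_simps(7))
    also have "A11 - A12 * (I * A21) + (A12 * (I * A21) + \<eta> * A21) = A11 + \<eta> * A21"
      by (rule eq_matI) (simp_all del: index_mult_mat(1))
    finally show ?thesis .
  qed
  have gCD: "mat_grade 0 (1\<^sub>m m + C * A21)"
    by (intro mat_grade_add mat_grade_one mat_grade_mult[OF gC grades(3)]) auto
  have 1: "det_even (A11 + \<eta> * A21) = det_even S * det_even (1\<^sub>m m + C * A21)"
    unfolding eq1[symmetric] by (rule det_even_mult[OF gS gCD, of m]) auto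
  have eq2: "I * (1\<^sub>m n + A21 * C) = B22 - B21 * \<eta>"
  proof -
    have "I * (1\<^sub>m n + A21 * C) = I + I * ((A21 * B11) * (Q * I))"
      by (simp add: C_def mat_ring_simps)
    also have "I * ((A21 * B11) * (Q * I)) = - (B21 * (A12 * I) + B21 * \<eta>)"
      by (simp add: A21B11 mat_ring_simps IA) (simp add: Q_def mat_ring_simps I)
    also have "B21 * (A12 * I) = I - B22"
    proof -
      have "B21 * A12 = 1\<^sub>m n - B22 * A22"
      proof (rule eq_matI)
        fix i j assume ij: "i < dim_row (1\<^sub>m n - B22 * A22)" "j < dim_col (1\<^sub>m n - B22 * A22)"
        then have "(B21 * A12 + B22 * A22) $$ (i, j) = 1\<^sub>m n $$ (i, j)" by (simp only: BA(4))
        with ij show "(B21 * A12) $$ (i, j) = (1\<^sub>m n - B22 * A22) $$ (i, j)"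
          by (simp add: eq_diff_eq del: index_mult_mat(1) index_one_mat(1))
      qed simp_all
      then have "B21 * A12 * I = (1\<^sub>m n - B22 * A22) * I" by simp
      then show ?thesis using I by (simp add: mat_ring_simps)
    qed
    also have "I + - (I - B22 + B21 * \<eta>) = B22 - B21 * \<eta>"
      by (rule eq_matI) (simp_all del: index_mult_mat(1))
    finally show ?thesis .
  qed
  have gDC: "mat_grade 0 (1\<^sub>m n + A21 * C)"
    by (intro mat_grade_add mat_grade_one mat_grade_mult[OF grades(3) gC]) auto
  have 2: "det_even (B22 - B21 * \<eta>) = det_even I * det_even (1\<^sub>m n + A21 * C)"
    unfolding eq2[symmetric] by (rule det_even_mult[OF I(2) gDC, of n]) auto
  have "det_even (A11 + \<eta> * A21) * det_even (B22 - B21 * \<eta>) =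
      det_even S * (det_even (1\<^sub>m m + C * A21) * det_even I) * det_even (1\<^sub>m n + A21 * C)"
    by (simp only: 1 2 mult.assoc)
  also have "det_even (1\<^sub>m m + C * A21) * det_even I = det_even I * det_even (1\<^sub>m m + C * A21)"
    by (rule det_even_commute)
  also have "det_even S * (det_even I * det_even (1\<^sub>m m + C * A21)) * det_even (1\<^sub>m n + A21 * C) =
      det_even S * det_even I * (det_even (1\<^sub>m m + C * A21) * det_even (1\<^sub>m n + A21 * C))"
    by (simp only: mult.assoc)
  also have "det_even (1\<^sub>m m + C * A21) * det_even (1\<^sub>m n + A21 * C) = 1"
    by (rule det_even_odd_product[OF carrier_matI gC carrier_matI grades(3)]) simp_all
  finally have "det_even (A11 + \<eta> * A21) * det_even (B22 - B21 * \<eta>) = det_even S * det_even I" by simp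
  moreover have "split_block (four_block_mat A11 A12 A21 A22) m m = (A11, A12, A21, A22)"
    by (auto simp: split_block_def Let_def intro!: eq_matI)
  moreover have "mat_inv A22 = I" by (rule mat_inv_eq[OF carrier(4) I(1,3,4)])
  ultimately show ?thesis by (simp add: Ber_def S_def)
qed


lemma body_product:
  assumes "X \<in> carrier_mat k k" "mat_grade 0 X" "Z \<in> carrier_mat k k"
    and "U \<in> carrier_mat k l" "mat_grade 1 U" "V \<in> carrier_mat l k"
  shows "det (map_mat gbody (X * Z + U * V)) = det (map_mat gbody X) * det (map_mat gbody Z)"
proof -
  have U: "map_mat gbody U = 0\<^sub>m k l"
    using assms(4,5) by (intro eq_matI) (auto simp: mat_grade_def gbody_odd[of _ "Suc 0"])
  have "map_mat gbody (X * Z + U * V) = map_mat gbody (X * Z) + map_mat gbody (U * V)"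
    using assms by (intro eq_matI) (auto simp del: index_mult_mat(1))
  also have "\<dots> = map_mat gbody X * map_mat gbody Z + map_mat gbody U * map_mat gbody V"
    by (simp only: gbody.mat_hom_mult[OF assms(1,3)] gbody.mat_hom_mult[OF assms(4,6)])
  also have "\<dots> = map_mat gbody X * map_mat gbody Z"
    unfolding U using assms left_mult_zero_mat[of "map_mat gbody V" l k k]
      right_add_zero_mat[of "map_mat gbody X * map_mat gbody Z" k k] by simp
  finally show ?thesis using assms by (simp add: det_mult[of _ k])
qed

lemma mult_prod_cong:
  fixes P :: "'k grassmann"
  assumes "finite I" "\<And>i. i \<in> I \<Longrightarrow> P * of_geven (f i) = P * of_geven (g i)"
  shows "P * of_geven (prod f I) = P * of_geven (prod g I)"
  using assms
proof (induction I rule: finite_induct)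
  case (insert i I)
  have "P * of_geven (f i) = P * of_geven (g i)" by (rule insert.prems) simp
  moreover have "P * of_geven (prod f (insert i I)) = P * of_geven (f i) * of_geven (prod f I)"
    using insert.hyps by (simp add: mult.assoc)
  ultimately have "P * of_geven (prod f (insert i I)) = P * of_geven (g i) * of_geven (prod f I)"
    by simp
  also have "\<dots> = P * of_geven (prod f I) * of_geven (g i)"
    by (simp only: mult.assoc of_geven_commute[of "g i"])
  also have "P * of_geven (prod f I) = P * of_geven (prod g I)"
    using insert by blast
  also have "P * of_geven (prod g I) * of_geven (g i) = P * (of_geven (g i) * of_geven (prod g I))"
    by (simp only: mult.assoc of_geven_commute[of "g i"])
  also have "\<dots> = P * of_geven (prod g (insert i I))"
    using insert.hyps by simp
  finally show ?case .
qed simp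

text \<open>Entries may be changed modulo the annihilator of \<open>P\<close>, one factor at a time
  in each term of the Leibniz formula, because even factors can be moved next to
  \<open>P\<close>.\<close>

lemma mult_det_even_cong:
  fixes P :: "'k grassmann"
  assumes U: "U \<in> carrier_mat k k" "mat_grade 0 U" and V: "V \<in> carrier_mat k k" "mat_grade 0 V"
    and eq: "\<And>i j. i < k \<Longrightarrow> j < k \<Longrightarrow> P * U $$ (i, j) = P * V $$ (i, j)"
  shows "P * det_even U = P * det_even V"
proof -
  have det: "P * det_even W = (\<Sum>q | q permutes {0..<k}. of_int (sign q) *
      (P * of_geven (\<Prod>i=0..<k. Geven (W $$ (i, q i)))))"
    if W: "W \<in> carrier_mat k k" for W
  proof -
    have "det (map_mat Geven W) = (\<Sum>q | q permutes {0..<k}. of_int (sign q) * (\<Prod>i=0..<k. Geven (W $$ (i, q i))))"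
      using det_def'[of "map_mat Geven W" k] W
    proof -
      have "det (map_mat Geven W) = (\<Sum>q | q permutes {0..<k}. of_int (sign q) * (\<Prod>i=0..<k. map_mat Geven W $$ (i, q i)))"
        using W by (intro det_def') simp
      also have "\<dots> = (\<Sum>q | q permutes {0..<k}. of_int (sign q) * (\<Prod>i=0..<k. Geven (W $$ (i, q i))))"
      proof (intro sum.cong refl arg_cong2[where f = "(*)"] prod.cong)
        fix q i assume "q \<in> {q. q permutes {0..<k}}" "i \<in> {0..<k}"
        then have "q i < k" "i < k" using permutes_in_image[of q "{0..<k}" i] by auto
        then show "map_mat Geven W $$ (i, q i) = Geven (W $$ (i, q i))" using W by simp
      qed
      finally show ?thesis .
    qed
    then have "P * det_even W = (\<Sum>q | q permutes {0..<k}. P * (of_int (sign q) * of_geven (\<Prod>i=0..<k. Geven (W $$ (i, q i)))))"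
      by (simp add: det_even_def of_geven_sum sum_distrib_left of_geven_of_int)
    also have "\<dots> = (\<Sum>q | q permutes {0..<k}. of_int (sign q) * (P * of_geven (\<Prod>i=0..<k. Geven (W $$ (i, q i)))))"
    proof (rule sum.cong[OF refl])
      fix q :: "nat \<Rightarrow> nat"
      have "P * of_int (sign q) = of_int (sign q) * P" by (rule mult_of_int_commute[symmetric])
      then show "P * (of_int (sign q) * of_geven (\<Prod>i=0..<k. Geven (W $$ (i, q i)))) =
          of_int (sign q) * (P * of_geven (\<Prod>i=0..<k. Geven (W $$ (i, q i))))"
        by (metis mult.assoc)
    qed
    finally show ?thesis .
  qed
  show ?thesis
    unfolding det[OF U(1)] det[OF V(1)]
  proof (rule sum.cong[OF refl])
    fix q assume q: "q \<in> {q. q permutes {0..<k}}"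
    have "P * of_geven (\<Prod>i=0..<k. Geven (U $$ (i, q i))) = P * of_geven (\<Prod>i=0..<k. Geven (V $$ (i, q i)))"
    proof (rule mult_prod_cong)
      fix i assume "i \<in> {0..<k}"
      then have "q i < k" "i < k" using permutes_in_image[of q "{0..<k}" i] q by auto
      then show "P * of_geven (Geven (U $$ (i, q i))) = P * of_geven (Geven (V $$ (i, q i)))"
        using eq U V by (simp add: of_geven_Geven mat_grade_def)
    qed simp
    then show "of_int (sign q) * (P * of_geven (\<Prod>i=0..<k. Geven (U $$ (i, q i)))) =
        of_int (sign q) * (P * of_geven (\<Prod>i=0..<k. Geven (V $$ (i, q i))))"
      by (rule arg_cong)
  qed
qed

lemma transform_body:
  assumes X: "X \<in> carrier_mat m m" "mat_grade 0 X" and \<xi>: "\<xi> \<in> carrier_mat m n" "mat_grade 1 \<xi>"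
    and Y: "Y \<in> carrier_mat n n" "mat_grade 0 Y" and y: "y \<in> carrier_mat m n" "mat_grade 1 y"
    and det: "det (map_mat gbody X) \<noteq> 0" "det (map_mat gbody Y) \<noteq> 0"
  shows "det (map_mat gbody (X * A11 + \<xi> * A21)) \<noteq> 0" "det (map_mat gbody (B21 * y + B22 * Y)) \<noteq> 0"
proof -
  show "det (map_mat gbody (X * A11 + \<xi> * A21)) \<noteq> 0"
    using body_product[OF X carrier(1) \<xi> carrier(3)] det body_blocks(1) by auto
  have "B21 * y + B22 * Y = B22 * Y + B21 * y"
    using carrier Y y by (intro comm_add_mat[of _ n n]) auto
  then show "det (map_mat gbody (B21 * y + B22 * Y)) \<noteq> 0"
    using body_product[OF carrier(8) grades(8) Y(1) carrier(7) grades(7) y(1)] det body_blocks(2) by auto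
qed

text \<open>\<open>p\<close> is the product of the block row (X, \<xi>) and the block column (y, Y).
  The former is multiplied by A on the right and the latter by B, the inverse of A, on the
  left.\<close>

lemma transform:
  assumes X: "X \<in> carrier_mat m m" "mat_grade 0 X" and \<xi>: "\<xi> \<in> carrier_mat m n" "mat_grade 1 \<xi>"
    and Y: "Y \<in> carrier_mat n n" "mat_grade 0 Y" and y: "y \<in> carrier_mat m n" "mat_grade 1 y"
    and det: "det (map_mat gbody X) \<noteq> 0"
  defines "p \<equiv> X * y + \<xi> * Y"
  defines "P \<equiv> oprod (\<lambda>s. p $$ (s div n, s mod n)) (m * n)"
  shows "(X * A11 + \<xi> * A21) * (B11 * y + B12 * Y) + (X * A12 + \<xi> * A22) * (B21 * y + B22 * Y) = p"
    and "det_even (X * A11 + \<xi> * A21) * det_even (B21 * y + B22 * Y) * P =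
      Ber m (four_block_mat A11 A12 A21 A22) * (det_even X * det_even Y * P)"
proof -
  note d [simp] = carrier_matD[OF X(1)] carrier_matD[OF \<xi>(1)] carrier_matD[OF Y(1)] carrier_matD[OF y(1)]
  have "(X * A11 + \<xi> * A21) * (B11 * y + B12 * Y) + (X * A12 + \<xi> * A22) * (B21 * y + B22 * Y) =
     X * ((A11 * B11 + A12 * B21) * y + (A11 * B12 + A12 * B22) * Y) +
     \<xi> * ((A21 * B11 + A22 * B21) * y + (A21 * B12 + A22 * B22) * Y)"
    by (rule eq_matI) (simp_all add: mat_ring_simps algebra_simps del: index_mult_mat(1))
  also have "\<dots> = p"
    using \<xi> y Y X by (simp add: AB p_def)
  finally show "(X * A11 + \<xi> * A21) * (B11 * y + B12 * Y) + (X * A12 + \<xi> * A22) * (B21 * y + B22 * Y) = p" .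
  have pd [simp]: "dim_row p = m" "dim_col p = n" by (simp_all add: p_def)
  have p: "mat_grade 1 p"
    unfolding p_def by (intro mat_grade_add mat_grade_mult[OF X(2) y(2)] mat_grade_mult[OF \<xi>(2) Y(2)]) auto
  obtain Xi where Xi: "Xi \<in> carrier_mat m m" "mat_grade 0 Xi" "X * Xi = 1\<^sub>m m" "Xi * X = 1\<^sub>m m"
    by (rule body_det_inverse[OF X(2,1) det])
  note [simp] = carrier_matD[OF Xi(1)]
  define \<eta> where "\<eta> = Xi * \<xi>"
  have \<eta>: "\<eta> \<in> carrier_mat m n" "mat_grade 1 \<eta>"
    by (auto simp: \<eta>_def intro!: mat_grade_mult[OF Xi(2) \<xi>(2)])
  note [simp] = carrier_matD[OF \<eta>(1)]
  have XXi: "X * (Xi * Z) = Z" if "dim_row Z = m" for Z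
    using Xi(3) that by (simp add: mat_ring_simps(1)[symmetric] mat_ring_simps(7))
  have XiX: "Xi * (X * Z) = Z" if "dim_row Z = m" for Z
    using Xi(4) that by (simp add: mat_ring_simps(1)[symmetric] mat_ring_simps(7))
  have X': "X * A11 + \<xi> * A21 = X * (A11 + \<eta> * A21)"
    by (simp add: \<eta>_def mat_ring_simps XXi)
  have g1: "mat_grade 0 (A11 + \<eta> * A21)" "mat_grade 0 (B22 - B21 * \<eta>)"
    by (intro mat_grade_add mat_grade_diff grades mat_grade_mult[OF \<eta>(2) grades(3)]
        mat_grade_mult[OF grades(7) \<eta>(2)]; simp)+
  have detX': "det_even (X * A11 + \<xi> * A21) = det_even X * det_even (A11 + \<eta> * A21)"
    unfolding X' by (rule det_even_mult[OF X(2) g1(1) X(1)]) auto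
  \<comment> \<open>Solving for \<open>y\<close> turns the new Y into (B22 - B21 \<eta>) Y plus a
    multiple of \<open>p\<close>, and \<open>P\<close> annihilates the second summand.\<close>
  have y_eq: "y = Xi * p - \<eta> * Y"
  proof -
    have "Xi * p = y + \<eta> * Y" by (simp add: p_def \<eta>_def mat_ring_simps XiX)
    then show ?thesis by (simp only:) (rule eq_matI, simp_all del: index_mult_mat(1))
  qed
  let ?Y' = "B21 * y + B22 * Y" and ?Z = "(B22 - B21 * \<eta>) * Y"
  define c where "c = B21 * Xi"
  have cd [simp]: "dim_row c = n" "dim_col c = m" by (simp_all add: c_def)
  have c: "mat_grade 1 c" unfolding c_def by (rule mat_grade_mult[OF grades(7) Xi(2)]) simp_all
  have Y': "?Y' = ?Z + c * p"
    by (subst y_eq) (rule eq_matI, simp_all add: c_def mat_ring_simps algebra_simps del: index_mult_mat(1))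
  have "P * det_even ?Y' = P * det_even ?Z"
  proof (rule mult_det_even_cong[of _ n])
    show "mat_grade 0 ?Y'" "mat_grade 0 ?Z"
      by (intro mat_grade_add mat_grade_mult[OF grades(7) y(2)] mat_grade_mult[OF grades(8) Y(2)]
          mat_grade_mult[OF g1(2) Y(2)]; simp)+
    fix i j assume ij: "i < n" "j < n"
    \<comment> \<open>The entry (k, j) of \<open>p\<close> is the odd factor of \<open>P\<close> at
      place k n + j, so it annihilates \<open>P\<close>; first it must be brought to the left of the
      odd entry of \<open>c\<close>.\<close>
    have "P * (c $$ (i, k) * p $$ (k, j)) = 0" if k: "k < m" for k
    proof -
      have "k * n + j < m * n"
      proof -
        have "Suc k * n \<le> m * n" using k by (intro mult_le_mono1) simp
        with ij show ?thesis by simp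
      qed
      moreover have "p $$ (s div n, s mod n) \<in> G_grade 1" if "s < m * n" for s
        using that ij by (intro mat_gradeD[OF p]) (auto simp: less_mult_imp_div_less)
      ultimately have "P * p $$ ((k * n + j) div n, (k * n + j) mod n) = 0"
        unfolding P_def by (intro oprod_mult_odd_factor[where d = "\<lambda>_. 1"]) blast+
      then have "P * p $$ (k, j) = 0" using ij by simp
      moreover have "c $$ (i, k) * p $$ (k, j) = - (p $$ (k, j) * c $$ (i, k))"
        using ij k by (intro G_odd_anticommute[of _ 1 _ 1] mat_gradeD[OF c] mat_gradeD[OF p]) auto
      ultimately show ?thesis by (simp add: mult.assoc[symmetric])
    qed
    then have "P * (c * p) $$ (i, j) = 0"
      using ij by (simp add: index_mult_mat_sum sum_distrib_left del: index_mult_mat(1))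
    then show "P * ?Y' $$ (i, j) = P * ?Z $$ (i, j)"
      unfolding Y' using ij by (simp add: distrib_left del: index_mult_mat(1))
  qed auto
  then have PY: "det_even ?Y' * P = det_even ?Z * P" by (simp only: det_even_commute)
  have detZ: "det_even ?Z = det_even (B22 - B21 * \<eta>) * det_even Y"
    by (rule det_even_mult[OF g1(2) Y(2) _ Y(1)]) auto
  have "det_even (X * A11 + \<xi> * A21) * det_even ?Y' * P =
      det_even X * det_even (A11 + \<eta> * A21) * (det_even ?Y' * P)"
    by (simp only: detX' mult.assoc)
  also have "\<dots> = det_even X * (det_even (A11 + \<eta> * A21) * det_even (B22 - B21 * \<eta>)) * (det_even Y * P)"
    by (simp only: PY detZ mult.assoc)
  also have "\<dots> = (det_even (A11 + \<eta> * A21) * det_even (B22 - B21 * \<eta>)) * det_even X * (det_even Y * P)"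
    by (simp only: det_even_commute[of X])
  also have "\<dots> = Ber m (four_block_mat A11 A12 A21 A22) * (det_even X * det_even Y * P)"
    by (simp only: Ber_eq[OF \<eta>] mult.assoc)
  finally show "det_even (X * A11 + \<xi> * A21) * det_even ?Y' * P =
      Ber m (four_block_mat A11 A12 A21 A22) * (det_even X * det_even Y * P)" .
qed

end

section \<open>Young symmetrizers of rectangular shape\<close>

context grid
begin

lemma flip: "grid v u b a l"
proof
  have "bij_betw (prod.swap \<circ> (\<lambda>s. (u s, v s))) {..<l} ({..<b} \<times> {..<a})"
    by (rule bij_betw_trans[OF bij]) (auto intro!: bij_betw_byWitness[where f' = prod.swap])
  then show "bij_betw (\<lambda>s. (v s, u s)) {..<l} ({..<b} \<times> {..<a})"
    by (simp add: comp_def)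
qed

interpretation R: grid v u b a l
  by (rule flip)

lemma R_C_trivial: "\<sigma> \<in> C \<Longrightarrow> \<sigma> \<in> R.C \<Longrightarrow> \<sigma> = id"
proof
  fix s assume "\<sigma> \<in> C" "\<sigma> \<in> R.C"
  then show "\<sigma> s = id s"
    using coord_inject[of "\<sigma> s" s] C_lt C_v R.C_v permutes_not_in[OF C_permutes, of \<sigma> s] by (cases "s < l") auto
qed

section \<open>The square of the Young symmetrizer\<close>

definition factors :: "(nat \<Rightarrow> nat) \<Rightarrow> (nat \<Rightarrow> nat) \<Rightarrow> bool"
  where "factors \<pi> \<sigma> \<longleftrightarrow> \<sigma> \<in> C \<and> (\<exists>\<tau>\<in>R.C. \<pi> = \<tau> \<circ> \<sigma>)"

text \<open>The coefficient of \<pi> in the Young symmetrizer. It is well defined because row and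
  column group meet only in the identity.\<close>

definition young_sign :: "(nat \<Rightarrow> nat) \<Rightarrow> int"
  where "young_sign \<pi> = (if \<exists>\<sigma>. factors \<pi> \<sigma> then sign (SOME \<sigma>. factors \<pi> \<sigma>) else 0)"

text \<open>The classical dichotomy: unless \<pi> moves two boxes of one column into one row, some
  \<sigma> in the column group moves every box to the same row as \<pi> does, and \<pi> after the
  inverse of \<sigma> preserves the rows.\<close>

lemma factors_or_transposition:
  assumes \<pi>: "\<pi> permutes {..<l}"
  obtains \<sigma> where "factors \<pi> \<sigma>"
  | s t where "s < l" "t < l" "s \<noteq> t" "v s = v t" "u (\<pi> s) = u (\<pi> t)"
proof (cases "inj_on (\<lambda>s. (u (\<pi> s), v s)) {..<l}")
  case False
  then show ?thesis by (auto simp: inj_on_def intro: that(2))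
next
  case True
  define g where "g = restrict (\<lambda>s. u (\<pi> s)) {..<l}"
  have \<pi>_lt: "\<pi> s < l" if "s < l" for s using permutes_in_image[OF \<pi>, of s] that by simp
  have "g \<in> {..<l} \<rightarrow>\<^sub>E {..<a}" "inj_on (\<lambda>s. (g s, v s)) {..<l}"
    using True \<pi>_lt coord by (auto simp: g_def inj_on_def)
  note g = of_fun[OF this]
  define \<sigma> where "\<sigma> = of_fun g"
  have u\<sigma>: "u (\<sigma> s) = u (\<pi> s)" if "s < l" for s
  proof -
    have "u (\<sigma> s) = g s" unfolding \<sigma>_def by (rule g(2)[OF that])
    then show ?thesis using that by (simp add: g_def)
  qed
  have \<sigma>: "\<sigma> \<in> C" unfolding \<sigma>_def by (rule g(1))
  note \<sigma>p = C_permutes[OF \<sigma>]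
  define \<tau> where "\<tau> = \<pi> \<circ> inv_into UNIV \<sigma>"
  have "\<tau> permutes {..<l}" unfolding \<tau>_def by (intro permutes_compose permutes_inv \<sigma>p \<pi>)
  moreover have "u (\<tau> s) = u s" if "s < l" for s
  proof -
    have "inv_into UNIV \<sigma> s < l" using permutes_in_image[OF permutes_inv[OF \<sigma>p], of s] that by simp
    from u\<sigma>[OF this] show ?thesis using permutes_inverses(1)[OF \<sigma>p] by (simp add: \<tau>_def)
  qed
  ultimately have "\<tau> \<in> R.C" by (simp add: R.C_def)
  moreover have "\<pi> = \<tau> \<circ> \<sigma>" using permutes_inverses(2)[OF \<sigma>p] by (simp add: \<tau>_def fun_eq_iff)
  ultimately have "factors \<pi> \<sigma>" using \<sigma> by (auto simp: factors_def)
  then show ?thesis by (rule that(1))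
qed

text \<open>The value of \<open>f\<close>, extended linearly to the group ring, at a \<pi> b, with a
  the sum over the row group and b the signed sum over the column group. Identities in the group
  ring are expressed by arbitrary \<open>f\<close>.\<close>

definition double_sum :: "((nat \<Rightarrow> nat) \<Rightarrow> 'r::ring_1) \<Rightarrow> (nat \<Rightarrow> nat) \<Rightarrow> 'r"
  where "double_sum f \<pi> = (\<Sum>\<tau>\<in>R.C. \<Sum>\<sigma>\<in>C. of_int (sign \<sigma>) * f (\<tau> \<circ> \<pi> \<circ> \<sigma>))"

lemma double_sum_left: "\<rho> \<in> R.C \<Longrightarrow> double_sum f (\<rho> \<circ> \<pi>) = double_sum f \<pi>"
  unfolding double_sum_def
  by (subst (2) sum.reindex_bij_betw[OF R.bij_C_right, symmetric]) (simp_all add: comp_assoc)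

lemma double_sum_right:
  assumes "\<rho> \<in> C"
  shows "double_sum f (\<pi> \<circ> \<rho>) = of_int (sign \<rho>) * double_sum f \<pi>"
proof -
  have "(\<Sum>\<sigma>\<in>C. of_int (sign \<sigma>) * f (\<tau> \<circ> \<pi> \<circ> \<sigma>)) =
      of_int (sign \<rho>) * (\<Sum>\<sigma>\<in>C. of_int (sign \<sigma>) * f (\<tau> \<circ> (\<pi> \<circ> \<rho>) \<circ> \<sigma>))" for \<tau>
  proof -
    have "(\<Sum>\<sigma>\<in>C. of_int (sign \<sigma>) * f (\<tau> \<circ> \<pi> \<circ> \<sigma>)) = (\<Sum>\<sigma>\<in>C. of_int (sign (\<rho> \<circ> \<sigma>)) * f (\<tau> \<circ> \<pi> \<circ> (\<rho> \<circ> \<sigma>)))"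
      by (rule sum.reindex_bij_betw[OF bij_C_left[OF assms], symmetric])
    also have "\<dots> = (\<Sum>\<sigma>\<in>C. of_int (sign \<rho>) * (of_int (sign \<sigma>) * f (\<tau> \<circ> (\<pi> \<circ> \<rho>) \<circ> \<sigma>)))"
    proof (rule sum.cong[OF refl])
      fix \<sigma> assume "\<sigma> \<in> C"
      then have "sign (\<rho> \<circ> \<sigma>) = sign \<rho> * sign \<sigma>"
        by (intro sign_compose C_permutation assms)
      then show "of_int (sign (\<rho> \<circ> \<sigma>)) * f (\<tau> \<circ> \<pi> \<circ> (\<rho> \<circ> \<sigma>)) =
          of_int (sign \<rho>) * (of_int (sign \<sigma>) * f (\<tau> \<circ> (\<pi> \<circ> \<rho>) \<circ> \<sigma>))"
        by (simp only: of_int_mult mult.assoc comp_assoc)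
    qed
    finally show ?thesis by (simp add: sum_distrib_left)
  qed
  then have "double_sum f \<pi> = of_int (sign \<rho>) * double_sum f (\<pi> \<circ> \<rho>)"
    unfolding double_sum_def by (simp add: sum_distrib_left)
  then have "of_int (sign \<rho>) * double_sum f \<pi> = of_int (sign \<rho> * sign \<rho>) * double_sum f (\<pi> \<circ> \<rho>)"
    by (simp only: of_int_mult mult.assoc)
  then show ?thesis by (simp only: sign_idempotent of_int_1 mult_1)
qed

text \<open>If \<pi> is a product from the two groups, its factors are absorbed in a and b.
  Otherwise \<pi> carries a transposition of the column group to one of the row group; passing it
  through gives a \<pi> b = - a \<pi> b.\<close>

lemma double_sum_eq:
  fixes f :: "(nat \<Rightarrow> nat) \<Rightarrow> 'r::ring_1"
  assumes tf: "\<And>x :: 'r. x + x = 0 \<Longrightarrow> x = 0" and \<pi>: "\<pi> permutes {..<l}"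
  shows "double_sum f \<pi> = of_int (young_sign \<pi>) * double_sum f id"
proof (cases "\<exists>\<sigma>. factors \<pi> \<sigma>")
  case True
  define \<sigma> where "\<sigma> = (SOME \<sigma>. factors \<pi> \<sigma>)"
  have "factors \<pi> \<sigma>" unfolding \<sigma>_def by (rule someI_ex[OF True])
  then obtain \<tau> where *: "\<sigma> \<in> C" "\<tau> \<in> R.C" "\<pi> = \<tau> \<circ> (id \<circ> \<sigma>)" by (auto simp: factors_def)
  show ?thesis
    unfolding *(3) double_sum_left[OF *(2)] double_sum_right[OF *(1)]
    using True by (simp add: young_sign_def \<sigma>_def[symmetric] *(3)[symmetric, simplified])
next
  case False
  then obtain s t where st: "s < l" "t < l" "s \<noteq> t" "v s = v t" "u (\<pi> s) = u (\<pi> t)"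
    using factors_or_transposition[OF \<pi>] by metis
  define \<rho> where "\<rho> = transpose s t"
  define \<rho>' where "\<rho>' = transpose (\<pi> s) (\<pi> t)"
  have \<rho>: "\<rho> \<in> C" "sign \<rho> = -1" using st by (simp_all add: \<rho>_def transpose_C sign_swap_id)
  have \<rho>': "\<rho>' \<in> R.C"
    unfolding \<rho>'_def using st permutes_in_image[OF \<pi>, of s] permutes_in_image[OF \<pi>, of t]
    by (intro R.transpose_C) auto
  have "\<pi> \<circ> \<rho> = \<rho>' \<circ> \<pi>"
    using permutes_inj[OF \<pi>] by (auto simp: \<rho>_def \<rho>'_def transpose_def fun_eq_iff dest: injD)
  then have "double_sum f \<pi> = - double_sum f \<pi>"
    using double_sum_left[OF \<rho>', of f \<pi>] double_sum_right[OF \<rho>(1), of f \<pi>] \<rho>(2) by simp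
  then have "double_sum f \<pi> + double_sum f \<pi> = 0" by (rule eq_neg_iff_add_eq_0[THEN iffD1])
  then have "double_sum f \<pi> = 0" by (rule tf)
  moreover have "young_sign \<pi> = 0" using False by (simp only: young_sign_def if_False)
  ultimately show ?thesis by simp
qed

text \<open>The number c with \<open>e_T\<close> \<open>e_T\<close> = c \<open>e_T\<close>: in the
  product (a b) (a b) every group element which occurs in the inner factor b a is replaced by its
  coefficient according to \<open>double_sum_eq\<close>.\<close>

definition young_const :: int
  where "young_const = (\<Sum>\<sigma>\<in>C. \<Sum>\<tau>\<in>R.C. sign \<sigma> * young_sign (\<sigma> \<circ> \<tau>))"

lemma young_quasi_idempotent:
  fixes f :: "(nat \<Rightarrow> nat) \<Rightarrow> 'r::ring_1"
  assumes tf: "\<And>x :: 'r. x + x = 0 \<Longrightarrow> x = 0"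
  shows "(\<Sum>\<sigma>\<in>C. \<Sum>\<tau>\<in>R.C. of_int (sign \<sigma>) *
      (\<Sum>\<sigma>'\<in>C. \<Sum>\<tau>'\<in>R.C. of_int (sign \<sigma>') * f (\<tau> \<circ> \<sigma> \<circ> (\<tau>' \<circ> \<sigma>')))) =
    of_int young_const * (\<Sum>\<sigma>\<in>C. \<Sum>\<tau>\<in>R.C. of_int (sign \<sigma>) * f (\<tau> \<circ> \<sigma>))"
proof -
  have "(\<Sum>\<sigma>\<in>C. \<Sum>\<tau>\<in>R.C. of_int (sign \<sigma>) *
      (\<Sum>\<sigma>'\<in>C. \<Sum>\<tau>'\<in>R.C. of_int (sign \<sigma>') * f (\<tau> \<circ> \<sigma> \<circ> (\<tau>' \<circ> \<sigma>')))) =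
    (\<Sum>\<sigma>\<in>C. of_int (sign \<sigma>) * (\<Sum>\<tau>\<in>R.C. \<Sum>\<sigma>'\<in>C. \<Sum>\<tau>'\<in>R.C. of_int (sign \<sigma>') * f (\<tau> \<circ> (\<sigma> \<circ> \<tau>') \<circ> \<sigma>')))"
    by (simp only: sum_distrib_left comp_assoc)
  also have "\<dots> = (\<Sum>\<sigma>\<in>C. of_int (sign \<sigma>) * (\<Sum>\<tau>'\<in>R.C. double_sum f (\<sigma> \<circ> \<tau>')))"
  proof (rule sum.cong[OF refl], rule arg_cong[where f = "(*) _"])
    fix \<sigma>
    have "(\<Sum>\<tau>\<in>R.C. \<Sum>\<sigma>'\<in>C. \<Sum>\<tau>'\<in>R.C. of_int (sign \<sigma>') * f (\<tau> \<circ> (\<sigma> \<circ> \<tau>') \<circ> \<sigma>')) =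
        (\<Sum>\<tau>\<in>R.C. \<Sum>\<tau>'\<in>R.C. \<Sum>\<sigma>'\<in>C. of_int (sign \<sigma>') * f (\<tau> \<circ> (\<sigma> \<circ> \<tau>') \<circ> \<sigma>'))"
      by (intro sum.cong refl sum.swap)
    also have "\<dots> = (\<Sum>\<tau>'\<in>R.C. double_sum f (\<sigma> \<circ> \<tau>'))"
      unfolding double_sum_def by (rule sum.swap)
    finally show "(\<Sum>\<tau>\<in>R.C. \<Sum>\<sigma>'\<in>C. \<Sum>\<tau>'\<in>R.C. of_int (sign \<sigma>') * f (\<tau> \<circ> (\<sigma> \<circ> \<tau>') \<circ> \<sigma>')) =
        (\<Sum>\<tau>'\<in>R.C. double_sum f (\<sigma> \<circ> \<tau>'))" .
  qed
  also have "\<dots> = (\<Sum>\<sigma>\<in>C. of_int (sign \<sigma>) * (\<Sum>\<tau>'\<in>R.C. of_int (young_sign (\<sigma> \<circ> \<tau>')) * double_sum f id))"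
  proof (rule sum.cong[OF refl], rule arg_cong[where f = "(*) _"], rule sum.cong[OF refl])
    fix \<sigma> \<tau>' assume "\<sigma> \<in> C" "\<tau>' \<in> R.C"
    then have "\<sigma> \<circ> \<tau>' permutes {..<l}" by (intro permutes_compose[OF R.C_permutes C_permutes])
    with tf show "double_sum f (\<sigma> \<circ> \<tau>') = of_int (young_sign (\<sigma> \<circ> \<tau>')) * double_sum f id"
      by (rule double_sum_eq)
  qed
  also have "\<dots> = of_int young_const * double_sum f id"
    by (simp add: young_const_def sum_distrib_left sum_distrib_right mult.assoc)
  also have "double_sum f id = (\<Sum>\<sigma>\<in>C. \<Sum>\<tau>\<in>R.C. of_int (sign \<sigma>) * f (\<tau> \<circ> \<sigma>))"
    unfolding double_sum_def by (subst sum.swap) simp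
  finally show ?thesis .
qed

text \<open>With \<open>v\<close> the word of row numbers, whose stabilizer is \<open>R\<close>, the number \<open>c |R|\<close> is the square
  of the norm of the image of \<open>v\<close> under the Young symmetrizer.\<close>

lemma young_const_pos: "young_const > 0"
proof -
  \<comment> \<open>The indicator of the row group picks out the permutations that fix the word of
    row numbers.\<close>
  define f :: "(nat \<Rightarrow> nat) \<Rightarrow> int" where "f \<pi> = of_bool (\<pi> \<in> R.C)" for \<pi>
  define word where "word \<pi> = restrict (\<lambda>s. u (inv_into UNIV \<pi> s)) {..<l}" for \<pi> :: "nat \<Rightarrow> nat"
  define X where "X = C \<times> R.C"
  define sg :: "(nat \<Rightarrow> nat) \<times> (nat \<Rightarrow> nat) \<Rightarrow> int" where "sg p = sign (fst p)" for p
  define g :: "(nat \<Rightarrow> nat) \<times> (nat \<Rightarrow> nat) \<Rightarrow> nat \<Rightarrow> nat" where "g p = snd p \<circ> fst p" for p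
  have finX: "finite X" by (simp add: X_def finite_C R.finite_C)
  have gp: "g p permutes {..<l}" if "p \<in> X" for p
    using that permutes_compose[OF C_permutes R.C_permutes, of "fst p" "snd p"] by (auto simp: g_def X_def)
  have R_left: "\<tau> \<circ> \<pi> \<in> R.C \<longleftrightarrow> \<pi> \<in> R.C" if "\<tau> \<in> R.C" for \<tau> \<pi>
  proof
    assume "\<tau> \<circ> \<pi> \<in> R.C"
    then have "inv_into UNIV \<tau> \<circ> (\<tau> \<circ> \<pi>) \<in> R.C" by (rule R.C_compose[OF R.C_inv[OF that]])
    moreover have "inv_into UNIV \<tau> \<circ> (\<tau> \<circ> \<pi>) = \<pi>"
      by (rule ext) (simp add: permutes_inverses[OF R.C_permutes[OF that]])
    ultimately show "\<pi> \<in> R.C" by (simp only:)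
  qed (rule R.C_compose[OF that])
  have word_eq: "word \<pi> = word \<rho> \<longleftrightarrow> inv_into UNIV \<pi> \<circ> \<rho> \<in> R.C"
    if \<pi>: "\<pi> permutes {..<l}" and \<rho>: "\<rho> permutes {..<l}" for \<pi> \<rho>
  proof -
    have "word \<pi> = word \<rho> \<longleftrightarrow> (\<forall>s<l. u (inv_into UNIV \<pi> s) = u (inv_into UNIV \<rho> s))"
      by (auto simp: word_def restrict_def fun_eq_iff)
    also have "\<dots> \<longleftrightarrow> (\<forall>s<l. u (inv_into UNIV \<pi> (\<rho> s)) = u s)"
    proof
      assume *: "\<forall>s<l. u (inv_into UNIV \<pi> s) = u (inv_into UNIV \<rho> s)"
      show "\<forall>s<l. u (inv_into UNIV \<pi> (\<rho> s)) = u s"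
        using * permutes_in_image[OF \<rho>] permutes_inverses[OF \<rho>] by (metis lessThan_iff)
    next
      assume *: "\<forall>s<l. u (inv_into UNIV \<pi> (\<rho> s)) = u s"
      show "\<forall>s<l. u (inv_into UNIV \<pi> s) = u (inv_into UNIV \<rho> s)"
        using * permutes_in_image[OF permutes_inv[OF \<rho>]] permutes_inverses[OF \<rho>] by (metis lessThan_iff)
    qed
    also have "\<dots> \<longleftrightarrow> inv_into UNIV \<pi> \<circ> \<rho> \<in> R.C"
      using permutes_compose[OF \<rho> permutes_inv[OF \<pi>]] by (simp add: R.C_def)
    finally show ?thesis .
  qed
  define T where "T = (\<Sum>p\<in>X. \<Sum>q\<in>X. sg p * sg q * of_bool (word (g p) = word (g q)))"
  \<comment> \<open>\<open>N w\<close> is the coefficient of the word \<open>w\<close> in the image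
    of the word of row numbers, so \<open>T\<close> is the sum of the squares of these
    coefficients.\<close>
  define N where "N w = (\<Sum>p\<in>X. sg p * of_bool (word (g p) = w))" for w
  have "T = (\<Sum>w\<in>word ` g ` X. N w * N w)"
  proof -
    have "(\<Sum>w\<in>word ` g ` X. N w * N w) = (\<Sum>w\<in>word ` g ` X. \<Sum>p\<in>X. \<Sum>q\<in>X.
        sg p * sg q * (of_bool (word (g p) = w) * of_bool (word (g q) = w)))"
      by (simp add: N_def sum_product mult_ac)
    also have "\<dots> = (\<Sum>p\<in>X. \<Sum>q\<in>X. \<Sum>w\<in>word ` g ` X.
        sg p * sg q * (of_bool (word (g p) = w) * of_bool (word (g q) = w)))"
      by (subst sum.swap, intro sum.cong refl sum.swap)
    also have "\<dots> = T"
      unfolding T_def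
    proof (intro sum.cong refl)
      fix p q assume p: "p \<in> X" "q \<in> X"
      have "(\<Sum>w\<in>word ` g ` X. sg p * sg q * (of_bool (word (g p) = w) * of_bool (word (g q) = w))) =
          (\<Sum>w\<in>word ` g ` X. if w = word (g p) then sg p * sg q * of_bool (word (g p) = word (g q)) else 0)"
        by (intro sum.cong) auto
      then show "(\<Sum>w\<in>word ` g ` X. sg p * sg q * (of_bool (word (g p) = w) * of_bool (word (g q) = w))) =
          sg p * sg q * of_bool (word (g p) = word (g q))"
        using p finX by simp
    qed
    finally show ?thesis by simp
  qed
  \<comment> \<open>One square suffices: at the original word only pairs with \<sigma> = id
    contribute, so the coefficient is the order of the row group.\<close>
  also have "\<dots> \<ge> N (word id) * N (word id)"
  proof (rule member_le_sum)
    have "id = g (id, id)" "(id, id) \<in> X" by (simp_all add: g_def X_def id_C R.id_C)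
    then show "word id \<in> word ` g ` X" by (metis imageI)
  qed (use finX in auto)
  finally have "T \<ge> N (word id) * N (word id)" .
  moreover have "N (word id) = int (card R.C)"
  proof -
    have "N (word id) = (\<Sum>p\<in>X. of_bool (fst p = id))"
      unfolding N_def
    proof (rule sum.cong[OF refl])
      fix p assume p: "p \<in> X"
      have "word (g p) = word id \<longleftrightarrow> g p \<in> R.C"
        using word_eq[of id "g p"] gp[OF p] by (auto simp: permutes_id)
      also have "\<dots> \<longleftrightarrow> fst p \<in> R.C" using R_left p by (auto simp: g_def X_def)
      also have "\<dots> \<longleftrightarrow> fst p = id" using R_C_trivial R.id_C p by (auto simp: X_def)
      finally show "sg p * of_bool (word (g p) = word id) = of_bool (fst p = id)"
        by (simp add: sg_def)
    qed
    also have "\<dots> = (\<Sum>\<sigma>\<in>C. \<Sum>\<tau>\<in>R.C. of_bool (\<sigma> = id))"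
      by (simp only: X_def sum.cartesian_product case_prod_unfold)
    also have "\<dots> = (\<Sum>\<sigma>\<in>C. if \<sigma> = id then int (card R.C) else 0)"
      by (intro sum.cong) auto
    finally show ?thesis using id_C finite_C by simp
  qed
  moreover have cR: "card R.C > 0" using R.id_C R.finite_C by (auto simp: card_gt_0_iff)
  ultimately have "T > 0" by (metis mult_pos_pos of_nat_0_less_iff order_less_le_trans)
  moreover have "T = young_const * int (card R.C)"
  proof -
    \<comment> \<open>Invariance of the scalar product moves one symmetrizer to the other side as
      inverses. There the inverse of \<tau> is absorbed in \<tau>' and the inverse of \<sigma> is
      renamed. Since \<open>f\<close> is invariant under the row group on the left, \<tau> can be
      put back in front, which produces the square of \<open>e_T\<close>.\<close>
    have "T = (\<Sum>p\<in>X. \<Sum>q\<in>X. sg p * (sg q * f (inv_into UNIV (g p) \<circ> g q)))"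
      unfolding T_def
    proof (intro sum.cong refl)
      fix p q assume "p \<in> X" "q \<in> X"
      then show "sg p * sg q * of_bool (word (g p) = word (g q)) = sg p * (sg q * f (inv_into UNIV (g p) \<circ> g q))"
        by (simp only: word_eq[OF gp gp] f_def mult.assoc)
    qed
    also have "\<dots> = (\<Sum>\<sigma>\<in>C. \<Sum>\<tau>\<in>R.C. \<Sum>\<sigma>'\<in>C. \<Sum>\<tau>'\<in>R.C.
        sign \<sigma> * (sign \<sigma>' * f (inv_into UNIV (\<tau> \<circ> \<sigma>) \<circ> (\<tau>' \<circ> \<sigma>'))))"
      by (simp only: X_def sum.cartesian_product' sg_def g_def fst_conv snd_conv)
    also have "\<dots> = (\<Sum>\<sigma>\<in>C. \<Sum>\<tau>\<in>R.C. \<Sum>\<sigma>'\<in>C. \<Sum>\<tau>'\<in>R.C.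
        sign \<sigma> * (sign \<sigma>' * f (inv_into UNIV \<sigma> \<circ> (\<tau>' \<circ> \<sigma>'))))"
    proof (rule sum.cong[OF refl], rule sum.cong[OF refl], rule sum.cong[OF refl])
      fix \<sigma> \<tau> \<sigma>' :: "nat \<Rightarrow> nat" assume *: "\<sigma> \<in> C" "\<tau> \<in> R.C"
      have "inv_into UNIV (\<tau> \<circ> \<sigma>) \<circ> (\<tau>' \<circ> \<sigma>') = inv_into UNIV \<sigma> \<circ> ((inv_into UNIV \<tau> \<circ> \<tau>') \<circ> \<sigma>')" for \<tau>'
        using permutation_inverse_compose[OF R.C_permutation[OF *(2)] C_permutation[OF *(1)]]
        by (simp add: comp_assoc)
      then show "(\<Sum>\<tau>'\<in>R.C. sign \<sigma> * (sign \<sigma>' * f (inv_into UNIV (\<tau> \<circ> \<sigma>) \<circ> (\<tau>' \<circ> \<sigma>')))) =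
          (\<Sum>\<tau>'\<in>R.C. sign \<sigma> * (sign \<sigma>' * f (inv_into UNIV \<sigma> \<circ> (\<tau>' \<circ> \<sigma>'))))"
        using sum.reindex_bij_betw[OF R.bij_C_left[OF R.C_inv[OF *(2)]],
            of "\<lambda>\<tau>'. sign \<sigma> * (sign \<sigma>' * f (inv_into UNIV \<sigma> \<circ> (\<tau>' \<circ> \<sigma>')))"] by (simp only:)
    qed
    also have "\<dots> = (\<Sum>\<sigma>\<in>C. \<Sum>\<tau>\<in>R.C. \<Sum>\<sigma>'\<in>C. \<Sum>\<tau>'\<in>R.C. sign \<sigma> * (sign \<sigma>' * f (\<sigma> \<circ> (\<tau>' \<circ> \<sigma>'))))"
    proof -
      define h where "h \<sigma> = (\<Sum>\<tau>\<in>R.C. \<Sum>\<sigma>'\<in>C. \<Sum>\<tau>'\<in>R.C. sign \<sigma> * (sign \<sigma>' * f (\<sigma> \<circ> (\<tau>' \<circ> \<sigma>'))))" for \<sigma>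
      have "(\<Sum>\<sigma>\<in>C. h (inv_into UNIV \<sigma>)) = (\<Sum>\<sigma>\<in>C. h \<sigma>)"
        by (rule sum.reindex_bij_betw[OF bij_C_inv])
      then show ?thesis
        by (simp add: h_def sign_inverse[OF C_permutation] cong: sum.cong)
    qed
    also have "\<dots> = (\<Sum>\<sigma>\<in>C. \<Sum>\<tau>\<in>R.C. of_int (sign \<sigma>) *
        (\<Sum>\<sigma>'\<in>C. \<Sum>\<tau>'\<in>R.C. of_int (sign \<sigma>') * f (\<tau> \<circ> \<sigma> \<circ> (\<tau>' \<circ> \<sigma>'))))"
    proof (intro sum.cong refl)
      fix \<sigma> \<tau> assume "\<tau> \<in> R.C"
      then show "(\<Sum>\<sigma>'\<in>C. \<Sum>\<tau>'\<in>R.C. sign \<sigma> * (sign \<sigma>' * f (\<sigma> \<circ> (\<tau>' \<circ> \<sigma>')))) =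
        of_int (sign \<sigma>) * (\<Sum>\<sigma>'\<in>C. \<Sum>\<tau>'\<in>R.C. of_int (sign \<sigma>') * f (\<tau> \<circ> \<sigma> \<circ> (\<tau>' \<circ> \<sigma>')))"
        by (simp add: f_def sum_distrib_left comp_assoc R_left)
    qed
    also have "\<dots> = of_int young_const * (\<Sum>\<sigma>\<in>C. \<Sum>\<tau>\<in>R.C. of_int (sign \<sigma>) * f (\<tau> \<circ> \<sigma>))"
      by (rule young_quasi_idempotent) simp
    also have "(\<Sum>\<sigma>\<in>C. \<Sum>\<tau>\<in>R.C. of_int (sign \<sigma>) * f (\<tau> \<circ> \<sigma>)) = (\<Sum>\<sigma>\<in>C. if \<sigma> = id then int (card R.C) else 0)"
    proof (rule sum.cong[OF refl])
      fix \<sigma> assume "\<sigma> \<in> C"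
      then have "\<sigma> \<in> R.C \<longleftrightarrow> \<sigma> = id" using R_C_trivial R.id_C by auto
      then show "(\<Sum>\<tau>\<in>R.C. of_int (sign \<sigma>) * f (\<tau> \<circ> \<sigma>)) = (if \<sigma> = id then int (card R.C) else 0)"
        by (simp add: f_def R_left cong: sum.cong)
    qed
    also have "\<dots> = int (card R.C)" using id_C finite_C by simp
    finally show ?thesis by simp
  qed
  ultimately show ?thesis using cR by (simp add: zero_less_mult_iff)
qed

end

section \<open>Values of Young symmetrized tensors\<close>

lemma sum_sum_restrict:
  fixes x :: "'r::ring_1"
  assumes "finite A" "finite B" "A' \<subseteq> A" "B' \<subseteq> B"
  shows "(\<Sum>a\<in>A. \<Sum>b\<in>B. if a \<in> A' \<and> b \<in> B' then x else 0) = of_nat (card A' * card B') * x"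
proof -
  have "(\<Sum>b\<in>B. if a \<in> A' \<and> b \<in> B' then x else 0) = (if a \<in> A' then of_nat (card B') * x else 0)" for a
    using sum.inter_restrict[OF assms(2), of "\<lambda>_. x" B'] assms(4) by (simp add: Int_absorb1)
  then show ?thesis
    using sum.inter_restrict[OF assms(1), of "\<lambda>_. of_nat (card B') * x" A'] assms(3)
    by (simp add: Int_absorb1 mult.assoc)
qed

lemma boxes_replicate: "boxes (replicate r c) = map (\<lambda>s. (s div c, s mod c)) [0..<r * c]"
proof -
  have "boxes (replicate r c) = concat (map (\<lambda>i. map (Pair i) [0..<c]) [0..<r])"
    unfolding boxes_def by (intro arg_cong[where f = concat]) simp
  also have "\<dots> = map (\<lambda>s. (s div c, s mod c)) [0..<r * c]"
  proof (induction r)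
    case (Suc r)
    have "[0..<Suc r * c] = [0..<r * c] @ map (\<lambda>j. r * c + j) [0..<c]"
      using map_add_upt[of "r * c" c] upt_add_eq_append[of 0 "r * c" c] by (simp add: add.commute)
    then have "map (\<lambda>s. (s div c, s mod c)) [0..<Suc r * c] =
        map (\<lambda>s. (s div c, s mod c)) [0..<r * c] @ map (\<lambda>j. ((r * c + j) div c, (r * c + j) mod c)) [0..<c]"
      by (simp add: comp_def)
    also have "map (\<lambda>j. ((r * c + j) div c, (r * c + j) mod c)) [0..<c] = map (Pair r) [0..<c]"
      by (intro map_cong) auto
    finally show ?case using Suc by simp
  qed simp
  finally show ?thesis .
qed

context
  fixes r c :: nat
begin

abbreviation (input) "col_group \<equiv> grid.C (\<lambda>s. s mod c) (r * c)"
abbreviation (input) "row_group \<equiv> grid.C (\<lambda>s. s div c) (r * c)"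

interpretation G: grid "\<lambda>s. s div c" "\<lambda>s. s mod c" r c "r * c"
  by (rule grid_rows)

interpretation F: grid "\<lambda>s. s mod c" "\<lambda>s. s div c" c r "r * c"
  by (rule grid_columns)

lemma column_stabilizer_eq: "column_stabilizer (replicate r c) = col_group"
  by (auto simp: column_stabilizer_def G.C_def boxes_replicate permutes_in_image[of _ "{..<r * c}", simplified])

lemma row_stabilizer_eq: "row_stabilizer (replicate r c) = row_group"
  by (auto simp: row_stabilizer_def F.C_def boxes_replicate permutes_in_image[of _ "{..<r * c}", simplified])

lemma ev_young_left:
  assumes "graded \<phi>" "tlen (r * c) x"
  shows "ev \<phi> (young_left (replicate r c) x) =
    (\<Sum>\<sigma>\<in>col_group. \<Sum>\<tau>\<in>row_group. of_int (sign \<sigma>) * ev (\<lambda>s. \<phi> (\<tau> (\<sigma> s))) x)"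
  unfolding young_left_def column_stabilizer_eq row_stabilizer_eq ev_sum ev_of_int
proof (intro sum.cong refl arg_cong[where f = "(*) _"])
  fix \<sigma> \<tau> assume "\<sigma> \<in> col_group" "\<tau> \<in> row_group"
  then show "ev \<phi> (perm_left (\<tau> \<circ> \<sigma>) x) = ev (\<lambda>s. \<phi> (\<tau> (\<sigma> s))) x"
    using ev_perm_left[OF assms permutes_compose[OF G.C_permutes F.C_permutes]] by (simp add: comp_def)
qed

lemma ev_young_right:
  assumes "graded \<phi>" "tlen (r * c) x"
  shows "ev \<phi> (young_right (replicate r c) x) =
    (\<Sum>\<sigma>\<in>col_group. \<Sum>\<tau>\<in>row_group. of_int (sign \<sigma>) *
      ev (\<lambda>s. \<phi> (inv_into UNIV \<sigma> (inv_into UNIV \<tau> s))) x)"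
  unfolding young_right_def column_stabilizer_eq row_stabilizer_eq ev_sum ev_of_int
proof (intro sum.cong refl arg_cong[where f = "(*) _"])
  fix \<sigma> \<tau> assume *: "\<sigma> \<in> col_group" "\<tau> \<in> row_group"
  then show "ev \<phi> (perm_right x (\<tau> \<circ> \<sigma>)) = ev (\<lambda>s. \<phi> (inv_into UNIV \<sigma> (inv_into UNIV \<tau> s))) x"
    using ev_perm_right[OF assms permutes_compose[OF G.C_permutes F.C_permutes]]
      permutation_inverse_compose[OF F.C_permutation[OF *(2)] G.C_permutation[OF *(1)]]
    by (simp add: comp_def)
qed

lemma tlen_young_left: "tlen l x \<Longrightarrow> tlen l (young_left lam x)"
  unfolding young_left_def by (intro tlen_sum tlen_of_int tlen_perm_left)


lemma tlen_diff: "tlen l x \<Longrightarrow> tlen l y \<Longrightarrow> tlen l (x - y)"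
  unfolding tlen_def
proof
  fix w
  assume *: "\<forall>w\<in>tsupp x. length w = l" "\<forall>w\<in>tsupp y. length w = l" and "w \<in> tsupp (x - y)"
  then have "w \<in> tsupp x \<or> w \<in> tsupp y" by (auto simp: tsupp_iff)
  with * show "length w = l" by blast
qed

text \<open>Equality is tested on values, where both symmetrizers become sums over permutations of
  the points; \<open>young_quasi_idempotent\<close> is applied to the function that sends \<pi> to
  the value at the points permuted by \<pi>.\<close>

lemma young_left_idempotent:
  fixes x :: "'k::field_char_0 tensor"
  assumes x: "tlen (r * c) x"
  shows "young_left (replicate r c) (young_left (replicate r c) x) =
    of_int G.young_const * young_left (replicate r c) x"
proof -
  let ?y = "young_left (replicate r c)"
  have "?y (?y x) - of_int G.young_const * ?y x = 0"
  proof (rule tensor_eq_zeroI)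
    show "tlen (r * c) (?y (?y x) - of_int G.young_const * ?y x)"
      by (intro tlen_diff tlen_of_int tlen_young_left x)
    fix \<phi> :: "nat \<Rightarrow> letter \<Rightarrow> 'k grassmann"
    assume \<phi>: "graded \<phi>"
    then have gr: "graded (\<lambda>s. \<phi> (f s))" for f by (simp add: graded_def)
    have "ev \<phi> (?y (?y x)) = (\<Sum>\<sigma>\<in>col_group. \<Sum>\<tau>\<in>row_group. of_int (sign \<sigma>) *
        (\<Sum>\<sigma>'\<in>col_group. \<Sum>\<tau>'\<in>row_group. of_int (sign \<sigma>') * ev (\<lambda>s. \<phi> (\<tau> (\<sigma> (\<tau>' (\<sigma>' s))))) x))"
      by (simp only: ev_young_left[OF \<phi> tlen_young_left[OF x]] ev_young_left[OF gr x])
    also have "\<dots> = of_int G.young_const * ev \<phi> (?y x)"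
      using G.young_quasi_idempotent[of "\<lambda>\<pi>. ev (\<lambda>s. \<phi> (\<pi> s)) x", OF G_grade_two_eq_zero]
      by (simp add: ev_young_left[OF \<phi> x])
    finally show "ev \<phi> (?y (?y x) - of_int G.young_const * ?y x) = 0"
      by (simp add: ev_diff ev_of_int)
  qed
  then show ?thesis by simp
qed


subsection \<open>Points constant along rows\<close>

text \<open>At points constant along rows the row group acts trivially and contributes only its
  order. The alternation over the columns that remains is evaluated by
  \<open>alternating_oprod_odd\<close>, with \<open>B\<close> the slots containing odd
  elements.\<close>

lemma value_left:
  fixes W :: "nat \<Rightarrow> nat \<Rightarrow> 'k::field_char_0 geven"
  assumes gr: "graded z" and B: "B \<subseteq> {..<r * c}" and odd: "\<And>i j. \<eta> i j \<in> G_grade 1"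
    and z: "\<And>k s. k < r \<Longrightarrow> s < r * c \<Longrightarrow> z k (Vec (\<phi> (s div c, s mod c))) =
      (if s \<in> B then \<Sum>i<r. of_geven (W k i) * \<eta> i (s mod c) else of_geven (W k (s div c)))"
  shows "ev (\<lambda>s. z (s div c)) (filling_tensor (replicate r c) \<phi>) =
    of_nat (card row_group) * (of_geven (det (mat r r (\<lambda>(i, j). W i j)) ^ c) *
    of_nat (card {\<sigma> \<in> col_group. \<forall>s<r * c. s \<notin> B \<longrightarrow> \<sigma> s = s}) *
    oprod (\<lambda>s. if s \<in> B then \<eta> (s div c) (s mod c) else 1) (r * c))"
proof -
  let ?w = "map (\<lambda>x. Vec (\<phi> x)) (boxes (replicate r c))"
  have len: "length ?w = r * c" by (simp add: boxes_replicate)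
  then have w: "tlen (r * c) (tword ?w)" using tlen_tword[of ?w] by simp
  have "graded (\<lambda>s. z (s div c))" using gr by (simp add: graded_def)
  then have "ev (\<lambda>s. z (s div c)) (filling_tensor (replicate r c) \<phi>) =
     (\<Sum>\<sigma>\<in>col_group. \<Sum>\<tau>\<in>row_group. of_int (sign \<sigma>) * evw (\<lambda>s. z (\<tau> (\<sigma> s) div c)) ?w)"
    unfolding filling_tensor_def by (subst ev_young_left[OF _ w]) (simp_all add: ev_tword)
  also have "\<dots> = (\<Sum>\<sigma>\<in>col_group. \<Sum>\<tau>\<in>row_group. of_int (sign \<sigma>) *
      oprod (\<lambda>s. z (\<sigma> s div c) (Vec (\<phi> (s div c, s mod c)))) (r * c))"
    unfolding evw_def len
  proof (intro sum.cong refl arg_cong[where f = "(*) _"] oprod_cong)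
    fix \<sigma> \<tau> s assume "\<sigma> \<in> col_group" "\<tau> \<in> row_group" "s < r * c"
    then show "z (\<tau> (\<sigma> s) div c) (?w ! s) = z (\<sigma> s div c) (Vec (\<phi> (s div c, s mod c)))"
      using F.C_v G.C_lt by (simp add: boxes_replicate)
  qed
  also have "\<dots> = of_nat (card row_group) * (\<Sum>\<sigma>\<in>col_group. of_int (sign \<sigma>) *
      oprod (\<lambda>s. (\<lambda>k s. z k (Vec (\<phi> (s div c, s mod c)))) (\<sigma> s div c) s) (r * c))"
    by (simp add: sum_distrib_left)
  also have "\<dots> = of_nat (card row_group) * (of_geven (G.D W) *
    of_nat (card {\<sigma> \<in> col_group. \<forall>s<r * c. s \<notin> B \<longrightarrow> \<sigma> s = s}) *
    oprod (\<lambda>s. if s \<in> B then \<eta> (s div c) (s mod c) else 1) (r * c))"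
    by (subst G.alternating_oprod_odd[OF B odd z]) simp_all
  finally show ?thesis by (simp only: G.D_eq_det)
qed


subsection \<open>Points constant along columns, on covariant tensors\<close>

text \<open>The coordinate in slot \<open>s\<close> is odd exactly if the letter there is even, and
  then it passes the \<open>s\<close> odd parameters of the earlier slots.\<close>

lemma evw_pull_out:
  fixes y :: "nat \<Rightarrow> letter \<Rightarrow> 'k::comm_ring_1 grassmann"
  assumes "\<And>s. s < l \<Longrightarrow> \<theta> s \<in> G_grade 1"
    and "\<And>s. s < l \<Longrightarrow> y s (v ! s) \<in> G_grade (of_bool (\<not> letter_odd (v ! s)))"
  shows "oprod (\<lambda>s. y s (v ! s) * \<theta> s) l =
    (- 1) ^ (\<Sum>s<l. if letter_odd (v ! s) then 0 else s) * oprod (\<lambda>s. y s (v ! s)) l * oprod \<theta> l"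
  using assms
proof (induction l)
  case (Suc l)
  let ?e = "\<Sum>s<l. if letter_odd (v ! s) then 0 else s"
  let ?p = "if letter_odd (v ! l) then 0 else 1 :: nat"
  have yl: "y l (v ! l) \<in> G_grade ?p" using Suc.prems(2)[of l] by (auto split: if_splits)
  have "oprod \<theta> l \<in> G_grade (\<Sum>s<l. 1)"
    using Suc.prems by (intro oprod_grade) simp
  then have "oprod \<theta> l * y l (v ! l) = (- 1) ^ (l * ?p) * (y l (v ! l) * oprod \<theta> l)"
    using yl by (intro G_grade_commute) simp_all
  moreover have "oprod (\<lambda>s. y s (v ! s) * \<theta> s) (Suc l) =
      (- 1) ^ ?e * (oprod (\<lambda>s. y s (v ! s)) l * (oprod \<theta> l * y l (v ! l))) * \<theta> l"
    using Suc by (simp add: mult.assoc)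
  moreover have "(- 1) ^ ?e * (oprod (\<lambda>s. y s (v ! s)) l * ((- 1) ^ (l * ?p) * x)) =
      (- 1) ^ (?e + l * ?p) * (oprod (\<lambda>s. y s (v ! s)) l * x)" for x :: "'k grassmann"
    by (simp add: neg_one_power_mult power_add)
  moreover have "?e + l * ?p = (\<Sum>s<Suc l. if letter_odd (v ! s) then 0 else s)" by simp
  ultimately show ?case by (simp only: mult.assoc oprod_simps)
qed simp

text \<open>The permutation of the slots permutes the odd parameters, whose product acquires the
  signs of \<sigma> and \<tau>. The sign of \<sigma> cancels the one in \<open>e_T\<close>, so that
  the column group contributes only its order. The sign of \<tau> turns the symmetrization of the
  rows into an alternation. Rows and columns thus change roles, and \<open>B\<close> consists of the
  slots with even letters, whose coordinates are odd.\<close>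

lemma value_right:
  fixes W :: "nat \<Rightarrow> nat \<Rightarrow> 'k::field_char_0 geven"
  assumes gr: "\<And>k b. z k b \<in> G_grade (of_bool (\<not> letter_odd b))" and \<theta>: "\<And>s. \<theta> s \<in> G_grade 1"
    and B: "B \<subseteq> {..<r * c}" and odd: "\<And>i j. \<eta> i j \<in> G_grade 1"
    and z: "\<And>k s. k < c \<Longrightarrow> s < r * c \<Longrightarrow> z k (Cov (\<psi> (s div c, s mod c))) =
      (if s \<in> B then \<Sum>i<c. of_geven (W k i) * \<eta> i (s div c) else of_geven (W k (s mod c)))"
    and B_iff: "\<And>s. s < r * c \<Longrightarrow> s \<in> B \<longleftrightarrow> \<not> is_odd (\<psi> (s div c, s mod c))"
  shows "ev (\<lambda>s b. z (s mod c) b * \<theta> s) (filling_cotensor (replicate r c) \<psi>) =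
    of_nat (card col_group) * (- 1) ^ \<Sum>B * (of_geven (det (mat c c (\<lambda>(i, j). W i j)) ^ r) *
    of_nat (card {\<tau> \<in> row_group. \<forall>s<r * c. s \<notin> B \<longrightarrow> \<tau> s = s}) *
    oprod (\<lambda>s. if s \<in> B then \<eta> (s mod c) (s div c) else 1) (r * c)) * oprod \<theta> (r * c)"
proof -
  let ?v = "map (\<lambda>x. Cov (\<psi> x)) (boxes (replicate r c))"
  let ?l = "r * c" and ?i = "inv_into UNIV"
  have len: "length ?v = ?l" by (simp add: boxes_replicate)
  have nth: "?v ! s = Cov (\<psi> (s div c, s mod c))" if "s < ?l" for s
    using that by (simp add: boxes_replicate)
  have v: "tlen ?l (tword ?v)" using tlen_tword[of ?v] len by simp
  have "z k b * \<theta> s \<in> G_grade (of_bool (letter_odd b))" for k b s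
    using G_grade_mult[OF gr \<theta>, of k b s]
      G_grade_parity[of "of_bool (\<not> letter_odd b) + 1" "of_bool (letter_odd b)"] by (cases "letter_odd b") auto
  then have g: "graded (\<lambda>s b. z (s mod c) b * \<theta> s)" by (simp add: graded_def)
  have E: "(\<Sum>s<?l. if letter_odd (?v ! s) then 0 else s) = \<Sum>B"
  proof -
    have "(\<Sum>s<?l. if letter_odd (?v ! s) then 0 else s) = (\<Sum>s<?l. if s \<in> B then s else 0)"
      using B_iff nth by (intro sum.cong) auto
    also have "\<dots> = \<Sum>B" using B by (simp add: sum.If_cases Int_absorb1)
    finally show ?thesis .
  qed
  have "ev (\<lambda>s b. z (s mod c) b * \<theta> s) (filling_cotensor (replicate r c) \<psi>) =
     (\<Sum>\<sigma>\<in>col_group. \<Sum>\<tau>\<in>row_group. of_int (sign \<sigma>) *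
       evw (\<lambda>s b. z (?i \<sigma> (?i \<tau> s) mod c) b * \<theta> (?i \<sigma> (?i \<tau> s))) ?v)"
    unfolding filling_cotensor_def by (subst ev_young_right[OF g v]) (simp add: ev_tword)
  also have "\<dots> = (\<Sum>\<sigma>\<in>col_group. \<Sum>\<tau>\<in>row_group.
      (- 1) ^ \<Sum>B * (of_int (sign (?i \<tau>)) * oprod (\<lambda>s. z (?i \<tau> s mod c) (?v ! s)) ?l) * oprod \<theta> ?l)"
  proof (intro sum.cong refl)
    fix \<sigma> \<tau> assume \<sigma>: "\<sigma> \<in> col_group" and \<tau>: "\<tau> \<in> row_group"
    note \<sigma>' = G.C_inv[OF \<sigma>] and \<tau>' = F.C_inv[OF \<tau>]
    have "evw (\<lambda>s b. z (?i \<sigma> (?i \<tau> s) mod c) b * \<theta> (?i \<sigma> (?i \<tau> s))) ?v =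
        oprod (\<lambda>s. z (?i \<sigma> (?i \<tau> s) mod c) (?v ! s) * \<theta> (?i \<sigma> (?i \<tau> s))) ?l"
      by (simp only: evw_def len)
    also have "\<dots> = (- 1) ^ \<Sum>B * oprod (\<lambda>s. z (?i \<sigma> (?i \<tau> s) mod c) (?v ! s)) ?l * oprod (\<lambda>s. \<theta> (?i \<sigma> (?i \<tau> s))) ?l"
      unfolding E[symmetric]
      by (rule evw_pull_out[where y = "\<lambda>s. z (?i \<sigma> (?i \<tau> s) mod c)" and \<theta> = "\<lambda>s. \<theta> (?i \<sigma> (?i \<tau> s))"])
        (rule \<theta>, rule gr)
    also have "oprod (\<lambda>s. z (?i \<sigma> (?i \<tau> s) mod c) (?v ! s)) ?l = oprod (\<lambda>s. z (?i \<tau> s mod c) (?v ! s)) ?l"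
      using G.C_v[OF \<sigma>'] F.C_lt[OF \<tau>'] by (intro oprod_cong) auto
    also have "oprod (\<lambda>s. \<theta> (?i \<sigma> (?i \<tau> s))) ?l = of_int (sign (?i \<sigma> \<circ> ?i \<tau>)) * oprod \<theta> ?l"
      using oprod_permute_odd[OF permutes_compose[OF F.C_permutes[OF \<tau>'] G.C_permutes[OF \<sigma>']], of ?l \<theta> "\<lambda>_. 1"] \<theta>
      by simp
    also have "sign (?i \<sigma> \<circ> ?i \<tau>) = sign \<sigma> * sign (?i \<tau>)"
      using sign_compose[OF G.C_permutation[OF \<sigma>'] F.C_permutation[OF \<tau>']] sign_inverse[OF G.C_permutation[OF \<sigma>]]
      by simp
    finally have eq: "evw (\<lambda>s b. z (?i \<sigma> (?i \<tau> s) mod c) b * \<theta> (?i \<sigma> (?i \<tau> s))) ?v =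
      (- 1) ^ \<Sum>B * oprod (\<lambda>s. z (?i \<tau> s mod c) (?v ! s)) ?l * (of_int (sign \<sigma> * sign (?i \<tau>)) * oprod \<theta> ?l)" .
    have s1: "sign \<sigma> = 1 \<or> sign \<sigma> = -1" by (cases \<sigma> rule: sign_cases) auto
    have s2: "sign (?i \<tau>) = 1 \<or> sign (?i \<tau>) = -1" by (cases "?i \<tau>" rule: sign_cases) auto
    show "of_int (sign \<sigma>) * evw (\<lambda>s b. z (?i \<sigma> (?i \<tau> s) mod c) b * \<theta> (?i \<sigma> (?i \<tau> s))) ?v =
        (- 1) ^ \<Sum>B * (of_int (sign (?i \<tau>)) * oprod (\<lambda>s. z (?i \<tau> s mod c) (?v ! s)) ?l) * oprod \<theta> ?l"
      unfolding eq using s1 s2 by (auto simp: mult.assoc)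
  qed
  also have "\<dots> = of_nat (card col_group) * (- 1) ^ \<Sum>B *
      (\<Sum>\<tau>\<in>row_group. of_int (sign (?i \<tau>)) * oprod (\<lambda>s. z (?i \<tau> s mod c) (?v ! s)) ?l) * oprod \<theta> ?l"
    by (simp add: sum_distrib_left sum_distrib_right mult.assoc)
  also have "(\<Sum>\<tau>\<in>row_group. of_int (sign (?i \<tau>)) * oprod (\<lambda>s. z (?i \<tau> s mod c) (?v ! s)) ?l) =
      (\<Sum>\<tau>\<in>row_group. of_int (sign \<tau>) * oprod (\<lambda>s. z (\<tau> s mod c) (?v ! s)) ?l)"
    by (rule sum.reindex_bij_betw[OF F.bij_C_inv])
  also have "\<dots> = (\<Sum>\<tau>\<in>row_group. of_int (sign \<tau>) *
      oprod (\<lambda>s. (\<lambda>k s. z k (Cov (\<psi> (s div c, s mod c)))) (\<tau> s mod c) s) ?l)"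
    by (intro sum.cong refl arg_cong[where f = "(*) _"] oprod_cong) (simp only: nth)
  also have "\<dots> = of_geven (F.D W) *
    of_nat (card {\<tau> \<in> row_group. \<forall>s<?l. s \<notin> B \<longrightarrow> \<tau> s = s}) *
    oprod (\<lambda>s. if s \<in> B then \<eta> (s mod c) (s div c) else 1) ?l"
    by (subst F.alternating_oprod_odd[OF B odd z]) simp_all
  finally show ?thesis by (simp only: F.D_eq_det)
qed


subsection \<open>The diagonal coefficient of a canonical tensor\<close>

text \<open>Even letters determine their row and odd letters their column. Hence \<tau> \<sigma>
  returns the word to itself only if \<sigma> fixes the even boxes and \<tau> the odd ones; the sign
  from permuting odd letters then cancels \<open>sign \<sigma>\<close>, and each such pair
  contributes 1.\<close>

lemma young_coefficient:
  assumes B: "B = {s. s < r * c \<and> is_odd (\<phi> (s div c, s mod c))}"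
    and canonical: "\<And>s. s < r * c \<Longrightarrow> \<phi> (s div c, s mod c) = (if s \<in> B then Od (s mod c) else Ev (s div c))"
  defines "w \<equiv> map (\<lambda>x. Vec (\<phi> x)) (boxes (replicate r c))"
  shows "tcoeff (young_left (replicate r c) (tword w) :: 'k::field_char_0 tensor) w =
    of_nat (card {\<sigma> \<in> col_group. \<forall>s<r * c. s \<notin> B \<longrightarrow> \<sigma> s = s} *
      card {\<tau> \<in> row_group. \<forall>s<r * c. s \<in> B \<longrightarrow> \<tau> s = s})" (is "?t = of_nat (card ?C * card ?R)")
proof -
  let ?l = "r * c"
  have len: "length w = ?l" by (simp add: w_def boxes_replicate)
  have nth: "w ! s = Vec (if s \<in> B then Od (s mod c) else Ev (s div c))" if "s < ?l" for s
    using that canonical[of s] by (simp add: w_def boxes_replicate)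
  have w: "tlen ?l (tword w :: 'k tensor)" using tlen_tword[of w] len by simp
  obtain N where N: "?t - of_nat (card ?C * card ?R) \<in> G_sub {..<N}" using G_sub_bound by blast
  \<comment> \<open>Even slots receive the value 1, so the value is the same whichever even boxes
    \<tau> permutes.\<close>
  define S where "S s = (if s \<in> B then {|N + s|} else {||})" for s
  define z :: "nat \<Rightarrow> 'k grassmann" where "z s = gmono (S s)" for s
  define \<psi> where "\<psi> = (\<lambda>s b. if s < ?l \<and> b = w ! s then z s else 0)"
  have zB: "z s \<in> G_grade (of_bool (s \<in> B))" for s
    by (auto simp: z_def S_def gmono_grade fcard.rep_eq)
  have "\<psi> s b \<in> G_grade (of_bool (letter_odd b))" for s b
    using zB[of s] by (cases "s < ?l \<and> b = w ! s") (auto simp: \<psi>_def nth)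
  then have "graded \<psi>" by (simp add: graded_def)
  have key: "evw (\<lambda>s. \<psi> (\<tau> (\<sigma> s))) w = (if \<sigma> \<in> ?C \<and> \<tau> \<in> ?R then of_int (sign \<sigma>) * oprod z ?l else 0)"
    if \<sigma>: "\<sigma> \<in> col_group" and \<tau>: "\<tau> \<in> row_group" for \<sigma> \<tau>
  proof -
    have lt: "\<sigma> s < ?l" "\<tau> (\<sigma> s) < ?l" "\<tau> s < ?l" if "s < ?l" for s
      using that G.C_lt[OF \<sigma>] F.C_lt[OF \<tau>] by auto
    show ?thesis
    proof (cases "\<forall>s<?l. w ! s = w ! \<tau> (\<sigma> s)")
      case False
      then obtain s where s: "s < ?l" "w ! s \<noteq> w ! \<tau> (\<sigma> s)" by blast
      then have 0: "evw (\<lambda>s. \<psi> (\<tau> (\<sigma> s))) w = 0"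
        unfolding evw_def len by (intro oprod_zero[of _ s]) (simp_all add: \<psi>_def)
      have "\<not> (\<sigma> \<in> ?C \<and> \<tau> \<in> ?R)"
      proof
        assume *: "\<sigma> \<in> ?C \<and> \<tau> \<in> ?R"
        have "w ! s = w ! \<tau> (\<sigma> s)"
        proof (cases "s \<in> B")
          case True
          have "\<sigma> s \<in> B"
          proof (rule ccontr)
            assume "\<sigma> s \<notin> B"
            with * s(1) lt have "\<sigma> (\<sigma> s) = \<sigma> s" by auto
            then have "\<sigma> s = s" using permutes_inj[OF G.C_permutes[OF \<sigma>]] by (metis injD)
            with True \<open>\<sigma> s \<notin> B\<close> show False by simp
          qed
          with * s(1) lt have "\<tau> (\<sigma> s) = \<sigma> s" by auto
          then show ?thesis using True \<open>\<sigma> s \<in> B\<close> s(1) lt G.C_v[OF \<sigma> s(1)] by (simp add: nth)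
        next
          case False
          with * s(1) have "\<sigma> s = s" by auto
          moreover have "\<tau> s \<notin> B"
          proof
            assume "\<tau> s \<in> B"
            with * s(1) lt have "\<tau> (\<tau> s) = \<tau> s" by auto
            then have "\<tau> s = s" using permutes_inj[OF F.C_permutes[OF \<tau>]] by (metis injD)
            with False \<open>\<tau> s \<in> B\<close> show False by simp
          qed
          ultimately show ?thesis using False s(1) lt F.C_v[OF \<tau> s(1)] by (simp add: nth)
        qed
        with s show False by simp
      qed
      with 0 show ?thesis by (simp only: if_False)
    next
      case True
      \<comment> \<open>The even letter fixes the row of \<tau> (\<sigma> s), which is that of
        \<sigma> s; as \<sigma> keeps the column, \<sigma> s = s.\<close>
      have even: "\<sigma> s = s" "\<tau> s \<notin> B" if "s < ?l" "s \<notin> B" for s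
      proof -
        have "w ! s = w ! \<tau> (\<sigma> s)" using True that by blast
        then have *: "\<tau> (\<sigma> s) \<notin> B" "s div c = \<tau> (\<sigma> s) div c"
          using that lt[OF that(1)] by (auto simp: nth split: if_splits)
        then have "\<sigma> s div c = s div c" using F.C_v[OF \<tau> lt(1)[OF that(1)]] by simp
        then show "\<sigma> s = s"
          using G.coord_inject[OF lt(1)[OF that(1)] that(1)] G.C_v[OF \<sigma> that(1)] by blast
        with * show "\<tau> s \<notin> B" by simp
      qed
      have "\<sigma> permutes B"
      proof (rule permutes_superset[OF G.C_permutes[OF \<sigma>]])
        fix s assume "s \<in> {..<?l} - B"
        then show "\<sigma> s = s" using even by auto
      qed
      \<comment> \<open>The odd letter fixes the column of \<tau> s, and \<tau> keeps the
        row.\<close>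
      have odd: "\<tau> s = s" if "s \<in> B" for s
      proof -
        obtain t where t: "t \<in> B" "\<sigma> t = s"
          using permutes_image[OF \<open>\<sigma> permutes B\<close>] \<open>s \<in> B\<close> by (metis imageE)
        then have tl: "t < ?l" by (simp add: B)
        have "w ! t = w ! \<tau> (\<sigma> t)" using True tl by blast
        then have "t mod c = \<tau> s mod c"
          using t tl lt[OF tl] by (auto simp: nth split: if_splits)
        moreover have "t mod c = s mod c" using G.C_v[OF \<sigma> tl] t by simp
        moreover have "s < ?l" using lt(1)[OF tl] t by simp
        ultimately show ?thesis
          using G.coord_inject[of "\<tau> s" s] F.C_v[OF \<tau>, of s] lt(3)[of s] by simp
      qed
      have CR: "\<sigma> \<in> ?C \<and> \<tau> \<in> ?R" using even odd \<sigma> \<tau> by auto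
      have "evw (\<lambda>s. \<psi> (\<tau> (\<sigma> s))) w = oprod (\<lambda>s. z (\<sigma> s)) ?l"
        unfolding evw_def len
      proof (rule oprod_cong[OF refl])
        fix s assume s: "s < ?l"
        have "z (\<tau> (\<sigma> s)) = z (\<sigma> s)"
        proof (cases "s \<in> B")
          case True
          then have "\<sigma> s \<in> B" using permutes_in_image[OF \<open>\<sigma> permutes B\<close>] by blast
          then show ?thesis using odd by simp
        next
          case False
          then show ?thesis using even[OF s] by (simp add: z_def S_def)
        qed
        then show "\<psi> (\<tau> (\<sigma> s)) (w ! s) = z (\<sigma> s)" using True s lt[OF s] by (simp add: \<psi>_def)
      qed
      also have "\<dots> = of_int (sign \<sigma>) * oprod z ?l"
      proof (rule oprod_permute_odd[OF \<open>\<sigma> permutes B\<close> _ _ zB])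
        show "B \<subseteq> {..<?l}" by (auto simp: B)
        show "z s \<in> G_grade 1" if "s \<in> B" for s using zB[of s] that by simp
      qed
      finally show ?thesis using CR by (simp only: if_True simp_thms)
    qed
  qed
  have "ev \<psi> (young_left (replicate r c) (tword w)) = oprod z ?l * ?t"
  proof -
    have "ev \<psi> (young_left (replicate r c) (tword w)) =
        ev (\<lambda>s b. if b = w ! s then z s else 0) (young_left (replicate r c) (tword w))"
      by (rule ev_cong[OF tlen_young_left[OF w]]) (simp add: \<psi>_def)
    also have "\<dots> = oprod z ?l * ?t"
      using ev_dual_word[of w "young_left (replicate r c) (tword w)" z] tlen_young_left[OF w] len by simp
    finally show ?thesis .
  qed
  moreover have "ev \<psi> (young_left (replicate r c) (tword w)) = of_nat (card ?C * card ?R) * oprod z ?l"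
  proof -
    have "ev \<psi> (young_left (replicate r c) (tword w)) =
        (\<Sum>\<sigma>\<in>col_group. \<Sum>\<tau>\<in>row_group. of_int (sign \<sigma>) * evw (\<lambda>s. \<psi> (\<tau> (\<sigma> s))) w)"
      by (simp add: ev_young_left[OF \<open>graded \<psi>\<close> w] ev_tword)
    also have "\<dots> = (\<Sum>\<sigma>\<in>col_group. \<Sum>\<tau>\<in>row_group. if \<sigma> \<in> ?C \<and> \<tau> \<in> ?R then oprod z ?l else 0)"
    proof (intro sum.cong refl)
      fix \<sigma> \<tau> assume *: "\<sigma> \<in> col_group" "\<tau> \<in> row_group"
      show "of_int (sign \<sigma>) * evw (\<lambda>s. \<psi> (\<tau> (\<sigma> s))) w = (if \<sigma> \<in> ?C \<and> \<tau> \<in> ?R then oprod z ?l else 0)"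
        unfolding key[OF *]
        by (simp only: if_distrib[of "(*) _"] mult.assoc[symmetric] of_int_mult[symmetric]
            sign_idempotent of_int_1 mult_1 mult_zero_right)
    qed
    also have "\<dots> = of_nat (card ?C * card ?R) * oprod z ?l"
      by (rule sum_sum_restrict[OF G.finite_C F.finite_C]) auto
    finally show ?thesis .
  qed
  ultimately have "oprod z ?l * (?t - of_nat (card ?C * card ?R)) = 0"
    by (simp only: right_diff_distrib mult_of_nat_commute diff_self)
  then have "oprod (\<lambda>s. gmono (S s) * gmono {||}) ?l * (?t - of_nat (card ?C * card ?R)) = 0"
    by (simp add: z_def)
  then have "?t - of_nat (card ?C * card ?R) = 0"
    by (rule oprod_gmono_mult_eq_zero[OF _ N]) (auto simp: S_def)
  then show ?thesis by simp
qed

end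

section \<open>The pairing\<close>

lemma card_decreasing_pairs:
  fixes A :: "nat set"
  assumes "finite A"
  shows "card {(i, j). j < i \<and> i \<in> A \<and> j \<in> A} = card A choose 2"
  using assms
proof (induction A rule: finite_linorder_max_induct)
  case (insert b A)
  have "{(i, j). j < i \<and> i \<in> insert b A \<and> j \<in> insert b A} = {(i, j). j < i \<and> i \<in> A \<and> j \<in> A} \<union> Pair b ` A"
    using insert by (auto simp: image_iff)
  moreover have "finite {(i, j). j < i \<and> i \<in> A \<and> j \<in> A}"
    by (rule finite_subset[of _ "A \<times> A"]) (use insert in auto)
  moreover have "{(i, j). j < i \<and> i \<in> A \<and> j \<in> A} \<inter> Pair b ` A = {}"
    using insert by auto
  moreover have "card (Pair b ` A) = card A" by (simp add: card_image inj_on_def)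
  moreover have "b \<notin> A" using insert by auto
  ultimately show ?case
    using insert by (simp add: card_Un_disjoint numeral_2_eq_2)
qed simp

lemma nodd_eq_card: "nodd w = card {i. i < length w \<and> letter_odd (w ! i)}"
  by (simp add: nodd_def length_filter_conv_card)

lemma letter_pairing_Cov: "letter_pairing (Cov b) c = (if c = Vec b then 1 else 0)"
  by (cases c) auto

text \<open>If all letters match, the pairs of odd elements which change their order correspond to
  all pairs of odd slots.\<close>

lemma word_pairing_Cov:
  "word_pairing (map Cov us) w = (if w = map Vec us then (- 1) ^ (nodd w choose 2) else 0)"
proof (cases "length us = length w")
  case False
  then have "w \<noteq> map Vec us" by auto
  with False show ?thesis by (simp add: word_pairing_def)
next
  case True
  have "prod_list (map2 letter_pairing (map Cov us) w) = (if w = map Vec us then 1 else 0 :: 'a grassmann)"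
    using True by (induction us w rule: list_induct2) (auto simp: letter_pairing_Cov)
  moreover have "card {(i, j). j < i \<and> i < length (map Cov us) \<and> letter_odd (map Cov us ! i) \<and> letter_odd (w ! j)} =
      nodd w choose 2" if "w = map Vec us"
  proof -
    have "letter_odd (map Cov us ! i) = letter_odd (w ! i)" if "i < length w" for i
      using that by (simp add: \<open>w = map Vec us\<close>)
    then have eq': "j < i \<and> i < length (map Cov us) \<and> letter_odd (map Cov us ! i) \<and> letter_odd (w ! j) \<longleftrightarrow>
       j < i \<and> i \<in> {i. i < length w \<and> letter_odd (w ! i)} \<and> j \<in> {i. i < length w \<and> letter_odd (w ! i)}" for i j
      unfolding length_map True mem_Collect_eq by (meson less_trans)
    have eq: "{(i, j). j < i \<and> i < length (map Cov us) \<and> letter_odd (map Cov us ! i) \<and> letter_odd (w ! j)} =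
       {(i, j). j < i \<and> i \<in> {i. i < length w \<and> letter_odd (w ! i)} \<and> j \<in> {i. i < length w \<and> letter_odd (w ! i)}}"
      unfolding eq' ..
    show ?thesis unfolding eq nodd_eq_card by (rule card_decreasing_pairs) simp
  qed
  moreover have "length (map Cov us) = length w" using True by simp
  ultimately show ?thesis
    unfolding word_pairing_def by (cases "w = map Vec us") (simp_all only: refl if_True if_False simp_thms mult_1_right mult_zero_right)
qed

lemma pairing_superset:
  assumes "finite U" "finite W" "tsupp x \<subseteq> U" "tsupp y \<subseteq> W"
  shows "pairing x y = (\<Sum>u\<in>U. \<Sum>w\<in>W. word_pairing u w * (ginvol ^^ nodd w) (tcoeff x u) * tcoeff y w)"
proof -
  have "pairing x y = (\<Sum>u\<in>tsupp x. \<Sum>w\<in>W. word_pairing u w * (ginvol ^^ nodd w) (tcoeff x u) * tcoeff y w)"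
    unfolding pairing_def using assms
    by (intro sum.cong refl sum.mono_neutral_left) (auto simp: tsupp_iff)
  also have "\<dots> = (\<Sum>u\<in>U. \<Sum>w\<in>W. word_pairing u w * (ginvol ^^ nodd w) (tcoeff x u) * tcoeff y w)"
    using assms by (intro sum.mono_neutral_left) (auto simp: tsupp_iff)
  finally show ?thesis .
qed

lemma pairing_add:
  "pairing (x + x') y = pairing x y + pairing x' y"
  "pairing x (y + y') = pairing x y + pairing x y'"
proof -
  have "tsupp (x + x') \<subseteq> tsupp x \<union> tsupp x'" "tsupp (y + y') \<subseteq> tsupp y \<union> tsupp y'"
    by (auto simp: tsupp_iff)
  then show "pairing (x + x') y = pairing x y + pairing x' y" "pairing x (y + y') = pairing x y + pairing x y'"
    by (simp_all add: pairing_superset[of "tsupp x \<union> tsupp x'" "tsupp y \<union> tsupp y'"]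
        distrib_left distrib_right sum.distrib)
qed

lemma pairing_zero: "pairing 0 y = 0" "pairing x 0 = 0"
  using pairing_add[of 0 0 y] pairing_add(2)[of x 0 0] by simp_all

lemma pairing_uminus: "pairing (- x) y = - pairing x y" "pairing x (- y) = - pairing x y"
  using pairing_add(1)[of x "- x" y] pairing_add(2)[of x y "- y"]
  by (simp_all add: pairing_zero eq_neg_iff_add_eq_0 add.commute)

lemma pairing_sum: "pairing (sum f A) y = (\<Sum>a\<in>A. pairing (f a) y)" "pairing x (sum g A) = (\<Sum>a\<in>A. pairing x (g a))"
  by (induction A rule: infinite_finite_induct) (simp_all add: pairing_add pairing_zero)

lemma pairing_of_int: "pairing (of_int k * x) y = of_int k * pairing x y" "pairing x (of_int k * y) = of_int k * pairing x y"
proof -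
  have "pairing (of_nat q * x) y = of_nat q * pairing x y \<and> pairing x (of_nat q * y) = of_nat q * pairing x y" for q
    by (induction q) (simp_all add: distrib_right pairing_add pairing_zero)
  then show "pairing (of_int k * x) y = of_int k * pairing x y" "pairing x (of_int k * y) = of_int k * pairing x y"
    by (cases k rule: int_cases; simp add: pairing_uminus del: of_nat_Suc)+
qed

lemma pairing_sign:
  "pairing ((- 1) ^ q * x) y = (- 1) ^ q * pairing x y" "pairing x ((- 1) ^ q * y) = (- 1) ^ q * pairing x y"
  by (simp_all add: neg_one_power_mult pairing_uminus)

lemma pairing_tword: "pairing (tword u) (tword w * scal a) = word_pairing u w * a"
  by (subst pairing_superset[of "{u}" "{w}"]) (auto simp: tsupp_iff tcoeff_tword tcoeff_tword_scal split: if_splits)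

lemma nodd_permute:
  assumes "\<sigma> permutes {..<length w}"
  shows "nodd (map (\<lambda>k. w ! \<sigma> k) [0..<length w]) = nodd w"
proof -
  have "mset (map (\<lambda>k. w ! \<sigma> k) [0..<length w]) = mset w"
    using mset_permute_list[OF assms] by (simp add: permute_list_def)
  then have "mset (filter letter_odd (map (\<lambda>k. w ! \<sigma> k) [0..<length w])) = mset (filter letter_odd w)"
    by (simp only: mset_filter)
  then show ?thesis unfolding nodd_def by (rule mset_eq_length)
qed

text \<open>When the words match, both actions count the same inversions, and the sign of the
  pairing depends only on the number of odd letters, which a permutation preserves.\<close>

lemma pairing_adjoint:
  assumes "\<sigma> permutes {..<length us}" "tlen (length us) y"
  shows "pairing (perm_right (tword (map Cov us)) \<sigma>) y = pairing (tword (map Cov us)) (perm_left \<sigma> y)"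
proof (induction y rule: tensor_induct)
  case (single w a)
  let ?l = "length us" and ?u = "map Cov us" and ?i = "inv_into UNIV \<sigma>"
  have len: "length w = ?l" using single assms(2) by (simp add: tlen_def)
  have \<sigma>i: "?i permutes {..<?l}" by (rule permutes_inv[OF assms(1)])
  let ?us = "map (\<lambda>k. us ! \<sigma> k) [0..<?l]" and ?w = "map (\<lambda>k. w ! ?i k) [0..<?l]"
  let ?e1 = "card {(i, j). i < j \<and> j < ?l \<and> \<sigma> i > \<sigma> j \<and> letter_odd (?u ! \<sigma> i) \<and> letter_odd (?u ! \<sigma> j)}"
  let ?e2 = "card {(i, j). i < j \<and> j < ?l \<and> \<sigma> i > \<sigma> j \<and> letter_odd (w ! i) \<and> letter_odd (w ! j)}"
  have lt: "\<sigma> k < ?l" "?i k < ?l" if "k < ?l" for k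
    using that permutes_in_image[OF assms(1), of k] permutes_in_image[OF \<sigma>i, of k] by simp_all
  have u': "map (\<lambda>k. ?u ! \<sigma> k) [0..<?l] = map Cov ?us"
    using lt by simp
  have iff: "w = map Vec ?us \<longleftrightarrow> ?w = map Vec us"
  proof
    assume w: "w = map Vec ?us"
    show "?w = map Vec us"
    proof (rule nth_equalityI)
      fix k assume "k < length ?w"
      then have k: "k < ?l" by simp
      then have "?w ! k = w ! ?i k" by simp
      also have "\<dots> = Vec (us ! \<sigma> (?i k))" unfolding w using lt(2)[OF k] by simp
      finally show "?w ! k = map Vec us ! k" using k by (simp add: permutes_inverses[OF assms(1)])
    qed simp
  next
    assume w: "?w = map Vec us"
    show "w = map Vec ?us"
    proof (rule nth_equalityI)
      fix k assume "k < length w"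
      then have k: "k < ?l" by (simp add: len)
      have "?w ! \<sigma> k = Vec (us ! \<sigma> k)" unfolding w using lt(1)[OF k] by simp
      then show "w ! k = map Vec ?us ! k" using k lt(1)[OF k] by (simp add: permutes_inverses[OF assms(1)])
    qed (simp add: len)
  qed
  have nodd: "nodd ?w = nodd w" using nodd_permute[of ?i w] \<sigma>i by (simp add: len)
  have sign: "?e1 = ?e2" if w: "w = map Vec ?us"
  proof -
    have "letter_odd (?u ! \<sigma> k) = letter_odd (w ! k)" if "k < ?l" for k
      unfolding w using that lt by simp
    then have "{(i, j). i < j \<and> j < ?l \<and> \<sigma> i > \<sigma> j \<and> letter_odd (?u ! \<sigma> i) \<and> letter_odd (?u ! \<sigma> j)} =
       {(i, j). i < j \<and> j < ?l \<and> \<sigma> i > \<sigma> j \<and> letter_odd (w ! i) \<and> letter_odd (w ! j)}"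
      by auto
    then show ?thesis by simp
  qed
  have "pairing (perm_right (tword ?u) \<sigma>) (tword w * scal a) = (- 1) ^ ?e1 * (word_pairing (map Cov ?us) w * a)"
    unfolding perm_right_def lin_ext_tword length_map u' pairing_sign pairing_tword ..
  also have "\<dots> = (- 1) ^ ?e2 * (word_pairing ?u ?w * a)"
    unfolding word_pairing_Cov using iff nodd sign by (cases "w = map Vec ?us") simp_all
  also have "\<dots> = pairing (tword ?u) (perm_left \<sigma> (tword w * scal a))"
    unfolding perm_left_def lin_ext_tword_scal len
    using pairing_tword[of ?u ?w a] by (simp only: mult.assoc pairing_sign)
  finally show ?case .
qed (simp_all add: pairing_zero pairing_add perm_left_def lin_ext_add)

lemma pairing_tword_left:
  "pairing (tword (map Cov us)) y = (- 1) ^ (nodd (map Vec us) choose 2) * tcoeff y (map Vec us)"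
proof (induction y rule: tensor_induct)
  case (single w a)
  show ?case by (simp add: pairing_tword word_pairing_Cov tcoeff_tword_scal)
qed (simp_all add: pairing_zero pairing_add distrib_left)

text \<open>By adjointness both symmetrizers are moved to the right hand argument, where their
  product is a multiple of one of them; what remains is the coefficient found in
  \<open>young_coefficient\<close>. The two cardinalities count the column permutations of odd boxes
  and the row permutations of even boxes.\<close>

lemma pairing_canonical:
  fixes r c :: nat
  assumes B: "B = {s. s < r * c \<and> is_odd (\<psi> (s div c, s mod c))}"
    and canonical: "\<And>s. s < r * c \<Longrightarrow> \<psi> (s div c, s mod c) = (if s \<in> B then Od (s mod c) else Ev (s div c))"
  shows "pairing (filling_cotensor (replicate r c) \<psi>) (filling_tensor (replicate r c) \<psi>) =
    of_int (grid.young_const (\<lambda>s. s div c) (\<lambda>s. s mod c) (r * c)) * ((- 1) ^ (card B choose 2) *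
      (of_nat (card {\<sigma> \<in> grid.C (\<lambda>s. s mod c) (r * c). \<forall>s<r * c. s \<notin> B \<longrightarrow> \<sigma> s = s} *
      card {\<tau> \<in> grid.C (\<lambda>s. s div c) (r * c). \<forall>s<r * c. s \<in> B \<longrightarrow> \<tau> s = s}) :: 'k::field_char_0 grassmann))"
proof -
  interpret G: grid "\<lambda>s. s div c" "\<lambda>s. s mod c" r c "r * c" by (rule grid_rows)
  interpret F: grid "\<lambda>s. s mod c" "\<lambda>s. s div c" c r "r * c" by (rule grid_columns)
  let ?lam = "replicate r c"
  define us where "us = map \<psi> (boxes ?lam)"
  have len: "length us = r * c" by (simp add: us_def boxes_replicate)
  have w: "tlen (r * c) (tword (map Vec us) :: 'k tensor)" using tlen_tword[of "map Vec us"] len by simp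
  have nodd: "nodd (map Vec us) = card B"
    unfolding nodd_eq_card B by (intro arg_cong[where f = card]) (auto simp: us_def boxes_replicate)
  define h :: "'k tensor" where "h = young_left ?lam (tword (map Vec us))"
  have hl: "tlen (r * c) h" unfolding h_def by (rule tlen_young_left[OF w])
  have "pairing (young_right ?lam (tword (map Cov us))) h = pairing (tword (map Cov us)) (young_left ?lam h)"
    unfolding young_right_def young_left_def pairing_sum pairing_of_int column_stabilizer_eq row_stabilizer_eq
  proof (rule sum.cong[OF refl], rule sum.cong[OF refl], rule arg_cong[where f = "(*) _"])
    fix \<sigma> \<tau> assume "\<sigma> \<in> G.C" "\<tau> \<in> F.C"
    then have "\<tau> \<circ> \<sigma> permutes {..<length us}"
      unfolding len by (intro permutes_compose[OF G.C_permutes F.C_permutes])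
    then show "pairing (perm_right (tword (map Cov us)) (\<tau> \<circ> \<sigma>)) h = pairing (tword (map Cov us)) (perm_left (\<tau> \<circ> \<sigma>) h)"
      by (rule pairing_adjoint) (simp add: len hl)
  qed
  also have "\<dots> = of_int G.young_const * pairing (tword (map Cov us)) h"
    unfolding h_def young_left_idempotent[OF w] pairing_of_int ..
  also have "pairing (tword (map Cov us)) h = (- 1) ^ (card B choose 2) * tcoeff h (map Vec us)"
    unfolding pairing_tword_left nodd ..
  also have "tcoeff h (map Vec us) = of_nat (card {\<sigma> \<in> G.C. \<forall>s<r * c. s \<notin> B \<longrightarrow> \<sigma> s = s} *
      card {\<tau> \<in> F.C. \<forall>s<r * c. s \<in> B \<longrightarrow> \<tau> s = s})"
    using young_coefficient[OF B canonical] by (simp add: h_def us_def comp_def)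
  finally show ?thesis
    by (simp add: filling_cotensor_def filling_tensor_def h_def us_def comp_def)
qed


section \<open>Polarization\<close>

text \<open>Inclusion and exclusion: if some element of \<open>U\<close> lies outside
  \<open>T\<close>, adding or removing it pairs the sets above \<open>T\<close> with opposite
  signs.\<close>

lemma sum_Pow_alternating:
  assumes "finite U" "T \<subseteq> U"
  shows "(\<Sum>S\<in>Pow U. (- 1) ^ card S * of_bool (T \<subseteq> S)) = (if T = U then (- 1) ^ card U else 0 :: 'r::ring_1)"
  using assms
proof (induction U arbitrary: T rule: finite_induct)
  case (insert x U)
  have "(\<Sum>S\<in>Pow (insert x U). (- 1) ^ card S * of_bool (T \<subseteq> S)) =
      (\<Sum>S\<in>Pow U. (- 1) ^ card S * of_bool (T \<subseteq> S)) +
      (\<Sum>S\<in>Pow U. (- 1) ^ card (insert x S) * of_bool (T \<subseteq> insert x S) :: 'r)"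
  proof -
    have "inj_on (insert x) (Pow U)" using insert.hyps by (auto simp: inj_on_def)
    then have "(\<Sum>S\<in>insert x ` Pow U. f S) = (\<Sum>S\<in>Pow U. f (insert x S))" for f :: "'a set \<Rightarrow> 'r"
      by (simp add: sum.reindex)
    moreover have "Pow U \<inter> insert x ` Pow U = {}" using insert.hyps by auto
    ultimately show ?thesis unfolding Pow_insert using insert.hyps by (simp add: sum.union_disjoint del: sum_of_bool_mult_eq sum_mult_of_bool_eq)
  qed
  also have "\<dots> = (\<Sum>S\<in>Pow U. (if x \<in> T then 0 else (- 1) ^ card S * of_bool (T - {x} \<subseteq> S)) -
      (- 1) ^ card S * of_bool (T - {x} \<subseteq> S))"
    unfolding sum.distrib[symmetric]
  proof (rule sum.cong[OF refl])
    fix S assume "S \<in> Pow U"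
    then have "x \<notin> S" "finite S" using insert.hyps finite_subset by auto
    then have card: "card (insert x S) = Suc (card S)" by simp
    have 1: "T \<subseteq> insert x S \<longleftrightarrow> T - {x} \<subseteq> S" by auto
    have 2: "T \<subseteq> S \<longleftrightarrow> x \<notin> T \<and> T - {x} \<subseteq> S" using \<open>x \<notin> S\<close> by auto
    show "(- 1) ^ card S * of_bool (T \<subseteq> S) + (- 1) ^ card (insert x S) * of_bool (T \<subseteq> insert x S) =
        (if x \<in> T then 0 else (- 1) ^ card S * of_bool (T - {x} \<subseteq> S)) - (- 1 :: 'r) ^ card S * of_bool (T - {x} \<subseteq> S)"
      unfolding card 1 2 by (cases "x \<in> T"; cases "T - {x} \<subseteq> S") (simp_all only: of_bool_def power_Suc, simp_all)
  qed
  also have "\<dots> = (if x \<in> T then - (\<Sum>S\<in>Pow U. (- 1) ^ card S * of_bool (T - {x} \<subseteq> S)) else 0)"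
    by (simp add: sum_negf)
  also have "(\<Sum>S\<in>Pow U. (- 1) ^ card S * of_bool (T - {x} \<subseteq> S)) = (if T - {x} = U then (- 1) ^ card U else 0 :: 'r)"
    using insert.prems by (intro insert.IH) auto
  also have "(if x \<in> T then - (if T - {x} = U then (- 1) ^ card U else 0 :: 'r) else 0) =
      (if T = insert x U then (- 1) ^ card (insert x U) else 0)"
    using insert.hyps insert.prems by auto
  finally show ?case .
qed auto

lemma of_nat_mult_eq_zero:
  fixes a :: "'k::field_char_0 grassmann"
  assumes "of_nat q * a = 0" "q > 0"
  shows "a = 0"
proof (rule grassmann_eqI)
  fix S
  have "gcoeff (gconst (of_nat q) * a) S = 0" using assms by (simp add: gconst_of_nat)
  then show "gcoeff a S = gcoeff 0 S" using assms(2) by (simp add: gconst_mult_coeff)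
qed

text \<open>A symmetric multilinear function is recovered from its values on the diagonal by
  inclusion and exclusion. A fixed base point may be added to the diagonal.\<close>

lemma polarization:
  fixes M :: "(nat \<Rightarrow> letter \<Rightarrow> 'k::field_char_0 grassmann) \<Rightarrow> 'k grassmann"
  assumes multilinear: "\<And>(A :: nat set) \<chi>. finite A \<Longrightarrow>
      M (\<lambda>s b. \<Sum>a\<in>A. \<chi> s a b) = (\<Sum>g\<in>{..<N} \<rightarrow>\<^sub>E A. M (\<lambda>s. \<chi> s (g s)))"
    and zero: "\<And>\<chi> s. s < N \<Longrightarrow> (\<And>b. \<chi> s b = 0) \<Longrightarrow> M \<chi> = 0"
    and cong: "\<And>\<chi> \<chi>'. (\<And>s. s < N \<Longrightarrow> \<chi> s = \<chi>' s) \<Longrightarrow> M \<chi> = M \<chi>'"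
    and symmetric: "\<And>\<pi>. \<pi> permutes {..<N} \<Longrightarrow> (\<And>s. s < N \<Longrightarrow> blk (\<pi> s) = blk s) \<Longrightarrow> M (\<lambda>s. \<psi> (\<pi> s)) = M \<psi>"
    and diagonal: "\<And>z. (\<And>k b. z k b - base k b \<in> I b) \<Longrightarrow> M (\<lambda>s. z (blk s)) = 0"
    and I: "\<And>b. 0 \<in> I b" "\<And>b x y. x \<in> I b \<Longrightarrow> y \<in> I b \<Longrightarrow> x + y \<in> I b"
    and \<psi>: "\<And>s b. \<psi> s b \<in> I b"
  shows "M \<psi> = 0"
proof -
  let ?U = "{..<N}"
  define \<chi> where "\<chi> = (\<lambda>s r b. if r = N then base (blk s) b else if blk r = blk s then \<psi> r b else 0)"
  \<comment> \<open>The points which \<open>g\<close> uses, apart from the base point.\<close>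
  define T where "T g = g ` ?U - {N}" for g :: "nat \<Rightarrow> nat"
  have *: "(\<Sum>g\<in>?U \<rightarrow>\<^sub>E {..N}. of_bool (T g \<subseteq> S) * M (\<lambda>s. \<chi> s (g s))) = 0" if S: "S \<subseteq> ?U" for S
  proof -
    have fin: "finite S" using S finite_subset by blast
    define z where "z k b = base k b + (\<Sum>r\<in>S. if blk r = k then \<psi> r b else 0)" for k b
    have sum_I: "(\<Sum>r\<in>S. if blk r = k then \<psi> r b else 0) \<in> I b" for k b
      using fin by (induction S) (auto intro: I \<psi>)
    have "M (\<lambda>s. z (blk s)) = 0" by (rule diagonal) (simp add: z_def sum_I)
    moreover have "(\<lambda>s. z (blk s)) = (\<lambda>s b. \<Sum>r\<in>insert N S. \<chi> s r b)"
    proof (intro ext)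
      fix s b
      have "N \<notin> S" using S by auto
      then have "(\<Sum>r\<in>S. if blk r = blk s then \<psi> r b else 0) = (\<Sum>r\<in>S. \<chi> s r b)"
        by (intro sum.cong) (auto simp: \<chi>_def)
      then show "z (blk s) b = (\<Sum>r\<in>insert N S. \<chi> s r b)"
        using fin \<open>N \<notin> S\<close> by (simp add: z_def) (simp add: \<chi>_def)
    qed
    ultimately have "(\<Sum>g\<in>?U \<rightarrow>\<^sub>E insert N S. M (\<lambda>s. \<chi> s (g s))) = 0"
      using multilinear[of "insert N S" \<chi>] fin by simp
    moreover have "(\<Sum>g\<in>?U \<rightarrow>\<^sub>E {..N}. of_bool (T g \<subseteq> S) * M (\<lambda>s. \<chi> s (g s))) =
        (\<Sum>g\<in>?U \<rightarrow>\<^sub>E insert N S. M (\<lambda>s. \<chi> s (g s)))"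
    proof (rule sum.mono_neutral_cong_right)
      show "?U \<rightarrow>\<^sub>E insert N S \<subseteq> ?U \<rightarrow>\<^sub>E {..N}" using S by (intro PiE_mono) auto
      show "\<forall>g\<in>(?U \<rightarrow>\<^sub>E {..N}) - (?U \<rightarrow>\<^sub>E insert N S). of_bool (T g \<subseteq> S) * M (\<lambda>s. \<chi> s (g s)) = 0"
        by (auto simp: T_def PiE_def Pi_def image_subset_iff)
      fix g assume "g \<in> ?U \<rightarrow>\<^sub>E insert N S"
      then have "T g \<subseteq> S" by (auto simp: T_def)
      then show "of_bool (T g \<subseteq> S) * M (\<lambda>s. \<chi> s (g s)) = M (\<lambda>s. \<chi> s (g s))" by simp
    qed (auto intro: finite_PiE)
    ultimately show ?thesis by simp
  qed
  have "0 = (\<Sum>S\<in>Pow ?U. (- 1) ^ card S * (\<Sum>g\<in>?U \<rightarrow>\<^sub>E {..N}. of_bool (T g \<subseteq> S) * M (\<lambda>s. \<chi> s (g s))))"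
    using * by simp
  also have "\<dots> = (\<Sum>g\<in>?U \<rightarrow>\<^sub>E {..N}. (\<Sum>S\<in>Pow ?U. (- 1) ^ card S * of_bool (T g \<subseteq> S)) * M (\<lambda>s. \<chi> s (g s)))"
    unfolding sum_distrib_left sum_distrib_right mult.assoc[symmetric] by (rule sum.swap)
  also have "\<dots> = (\<Sum>g\<in>?U \<rightarrow>\<^sub>E {..N}. if T g = ?U then (- 1) ^ N * M (\<lambda>s. \<chi> s (g s)) else 0)"
  proof (rule sum.cong[OF refl])
    fix g assume "g \<in> ?U \<rightarrow>\<^sub>E {..N}"
    then have "g ` ?U \<subseteq> {..N}" by blast
    then have "T g \<subseteq> {..N} - {N}" unfolding T_def by blast
    then have "T g \<subseteq> ?U" by auto
    then show "(\<Sum>S\<in>Pow ?U. (- 1) ^ card S * of_bool (T g \<subseteq> S)) * M (\<lambda>s. \<chi> s (g s)) =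
        (if T g = ?U then (- 1) ^ N * M (\<lambda>s. \<chi> s (g s)) else 0)"
      using sum_Pow_alternating[of ?U "T g", where 'r = "'k grassmann"] by simp
  qed
  \<comment> \<open>If all \<open>N\<close> points occur in \<open>N\<close> slots, each occurs once
    and the base point does not occur. Such a permutation either respects the blocks, and symmetry
    gives \<open>M \<psi>\<close>, or has a zero slot.\<close>
  also have "\<dots> = (\<Sum>g\<in>?U \<rightarrow>\<^sub>E {..N}. of_bool (T g = ?U \<and> (\<forall>s<N. blk (g s) = blk s)) * ((- 1) ^ N * M \<psi>))"
  proof (rule sum.cong[OF refl])
    fix g assume g: "g \<in> ?U \<rightarrow>\<^sub>E {..N}"
    show "(if T g = ?U then (- 1) ^ N * M (\<lambda>s. \<chi> s (g s)) else 0) =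
        of_bool (T g = ?U \<and> (\<forall>s<N. blk (g s) = blk s)) * ((- 1) ^ N * M \<psi>)"
    proof (cases "T g = ?U")
      case True
      have sub: "?U \<subseteq> g ` ?U" using True by (auto simp: T_def)
      then have "g ` ?U = ?U" by (metis card_image_le card_seteq finite_imageI finite_lessThan)
      then have "inj_on g ?U" by (simp add: eq_card_imp_inj_on)
      have g_lt: "g s < N" if "s < N" for s using \<open>g ` ?U = ?U\<close> that by blast
      show ?thesis
      proof (cases "\<forall>s<N. blk (g s) = blk s")
        case blk: True
        define \<pi> where "\<pi> s = (if s < N then g s else s)" for s
        have "bij_betw \<pi> ?U ?U"
          using \<open>inj_on g ?U\<close> \<open>g ` ?U = ?U\<close> by (auto simp: bij_betw_def \<pi>_def inj_on_def image_def)
        then have "\<pi> permutes ?U" by (rule bij_imp_permutes) (simp add: \<pi>_def)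
        then have "M (\<lambda>s. \<psi> (\<pi> s)) = M \<psi>" by (rule symmetric) (simp add: \<pi>_def blk)
        moreover have "M (\<lambda>s. \<chi> s (g s)) = M (\<lambda>s. \<psi> (\<pi> s))"
        proof (rule cong)
          fix s assume s: "s < N"
          then show "\<chi> s (g s) = \<psi> (\<pi> s)" using g_lt[OF s] blk by (auto simp: \<chi>_def \<pi>_def fun_eq_iff)
        qed
        ultimately show ?thesis using True blk by simp
      next
        case False
        then obtain s where s: "s < N" "blk (g s) \<noteq> blk s" by blast
        then have "M (\<lambda>s. \<chi> s (g s)) = 0"
          using g_lt[OF s(1)] by (intro zero[of s]) (auto simp: \<chi>_def)
        with False show ?thesis by auto
      qed
    qed simp
  qed
  also have "\<dots> = of_nat (card {g \<in> ?U \<rightarrow>\<^sub>E {..N}. T g = ?U \<and> (\<forall>s<N. blk (g s) = blk s)}) * ((- 1) ^ N * M \<psi>)"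
    by (simp add: sum_distrib_right[symmetric] of_bool_def sum.If_cases finite_PiE Int_def)
  finally have "of_nat (card {g \<in> ?U \<rightarrow>\<^sub>E {..N}. T g = ?U \<and> (\<forall>s<N. blk (g s) = blk s)}) * ((- 1) ^ N * M \<psi>) = 0"
    by simp
  \<comment> \<open>The number of permutations respecting the blocks is positive because the
    identity is one of them.\<close>
  then have "(- 1) ^ N * M \<psi> = 0"
  proof (rule of_nat_mult_eq_zero)
    have "restrict id ?U \<in> {g \<in> ?U \<rightarrow>\<^sub>E {..N}. T g = ?U \<and> (\<forall>s<N. blk (g s) = blk s)}"
      by (auto simp: T_def image_def)
    moreover have "finite {g \<in> ?U \<rightarrow>\<^sub>E {..N}. T g = ?U \<and> (\<forall>s<N. blk (g s) = blk s)}"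
      by (rule finite_subset[of _ "?U \<rightarrow>\<^sub>E {..N}"]) (auto intro: finite_PiE)
    ultimately show "0 < card {g \<in> ?U \<rightarrow>\<^sub>E {..N}. T g = ?U \<and> (\<forall>s<N. blk (g s) = blk s)}"
      unfolding card_gt_0_iff by blast
  qed
  then show ?thesis by (simp add: neg_one_power_mult split: if_splits)
qed

section \<open>Evaluation of mixed tensors\<close>

text \<open>In the covariant slots the parities of the coordinates \<open>y\<close> are reversed; the odd parameters
  \<open>\<theta>\<close>, one for each slot, restore the parity of the value.\<close>

definition EV :: "nat \<Rightarrow> (nat \<Rightarrow> letter \<Rightarrow> 'k grassmann) \<Rightarrow> (nat \<Rightarrow> letter \<Rightarrow> 'k grassmann) \<Rightarrow>
    (nat \<Rightarrow> 'k grassmann) \<Rightarrow> 'k tensor \<Rightarrow> 'k::comm_ring_1 grassmann"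
  where "EV p x y \<theta> = ev (\<lambda>s b. if s < p then x s b else y (s - p) b * \<theta> (s - p))"

definition cograded :: "(nat \<Rightarrow> letter \<Rightarrow> 'k::comm_ring_1 grassmann) \<Rightarrow> bool"
  where "cograded y \<longleftrightarrow> (\<forall>s c. y s c \<in> G_grade (of_bool (\<not> letter_odd c)))"

definition odd_params :: "(nat \<Rightarrow> 'k::comm_ring_1 grassmann) \<Rightarrow> bool"
  where "odd_params \<theta> \<longleftrightarrow> (\<forall>s. \<theta> s \<in> G_grade 1)"

lemma graded_cograded_mult:
  assumes "cograded y" "odd_params \<theta>"
  shows "graded (\<lambda>s b. y s b * \<theta> s)"
  unfolding graded_def
proof (intro allI)
  fix s b
  have "y s b * \<theta> s \<in> G_grade (of_bool (\<not> letter_odd b) + 1)"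
    using assms by (intro G_grade_mult) (simp_all add: cograded_def odd_params_def)
  then show "y s b * \<theta> s \<in> G_grade (of_bool (letter_odd b))"
    using G_grade_parity[of "of_bool (\<not> letter_odd b) + 1" "of_bool (letter_odd b)"] by (cases "letter_odd b") auto
qed

lemma graded_point:
  assumes "graded x" "cograded y" "odd_params \<theta>"
  shows "graded (\<lambda>s b. if s < p then x s b else y (s - p) b * \<theta> (s - p))"
  using assms(1) graded_cograded_mult[OF assms(2,3)] by (auto simp: graded_def)

lemma EV_mult:
  assumes "graded x" "cograded y" "odd_params \<theta>" and X: "tlen p X"
  shows "EV p x y \<theta> (X * Y) = ev x X * ev (\<lambda>s b. y s b * \<theta> s) Y"
  unfolding EV_def ev_mult[OF graded_point[OF assms(1-3)] X]
  by (intro arg_cong2[where f = "(*)"] ev_cong[OF X]) simp_all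


lemma EV_diff: "EV p x y \<theta> (t - t') = EV p x y \<theta> t - EV p x y \<theta> t'"
  by (simp add: EV_def ev_diff)

lemma EV_sum: "EV p x y \<theta> (sum f A) = (\<Sum>a\<in>A. EV p x y \<theta> (f a))"
  by (simp add: EV_def ev_sum)

lemma EV_scal_mult:
  assumes "graded x" "cograded y" "odd_params \<theta>"
  shows "EV p x y \<theta> (scal a * t) = a * EV p x y \<theta> t"
  unfolding EV_def by (rule ev_scal_mult[OF graded_point[OF assms]])

lemma EV_eq:
  assumes "tlen (p + q) t"
  shows "EV p x y \<theta> t = (\<Sum>w\<in>tsupp t. oprod (\<lambda>s. x s (w ! s)) p *
    oprod (\<lambda>s. y s (w ! (p + s)) * \<theta> s) q * tcoeff t w)"
  unfolding EV_def ev_def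
proof (intro sum.cong refl arg_cong2[where f = "(*)"])
  fix w assume "w \<in> tsupp t"
  then have "length w = p + q" using assms by (simp add: tlen_def)
  then have "evw (\<lambda>s b. if s < p then x s b else y (s - p) b * \<theta> (s - p)) w =
      oprod (\<lambda>s. if s < p then x s (w ! s) else y (s - p) (w ! s) * \<theta> (s - p)) p *
      oprod (\<lambda>s. if p + s < p then x (p + s) (w ! (p + s)) else y (p + s - p) (w ! (p + s)) * \<theta> (p + s - p)) q"
    by (simp only: evw_def oprod_add)
  also have "oprod (\<lambda>s. if s < p then x s (w ! s) else y (s - p) (w ! s) * \<theta> (s - p)) p = oprod (\<lambda>s. x s (w ! s)) p"
    by (rule oprod_cong) simp_all
  also have "oprod (\<lambda>s. if p + s < p then x (p + s) (w ! (p + s)) else y (p + s - p) (w ! (p + s)) * \<theta> (p + s - p)) q =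
      oprod (\<lambda>s. y s (w ! (p + s)) * \<theta> s) q"
    by (rule oprod_cong) simp_all
  finally show "evw (\<lambda>s b. if s < p then x s b else y (s - p) b * \<theta> (s - p)) w =
      oprod (\<lambda>s. x s (w ! s)) p * oprod (\<lambda>s. y s (w ! (p + s)) * \<theta> s) q" .
qed

lemma mult_of_int_left_commute: "x * (of_int k * y) = of_int k * (x * y :: 'r::ring_1)"
  by (metis mult.assoc mult_of_int_commute)

text \<open>The odd parameters can be collected on the right in the order of their slots, with a
  sign depending only on the word; permuting them changes only this product.\<close>

lemma EV_permute_params:
  fixes t :: "'k::field_char_0 tensor"
  assumes y: "cograded y" and \<theta>: "odd_params \<theta>" and t: "tlen (p + q) t" and \<pi>: "\<pi> permutes {..<q}"
  shows "EV p x y (\<lambda>s. \<theta> (\<pi> s)) t = of_int (sign \<pi>) * EV p x y \<theta> t"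
proof -
  have "oprod (\<lambda>s. y s (w ! (p + s)) * \<theta> (\<pi> s)) q = of_int (sign \<pi>) * oprod (\<lambda>s. y s (w ! (p + s)) * \<theta> s) q"
    if "length w = p + q" for w
  proof -
    have nth: "drop p w ! s = w ! (p + s)" for s using that by simp
    have pull: "oprod (\<lambda>s. y s (w ! (p + s)) * \<theta>' s) q =
        (- 1) ^ (\<Sum>s<q. if letter_odd (drop p w ! s) then 0 else s) * oprod (\<lambda>s. y s (drop p w ! s)) q * oprod \<theta>' q"
      if "\<And>s. \<theta>' s \<in> G_grade 1" for \<theta>'
      unfolding nth[symmetric] using that y by (intro evw_pull_out) (simp_all add: cograded_def)
    have "oprod (\<lambda>s. \<theta> (\<pi> s)) q = of_int (sign \<pi>) * oprod \<theta> q"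
      using \<theta> by (intro oprod_permute_odd[OF \<pi>, where d = "\<lambda>_. 1"]) (simp_all add: odd_params_def)
    then show ?thesis
      using \<theta> by (simp add: pull odd_params_def mult_of_int_left_commute mult.assoc)
  qed
  then have "oprod (\<lambda>s. x s (w ! s)) p * oprod (\<lambda>s. y s (w ! (p + s)) * \<theta> (\<pi> s)) q * tcoeff t w =
     of_int (sign \<pi>) * (oprod (\<lambda>s. x s (w ! s)) p * oprod (\<lambda>s. y s (w ! (p + s)) * \<theta> s) q * tcoeff t w)"
    if "w \<in> tsupp t" for w
    using t that by (simp add: tlen_def mult_of_int_left_commute mult.assoc)
  then show ?thesis
    unfolding EV_eq[OF t] by (simp add: sum_distrib_left)
qed


section \<open>Points transformed by the general linear group\<close>

context
  notes One_nat_def [simp del]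
begin

text \<open>The pulled back coordinates as a row vector times the matrix of \<A>; in the covariant
  case, \<open>act_y\<close>, the inverse matrix times a column. The value 0 on all other letters
  keeps the point graded, and such letters do not occur in the corresponding slots of mixed
  tensors.\<close>

definition act_x :: "nat \<Rightarrow> nat \<Rightarrow> ('k tensor \<Rightarrow> 'k tensor) \<Rightarrow> (letter \<Rightarrow> 'k grassmann) \<Rightarrow> letter \<Rightarrow> 'k::comm_ring_1 grassmann"
  where "act_x m n \<A> f b = (case b of
      Vec c \<Rightarrow> if c \<in> Omega m n then \<Sum>i<m + n. f (Vec (theta m i)) * matrix_of m n \<A> $$ (i, theta_index m c) else 0
    | Cov c \<Rightarrow> 0)"

definition act_y :: "nat \<Rightarrow> nat \<Rightarrow> ('k tensor \<Rightarrow> 'k tensor) \<Rightarrow> (letter \<Rightarrow> 'k grassmann) \<Rightarrow> letter \<Rightarrow> 'k::comm_ring_1 grassmann"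
  where "act_y m n \<A> f b = (case b of
      Vec c \<Rightarrow> 0
    | Cov c \<Rightarrow> if c \<in> Omega m n then \<Sum>j<m + n. mat_inv (matrix_of m n \<A>) $$ (theta_index m c, j) * f (Cov (theta m j)) else 0)"

lemma EV_GL_act:
  assumes \<A>: "\<A> \<in> GL m n" and t: "t \<in> mixed_tensors m n p q"
    and xy: "graded x" "cograded y" "odd_params \<theta>"
  shows "EV p x y \<theta> (GL_act m n \<A> t) = EV p (\<lambda>s. act_x m n \<A> (x s)) (\<lambda>s. act_y m n \<A> (y s)) \<theta> t"
  unfolding EV_def ev_GL_act[OF \<A> graded_point[OF xy] t] ev_def[of _ t]
proof (rule sum.cong[OF refl], rule arg_cong[where f = "\<lambda>e. e * _"], rule evw_cong)
  fix w s assume "w \<in> tsupp t" and s: "s < length w"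
  then obtain us vs where w: "w = map Vec us @ map Cov vs" "set us \<subseteq> Omega m n" "set vs \<subseteq> Omega m n"
      "length us = p" "length vs = q"
    using mixed_tensors_word[OF t] by metis
  let ?\<phi> = "\<lambda>s b. if s < p then x s b else y (s - p) b * \<theta> (s - p)"
  show "GL_point m n \<A> ?\<phi> s (w ! s) =
      (if s < p then act_x m n \<A> (x s) (w ! s) else act_y m n \<A> (y (s - p)) (w ! s) * \<theta> (s - p))"
  proof (cases "s < p")
    case True
    then have c: "w ! s = Vec (us ! s)" "us ! s \<in> Omega m n"
      using w by (auto simp: nth_append)
    note ti = theta_index[OF c(2)]
    show ?thesis
      using GL_point_Vec[OF \<A>, of "theta_index m (us ! s)" ?\<phi> s] ti c True by (simp add: act_x_def)
  next
    case False
    then have c: "w ! s = Cov (vs ! (s - p))" "vs ! (s - p) \<in> Omega m n"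
      using w s by (auto simp: nth_append)
    note ti = theta_index[OF c(2)]
    show ?thesis
      using GL_point_Cov[OF graded_point[OF xy, of p], of m n \<A> s "theta_index m (vs ! (s - p))"]
        ti c False by (simp add: act_y_def sum_distrib_right mult.assoc)
  qed
qed

section \<open>The matrix of an element of \<open>GL V\<close> and its inverse\<close>

lemma four_block_mat_inject:
  assumes "four_block_mat P Q R S = four_block_mat P' Q' R' S'"
    and "P \<in> carrier_mat a a" "Q \<in> carrier_mat a b" "R \<in> carrier_mat b a" "S \<in> carrier_mat b b"
    and "P' \<in> carrier_mat a a" "Q' \<in> carrier_mat a b" "R' \<in> carrier_mat b a" "S' \<in> carrier_mat b b"
  shows "P = P'" "Q = Q'" "R = R'" "S = S'"
proof -
  have split: "split_block (four_block_mat P Q R S) a a = (P, Q, R, S)"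
    if "P \<in> carrier_mat a a" "Q \<in> carrier_mat a b" "R \<in> carrier_mat b a" "S \<in> carrier_mat b b" for P Q R S :: "'a mat"
    using carrier_matD[OF that(1)] carrier_matD[OF that(2)] carrier_matD[OF that(3)] carrier_matD[OF that(4)]
    by (simp add: split_block_def Let_def) (intro conjI eq_matI; simp)
  have "(P, Q, R, S) = (P', Q', R', S')"
    using arg_cong[OF assms(1), of "\<lambda>X. split_block X a a"]
    unfolding split[OF assms(2-5)] split[OF assms(6-9)] .
  then show "P = P'" "Q = Q'" "R = R'" "S = S'" by simp_all
qed

text \<open>The homogeneous components are the eigenspaces of the parity automorphism, in
  characteristic different from 2.\<close>

lemma ginvol_eq_grade:
  fixes a :: "'k::field_char_0 grassmann"
  assumes "ginvol a = (- 1) ^ p * a"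
  shows "a \<in> G_grade p"
  unfolding G_grade_def mem_Collect_eq
proof (intro allI impI)
  fix S assume S: "gcoeff a S \<noteq> 0"
  have "gcoeff (ginvol a) S = gcoeff ((- 1) ^ p * a) S" by (simp only: assms)
  then have "(- 1) ^ fcard S * gcoeff a S = (- 1) ^ p * gcoeff a S"
    by (simp add: gcoeff_ginvol neg_one_power_mult split: if_splits)
  with S show "even (fcard S + p)" by (auto simp: neg_one_power_mult split: if_splits)
qed

abbreviation (input) par :: "nat \<Rightarrow> nat \<Rightarrow> nat"
  where "par m i \<equiv> of_bool (m \<le> i)"

lemma mixed_zero: "0 \<in> mixed_tensors m n p q"
  by (auto simp: mixed_tensors_def tsupp_iff)

lemma mixed_subset:
  assumes "x \<in> mixed_tensors m n p q" "y \<in> mixed_tensors m n p q" "tsupp z \<subseteq> tsupp x \<union> tsupp y"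
  shows "z \<in> mixed_tensors m n p q"
  using assms unfolding mixed_tensors_def by blast

lemma mixed_add: "x \<in> mixed_tensors m n p q \<Longrightarrow> y \<in> mixed_tensors m n p q \<Longrightarrow> x + y \<in> mixed_tensors m n p q"
  by (rule mixed_subset[of x m n p q y]) (auto simp: tsupp_iff)

lemma mixed_mult_scal: "x \<in> mixed_tensors m n p q \<Longrightarrow> x * scal a \<in> mixed_tensors m n p q"
  by (rule mixed_subset[of x _ _ _ _ x]) (auto simp: tsupp_iff tcoeff_mult_scal)

lemma mixed_scal_mult: "x \<in> mixed_tensors m n p q \<Longrightarrow> scal a * x \<in> mixed_tensors m n p q"
  by (rule mixed_subset[of x _ _ _ _ x]) (auto simp: tsupp_iff tcoeff_scal_mult)

lemma Vspace_zero: "0 \<in> Vspace m n"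
  unfolding Tpow_def by (rule mixed_zero)

lemma Vspace_add: "x \<in> Vspace m n \<Longrightarrow> y \<in> Vspace m n \<Longrightarrow> x + y \<in> Vspace m n"
  unfolding Tpow_def by (rule mixed_add)

lemma Vspace_scal: "x \<in> Vspace m n \<Longrightarrow> x * scal a \<in> Vspace m n"
  unfolding Tpow_def by (rule mixed_mult_scal)

lemma Vspace_sum: "(\<And>i. i \<in> I \<Longrightarrow> f i \<in> Vspace m n) \<Longrightarrow> sum f I \<in> Vspace m n"
  by (induction I rule: infinite_finite_induct) (auto intro: Vspace_zero Vspace_add)

lemma Vspace_expand:
  assumes "v \<in> Vspace m n"
  shows "v = (\<Sum>i<m + n. tword [Vec (theta m i)] * scal (tcoeff v [Vec (theta m i)]))"
proof (rule tensor_eqI)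
  fix w
  show "tcoeff v w = tcoeff (\<Sum>i<m + n. tword [Vec (theta m i)] * scal (tcoeff v [Vec (theta m i)])) w"
  proof (cases "w \<in> tsupp v")
    case True
    then obtain k where "k < m + n" "w = [Vec (theta m k)]" using Vspace_word[OF assms] by blast
    then show ?thesis by (simp add: tcoeff_sum tcoeff_tword_scal theta_inject)
  next
    case False
    then have 0: "tcoeff v w = 0" by (simp add: tsupp_iff)
    have "(if w = [Vec (theta m i)] then tcoeff v [Vec (theta m i)] else 0) = 0" for i
      using 0 by auto
    then show ?thesis by (simp only: tcoeff_sum tcoeff_tword_scal 0 sum.neutral_const)
  qed
qed

lemma GL_sum:
  assumes \<A>: "\<A> \<in> GL m n" and f: "\<And>i. i \<in> I \<Longrightarrow> f i \<in> Vspace m n"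
  shows "\<A> (\<Sum>i\<in>I. f i * scal (a i)) = (\<Sum>i\<in>I. \<A> (f i) * scal (a i))"
proof -
  have add: "\<A> (x + y) = \<A> x + \<A> y" if "x \<in> Vspace m n" "y \<in> Vspace m n" for x y
    using \<A> that by (simp add: GL_def)
  have scal: "\<A> (x * scal a) = \<A> x * scal a" if "x \<in> Vspace m n" for x a
    using \<A> that by (simp add: GL_def)
  have zero: "\<A> 0 = 0" using scal[OF Vspace_zero, of 0] by simp
  show ?thesis
    using f by (induction I rule: infinite_finite_induct)
      (simp_all add: zero add scal Vspace_scal Vspace_sum)
qed

text \<open>The columns of \<open>N\<close> are the coordinates of preimages of the basis elements.
  Linearity gives one of the two products, injectivity of \<A> the other.\<close>

lemma GL_inverse_matrix:
  fixes \<A> :: "'k::field_char_0 tensor \<Rightarrow> 'k tensor"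
  assumes \<A>: "\<A> \<in> GL m n"
  obtains N where "N \<in> carrier_mat (m + n) (m + n)" "matrix_of m n \<A> * N = 1\<^sub>m (m + n)" "N * matrix_of m n \<A> = 1\<^sub>m (m + n)"
proof -
  let ?t = "\<lambda>i. tword [Vec (theta m i)] :: 'k tensor" and ?M = "matrix_of m n \<A>"
  have t: "?t i \<in> Vspace m n" if "i < m + n" for i
    using that by (intro Vspace_tword theta_Omega)
  have M: "?M $$ (k, i) = tcoeff (\<A> (?t i)) [Vec (theta m k)]" if "k < m + n" "i < m + n" for k i
    using that by (simp add: matrix_of_def)
  have Md: "dim_row ?M = m + n" "dim_col ?M = m + n" by (simp_all add: matrix_of_def)
  have bij: "bij_betw \<A> (Vspace m n) (Vspace m n)" using \<A> by (simp add: GL_def)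
  have "\<exists>v\<in>Vspace m n. \<A> v = ?t j" if "j < m + n" for j
    using bij t[OF that] by (metis bij_betw_imp_surj_on imageE)
  then obtain v where v: "\<And>j. j < m + n \<Longrightarrow> v j \<in> Vspace m n" "\<And>j. j < m + n \<Longrightarrow> \<A> (v j) = ?t j"
    by metis
  define N where "N = mat (m + n) (m + n) (\<lambda>(i, j). tcoeff (v j) [Vec (theta m i)])"
  have Nd: "dim_row N = m + n" "dim_col N = m + n" by (simp_all add: N_def)
  have "?M * N = 1\<^sub>m (m + n)"
  proof (rule eq_matI)
    fix k j assume "k < dim_row (1\<^sub>m (m + n) :: 'k grassmann mat)" "j < dim_col (1\<^sub>m (m + n) :: 'k grassmann mat)"
    then have kj: "k < m + n" "j < m + n" by simp_all
    have "?t j = \<A> (\<Sum>i<m + n. ?t i * scal (tcoeff (v j) [Vec (theta m i)]))"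
      using v[OF kj(2)] Vspace_expand[OF v(1)[OF kj(2)]] by simp
    also have "\<dots> = (\<Sum>i<m + n. \<A> (?t i) * scal (tcoeff (v j) [Vec (theta m i)]))"
      by (rule GL_sum[OF \<A>]) (simp add: t)
    finally have "tcoeff (?t j) [Vec (theta m k)] = (\<Sum>i<m + n. ?M $$ (k, i) * N $$ (i, j))"
      using kj by (simp add: tcoeff_sum tcoeff_mult_scal M N_def)
    then show "(?M * N) $$ (k, j) = 1\<^sub>m (m + n) $$ (k, j)"
      using kj by (simp add: index_mult_mat_sum Md Nd tcoeff_tword theta_inject del: index_mult_mat(1))
  qed (simp_all add: Md Nd)
  moreover have "N * ?M = 1\<^sub>m (m + n)"
  proof (rule eq_matI)
    fix k j assume "k < dim_row (1\<^sub>m (m + n) :: 'k grassmann mat)" "j < dim_col (1\<^sub>m (m + n) :: 'k grassmann mat)"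
    then have kj: "k < m + n" "j < m + n" by simp_all
    let ?x = "\<Sum>i<m + n. v i * scal (?M $$ (i, j))"
    have "\<A> ?x = (\<Sum>i<m + n. \<A> (v i) * scal (?M $$ (i, j)))"
      by (rule GL_sum[OF \<A>]) (simp add: v)
    also have "\<dots> = (\<Sum>i<m + n. ?t i * scal (tcoeff (\<A> (?t j)) [Vec (theta m i)]))"
      using kj by (intro sum.cong) (simp_all add: v M)
    also have "\<dots> = \<A> (?t j)"
      by (rule Vspace_expand[OF GL_Vspace[OF \<A> t[OF kj(2)]], symmetric])
    finally have "\<A> ?x = \<A> (?t j)" .
    moreover have "?x \<in> Vspace m n" by (rule Vspace_sum, rule Vspace_scal, rule v) simp
    \<comment> \<open>The combination of preimages with the coefficients of the image of a basis
      element has the same image as that element.\<close>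
    ultimately have x: "?x = ?t j"
      by (rule inj_onD[OF bij_betw_imp_inj_on[OF bij] _ _ t[OF kj(2)]])
    have "tcoeff (?t j) [Vec (theta m k)] = tcoeff ?x [Vec (theta m k)]" by (simp only: x)
    also have "\<dots> = (\<Sum>i<m + n. N $$ (k, i) * ?M $$ (i, j))"
      using kj by (simp add: tcoeff_sum tcoeff_mult_scal N_def)
    finally have "tcoeff (?t j) [Vec (theta m k)] = (\<Sum>i<m + n. N $$ (k, i) * ?M $$ (i, j))" .
    then show "(N * ?M) $$ (k, j) = 1\<^sub>m (m + n) $$ (k, j)"
      using kj by (simp add: index_mult_mat_sum Md Nd tcoeff_tword theta_inject del: index_mult_mat(1))
  qed (simp_all add: Md Nd)
  moreover have "N \<in> carrier_mat (m + n) (m + n)" by (simp add: N_def)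
  ultimately show thesis by (metis that)
qed

lemma matrix_of_parity:
  assumes \<A>: "\<A> \<in> GL m n" and "i < m + n" "j < m + n"
  shows "matrix_of m n \<A> $$ (i, j) \<in> G_grade (par m i + par m j)"
proof -
  have nodd: "nodd [Vec (theta m k)] = par m k" for k by (simp add: nodd_def theta_def)
  have "tword [Vec (theta m j)] \<in> tensor_grade (par m j)"
    by (auto simp: tensor_grade_def tcoeff_tword nodd)
  then have "\<A> (tword [Vec (theta m j)]) \<in> tensor_grade (par m j)"
    using \<A> Vspace_tword[OF theta_Omega[OF assms(3)]] unfolding GL_def by blast
  then have "tcoeff (\<A> (tword [Vec (theta m j)])) [Vec (theta m i)] \<in> G_grade (nodd [Vec (theta m i)] + par m j)"
    unfolding tensor_grade_def by blast
  then show ?thesis using assms by (simp only: nodd) (simp add: matrix_of_def)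
qed

text \<open>Applying the parity automorphism to \<open>N\<close> and conjugating by the diagonal
  matrix of signs gives another inverse of \<open>M\<close>. By uniqueness it is \<open>N\<close>,
  so the entries of \<open>N\<close> are eigenvectors of that automorphism.\<close>

lemma super_matrix_inverse_parity:
  fixes M :: "'k::field_char_0 grassmann mat"
  assumes M: "M \<in> carrier_mat k k" "\<And>i j. i < k \<Longrightarrow> j < k \<Longrightarrow> M $$ (i, j) \<in> G_grade (par m i + par m j)"
    and N: "N \<in> carrier_mat k k" "M * N = 1\<^sub>m k" "N * M = 1\<^sub>m k"
    and ij: "i < k" "j < k"
  shows "N $$ (i, j) \<in> G_grade (par m i + par m j)"
proof -
  define N' where "N' = mat k k (\<lambda>(i, j). (- 1) ^ (par m i + par m j) * ginvol (N $$ (i, j)))"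
  have N': "N' \<in> carrier_mat k k" by (simp add: N'_def)
  have "M * N' = 1\<^sub>m k"
  proof (rule eq_matI)
    fix a b assume "a < dim_row (1\<^sub>m k :: 'k grassmann mat)" "b < dim_col (1\<^sub>m k :: 'k grassmann mat)"
    then have ab: "a < k" "b < k" by simp_all
    have ginvol_sum: "ginvol (sum f A) = (\<Sum>x\<in>A. ginvol (f x))" for f :: "nat \<Rightarrow> 'k grassmann" and A
      by (induction A rule: infinite_finite_induct) simp_all
    have "(M * N') $$ (a, b) = (\<Sum>t<k. M $$ (a, t) * N' $$ (t, b))"
      using ab M(1) N' by (subst index_mult_mat_sum) auto
    also have "\<dots> = (\<Sum>t<k. (- 1) ^ (par m a + par m b) * ginvol (M $$ (a, t) * N $$ (t, b)))"
    proof (rule sum.cong[OF refl])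
      fix t assume "t \<in> {..<k}"
      then have t: "t < k" by simp
      have "ginvol (M $$ (a, t)) = (- 1) ^ (par m a + par m t) * M $$ (a, t)"
        by (rule ginvol_grade[OF M(2)[OF ab(1) t]])
      then show "M $$ (a, t) * N' $$ (t, b) = (- 1) ^ (par m a + par m b) * ginvol (M $$ (a, t) * N $$ (t, b))"
        using t ab by (simp add: N'_def neg_one_power_mult)
    qed
    also have "\<dots> = (- 1) ^ (par m a + par m b) * ginvol ((M * N) $$ (a, b))"
      using ab M(1) N(1) by (subst index_mult_mat_sum) (auto simp: ginvol_sum sum_distrib_left)
    also have "\<dots> = 1\<^sub>m k $$ (a, b)"
      using ab by (simp add: N(2) neg_one_power_mult)
    finally show "(M * N') $$ (a, b) = 1\<^sub>m k $$ (a, b)" .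
  qed (use M N' in auto)
  then have "N' = N"
    using assoc_mult_mat[OF N(1) M(1) N'] N N' by simp
  then have "N' $$ (i, j) = N $$ (i, j)" by simp
  then have eq: "(- 1) ^ (par m i + par m j) * ginvol (N $$ (i, j)) = N $$ (i, j)"
    using ij by (simp add: N'_def)
  have "(- 1) ^ (par m i + par m j) * N $$ (i, j) =
      (- 1) ^ (par m i + par m j) * ((- 1) ^ (par m i + par m j) * ginvol (N $$ (i, j)))"
    by (simp only: eq)
  also have "\<dots> = ginvol (N $$ (i, j))"
    by (simp only: mult.assoc[symmetric] power_mult_distrib[symmetric]) simp
  finally show ?thesis by (intro ginvol_eq_grade) (rule sym)
qed

lemma GL_blocks:
  fixes \<A> :: "'k::field_char_0 tensor \<Rightarrow> 'k tensor"
  assumes \<A>: "\<A> \<in> GL m n"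
  obtains A11 A12 A21 A22 B11 B12 B21 B22 where "super_inverse m n A11 A12 A21 A22 B11 B12 B21 B22"
    "matrix_of m n \<A> = four_block_mat A11 A12 A21 A22" "mat_inv (matrix_of m n \<A>) = four_block_mat B11 B12 B21 B22"
proof -
  let ?M = "matrix_of m n \<A>"
  have M: "?M \<in> carrier_mat (m + n) (m + n)" by (simp add: matrix_of_def)
  obtain N where N: "N \<in> carrier_mat (m + n) (m + n)" "?M * N = 1\<^sub>m (m + n)" "N * ?M = 1\<^sub>m (m + n)"
    by (rule GL_inverse_matrix[OF \<A>])
  have Mp: "?M $$ (i, j) \<in> G_grade (par m i + par m j)" if "i < m + n" "j < m + n" for i j
    by (rule matrix_of_parity[OF \<A> that])
  have Np: "N $$ (i, j) \<in> G_grade (par m i + par m j)" if "i < m + n" "j < m + n" for i j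
    by (rule super_matrix_inverse_parity[OF M Mp N that])
  obtain A11 A12 A21 A22 where A: "split_block ?M m m = (A11, A12, A21, A22)" by (metis prod_cases4)
  obtain B11 B12 B21 B22 where B: "split_block N m m = (B11, B12, B21, B22)" by (metis prod_cases4)
  note As = split_block[OF A, of n n] and Bs = split_block[OF B, of n n]
  have Ac: "A11 \<in> carrier_mat m m" "A12 \<in> carrier_mat m n" "A21 \<in> carrier_mat n m" "A22 \<in> carrier_mat n n"
      "?M = four_block_mat A11 A12 A21 A22"
    using As M by auto
  have Bc: "B11 \<in> carrier_mat m m" "B12 \<in> carrier_mat m n" "B21 \<in> carrier_mat n m" "B22 \<in> carrier_mat n n"
      "N = four_block_mat B11 B12 B21 B22"
    using Bs N by auto
  have grades: "mat_grade 0 P" "mat_grade 1 Q" "mat_grade 1 R" "mat_grade 0 S"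
    if "split_block X m m = (P, Q, R, S)" "X \<in> carrier_mat (m + n) (m + n)"
      "\<And>i j. i < m + n \<Longrightarrow> j < m + n \<Longrightarrow> X $$ (i, j) \<in> G_grade (par m i + par m j)" for P Q R S X :: "'k grassmann mat"
  proof -
    have def: "P = mat m m (($$) X)" "Q = mat m n (\<lambda>(i, j). X $$ (i, j + m))"
      "R = mat n m (\<lambda>(i, j). X $$ (i + m, j))" "S = mat n n (\<lambda>(i, j). X $$ (i + m, j + m))"
      using that(1,2) by (auto simp: split_block_def Let_def)
    note * = that(3)
    have "P $$ (i, j) \<in> G_grade 0" if "i < m" "j < m" for i j
      using *[of i j] that by (simp add: def)
    moreover have "Q $$ (i, j) \<in> G_grade 1" if "i < m" "j < n" for i j
      using *[of i "j + m"] that by (simp add: def)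
    moreover have "R $$ (i, j) \<in> G_grade 1" if "i < n" "j < m" for i j
      using *[of "i + m" j] that by (simp add: def)
    moreover have "S $$ (i, j) \<in> G_grade 0" if "i < n" "j < n" for i j
    proof -
      have "X $$ (i + m, j + m) \<in> G_grade (par m (i + m) + par m (j + m))"
        using that by (intro *) simp_all
      moreover have "G_grade (par m (i + m) + par m (j + m)) = (G_grade 0 :: 'k grassmann set)"
        by (rule G_grade_parity) simp
      ultimately show ?thesis using that by (simp only: def) simp
    qed
    ultimately show "mat_grade 0 P" "mat_grade 1 Q" "mat_grade 1 R" "mat_grade 0 S"
      by (auto simp: mat_grade_def def)
  qed
  note gA = grades[OF A M Mp] and gB = grades[OF B N(1) Np]
  have "?M * N = four_block_mat (A11 * B11 + A12 * B21) (A11 * B12 + A12 * B22)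
      (A21 * B11 + A22 * B21) (A21 * B12 + A22 * B22)"
    unfolding Ac(5) Bc(5) by (rule mult_four_block_mat[OF Ac(1-4) Bc(1-4)])
  then have "four_block_mat (A11 * B11 + A12 * B21) (A11 * B12 + A12 * B22)
      (A21 * B11 + A22 * B21) (A21 * B12 + A22 * B22) = four_block_mat (1\<^sub>m m) (0\<^sub>m m n) (0\<^sub>m n m) (1\<^sub>m n)"
    by (simp only: N(2) four_block_one_mat)
  note AB = four_block_mat_inject[OF this]
  have "N * ?M = four_block_mat (B11 * A11 + B12 * A21) (B11 * A12 + B12 * A22)
      (B21 * A11 + B22 * A21) (B21 * A12 + B22 * A22)"
    unfolding Ac(5) Bc(5) by (rule mult_four_block_mat[OF Bc(1-4) Ac(1-4)])
  then have "four_block_mat (B11 * A11 + B12 * A21) (B11 * A12 + B12 * A22)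
      (B21 * A11 + B22 * A21) (B21 * A12 + B22 * A22) = four_block_mat (1\<^sub>m m) (0\<^sub>m m n) (0\<^sub>m n m) (1\<^sub>m n)"
    by (simp only: N(3) four_block_one_mat)
  note BA = four_block_mat_inject[OF this]
  have "super_inverse m n A11 A12 A21 A22 B11 B12 B21 B22"
    by unfold_locales (use Ac Bc gA gB AB[of m n] BA[of m n] in auto)
  moreover have "mat_inv ?M = N" by (rule mat_inv_eq[OF M N])
  ultimately show thesis using that[OF _ Ac(5)] Bc(5) by metis
qed

end

section \<open>The value of \<open>b_tilde\<close>\<close>

text \<open>The cross term is where the sign (-1)^(n \<rho>) in \<alpha> comes from.\<close>

lemma choose_two_add: "(a + n) choose 2 = (a choose 2) + (n choose 2) + a * n"
  by (induction a) (simp_all add: numeral_2_eq_2)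

text \<open>When the factors chosen from \<open>f\<close> are moved to the left, the one at place s
  passes the factors \<open>g\<close> at the smaller places outside J. Their number is s minus the
  number of elements of J below s, and the sum over J is the exponent up to an even number.\<close>

lemma oprod_add_expand:
  fixes f g :: "nat \<Rightarrow> 'k::field_char_0 grassmann"
  assumes f: "\<And>s. s < N \<Longrightarrow> f s \<in> G_grade 1" and g: "\<And>s. s < N \<Longrightarrow> g s \<in> G_grade 1"
  shows "oprod (\<lambda>s. f s + g s) N = (\<Sum>J\<in>Pow {..<N}. (- 1) ^ (\<Sum>J + (card J choose 2)) *
    (oprod (\<lambda>s. if s \<in> J then f s else 1) N * oprod (\<lambda>s. if s \<in> J then 1 else g s) N))"
  using assms
proof (induction N)
  case (Suc N)
  let ?e = "\<lambda>J. \<Sum>J + (card J choose 2)"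
  let ?F = "\<lambda>J. oprod (\<lambda>s. if s \<in> J then f s else 1)"
  let ?G = "\<lambda>J. oprod (\<lambda>s. if s \<in> J then 1 else g s)"
  let ?h = "\<lambda>J. (- 1) ^ ?e J * (?F J (Suc N) * ?G J (Suc N))"
  have "inj_on (insert N) (Pow {..<N})" by (auto simp: inj_on_def)
  then have "(\<Sum>J\<in>Pow {..<Suc N}. ?h J) = (\<Sum>J\<in>Pow {..<N}. ?h J) + (\<Sum>J\<in>Pow {..<N}. ?h (insert N J))"
    unfolding lessThan_Suc Pow_insert by (subst sum.union_disjoint) (auto simp: sum.reindex simp del: oprod_simps)
  also have "(\<Sum>J\<in>Pow {..<N}. ?h J) = (\<Sum>J\<in>Pow {..<N}. (- 1) ^ ?e J * (?F J N * ?G J N) * g N)"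
    by (intro sum.cong) (auto simp: mult.assoc)
  also have "(\<Sum>J\<in>Pow {..<N}. ?h (insert N J)) = (\<Sum>J\<in>Pow {..<N}. (- 1) ^ ?e J * (?F J N * ?G J N) * f N)"
  proof (rule sum.cong[OF refl])
    fix J assume J: "J \<in> Pow {..<N}"
    then have fin: "finite J" "N \<notin> J" using finite_subset by auto
    have FN: "?F (insert N J) N = ?F J N" "?G (insert N J) N = ?G J N"
      by (rule oprod_cong; simp)+
    have "?G J N \<in> G_grade (\<Sum>s<N. of_bool (s \<notin> J))"
      using Suc.prems by (intro oprod_grade) auto
    then have comm: "f N * ?G J N = (- 1) ^ (1 * (\<Sum>s<N. of_bool (s \<notin> J))) * (?G J N * f N)"
      using Suc.prems by (intro G_grade_commute) simp_all
    have cnt: "(\<Sum>s<N. of_bool (s \<notin> J)) + card J = N"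
    proof -
      have "(\<Sum>s<N. of_bool (s \<notin> J)) = card ({..<N} - J)"
        by (simp add: sum.If_cases of_bool_def Int_def set_diff_eq)
      then show ?thesis using J card_Diff_subset[of J "{..<N}"] card_mono[of "{..<N}" J] fin by simp
    qed
    have e: "?e (insert N J) = N + card J + ?e J"
      using fin by (simp add: numeral_2_eq_2)
    have "?h (insert N J) = (- 1) ^ ?e (insert N J) * (?F J N * (f N * ?G J N))"
      by (simp add: FN mult.assoc)
    also have "\<dots> = (- 1) ^ (?e (insert N J) + (\<Sum>s<N. of_bool (s \<notin> J))) * (?F J N * ?G J N * f N)"
      unfolding comm by (simp add: neg_one_power_mult mult.assoc)
    also have "even (?e (insert N J) + (\<Sum>s<N. of_bool (s \<notin> J))) = even (?e J)"
      unfolding e using cnt by presburger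
    then have "(- 1) ^ (?e (insert N J) + (\<Sum>s<N. of_bool (s \<notin> J))) = ((- 1) ^ ?e J :: 'k grassmann)"
      by (simp only: minus_one_power_iff)
    finally show "?h (insert N J) = (- 1) ^ ?e J * (?F J N * ?G J N) * f N"
      by (simp only: mult.assoc)
  qed
  finally have "(\<Sum>J\<in>Pow {..<Suc N}. ?h J) = oprod (\<lambda>s. f s + g s) N * g N + oprod (\<lambda>s. f s + g s) N * f N"
    using Suc by (simp add: sum_distrib_right)
  then show ?case by (simp add: distrib_left add.commute)
qed (simp add: numeral_2_eq_2)

section \<open>Canonical fillings, their constants and their values\<close>

definition gec :: "'k::comm_ring_1 \<Rightarrow> 'k geven"
  where "gec k = Geven (gconst k)"

lemma of_geven_gec: "of_geven (gec k) = gconst k"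
  by (simp add: gec_def of_geven_Geven)

lemma gec_mult: "gec (a * b) = gec a * gec b"
  by (simp add: of_geven_inject[symmetric] of_geven_gec)

text \<open>Box \<open>(i, j)\<close> of the small rectangle has the number \<open>i * n + j\<close>; \<open>J\<close> is the set of the boxes
  which contain odd elements.\<close>

definition hfill :: "nat \<Rightarrow> nat \<Rightarrow> nat set \<Rightarrow> nat \<times> nat \<Rightarrow> basis"
  where "hfill m n J = restrict (\<lambda>(i, j). if j < n \<and> i * n + j \<in> J then Od j else Ev i) ({..<m} \<times> {..<n + 1})"

definition gfill :: "nat \<Rightarrow> nat \<Rightarrow> nat set \<Rightarrow> nat \<times> nat \<Rightarrow> basis"
  where "gfill m n J = restrict (\<lambda>(i, j). if i < m \<and> i * n + j \<notin> J then Ev i else Od j) ({..<m + 1} \<times> {..<n})"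

lemma slot_less: "i < m \<Longrightarrow> j < n \<Longrightarrow> i * n + j < m * (n :: nat)"
proof -
  assume "i < m" "j < n"
  then have "Suc i * n \<le> m * n" by (intro mult_le_mono1) simp
  then show ?thesis using \<open>j < n\<close> by simp
qed

lemma slot_coords:
  fixes s :: nat
  assumes "s < r * c"
  shows "s div c < r" "s mod c < c" "c > 0"
proof -
  show "c > 0" using assms by (cases c) auto
  then show "s mod c < c" by simp
  show "s div c < r" using assms by (simp add: less_mult_imp_div_less)
qed

text \<open>Injective because J is read off from the odd boxes, and surjective by
  \<open>card_filling_pairs\<close>.\<close>

lemma bij_betw_fillings:
  "bij_betw (\<lambda>J. (hfill m n J, gfill m n J)) (Pow {..<m * n}) (filling_pairs m n)"
proof -
  let ?F = "\<lambda>J. (hfill m n J, gfill m n J)"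
  have "J = {s. s < m * n \<and> is_odd (hfill m n J (s div n, s mod n))}" if "J \<subseteq> {..<m * n}" for J
  proof -
    have "is_odd (hfill m n J (s div n, s mod n)) \<longleftrightarrow> s \<in> J" if "s < m * n" for s
      using slot_coords[OF that] less_SucI[of "s mod n" n] by (auto simp: hfill_def split: if_splits)
    then show ?thesis using that by auto
  qed
  then have inj: "inj_on ?F (Pow {..<m * n})"
    by (intro inj_onI) (metis Pow_iff prod.inject)
  have sub: "?F ` Pow {..<m * n} \<subseteq> filling_pairs m n"
  proof (rule image_subsetI)
    fix J assume "J \<in> Pow {..<m * n}"
    have "hfill m n J \<in> canonical_fillings m n (replicate m (n + 1))"
      unfolding canonical_fillings_rectangle by (auto simp: hfill_def)
    moreover have "gfill m n J \<in> canonical_fillings m n (replicate (m + 1) n)"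
      unfolding canonical_fillings_rectangle by (auto simp: gfill_def)
    moreover have "\<forall>x\<in>{..<m} \<times> {..<n}. hfill m n J x = gfill m n J x"
      by (auto simp: hfill_def gfill_def)
    ultimately show "?F J \<in> filling_pairs m n"
      by (simp add: filling_pairs_def lambda_h_def lambda_g_def case_prod_unfold)
  qed
  have "finite (filling_pairs m n)"
    using card_filling_pairs[of m n] by (metis card.infinite power_not_zero zero_neq_numeral)
  moreover have "card (?F ` Pow {..<m * n}) = card (filling_pairs m n)"
    by (simp add: card_image[OF inj] card_Pow card_filling_pairs)
  ultimately have "?F ` Pow {..<m * n} = filling_pairs m n"
    using sub by (intro card_subset_eq)
  with inj show ?thesis by (simp add: bij_betw_def)
qed

lemma card_fixing_even_boxes:
  assumes "B = {s. s < r * c \<and> is_odd (\<phi> (s div c, s mod c))}"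
  shows "card {\<sigma> \<in> grid.C (\<lambda>s. s mod c) (r * c). \<forall>s<r * c. s \<notin> B \<longrightarrow> \<sigma> s = s} =
    (\<Prod>j<c. fact (card {i. i < r \<and> is_odd (\<phi> (i, j))}))"
proof -
  interpret G: grid "\<lambda>s. s div c" "\<lambda>s. s mod c" r c "r * c" by (rule grid_rows)
  have "{i. i < r \<and> G.enc i j \<in> B} = {i. i < r \<and> is_odd (\<phi> (i, j))}" if "j < c" for j
    using G.enc[of _ j] that by (auto simp: assms)
  then show ?thesis unfolding G.card_C_fixing by simp
qed

lemma kappa_hfill:
  "kappa n (lambda_h m n) (hfill m n J) =
    card {\<sigma> \<in> grid.C (\<lambda>s. s mod (n + 1)) (m * (n + 1)). \<forall>s<m * (n + 1).
      s \<notin> {s. s < m * (n + 1) \<and> is_odd (hfill m n J (s div (n + 1), s mod (n + 1)))} \<longrightarrow> \<sigma> s = s}"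
proof -
  have "{i. (i, j) \<in> set (boxes (lambda_h m n)) \<and> hfill m n J (i, j) = Od j} = {i. i < m \<and> is_odd (hfill m n J (i, j))}"
    if "j < n" for j
    using that by (auto simp: lambda_h_def boxes_rectangle hfill_def)
  \<comment> \<open>The additional column of the larger rectangle contains even elements only and
    contributes the factorial of 0.\<close>
  moreover have "{i. i < m \<and> is_odd (hfill m n J (i, n))} = {}"
    by (auto simp: hfill_def)
  then have "fact (card {i. i < m \<and> is_odd (hfill m n J (i, n))}) = (1 :: nat)" by (simp only: card.empty fact_0)
  moreover have "(\<Prod>j<n + 1. f j) = (\<Prod>j<n. f j) * f n" for f :: "nat \<Rightarrow> nat" by simp
  ultimately show ?thesis
    unfolding card_fixing_even_boxes[OF refl] kappa_def by (simp only: mult_1_right) (rule prod.cong, simp_all)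
qed

lemma kappa_gfill:
  "kappa n (lambda_g m n) (gfill m n J) =
    card {\<sigma> \<in> grid.C (\<lambda>s. s mod n) ((m + 1) * n). \<forall>s<(m + 1) * n.
      s \<notin> {s. s < (m + 1) * n \<and> is_odd (gfill m n J (s div n, s mod n))} \<longrightarrow> \<sigma> s = s}"
proof -
  have "{i. (i, j) \<in> set (boxes (lambda_g m n)) \<and> gfill m n J (i, j) = Od j} = {i. i < m + 1 \<and> is_odd (gfill m n J (i, j))}"
    if "j < n" for j
    using that unfolding lambda_g_def boxes_rectangle by (auto simp: gfill_def)
  then show ?thesis
    unfolding card_fixing_even_boxes[OF refl] kappa_def by simp
qed

lemma odd_boxes_gfill:
  assumes "J \<subseteq> {..<m * n}"
  shows "{s. s < (m + 1) * n \<and> is_odd (gfill m n J (s div n, s mod n))} = J \<union> {m * n..<m * n + n}"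
proof (intro equalityI subsetI)
  fix s assume "s \<in> {s. s < (m + 1) * n \<and> is_odd (gfill m n J (s div n, s mod n))}"
  then have s: "s < (m + 1) * n" "is_odd (gfill m n J (s div n, s mod n))" by auto
  note c = slot_coords[OF s(1)]
  show "s \<in> J \<union> {m * n..<m * n + n}"
  proof (cases "s < m * n")
    case True
    then have "s div n < m" by (rule slot_coords)
    with s c show ?thesis by (auto simp: gfill_def split: if_splits)
  qed (use s in auto)
next
  fix s assume s: "s \<in> J \<union> {m * n..<m * n + n}"
  then have lt: "s < (m + 1) * n" using assms by auto
  note c = slot_coords[OF lt]
  have "s \<in> J \<or> \<not> s div n < m"
  proof (cases "s \<in> J")
    case False
    then have "m * n \<le> s" using s by simp
    then have "m \<le> s div n" using c by (simp add: less_eq_div_iff_mult_less_eq)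
    then show ?thesis by simp
  qed simp
  then show "s \<in> {s. s < (m + 1) * n \<and> is_odd (gfill m n J (s div n, s mod n))}"
    using lt c by (auto simp: gfill_def)
qed

lemma rho_hfill:
  assumes "J \<subseteq> {..<m * n}"
  shows "rho m n (hfill m n J) = card J"
proof -
  have "bij_betw (\<lambda>s. (s div n, s mod n)) J {x \<in> {..<m} \<times> {..<n}. is_odd (hfill m n J x)}"
  proof (rule bij_betw_byWitness[where f' = "\<lambda>(i, j). i * n + j"])
    show "(\<lambda>s. (s div n, s mod n)) ` J \<subseteq> {x \<in> {..<m} \<times> {..<n}. is_odd (hfill m n J x)}"
      using assms slot_coords[of _ m n] by (fastforce simp: hfill_def)
  qed (auto simp: hfill_def split: if_splits)
  then show ?thesis by (simp add: rho_def bij_betw_same_card)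
qed

lemma value_hfill:
  fixes X :: "nat \<Rightarrow> nat \<Rightarrow> 'k::field_char_0 geven"
  assumes gr: "graded z" and odd: "\<And>i j. \<eta> i j \<in> G_grade 1"
    and ev: "\<And>k i. k < m \<Longrightarrow> i < m \<Longrightarrow> z k (Vec (Ev i)) = of_geven (X k i)"
    and od: "\<And>k j. k < m \<Longrightarrow> j < n \<Longrightarrow> z k (Vec (Od j)) = (\<Sum>i<m. of_geven (X k i) * \<eta> i j)"
  shows "ev (\<lambda>s. z (s div (n + 1))) (filling_tensor (lambda_h m n) (hfill m n J)) =
    of_geven (gec (of_nat (card (grid.C (\<lambda>s. s div (n + 1)) (m * (n + 1))))) * det (mat m m (\<lambda>(i, j). X i j)) ^ (n + 1) *
      gec (of_nat (kappa n (lambda_h m n) (hfill m n J)))) *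
    oprod (\<lambda>s. if s \<in> J then \<eta> (s div n) (s mod n) else 1) (m * n)"
proof -
  let ?B = "{s. s < m * (n + 1) \<and> is_odd (hfill m n J (s div (n + 1), s mod (n + 1)))}"
  have fill: "hfill m n J (s div (n + 1), s mod (n + 1)) =
      (if s mod (n + 1) < n \<and> s div (n + 1) * n + s mod (n + 1) \<in> J then Od (s mod (n + 1)) else Ev (s div (n + 1)))"
    if "s < m * (n + 1)" for s
    using slot_coords[OF that] by (simp add: hfill_def)
  have z: "z k (Vec (hfill m n J (s div (n + 1), s mod (n + 1)))) =
      (if s \<in> ?B then \<Sum>i<m. of_geven (X k i) * \<eta> i (s mod (n + 1)) else of_geven (X k (s div (n + 1))))"
    if "k < m" "s < m * (n + 1)" for k s
  proof (cases "s mod (n + 1) < n \<and> s div (n + 1) * n + s mod (n + 1) \<in> J")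
    case True
    then have "s \<in> ?B" using that by (simp only: fill mem_Collect_eq if_True is_odd.simps simp_thms)
    then show ?thesis using True that by (simp only: fill if_True simp_thms od)
  next
    case False
    then have "s \<notin> ?B" using that by (simp only: fill mem_Collect_eq if_False is_odd.simps simp_thms)
    then show ?thesis using False that slot_coords(1)[OF that(2)] by (simp only: fill if_False ev)
  qed
  have "ev (\<lambda>s. z (s div (n + 1))) (filling_tensor (lambda_h m n) (hfill m n J)) =
    of_nat (card (grid.C (\<lambda>s. s div (n + 1)) (m * (n + 1)))) * (of_geven (det (mat m m (\<lambda>(i, j). X i j)) ^ (n + 1)) *
    of_nat (kappa n (lambda_h m n) (hfill m n J)) *
    oprod (\<lambda>s. if s \<in> ?B then \<eta> (s div (n + 1)) (s mod (n + 1)) else 1) (m * (n + 1)))"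
    unfolding kappa_hfill unfolding lambda_h_def
    by (rule value_left[OF gr _ odd z]) auto
  \<comment> \<open>The last column contributes factors 1; what remains is renumbered from rows of
    length n + 1 to rows of length n.\<close>
  also have "oprod (\<lambda>s. if s \<in> ?B then \<eta> (s div (n + 1)) (s mod (n + 1)) else 1) (m * (n + 1)) =
      oprod (\<lambda>s. (\<lambda>i j. if j < n \<and> i * n + j \<in> J then \<eta> i j else 1) (s div (n + 1)) (s mod (n + 1))) (m * (n + 1))"
  proof (rule oprod_cong)
    fix s assume "s < m * (n + 1)"
    then have "s \<in> ?B \<longleftrightarrow> s mod (n + 1) < n \<and> s div (n + 1) * n + s mod (n + 1) \<in> J"
      by (simp only: fill mem_Collect_eq simp_thms) (simp only: is_odd.simps simp_thms split: if_split)
    then show "(if s \<in> ?B then \<eta> (s div (n + 1)) (s mod (n + 1)) else 1) =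
        (\<lambda>i j. if j < n \<and> i * n + j \<in> J then \<eta> i j else 1) (s div (n + 1)) (s mod (n + 1))"
      by (simp only:)
  qed (rule refl)
  also have "\<dots> = oprod (\<lambda>i. oprod (\<lambda>j. if j < n \<and> i * n + j \<in> J then \<eta> i j else 1) (n + 1)) m"
    by (rule oprod_grid)
  also have "\<dots> = oprod (\<lambda>i. oprod (\<lambda>j. if i * n + j \<in> J then \<eta> i j else 1) n) m"
    by (rule oprod_cong) (simp_all cong: oprod_cong)
  also have "\<dots> = oprod (\<lambda>s. (\<lambda>i j. if i * n + j \<in> J then \<eta> i j else 1) (s div n) (s mod n)) (m * n)"
    by (rule oprod_grid[symmetric])
  also have "\<dots> = oprod (\<lambda>s. if s \<in> J then \<eta> (s div n) (s mod n) else 1) (m * n)"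
    by (rule oprod_cong) simp_all
  finally show ?thesis
    by (simp add: of_geven_gec gconst_of_nat mult.assoc)
qed

lemma value_gfill:
  fixes Y :: "nat \<Rightarrow> nat \<Rightarrow> 'k::field_char_0 geven"
  assumes gr: "cograded z" and \<theta>: "odd_params \<theta>" and odd: "\<And>i j. \<zeta> i j \<in> G_grade 1" and J: "J \<subseteq> {..<m * n}"
    and od: "\<And>k i. k < n \<Longrightarrow> i < n \<Longrightarrow> z k (Cov (Od i)) = of_geven (Y i k)"
    and ev: "\<And>k i. k < n \<Longrightarrow> i < m \<Longrightarrow> z k (Cov (Ev i)) = (\<Sum>a<n. of_geven (Y a k) * \<zeta> i a)"
  shows "ev (\<lambda>s b. z (s mod n) b * \<theta> s) (filling_cotensor (lambda_g m n) (gfill m n J)) =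
    of_geven (gec (of_nat (card (grid.C (\<lambda>s. s mod n) ((m + 1) * n)))) * gec ((- 1) ^ \<Sum>({..<m * n} - J)) *
      det (mat n n (\<lambda>(i, j). Y j i)) ^ (m + 1) *
      gec (of_nat (card {\<tau> \<in> grid.C (\<lambda>s. s div n) ((m + 1) * n). \<forall>s<(m + 1) * n. s \<in> J \<union> {m * n..<m * n + n} \<longrightarrow> \<tau> s = s}))) *
    oprod (\<lambda>s. if s \<in> J then 1 else \<zeta> (s div n) (s mod n)) (m * n) * oprod \<theta> ((m + 1) * n)"
proof -
  let ?l = "(m + 1) * n"
  let ?B = "{..<m * n} - J"
  have iff: "s \<in> ?B \<longleftrightarrow> \<not> is_odd (gfill m n J (s div n, s mod n))" if "s < ?l" for s
    using odd_boxes_gfill[OF J] that J by (auto simp: set_eq_iff)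
  have fill: "gfill m n J (s div n, s mod n) = (if s \<in> ?B then Ev (s div n) else Od (s mod n))" if "s < ?l" for s
    using iff[OF that] slot_coords[OF that] by (auto simp: gfill_def split: if_splits)
  have z: "z k (Cov (gfill m n J (s div n, s mod n))) =
      (if s \<in> ?B then \<Sum>a<n. of_geven (Y a k) * \<zeta> (s div n) a else of_geven (Y (s mod n) k))"
    if "k < n" "s < ?l" for k s
    using that slot_coords[OF that(2)] slot_coords(1)[of s m n] by (auto simp: fill ev od)
  have "ev (\<lambda>s b. z (s mod n) b * \<theta> s) (filling_cotensor (lambda_g m n) (gfill m n J)) =
    of_nat (card (grid.C (\<lambda>s. s mod n) ?l)) * (- 1) ^ \<Sum>?B * (of_geven (det (mat n n (\<lambda>(i, j). Y j i)) ^ (m + 1)) *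
    of_nat (card {\<tau> \<in> grid.C (\<lambda>s. s div n) ?l. \<forall>s<?l. s \<notin> ?B \<longrightarrow> \<tau> s = s}) *
    oprod (\<lambda>s. if s \<in> ?B then (\<lambda>i j. \<zeta> j i) (s mod n) (s div n) else 1) ?l) * oprod \<theta> ?l"
    unfolding lambda_g_def
  proof (rule value_right)
    show "?B \<subseteq> {..<?l}" by auto
  qed (use gr \<theta> odd z iff in \<open>auto simp: cograded_def odd_params_def\<close>)
  also have "{\<tau> \<in> grid.C (\<lambda>s. s div n) ?l. \<forall>s<?l. s \<notin> ?B \<longrightarrow> \<tau> s = s} =
      {\<tau> \<in> grid.C (\<lambda>s. s div n) ?l. \<forall>s<?l. s \<in> J \<union> {m * n..<m * n + n} \<longrightarrow> \<tau> s = s}"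
    using J by auto
  also have "oprod (\<lambda>s. if s \<in> ?B then (\<lambda>i j. \<zeta> j i) (s mod n) (s div n) else 1) ?l =
      oprod (\<lambda>s. if s \<in> ?B then \<zeta> (s div n) (s mod n) else 1) (m * n + n)"
    by (rule oprod_cong) simp_all
  \<comment> \<open>The last row contains odd letters only, that is even coordinates, and
    contributes factors 1.\<close>
  also have "\<dots> = oprod (\<lambda>s. if s \<in> ?B then \<zeta> (s div n) (s mod n) else 1) (m * n)"
    unfolding oprod_add by simp
  also have "\<dots> = oprod (\<lambda>s. if s \<in> J then 1 else \<zeta> (s div n) (s mod n)) (m * n)"
    by (rule oprod_cong) auto
  finally show ?thesis
    by (simp add: of_geven_gec gconst_of_nat gconst_power mult.assoc)
qed

lemma gamma_gfill:
  assumes J: "J \<subseteq> {..<m * n}"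
  shows "gbody (pairing (filling_cotensor (lambda_g m n) (gfill m n J)) (filling_tensor (lambda_g m n) (gfill m n J))) =
    of_int (grid.young_const (\<lambda>s. s div n) (\<lambda>s. s mod n) ((m + 1) * n)) * ((- 1) ^ ((card J + n) choose 2) *
    (of_nat (kappa n (lambda_g m n) (gfill m n J)) *
     of_nat (card {\<tau> \<in> grid.C (\<lambda>s. s div n) ((m + 1) * n). \<forall>s<(m + 1) * n. s \<in> J \<union> {m * n..<m * n + n} \<longrightarrow> \<tau> s = s})
      :: 'k::field_char_0))"
proof -
  let ?l = "(m + 1) * n"
  let ?B = "{s. s < ?l \<and> is_odd (gfill m n J (s div n, s mod n))}"
  have B: "?B = J \<union> {m * n..<m * n + n}" by (rule odd_boxes_gfill[OF J])
  have "finite J" using J finite_subset by blast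
  moreover have "J \<inter> {m * n..<m * n + n} = {}" using J by auto
  ultimately have card: "card ?B = card J + n" unfolding B by (simp add: card_Un_disjoint)
  have can: "gfill m n J (s div n, s mod n) = (if s \<in> ?B then Od (s mod n) else Ev (s div n))" if "s < ?l" for s
    using slot_coords[OF that] that by (auto simp: gfill_def)
  have gb: "gbody (of_int k :: 'k grassmann) = of_int k" "gbody (of_nat q :: 'k grassmann) = of_nat q"
      "gbody ((- 1 :: 'k grassmann) ^ e) = (- 1) ^ e" for k q e
    by (simp_all add: gconst_of_int[symmetric] gconst_of_nat[symmetric] minus_one_power_iff)
  have "gbody (pairing (filling_cotensor (lambda_g m n) (gfill m n J)) (filling_tensor (lambda_g m n) (gfill m n J)) :: 'k grassmann) =
      gbody (of_int (grid.young_const (\<lambda>s. s div n) (\<lambda>s. s mod n) ?l) * ((- 1) ^ (card ?B choose 2) *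
      of_nat (card {\<sigma> \<in> grid.C (\<lambda>s. s mod n) ?l. \<forall>s<?l. s \<notin> ?B \<longrightarrow> \<sigma> s = s} *
      card {\<tau> \<in> grid.C (\<lambda>s. s div n) ?l. \<forall>s<?l. s \<in> ?B \<longrightarrow> \<tau> s = s})))"
    unfolding lambda_g_def by (rule arg_cong[where f = gbody], rule pairing_canonical[OF refl can])
  also have "\<dots> = of_int (grid.young_const (\<lambda>s. s div n) (\<lambda>s. s mod n) ?l) * ((- 1) ^ (card ?B choose 2) *
      (of_nat (card {\<sigma> \<in> grid.C (\<lambda>s. s mod n) ?l. \<forall>s<?l. s \<notin> ?B \<longrightarrow> \<sigma> s = s}) *
      of_nat (card {\<tau> \<in> grid.C (\<lambda>s. s div n) ?l. \<forall>s<?l. s \<in> ?B \<longrightarrow> \<tau> s = s})))"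
    by (simp only: gbody_mult gb of_nat_mult)
  finally show ?thesis
    unfolding kappa_gfill[symmetric] card unfolding B .
qed

definition h_rows :: "nat \<Rightarrow> nat \<Rightarrow> nat"
  where "h_rows m n = card (grid.C (\<lambda>s. s div (n + 1)) (m * (n + 1)))"

definition g_columns :: "nat \<Rightarrow> nat \<Rightarrow> nat"
  where "g_columns m n = card (grid.C (\<lambda>s. s mod n) ((m + 1) * n))"

text \<open>The part of the coefficients common to all J: the group orders from
  \<open>value_left\<close> and \<open>value_right\<close>, the constant c of the square of
  \<open>e_T\<close> from the pairing, and the sign which remains when the J-dependent signs are
  matched with \<open>oprod_add_expand\<close>.\<close>

definition b_const :: "nat \<Rightarrow> nat \<Rightarrow> 'k::field_char_0"
  where "b_const m n = of_nat (h_rows m n) * of_nat (g_columns m n) /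
    of_int (grid.young_const (\<lambda>s. s div n) (\<lambda>s. s mod n) ((m + 1) * n)) *
    (- 1) ^ ((n choose 2) + \<Sum>{..<m * n})"

lemma card_C_pos: "grid u v a b l \<Longrightarrow> card (grid.C v l) > 0"
  using grid.id_C grid.finite_C by (metis card_gt_0_iff empty_iff)

lemma b_const_nonzero: "b_const m n \<noteq> 0"
proof -
  have "grid.young_const (\<lambda>s. s div n) (\<lambda>s. s mod n) ((m + 1) * n) > 0"
    by (rule grid.young_const_pos[OF grid_rows])
  moreover have "h_rows m n > 0" "g_columns m n > 0"
    unfolding h_rows_def g_columns_def by (rule card_C_pos[OF grid_columns], rule card_C_pos[OF grid_rows])
  ultimately show ?thesis by (simp add: b_const_def)
qed

text \<open>This is what \<alpha> is made for. \<kappa>(h) cancels against the value of h,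
  \<kappa>(g) against the pairing, and \<open>NR\<close> occurs both in the value of the dual tensor
  and in the pairing. The exponents n |J|, binomial(|J| + n, 2) and the sum over the complement of J
  combine to the exponent of \<open>oprod_add_expand\<close> plus a constant.\<close>

lemma coefficient_J:
  assumes J: "J \<subseteq> {..<m * n}"
  defines "NR \<equiv> card {\<tau> \<in> grid.C (\<lambda>s. s div n) ((m + 1) * n). \<forall>s<(m + 1) * n. s \<in> J \<union> {m * n..<m * n + n} \<longrightarrow> \<tau> s = s}"
  shows "(1 / alpha m n (hfill m n J) (gfill m n J)) * of_nat (h_rows m n) * of_nat (kappa n (lambda_h m n) (hfill m n J)) *
     (1 / gbody (pairing (filling_cotensor (lambda_g m n) (gfill m n J)) (filling_tensor (lambda_g m n) (gfill m n J)))) *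
     of_nat (g_columns m n) * (- 1) ^ \<Sum>({..<m * n} - J) * of_nat NR =
    (b_const m n * (- 1) ^ (\<Sum>J + (card J choose 2)) :: 'k::field_char_0)"
proof -
  let ?kh = "kappa n (lambda_h m n) (hfill m n J)" and ?kg = "kappa n (lambda_g m n) (gfill m n J)"
  let ?c = "grid.young_const (\<lambda>s. s div n) (\<lambda>s. s mod n) ((m + 1) * n)"
  have fin: "finite J" using J finite_subset by blast
  have "?kh > 0" "?kg > 0" by (simp_all add: kappa_def prod_pos)
  moreover have "?c > 0" by (rule grid.young_const_pos[OF grid_rows])
  moreover have "NR > 0"
  proof -
    interpret F: grid "\<lambda>s. s mod n" "\<lambda>s. s div n" n "m + 1" "(m + 1) * n" by (rule grid_columns)
    have "id \<in> {\<tau> \<in> F.C. \<forall>s<(m + 1) * n. s \<in> J \<union> {m * n..<m * n + n} \<longrightarrow> \<tau> s = s}"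
      using F.id_C by simp
    then show ?thesis unfolding NR_def using F.finite_C by (auto simp: card_gt_0_iff)
  qed
  moreover have inv: "1 / (- 1) ^ e = ((- 1) ^ e :: 'k)" for e by (simp add: minus_one_power_iff)
  have "(- 1) ^ \<Sum>({..<m * n} - J) = ((- 1) ^ (n * card J) * ((- 1) ^ ((card J + n) choose 2) *
      ((- 1) ^ (n choose 2) * ((- 1) ^ \<Sum>{..<m * n} * ((- 1) ^ \<Sum>J * (- 1) ^ (card J choose 2))))) :: 'k)"
  proof -
    have "\<Sum>{..<m * n} = \<Sum>J + \<Sum>({..<m * n} - J)"
      using J by (subst sum.subset_diff[of J]) auto
    then have "even (\<Sum>({..<m * n} - J)) = even (n * card J + ((card J + n) choose 2) +
        (n choose 2) + \<Sum>{..<m * n} + \<Sum>J + (card J choose 2))"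
      unfolding choose_two_add by (simp add: mult.commute) blast
    then have "(- 1) ^ \<Sum>({..<m * n} - J) = ((- 1) ^ (n * card J + ((card J + n) choose 2) +
        (n choose 2) + \<Sum>{..<m * n} + \<Sum>J + (card J choose 2)) :: 'k)"
      by (simp only: minus_one_power_iff)
    then show ?thesis by (simp only: power_add mult.assoc)
  qed
  ultimately show ?thesis
    unfolding alpha_def gamma_gfill[OF J] NR_def[symmetric] rho_hfill[OF J] b_const_def
    by (simp add: field_simps power_add)
qed

lemma EV_b_tilde_factors:
  fixes X Y :: "nat \<Rightarrow> nat \<Rightarrow> 'k::field_char_0 geven"
  assumes gr: "graded z" "cograded z'" "odd_params \<theta>"
    and odd: "\<And>i j. \<eta> i j \<in> G_grade 1" "\<And>i j. \<zeta> i j \<in> G_grade 1"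
    and h_ev: "\<And>k i. k < m \<Longrightarrow> i < m \<Longrightarrow> z k (Vec (Ev i)) = of_geven (X k i)"
    and h_od: "\<And>k j. k < m \<Longrightarrow> j < n \<Longrightarrow> z k (Vec (Od j)) = (\<Sum>i<m. of_geven (X k i) * \<eta> i j)"
    and g_od: "\<And>k i. k < n \<Longrightarrow> i < n \<Longrightarrow> z' k (Cov (Od i)) = of_geven (Y i k)"
    and g_ev: "\<And>k i. k < n \<Longrightarrow> i < m \<Longrightarrow> z' k (Cov (Ev i)) = (\<Sum>a<n. of_geven (Y a k) * \<zeta> i a)"
  shows "EV (m * (n + 1)) (\<lambda>s. z (s div (n + 1))) (\<lambda>s. z' (s mod n)) \<theta> (b_tilde m n) =
    of_geven (gec (b_const m n) * det (mat m m (\<lambda>(i, j). X i j)) ^ (n + 1) * det (mat n n (\<lambda>(i, j). Y j i)) ^ (m + 1)) *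
    oprod (\<lambda>s. \<eta> (s div n) (s mod n) + \<zeta> (s div n) (s mod n)) (m * n) * oprod \<theta> ((m + 1) * n)"
proof -
  let ?x = "\<lambda>s. z (s div (n + 1))" and ?y = "\<lambda>s. z' (s mod n)"
  let ?dX = "det (mat m m (\<lambda>(i, j). X i j)) ^ (n + 1)" and ?dY = "det (mat n n (\<lambda>(i, j). Y j i)) ^ (m + 1)"
  let ?O = "oprod \<theta> ((m + 1) * n)"
  have gx: "graded ?x" and gy: "cograded ?y" using gr by (simp_all add: graded_def cograded_def)
  note gyt = graded_cograded_mult[OF gy gr(3)]
  have term_J: "EV (m * (n + 1)) ?x ?y \<theta> (h_scaled m n (hfill m n J) (gfill m n J) * g_dual_scaled m n (gfill m n J)) =
      of_geven (gec (b_const m n) * ?dX * ?dY) * ((- 1) ^ (\<Sum>J + (card J choose 2)) *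
      (oprod (\<lambda>s. if s \<in> J then \<eta> (s div n) (s mod n) else 1) (m * n) *
       oprod (\<lambda>s. if s \<in> J then 1 else \<zeta> (s div n) (s mod n)) (m * n))) * ?O"
    if J: "J \<subseteq> {..<m * n}" for J
  proof -
    let ?a = "1 / alpha m n (hfill m n J) (gfill m n J) :: 'k"
    let ?g = "1 / gbody (pairing (filling_cotensor (lambda_g m n) (gfill m n J)) (filling_tensor (lambda_g m n) (gfill m n J))) :: 'k"
    let ?kh = "of_nat (kappa n (lambda_h m n) (hfill m n J)) :: 'k"
    let ?NR = "of_nat (card {\<tau> \<in> grid.C (\<lambda>s. s div n) ((m + 1) * n). \<forall>s<(m + 1) * n. s \<in> J \<union> {m * n..<m * n + n} \<longrightarrow> \<tau> s = s}) :: 'k"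
    let ?e = "(- 1) ^ \<Sum>({..<m * n} - J) :: 'k"
    let ?oh = "oprod (\<lambda>s. if s \<in> J then \<eta> (s div n) (s mod n) else 1) (m * n)"
    let ?og = "oprod (\<lambda>s. if s \<in> J then 1 else \<zeta> (s div n) (s mod n)) (m * n)"
    let ?s = "(- 1) ^ (\<Sum>J + (card J choose 2)) :: 'k"
    let ?eh = "gec (of_nat (h_rows m n)) * ?dX * gec ?kh"
    let ?eg = "gec (of_nat (g_columns m n)) * gec ?e * ?dY * gec ?NR"
    have w: "tlen (m * (n + 1)) (filling_tensor (lambda_h m n) (hfill m n J) :: 'k tensor)"
      unfolding filling_tensor_def lambda_h_def
      using tlen_young_left[OF tlen_tword[of "map (\<lambda>x. Vec (hfill m n J x)) (boxes (replicate m (n + 1)))"]]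
      by (simp add: boxes_replicate)
    have "EV (m * (n + 1)) ?x ?y \<theta> (h_scaled m n (hfill m n J) (gfill m n J) * g_dual_scaled m n (gfill m n J)) =
        gconst ?a * ev ?x (filling_tensor (lambda_h m n) (hfill m n J)) *
        (gconst ?g * ev (\<lambda>s b. ?y s b * \<theta> s) (filling_cotensor (lambda_g m n) (gfill m n J)))"
      unfolding h_scaled_def g_dual_scaled_def
      by (subst EV_mult[OF gx gy gr(3) tlen_scal_mult[OF w]])
        (simp only: ev_scal_mult[OF gx] ev_scal_mult[OF gyt])
    also have "\<dots> = of_geven (gec ?a) * (of_geven ?eh * ?oh) * (of_geven (gec ?g) * (of_geven ?eg * ?og * ?O))"
    proof -
      have "ev ?x (filling_tensor (lambda_h m n) (hfill m n J)) = of_geven ?eh * ?oh"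
        unfolding h_rows_def by (rule value_hfill[OF gr(1) odd(1) h_ev h_od])
      moreover have "ev (\<lambda>s b. ?y s b * \<theta> s) (filling_cotensor (lambda_g m n) (gfill m n J)) = of_geven ?eg * ?og * ?O"
        unfolding g_columns_def by (rule value_gfill[OF gr(2,3) odd(2) J g_od g_ev])
      ultimately show ?thesis by (simp only: of_geven_gec)
    qed
    also have "\<dots> = of_geven (gec ?a) * of_geven ?eh * (?oh * (of_geven (gec ?g * ?eg))) * (?og * ?O)"
      by (simp only: mult.assoc of_geven_simps(4))
    also have "?oh * of_geven (gec ?g * ?eg) = of_geven (gec ?g * ?eg) * ?oh"
      by (rule of_geven_commute[symmetric])
    also have "of_geven (gec ?a) * of_geven ?eh * (of_geven (gec ?g * ?eg) * ?oh) * (?og * ?O) =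
        of_geven (gec ?a * ?eh * (gec ?g * ?eg)) * (?oh * ?og) * ?O"
      by (simp only: mult.assoc of_geven_simps(4))
    also have "gec ?a * ?eh * (gec ?g * ?eg) =
        gec (?a * of_nat (h_rows m n) * ?kh * ?g * of_nat (g_columns m n) * ?e * ?NR) * ?dX * ?dY"
      by (simp only: gec_mult mult_ac)
    also have "?a * of_nat (h_rows m n) * ?kh * ?g * of_nat (g_columns m n) * ?e * ?NR = b_const m n * ?s"
      by (rule coefficient_J[OF J])
    also have "gec (b_const m n * ?s) * ?dX * ?dY = gec (b_const m n) * ?dX * ?dY * gec ?s"
      by (simp only: gec_mult mult_ac)
    also have "of_geven (gec (b_const m n) * ?dX * ?dY * gec ?s) = of_geven (gec (b_const m n) * ?dX * ?dY) * (- 1) ^ (\<Sum>J + (card J choose 2))"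
      by (simp only: of_geven_simps(4) of_geven_gec gconst_power gconst_simps)
    finally show ?thesis by (simp only: mult.assoc)
  qed
  have "EV (m * (n + 1)) ?x ?y \<theta> (b_tilde m n) = (\<Sum>(\<phi>, \<psi>)\<in>filling_pairs m n.
      EV (m * (n + 1)) ?x ?y \<theta> (h_scaled m n \<phi> \<psi> * g_dual_scaled m n \<psi>))"
    by (simp add: b_tilde_def EV_sum case_prod_unfold)
  also have "\<dots> = (\<Sum>J\<in>Pow {..<m * n}.
      EV (m * (n + 1)) ?x ?y \<theta> (h_scaled m n (hfill m n J) (gfill m n J) * g_dual_scaled m n (gfill m n J)))"
    using sum.reindex_bij_betw[OF bij_betw_fillings, where g = "\<lambda>(\<phi>, \<psi>).
      EV (m * (n + 1)) ?x ?y \<theta> (h_scaled m n \<phi> \<psi> * g_dual_scaled m n \<psi>)"] by simp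
  also have "\<dots> = of_geven (gec (b_const m n) * ?dX * ?dY) * (\<Sum>J\<in>Pow {..<m * n}. (- 1) ^ (\<Sum>J + (card J choose 2)) *
      (oprod (\<lambda>s. if s \<in> J then \<eta> (s div n) (s mod n) else 1) (m * n) *
       oprod (\<lambda>s. if s \<in> J then 1 else \<zeta> (s div n) (s mod n)) (m * n))) * ?O"
    unfolding sum_distrib_left sum_distrib_right by (rule sum.cong[OF refl], rule term_J) simp
  also have "(\<Sum>J\<in>Pow {..<m * n}. (- 1) ^ (\<Sum>J + (card J choose 2)) *
      (oprod (\<lambda>s. if s \<in> J then \<eta> (s div n) (s mod n) else 1) (m * n) *
       oprod (\<lambda>s. if s \<in> J then 1 else \<zeta> (s div n) (s mod n)) (m * n))) =
      oprod (\<lambda>s. \<eta> (s div n) (s mod n) + \<zeta> (s div n) (s mod n)) (m * n)"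
    by (rule oprod_add_expand[OF odd, symmetric])
  finally show ?thesis .
qed

text \<open>The coordinates, in the notation at the top, of the point \<open>s \<mapsto> z (s div (n + 1))\<close> of \<open>V\<close>
  (with \<open>k\<close> the row of \<open>\<lambda>\<^sub>h\<close>) and of the point \<open>s \<mapsto> z (s mod n)\<close> of \<open>V\<^sup>*\<close> (with \<open>k\<close> the column of
  \<open>\<lambda>\<^sub>g\<close>).\<close>

definition pt_X :: "nat \<Rightarrow> (nat \<Rightarrow> letter \<Rightarrow> 'k grassmann) \<Rightarrow> 'k grassmann mat"
  where "pt_X m z = mat m m (\<lambda>(k, i). z k (Vec (Ev i)))"

definition pt_Xi :: "nat \<Rightarrow> nat \<Rightarrow> (nat \<Rightarrow> letter \<Rightarrow> 'k grassmann) \<Rightarrow> 'k grassmann mat"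
  where "pt_Xi m n z = mat m n (\<lambda>(k, j). z k (Vec (Od j)))"

definition pt_Y :: "nat \<Rightarrow> (nat \<Rightarrow> letter \<Rightarrow> 'k grassmann) \<Rightarrow> 'k grassmann mat"
  where "pt_Y n z = mat n n (\<lambda>(i, k). z k (Cov (Od i)))"

definition pt_y :: "nat \<Rightarrow> nat \<Rightarrow> (nat \<Rightarrow> letter \<Rightarrow> 'k grassmann) \<Rightarrow> 'k grassmann mat"
  where "pt_y m n z = mat m n (\<lambda>(i, k). z k (Cov (Ev i)))"

lemmas pt_defs = pt_X_def pt_Xi_def pt_Y_def pt_y_def

lemma pt_dims [simp]:
  "dim_row (pt_X m z) = m" "dim_col (pt_X m z) = m" "dim_row (pt_Xi m n z) = m" "dim_col (pt_Xi m n z) = n"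
  "dim_row (pt_Y n z) = n" "dim_col (pt_Y n z) = n" "dim_row (pt_y m n z) = m" "dim_col (pt_y m n z) = n"
  by (simp_all add: pt_defs)

lemma pt_carrier: "pt_X m z \<in> carrier_mat m m" "pt_Xi m n z \<in> carrier_mat m n"
  "pt_Y n z \<in> carrier_mat n n" "pt_y m n z \<in> carrier_mat m n"
  by (simp_all add: carrier_matI)

lemma pt_grade:
  "graded z \<Longrightarrow> mat_grade 0 (pt_X m z)" "graded z \<Longrightarrow> mat_grade 1 (pt_Xi m n z)"
  "cograded z' \<Longrightarrow> mat_grade 0 (pt_Y n z')" "cograded z' \<Longrightarrow> mat_grade 1 (pt_y m n z')"
  by (auto simp: mat_grade_def graded_def cograded_def pt_defs) (metis is_odd.simps letter_odd.simps of_bool_eq One_nat_def)+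

text \<open>With \<eta> = X^-1 \<xi> and \<zeta> = y Y^-1 one has p = X (\<eta> + \<zeta>) Y, so the
  product of the entries of p absorbs the n-th power of det X and the m-th power of det Y, and one
  power of each is left.\<close>

lemma EV_b_tilde:
  fixes z z' :: "nat \<Rightarrow> letter \<Rightarrow> 'k::field_char_0 grassmann"
  assumes gr: "graded z" "cograded z'" "odd_params \<theta>"
    and det: "det (map_mat gbody (pt_X m z)) \<noteq> 0" "det (map_mat gbody (pt_Y n z')) \<noteq> 0"
  shows "EV (m * (n + 1)) (\<lambda>s. z (s div (n + 1))) (\<lambda>s. z' (s mod n)) \<theta> (b_tilde m n) =
    gconst (b_const m n) * (det_even (pt_X m z) * det_even (pt_Y n z') *
      oprod (\<lambda>s. (pt_X m z * pt_y m n z' + pt_Xi m n z * pt_Y n z') $$ (s div n, s mod n)) (m * n)) *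
    oprod \<theta> ((m + 1) * n)"
proof -
  interpret G: grid "\<lambda>s. s div n" "\<lambda>s. s mod n" m n "m * n" by (rule grid_rows)
  interpret F: grid "\<lambda>s. s mod n" "\<lambda>s. s div n" n m "m * n" by (rule grid_columns)
  let ?X = "pt_X m z" and ?\<xi> = "pt_Xi m n z" and ?Y = "pt_Y n z'" and ?y = "pt_y m n z'"
  note gX = pt_grade(1)[OF gr(1), of m] and g\<xi> = pt_grade(2)[OF gr(1), of m n]
    and gY = pt_grade(3)[OF gr(2), of n] and gy = pt_grade(4)[OF gr(2), of m n]
  obtain Xi where Xi: "Xi \<in> carrier_mat m m" "mat_grade 0 Xi" "?X * Xi = 1\<^sub>m m"
    by (rule body_det_inverse[OF gX pt_carrier(1) det(1)])
  obtain Yi where Yi: "Yi \<in> carrier_mat n n" "mat_grade 0 Yi" "Yi * ?Y = 1\<^sub>m n"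
    by (rule body_det_inverse[OF gY pt_carrier(3) det(2)])
  note d [simp] = carrier_matD[OF Xi(1)] carrier_matD[OF Yi(1)]
  define H where "H = Xi * ?\<xi>"
  define Z where "Z = ?y * Yi"
  have dHZ [simp]: "dim_row H = m" "dim_col H = n" "dim_row Z = m" "dim_col Z = n" by (simp_all add: H_def Z_def)
  have gH: "mat_grade 1 H" unfolding H_def by (rule mat_grade_mult[OF Xi(2) g\<xi>]) simp_all
  have gZ: "mat_grade 1 Z" unfolding Z_def by (rule mat_grade_mult[OF gy Yi(2)]) simp_all
  have XH: "?X * H = ?\<xi>" unfolding H_def by (simp add: mat_ring_simps(1)[symmetric] Xi(3) mat_ring_simps)
  have ZY: "Z * ?Y = ?y" unfolding Z_def by (simp add: mat_ring_simps Yi(3))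
  \<comment> \<open>The value 0 outside the matrix makes the entries odd for all indices, as the
    lemmas on grids require.\<close>
  define \<eta> where "\<eta> i j = (if i < m \<and> j < n then H $$ (i, j) else 0)" for i j
  define \<zeta> where "\<zeta> i j = (if i < m \<and> j < n then Z $$ (i, j) else 0)" for i j
  have odd: "\<eta> i j \<in> G_grade 1" "\<zeta> i j \<in> G_grade 1" for i j
    using mat_gradeD[OF gH] mat_gradeD[OF gZ] by (auto simp: \<eta>_def \<zeta>_def)
  define Xf where "Xf k i = Geven (z k (Vec (Ev i)))" for k i
  define Yf where "Yf i k = Geven (z' k (Cov (Od i)))" for i k
  have Xf: "of_geven (Xf k i) = z k (Vec (Ev i))" for k i
    using gradedD[OF gr(1), of k "Vec (Ev i)"] by (simp add: Xf_def of_geven_Geven)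
  have Yf: "of_geven (Yf i k) = z' k (Cov (Od i))" for k i
    using gr(2)[unfolded cograded_def, rule_format, of k "Cov (Od i)"] by (simp add: Yf_def of_geven_Geven)
  have h_od: "z k (Vec (Od j)) = (\<Sum>i<m. of_geven (Xf k i) * \<eta> i j)" if "k < m" "j < n" for k j
  proof -
    have "z k (Vec (Od j)) = (?X * H) $$ (k, j)" using that by (simp add: XH pt_Xi_def)
    also have "\<dots> = (\<Sum>i<m. of_geven (Xf k i) * \<eta> i j)"
      using that by (subst index_mult_mat_sum) (simp_all add: \<eta>_def Xf pt_X_def)
    finally show ?thesis .
  qed
  have g_ev: "z' k (Cov (Ev i)) = (\<Sum>a<n. of_geven (Yf a k) * \<zeta> i a)" if "k < n" "i < m" for k i
  proof -
    have "z' k (Cov (Ev i)) = (Z * ?Y) $$ (i, k)" using that by (simp add: ZY pt_y_def)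
    also have "\<dots> = (\<Sum>a<n. \<zeta> i a * of_geven (Yf a k))"
      using that by (subst index_mult_mat_sum) (simp_all add: \<zeta>_def Yf pt_Y_def)
    also have "\<dots> = (\<Sum>a<n. of_geven (Yf a k) * \<zeta> i a)" by (simp only: of_geven_commute)
    finally show ?thesis .
  qed
  define w where "w i j = \<eta> i j + \<zeta> i j" for i j
  have w: "w i j \<in> G_grade 1" for i j unfolding w_def by (intro G_grade_add odd)
  \<comment> \<open>The substitution is made in two steps, with X along the columns and with Y along
    the rows; each is an instance of \<open>oprod_linear_odd\<close> on one of the two
    grids.\<close>
  define q where "q i j = (\<Sum>a<n. of_geven (Yf a j) * w i a)" for i j
  have q: "q i j \<in> G_grade 1" for i j
    unfolding q_def by (rule G_grade_sum) (metis G_grade_mult[OF of_geven_grade w] add_0 even_zero)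
  have p: "(?X * ?y + ?\<xi> * ?Y) $$ (i, j) = (\<Sum>k<m. of_geven (Xf i k) * q k j)" if "i < m" "j < n" for i j
  proof -
    have "?X * ?y + ?\<xi> * ?Y = ?X * ((H + Z) * ?Y)"
      by (simp only: ZY[symmetric]) (simp add: XH[symmetric] mat_ring_simps, rule comm_add_mat[of _ m n], auto intro!: carrier_matI)
    also have "\<dots> $$ (i, j) = (\<Sum>k<m. ?X $$ (i, k) * ((H + Z) * ?Y) $$ (k, j))"
      using that by (subst index_mult_mat_sum) simp_all
    also have "\<dots> = (\<Sum>k<m. of_geven (Xf i k) * q k j)"
    proof (rule sum.cong[OF refl], rule arg_cong2[where f = "(*)"])
      fix k assume "k \<in> {..<m}"
      then have k: "k < m" by simp
      show "?X $$ (i, k) = of_geven (Xf i k)" using k that by (simp add: Xf pt_X_def)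
      have "((H + Z) * ?Y) $$ (k, j) = (\<Sum>a<n. w k a * of_geven (Yf a j))"
        using k that by (subst index_mult_mat_sum) (simp_all add: w_def \<eta>_def \<zeta>_def Yf pt_Y_def)
      then show "((H + Z) * ?Y) $$ (k, j) = q k j" by (simp only: q_def of_geven_commute)
    qed
    finally show ?thesis .
  qed
  let ?dX = "det (mat m m (\<lambda>(i, j). Xf i j))" and ?dY = "det (mat n n (\<lambda>(i, j). Yf j i))"
  have "oprod (\<lambda>s. (?X * ?y + ?\<xi> * ?Y) $$ (s div n, s mod n)) (m * n) =
      oprod (\<lambda>s. \<Sum>k<m. of_geven (Xf (s div n) k) * q k (s mod n)) (m * n)"
    by (rule oprod_cong[OF refl]) (simp only: p slot_coords)
  also have "\<dots> = of_geven (?dX ^ n) * oprod (\<lambda>s. q (s div n) (s mod n)) (m * n)"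
    unfolding G.D_eq_det[symmetric] by (rule G.oprod_linear_odd[OF q])
  also have "oprod (\<lambda>s. q (s div n) (s mod n)) (m * n) =
      oprod (\<lambda>s. \<Sum>a<n. of_geven ((\<lambda>j a. Yf a j) (s mod n) a) * (\<lambda>a i. w i a) a (s div n)) (m * n)"
    by (simp only: q_def)
  also have "\<dots> = of_geven (?dY ^ m) * oprod (\<lambda>s. w (s div n) (s mod n)) (m * n)"
    using F.oprod_linear_odd[of "\<lambda>a i. w i a" "\<lambda>j a. Yf a j", OF w] by (simp only: F.D_eq_det)
  finally have P: "oprod (\<lambda>s. (?X * ?y + ?\<xi> * ?Y) $$ (s div n, s mod n)) (m * n) =
      of_geven (?dX ^ n) * (of_geven (?dY ^ m) * oprod (\<lambda>s. w (s div n) (s mod n)) (m * n))" .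
  have "map_mat Geven ?X = mat m m (\<lambda>(i, j). Xf i j)" by (rule eq_matI) (simp_all add: pt_X_def Xf_def)
  then have dX: "det_even ?X = of_geven ?dX" by (simp only: det_even_def)
  have "map_mat Geven ?Y = transpose_mat (mat n n (\<lambda>(i, j). Yf j i))"
    by (rule eq_matI) (simp_all add: pt_Y_def Yf_def)
  then have dY: "det_even ?Y = of_geven ?dY"
    using det_transpose[of "mat n n (\<lambda>(i, j). Yf j i)" n] by (simp only: det_even_def mat_carrier)
  have "EV (m * (n + 1)) (\<lambda>s. z (s div (n + 1))) (\<lambda>s. z' (s mod n)) \<theta> (b_tilde m n) =
    of_geven (gec (b_const m n) * ?dX ^ (n + 1) * ?dY ^ (m + 1)) *
    oprod (\<lambda>s. \<eta> (s div n) (s mod n) + \<zeta> (s div n) (s mod n)) (m * n) * oprod \<theta> ((m + 1) * n)"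
    by (rule EV_b_tilde_factors[OF gr odd Xf[symmetric] h_od Yf[symmetric] g_ev])
  also have "gec (b_const m n) * ?dX ^ (n + 1) * ?dY ^ (m + 1) = gec (b_const m n) * (?dX * ?dY * (?dX ^ n * ?dY ^ m))"
    by (simp add: mult_ac)
  finally show ?thesis
    unfolding P dX dY of_geven_gec[symmetric] w_def[symmetric] by (simp only: of_geven_simps(4) mult.assoc)
qed

section \<open>Transformation of points and of the value of \<open>b_tilde\<close>\<close>

lemma act_x_graded:
  assumes "\<A> \<in> GL m n" "graded x"
  shows "graded (\<lambda>s. act_x m n \<A> (x s))"
  unfolding graded_def
proof (intro allI)
  fix s b
  show "act_x m n \<A> (x s) b \<in> G_grade (of_bool (letter_odd b))"
  proof (cases b)
    case (Vec c)
    show ?thesis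
    proof (cases "c \<in> Omega m n")
      case True
      note ti = theta_index[OF True]
      have "x s (Vec (theta m i)) * matrix_of m n \<A> $$ (i, theta_index m c) \<in> G_grade (of_bool (is_odd c))"
        if "i < m + n" for i
      proof -
        have "x s (Vec (theta m i)) \<in> G_grade (of_bool (m \<le> i))"
          using gradedD[OF assms(2), of s "Vec (theta m i)"] by (simp add: theta_def split: if_splits)
        then have "x s (Vec (theta m i)) * matrix_of m n \<A> $$ (i, theta_index m c) \<in>
            G_grade (of_bool (m \<le> i) + (of_bool (m \<le> i) + of_bool (m \<le> theta_index m c)))"
          using matrix_of_parity[OF assms(1) that, of "theta_index m c"] ti by (intro G_grade_mult) simp_all
        also have "G_grade (of_bool (m \<le> i) + (of_bool (m \<le> i) + of_bool (m \<le> theta_index m c))) =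
            (G_grade (of_bool (is_odd c)) :: 'a grassmann set)"
          using True by (intro G_grade_parity) (auto simp: Omega_def)
        finally show ?thesis .
      qed
      then show ?thesis unfolding Vec act_x_def letter.case letter_odd.simps if_P[OF True] by (intro G_grade_sum) simp
    qed (simp add: Vec act_x_def)
  qed (simp add: act_x_def)
qed

lemma mat_inv_parity:
  fixes \<A> :: "'k::field_char_0 tensor \<Rightarrow> 'k tensor"
  assumes \<A>: "\<A> \<in> GL m n" and ij: "i < m + n" "j < m + n"
  shows "mat_inv (matrix_of m n \<A>) $$ (i, j) \<in> G_grade (of_bool (m \<le> i) + of_bool (m \<le> j))"
proof -
  have M: "matrix_of m n \<A> \<in> carrier_mat (m + n) (m + n)" by (simp add: matrix_of_def)
  obtain N where N: "N \<in> carrier_mat (m + n) (m + n)" "matrix_of m n \<A> * N = 1\<^sub>m (m + n)" "N * matrix_of m n \<A> = 1\<^sub>m (m + n)"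
    by (rule GL_inverse_matrix[OF \<A>])
  show ?thesis
    unfolding mat_inv_eq[OF M N] by (rule super_matrix_inverse_parity[OF M matrix_of_parity[OF \<A>] N ij])
qed

lemma act_y_cograded:
  fixes \<A> :: "'k::field_char_0 tensor \<Rightarrow> 'k tensor"
  assumes "\<A> \<in> GL m n" "cograded y"
  shows "cograded (\<lambda>s. act_y m n \<A> (y s))"
  unfolding cograded_def
proof (intro allI)
  fix s b
  show "act_y m n \<A> (y s) b \<in> G_grade (of_bool (\<not> letter_odd b))"
  proof (cases b)
    case (Cov c)
    show ?thesis
    proof (cases "c \<in> Omega m n")
      case True
      note ti = theta_index[OF True]
      have "mat_inv (matrix_of m n \<A>) $$ (theta_index m c, j) * y s (Cov (theta m j)) \<in> G_grade (of_bool (\<not> is_odd c))"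
        if "j < m + n" for j
      proof -
        have "y s (Cov (theta m j)) \<in> G_grade (of_bool (\<not> m \<le> j))"
          using assms(2)[unfolded cograded_def, rule_format, of s "Cov (theta m j)"]
          by (simp add: theta_def split: if_splits)
        then have "mat_inv (matrix_of m n \<A>) $$ (theta_index m c, j) * y s (Cov (theta m j)) \<in>
            G_grade (of_bool (m \<le> theta_index m c) + of_bool (m \<le> j) + of_bool (\<not> m \<le> j))"
          using mat_inv_parity[OF assms(1) _ that, of "theta_index m c"] ti by (intro G_grade_mult) simp_all
        also have "G_grade (of_bool (m \<le> theta_index m c) + of_bool (m \<le> j) + of_bool (\<not> m \<le> j)) =
            (G_grade (of_bool (\<not> is_odd c)) :: 'k grassmann set)"
          using True by (intro G_grade_parity) (auto simp: Omega_def)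
        finally show ?thesis .
      qed
      then show ?thesis unfolding Cov act_y_def letter.case letter_odd.simps if_P[OF True] by (intro G_grade_sum) simp
    qed (simp add: Cov act_y_def)
  qed (simp add: act_y_def)
qed

lemma sum_lessThan_add:
  fixes m n :: nat
  shows "(\<Sum>i<m + n. f i) = (\<Sum>i<m. f i) + (\<Sum>j<n. f (m + j) :: 'a::comm_monoid_add)"
  by (induction n) (simp_all add: add.assoc)

lemma act_points:
  assumes S: "super_inverse m n A11 A12 A21 A22 B11 B12 B21 B22"
    and A: "matrix_of m n \<A> = four_block_mat A11 A12 A21 A22" and B: "mat_inv (matrix_of m n \<A>) = four_block_mat B11 B12 B21 B22"
  shows "pt_X m (\<lambda>k. act_x m n \<A> (z k)) = pt_X m z * A11 + pt_Xi m n z * A21"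
    and "pt_Xi m n (\<lambda>k. act_x m n \<A> (z k)) = pt_X m z * A12 + pt_Xi m n z * A22"
    and "pt_y m n (\<lambda>k. act_y m n \<A> (z' k)) = B11 * pt_y m n z' + B12 * pt_Y n z'"
    and "pt_Y n (\<lambda>k. act_y m n \<A> (z' k)) = B21 * pt_y m n z' + B22 * pt_Y n z'"
proof -
  interpret super_inverse m n A11 A12 A21 A22 B11 B12 B21 B22 by (rule S)
  show "pt_X m (\<lambda>k. act_x m n \<A> (z k)) = pt_X m z * A11 + pt_Xi m n z * A21"
    by (rule eq_matI) (simp_all add: pt_X_def pt_Xi_def act_x_def A Omega_def sum_lessThan_add theta_def
        index_mult_mat_sum del: index_mult_mat(1))
  show "pt_Xi m n (\<lambda>k. act_x m n \<A> (z k)) = pt_X m z * A12 + pt_Xi m n z * A22"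
    by (rule eq_matI) (simp_all add: pt_X_def pt_Xi_def act_x_def A Omega_def sum_lessThan_add theta_def
        index_mult_mat_sum del: index_mult_mat(1))
  show "pt_y m n (\<lambda>k. act_y m n \<A> (z' k)) = B11 * pt_y m n z' + B12 * pt_Y n z'"
    by (rule eq_matI) (simp_all add: pt_y_def pt_Y_def act_y_def B Omega_def sum_lessThan_add theta_def
        index_mult_mat_sum del: index_mult_mat(1))
  show "pt_Y n (\<lambda>k. act_y m n \<A> (z' k)) = B21 * pt_y m n z' + B22 * pt_Y n z'"
    by (rule eq_matI) (simp_all add: pt_y_def pt_Y_def act_y_def B Omega_def sum_lessThan_add theta_def
        index_mult_mat_sum del: index_mult_mat(1))
qed

lemma EV_transform:
  fixes z z' :: "nat \<Rightarrow> letter \<Rightarrow> 'k::field_char_0 grassmann"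
  assumes \<A>: "\<A> \<in> GL m n" and gr: "graded z" "cograded z'" "odd_params \<theta>"
    and det: "det (map_mat gbody (pt_X m z)) \<noteq> 0" "det (map_mat gbody (pt_Y n z')) \<noteq> 0"
    and b: "(b_tilde m n :: 'k tensor) \<in> mixed_tensors m n (m * (n + 1)) ((m + 1) * n)"
  shows "EV (m * (n + 1)) (\<lambda>s. z (s div (n + 1))) (\<lambda>s. z' (s mod n)) \<theta> (GL_act m n \<A> (b_tilde m n)) =
    EV (m * (n + 1)) (\<lambda>s. z (s div (n + 1))) (\<lambda>s. z' (s mod n)) \<theta> (scal (Ber m (matrix_of m n \<A>)) * b_tilde m n)"
proof -
  obtain A11 A12 A21 A22 B11 B12 B21 B22 where S: "super_inverse m n A11 A12 A21 A22 B11 B12 B21 B22"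
    and A: "matrix_of m n \<A> = four_block_mat A11 A12 A21 A22" and B: "mat_inv (matrix_of m n \<A>) = four_block_mat B11 B12 B21 B22"
    by (rule GL_blocks[OF \<A>])
  let ?X = "pt_X m z" and ?\<xi> = "pt_Xi m n z" and ?Y = "pt_Y n z'" and ?y = "pt_y m n z'"
  let ?z = "\<lambda>k. act_x m n \<A> (z k)" and ?z' = "\<lambda>k. act_y m n \<A> (z' k)"
  let ?O = "oprod \<theta> ((m + 1) * n)" and ?P = "oprod (\<lambda>s. (?X * ?y + ?\<xi> * ?Y) $$ (s div n, s mod n)) (m * n)"
  let ?c = "gconst (b_const m n) :: 'k grassmann" and ?B = "Ber m (matrix_of m n \<A>)"
  have gx: "graded (\<lambda>s. z (s div (n + 1)))" and gy: "cograded (\<lambda>s. z' (s mod n))"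
    using gr by (simp_all add: graded_def cograded_def)
  note gX = pt_carrier(1)[of m z] pt_grade(1)[OF gr(1), of m] pt_carrier(2)[of m n z] pt_grade(2)[OF gr(1), of m n]
    and gY = pt_carrier(3)[of n z'] pt_grade(3)[OF gr(2), of n] pt_carrier(4)[of m n z'] pt_grade(4)[OF gr(2), of m n]
  note pts = act_points(1,2)[OF S A B, of z] act_points(3,4)[OF S A B, of z']
  have det': "det (map_mat gbody (pt_X m ?z)) \<noteq> 0" "det (map_mat gbody (pt_Y n ?z')) \<noteq> 0"
    unfolding pts by (rule super_inverse.transform_body[OF S gX gY det])+
  have "EV (m * (n + 1)) (\<lambda>s. z (s div (n + 1))) (\<lambda>s. z' (s mod n)) \<theta> (GL_act m n \<A> (b_tilde m n)) =
      EV (m * (n + 1)) (\<lambda>s. ?z (s div (n + 1))) (\<lambda>s. ?z' (s mod n)) \<theta> (b_tilde m n)"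
    by (rule EV_GL_act[OF \<A> b gx gy gr(3)])
  also have "\<dots> = ?c * (det_even (pt_X m ?z) * det_even (pt_Y n ?z') *
      oprod (\<lambda>s. (pt_X m ?z * pt_y m n ?z' + pt_Xi m n ?z * pt_Y n ?z') $$ (s div n, s mod n)) (m * n)) * ?O"
    by (rule EV_b_tilde[OF act_x_graded[OF \<A> gr(1)] act_y_cograded[OF \<A> gr(2)] gr(3) det'])
  also have "\<dots> = ?c * (?B * (det_even ?X * det_even ?Y * ?P)) * ?O"
    unfolding pts super_inverse.transform(1)[OF S gX gY det(1)] super_inverse.transform(2)[OF S gX gY det(1)] A ..
  also have "\<dots> = ?B * (?c * (det_even ?X * det_even ?Y * ?P) * ?O)"
    by (simp only: mult.assoc[symmetric] gconst_commute[of _ ?B])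
  also have "\<dots> = EV (m * (n + 1)) (\<lambda>s. z (s div (n + 1))) (\<lambda>s. z' (s mod n)) \<theta> (scal ?B * b_tilde m n)"
    by (simp only: EV_scal_mult[OF gx gy gr(3)] EV_b_tilde[OF gr det])
  finally show ?thesis .
qed

section \<open>Tensors with constant coefficients\<close>

text \<open>Coefficients in the ground field are even, and they are invertible when nonzero. This
  gives the parity of \<open>b_tilde\<close> and the freeness of the module it generates.\<close>

definition const_tensors :: "(letter list \<Rightarrow> bool) \<Rightarrow> 'k::comm_ring_1 tensor set"
  where "const_tensors Q = {x. \<forall>w. tcoeff x w \<noteq> 0 \<longrightarrow> Q w \<and> tcoeff x w \<in> range gconst}"

lemma gconst_zero_range: "0 \<in> range gconst"
  by (metis gconst_simps(1) rangeI)

lemma const_tensors_coeff: "x \<in> const_tensors Q \<Longrightarrow> tcoeff x w \<in> range gconst"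
  using gconst_zero_range by (cases "tcoeff x w = 0") (auto simp: const_tensors_def)

lemma const_tensors_add:
  assumes "x \<in> const_tensors Q" "y \<in> const_tensors Q"
  shows "x + y \<in> const_tensors Q"
proof -
  have "tcoeff (x + y) w \<in> range gconst" for w
    using const_tensors_coeff[OF assms(1), of w] const_tensors_coeff[OF assms(2), of w]
    by (auto simp flip: gconst_simps)
  moreover have "Q w" if "tcoeff (x + y) w \<noteq> 0" for w
    using that assms by (cases "tcoeff x w = 0") (auto simp: const_tensors_def)
  ultimately show ?thesis by (simp add: const_tensors_def)
qed

lemma const_tensors_sum: "(\<And>i. i \<in> I \<Longrightarrow> f i \<in> const_tensors Q) \<Longrightarrow> sum f I \<in> const_tensors Q"
  by (induction I rule: infinite_finite_induct) (auto intro!: const_tensors_add, simp_all add: const_tensors_def)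

lemma ginvol_funpow_gconst: "(ginvol ^^ k) (gconst c) = gconst c"
  using ginvol_funpow_grade[of "gconst c" 0 k] by simp

lemma const_tensors_scal:
  assumes "x \<in> const_tensors Q"
  shows "scal (gconst c) * x \<in> const_tensors Q"
  unfolding const_tensors_def mem_Collect_eq
proof (intro allI impI)
  fix w assume "tcoeff (scal (gconst c) * x) w \<noteq> 0"
  then have "tcoeff x w \<noteq> 0" by (auto simp: tcoeff_scal_mult)
  then obtain d where "Q w" "tcoeff x w = gconst d" using assms by (auto simp: const_tensors_def)
  then show "Q w \<and> tcoeff (scal (gconst c) * x) w \<in> range gconst"
    by (auto simp: tcoeff_scal_mult ginvol_funpow_gconst simp flip: gconst_simps)
qed

lemma const_tensors_sign: "x \<in> const_tensors Q \<Longrightarrow> (- 1) ^ q * x \<in> const_tensors Q"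
  using const_tensors_scal[of x Q "(- 1) ^ q"] by (simp only: sign_eq_scal gconst_power gconst_simps)

lemma const_tensors_of_int: "x \<in> const_tensors Q \<Longrightarrow> of_int k * x \<in> const_tensors Q"
  using const_tensors_scal[of x Q "of_int k"] by (simp only: of_int_eq_scal)

lemma const_tensors_tword: "Q w \<Longrightarrow> tword w \<in> const_tensors Q"
  by (auto simp: const_tensors_def tcoeff_tword split: if_splits) (metis gconst_simps(2) rangeI)

lemma const_tensors_mono: "x \<in> const_tensors Q \<Longrightarrow> (\<And>w. Q w \<Longrightarrow> Q' w) \<Longrightarrow> x \<in> const_tensors Q'"
  by (simp add: const_tensors_def)

lemma const_tensors_mult:
  assumes "x \<in> const_tensors Q" "y \<in> const_tensors Q'"
  shows "x * y \<in> const_tensors (\<lambda>w. \<exists>u v. w = u @ v \<and> Q u \<and> Q' v)"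
proof -
  have "x * y = (\<Sum>u\<in>tsupp x. tword u * scal (tcoeff x u)) * (\<Sum>v\<in>tsupp y. tword v * scal (tcoeff y v))"
    by (simp flip: tensor_expand)
  also have "\<dots> = (\<Sum>u\<in>tsupp x. \<Sum>v\<in>tsupp y. tword (u @ v) * scal ((ginvol ^^ nodd v) (tcoeff x u) * tcoeff y v))"
    by (simp only: sum_product tword_scal_mult)
  also have "\<dots> \<in> const_tensors (\<lambda>w. \<exists>u v. w = u @ v \<and> Q u \<and> Q' v)"
  proof (intro const_tensors_sum)
    fix u v assume uv: "u \<in> tsupp x" "v \<in> tsupp y"
    obtain c d where cd: "tcoeff x u = gconst c" "tcoeff y v = gconst d" "Q u" "Q' v"
      using assms uv unfolding const_tensors_def tsupp_iff by blast
    have eq: "(ginvol ^^ nodd v) (tcoeff x u) * tcoeff y v = gconst (c * d)"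
      by (simp add: cd ginvol_funpow_gconst)
    show "tword (u @ v) * scal ((ginvol ^^ nodd v) (tcoeff x u) * tcoeff y v) \<in>
        const_tensors (\<lambda>w. \<exists>u v. w = u @ v \<and> Q u \<and> Q' v)"
      unfolding eq using cd(3,4) by (auto simp: const_tensors_def tcoeff_tword_scal simp del: gconst_simps split: if_splits)
  qed
  finally show ?thesis .
qed

lemma mset_permuted_word:
  assumes "\<sigma> permutes {..<length w}"
  shows "mset (map (\<lambda>k. w ! \<sigma> k) [0..<length w]) = mset w"
  using mset_permute_list[OF assms] by (simp add: permute_list_def)

lemma const_tensors_young:
  assumes w: "Q w" "length w = r * c" and Q: "\<And>v. mset v = mset w \<Longrightarrow> Q v"
  shows "young_left (replicate r c) (tword w) \<in> const_tensors Q"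
    and "young_right (replicate r c) (tword w) \<in> const_tensors Q"
proof -
  interpret G: grid "\<lambda>s. s div c" "\<lambda>s. s mod c" r c "r * c" by (rule grid_rows)
  interpret F: grid "\<lambda>s. s mod c" "\<lambda>s. s div c" c r "r * c" by (rule grid_columns)
  have perm: "\<tau> \<circ> \<sigma> permutes {..<length w}" if "\<sigma> \<in> G.C" "\<tau> \<in> F.C" for \<sigma> \<tau>
    unfolding w(2) using that by (intro permutes_compose[OF G.C_permutes F.C_permutes])
  show "young_left (replicate r c) (tword w) \<in> const_tensors Q"
    unfolding young_left_def column_stabilizer_eq row_stabilizer_eq perm_left_def lin_ext_tword
    by (intro const_tensors_sum const_tensors_of_int const_tensors_sign const_tensors_tword Q
        mset_permuted_word permutes_inv perm)
  show "young_right (replicate r c) (tword w) \<in> const_tensors Q"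
    unfolding young_right_def column_stabilizer_eq row_stabilizer_eq perm_right_def lin_ext_tword
    by (intro const_tensors_sum const_tensors_of_int const_tensors_sign const_tensors_tword Q
        mset_permuted_word perm)
qed

lemma nodd_mset: "mset v = mset w \<Longrightarrow> nodd v = nodd w"
  unfolding nodd_def by (metis mset_filter size_mset)

definition vec_word :: "nat \<Rightarrow> nat \<Rightarrow> nat \<Rightarrow> nat \<Rightarrow> letter list \<Rightarrow> bool"
  where "vec_word m n l k w \<longleftrightarrow> set w \<subseteq> Vec ` Omega m n \<and> length w = l \<and> nodd w = k"

definition cov_word :: "nat \<Rightarrow> nat \<Rightarrow> nat \<Rightarrow> nat \<Rightarrow> letter list \<Rightarrow> bool"
  where "cov_word m n l k w \<longleftrightarrow> set w \<subseteq> Cov ` Omega m n \<and> length w = l \<and> nodd w = k"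

text \<open>The parity is that of n: the word of h has |J| odd letters and that of the dual of g has
  |J| + n, the last row being odd.\<close>

definition b_word :: "nat \<Rightarrow> nat \<Rightarrow> letter list \<Rightarrow> bool"
  where "b_word m n w \<longleftrightarrow> (\<exists>us vs. w = map Vec us @ map Cov vs \<and> set us \<subseteq> Omega m n \<and> set vs \<subseteq> Omega m n \<and>
    length us = m * (n + 1) \<and> length vs = (m + 1) * n) \<and> even (nodd w + n)"

lemma filling_tensor_const:
  assumes J: "J \<subseteq> {..<m * n}"
  shows "filling_tensor (lambda_h m n) (hfill m n J) \<in> const_tensors (vec_word m n (m * (n + 1)) (card J))"
    and "filling_cotensor (lambda_g m n) (gfill m n J) \<in> const_tensors (cov_word m n ((m + 1) * n) (card J + n))"
proof -
  let ?w = "map (\<lambda>x. Vec (hfill m n J x)) (boxes (replicate m (n + 1)))"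
  let ?v = "map (\<lambda>x. Cov (gfill m n J x)) (boxes (replicate (m + 1) n))"
  have fin: "finite J" using J finite_subset by blast
  have lw: "length ?w = m * (n + 1)" by (simp add: boxes_replicate)
  have lv: "length ?v = (m + 1) * n" unfolding boxes_replicate by simp
  have enc: "(q * k + r) div k = q" "(q * k + r) mod k = r" if "r < k" for q r k :: nat
    using that by simp_all
  \<comment> \<open>The map converts the number of a box in the small rectangle into its number in
    \<lambda>_h.\<close>
  have "{s. s < m * (n + 1) \<and> is_odd (hfill m n J (s div (n + 1), s mod (n + 1)))} =
      (\<lambda>s. s div n * (n + 1) + s mod n) ` J"
  proof (intro equalityI subsetI)
    fix s assume "s \<in> {s. s < m * (n + 1) \<and> is_odd (hfill m n J (s div (n + 1), s mod (n + 1)))}"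
    then have s: "s < m * (n + 1)" "is_odd (hfill m n J (s div (n + 1), s mod (n + 1)))" by auto
    note c = slot_coords[OF s(1)]
    from s c have *: "s mod (n + 1) < n" "s div (n + 1) * n + s mod (n + 1) \<in> J"
      by (simp_all add: hfill_def split: if_splits)
    have "s = (s div (n + 1) * n + s mod (n + 1)) div n * (n + 1) + (s div (n + 1) * n + s mod (n + 1)) mod n"
    proof -
      have "(s div (n + 1) * n + s mod (n + 1)) div n = s div (n + 1)"
        "(s div (n + 1) * n + s mod (n + 1)) mod n = s mod (n + 1)"
        using *(1) by simp_all
      then show ?thesis by (simp only: div_mult_mod_eq)
    qed
    then show "s \<in> (\<lambda>s. s div n * (n + 1) + s mod n) ` J" using *(2) by blast
  next
    fix s assume "s \<in> (\<lambda>s. s div n * (n + 1) + s mod n) ` J"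
    then obtain t where t: "t \<in> J" "s = t div n * (n + 1) + t mod n" by blast
    have "t < m * n" using t J by auto
    note c = slot_coords[OF this]
    have r: "t mod n < n + 1" using c(2) by simp
    have "s div (n + 1) = t div n" "s mod (n + 1) = t mod n" "s < m * (n + 1)"
      unfolding t(2) by (rule enc[OF r] slot_less[OF c(1) r])+
    then show "s \<in> {s. s < m * (n + 1) \<and> is_odd (hfill m n J (s div (n + 1), s mod (n + 1)))}"
      using t c by (simp add: hfill_def)
  qed
  moreover have "inj_on (\<lambda>s. s div n * (n + 1) + s mod n) J"
  proof (rule inj_onI)
    fix s t assume st: "s \<in> J" "t \<in> J" "s div n * (n + 1) + s mod n = t div n * (n + 1) + t mod n"
    have lt: "s < m * n" "t < m * n" using st J by auto
    have d: "(x div n * (n + 1) + x mod n) div (n + 1) = x div n" "(x div n * (n + 1) + x mod n) mod (n + 1) = x mod n"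
      if "x < m * n" for x using enc[of "x mod n" "n + 1" "x div n"] slot_coords(2)[OF that] by linarith+
    have "s div n = t div n" "s mod n = t mod n" using d[OF lt(1)] d[OF lt(2)] unfolding st(3) by simp_all
    then show "s = t" by (metis div_mult_mod_eq)
  qed
  ultimately have "card {s. s < m * (n + 1) \<and> is_odd (hfill m n J (s div (n + 1), s mod (n + 1)))} = card J"
    by (simp add: card_image)
  moreover have "{i. i < length ?w \<and> letter_odd (?w ! i)} =
      {s. s < m * (n + 1) \<and> is_odd (hfill m n J (s div (n + 1), s mod (n + 1)))}"
    by (auto simp: boxes_replicate)
  ultimately have nw: "nodd ?w = card J" by (simp only: nodd_eq_card)
  have "card {s. s < (m + 1) * n \<and> is_odd (gfill m n J (s div n, s mod n))} = card J + n"
    unfolding odd_boxes_gfill[OF J] using fin J by (subst card_Un_disjoint) auto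
  moreover have "{i. i < length ?v \<and> letter_odd (?v ! i)} = {s. s < (m + 1) * n \<and> is_odd (gfill m n J (s div n, s mod n))}"
    unfolding boxes_replicate by auto
  ultimately have nv: "nodd ?v = card J + n" by (simp only: nodd_eq_card)
  have sw: "set ?w \<subseteq> Vec ` Omega m n" "set ?v \<subseteq> Cov ` Omega m n"
    unfolding set_map boxes_rectangle by (auto simp: hfill_def gfill_def Omega_def)
  show "filling_tensor (lambda_h m n) (hfill m n J) \<in> const_tensors (vec_word m n (m * (n + 1)) (card J))"
    unfolding filling_tensor_def lambda_h_def
  proof (rule const_tensors_young(1)[OF _ lw])
    show *: "vec_word m n (m * (n + 1)) (card J) ?w" unfolding vec_word_def using lw nw sw by blast
    fix v assume "mset v = mset ?w"
    then show "vec_word m n (m * (n + 1)) (card J) v"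
      using * nodd_mset mset_eq_setD mset_eq_length unfolding vec_word_def by metis
  qed
  show "filling_cotensor (lambda_g m n) (gfill m n J) \<in> const_tensors (cov_word m n ((m + 1) * n) (card J + n))"
    unfolding filling_cotensor_def lambda_g_def
  proof (rule const_tensors_young(2)[OF _ lv])
    show *: "cov_word m n ((m + 1) * n) (card J + n) ?v" unfolding cov_word_def using lv nv sw by blast
    fix v assume "mset v = mset ?v"
    then show "cov_word m n ((m + 1) * n) (card J + n) v"
      using * nodd_mset mset_eq_setD mset_eq_length unfolding cov_word_def by metis
  qed
qed

lemma b_tilde_expand:
  "(b_tilde m n :: 'k::field_char_0 tensor) =
    (\<Sum>J\<in>Pow {..<m * n}. h_scaled m n (hfill m n J) (gfill m n J) * g_dual_scaled m n (gfill m n J))"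
proof -
  let ?F = "\<lambda>(\<phi>, \<psi>). h_scaled m n \<phi> \<psi> * g_dual_scaled m n \<psi> :: 'k tensor"
  have "(\<Sum>J\<in>Pow {..<m * n}. ?F (hfill m n J, gfill m n J)) = sum ?F (filling_pairs m n)"
    by (rule sum.reindex_bij_betw[OF bij_betw_fillings])
  then show ?thesis by (simp add: b_tilde_def)
qed

lemma b_tilde_const: "(b_tilde m n :: 'k::field_char_0 tensor) \<in> const_tensors (b_word m n)"
  unfolding b_tilde_expand
proof (rule const_tensors_sum)
  fix J assume "J \<in> Pow {..<m * n}"
  then have J: "J \<subseteq> {..<m * n}" by simp
  show "h_scaled m n (hfill m n J) (gfill m n J) * g_dual_scaled m n (gfill m n J) \<in> const_tensors (b_word m n)"
    unfolding h_scaled_def g_dual_scaled_def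
  proof (rule const_tensors_mono[OF const_tensors_mult[OF
        const_tensors_scal[OF filling_tensor_const(1)[OF J]] const_tensors_scal[OF filling_tensor_const(2)[OF J]]]])
    fix w assume "\<exists>u v. w = u @ v \<and> vec_word m n (m * (n + 1)) (card J) u \<and> cov_word m n ((m + 1) * n) (card J + n) v"
    then obtain u v where w: "w = u @ v" "set u \<subseteq> Vec ` Omega m n" "length u = m * (n + 1)" "nodd u = card J"
        "set v \<subseteq> Cov ` Omega m n" "length v = (m + 1) * n" "nodd v = card J + n"
      by (auto simp: vec_word_def cov_word_def)
    obtain us vs where uv: "u = map Vec us" "set us \<subseteq> Omega m n" "v = map Cov vs" "set vs \<subseteq> Omega m n"
    proof (rule that)
      show "u = map Vec (map (\<lambda>c. case c of Vec b \<Rightarrow> b | Cov b \<Rightarrow> b) u)"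
        using w(2) by (auto simp: map_idI[symmetric] intro!: map_idI[symmetric])
      show "v = map Cov (map (\<lambda>c. case c of Vec b \<Rightarrow> b | Cov b \<Rightarrow> b) v)"
        using w(5) by (auto intro!: map_idI[symmetric])
    qed (use w in auto)
    have "nodd w + n = 2 * (card J + n)" using w by simp
    then have "even (nodd w + n)" by simp
    with w uv show "b_word m n w" unfolding b_word_def by (metis length_map)
  qed
qed

lemma b_tilde_mixed: "(b_tilde m n :: 'k::field_char_0 tensor) \<in> mixed_tensors m n (m * (n + 1)) ((m + 1) * n)"
  unfolding mixed_tensors_def tsupp_iff mem_Collect_eq Ball_def
proof (intro allI impI)
  fix w assume "tcoeff (b_tilde m n :: 'k tensor) w \<noteq> 0"
  then have "b_word m n w" using b_tilde_const[of m n, where 'k = 'k] by (simp add: const_tensors_def)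
  then show "\<exists>us vs. w = map Vec us @ map Cov vs \<and> set us \<subseteq> Omega m n \<and> set vs \<subseteq> Omega m n \<and>
      length us = m * (n + 1) \<and> length vs = (m + 1) * n"
    unfolding b_word_def by (rule conjunct1)
qed

lemma b_tilde_grade: "(b_tilde m n :: 'k::field_char_0 tensor) \<in> tensor_grade n"
  unfolding tensor_grade_def mem_Collect_eq
proof
  fix w
  show "tcoeff (b_tilde m n :: 'k tensor) w \<in> G_grade (nodd w + n)"
  proof (cases "tcoeff (b_tilde m n :: 'k tensor) w = 0")
    case False
    then have "even (nodd w + n)" "tcoeff (b_tilde m n :: 'k tensor) w \<in> range gconst"
      using b_tilde_const[of m n, where 'k = 'k] by (auto simp: const_tensors_def b_word_def)
    then show ?thesis by auto
  qed simp
qed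

section \<open>Symmetry and polarization of \<open>b_tilde\<close>\<close>

text \<open>Acting from the left, the row sum is the outer factor of \<open>e_T\<close> and absorbs
  \<pi>.\<close>

lemma ev_young_left_symmetric:
  assumes \<phi>: "graded \<phi>" and x: "tlen (r * c) x" and \<pi>: "\<pi> \<in> grid.C (\<lambda>s. s div c) (r * c)"
  shows "ev (\<lambda>s. \<phi> (\<pi> s)) (young_left (replicate r c) x) = ev \<phi> (young_left (replicate r c) x)"
proof -
  interpret F: grid "\<lambda>s. s mod c" "\<lambda>s. s div c" c r "r * c" by (rule grid_columns)
  have \<phi>': "graded (\<lambda>s. \<phi> (\<pi> s))" using \<phi> by (simp add: graded_def)
  have "(\<Sum>\<tau>\<in>F.C. of_int (sign \<sigma>) * ev (\<lambda>s. \<phi> (\<pi> (\<tau> (\<sigma> s)))) x) =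
      (\<Sum>\<tau>\<in>F.C. of_int (sign \<sigma>) * ev (\<lambda>s. \<phi> (\<tau> (\<sigma> s))) x)" for \<sigma>
    using sum.reindex_bij_betw[OF F.bij_C_left[OF \<pi>], of "\<lambda>\<tau>. of_int (sign \<sigma>) * ev (\<lambda>s. \<phi> (\<tau> (\<sigma> s))) x"]
    by simp
  then show ?thesis unfolding ev_young_left[OF \<phi> x] ev_young_left[OF \<phi>' x] by simp
qed

text \<open>Acting from the right, the signed column sum is the outer factor of \<open>e_T\<close>;
  absorbing \<pi> costs its sign.\<close>

lemma ev_young_right_alternating:
  assumes \<phi>: "graded \<phi>" and x: "tlen (r * c) x" and \<pi>: "\<pi> \<in> grid.C (\<lambda>s. s mod c) (r * c)"
  shows "ev (\<lambda>s. \<phi> (\<pi> s)) (young_right (replicate r c) x) = of_int (sign \<pi>) * ev \<phi> (young_right (replicate r c) x)"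
proof -
  interpret G: grid "\<lambda>s. s div c" "\<lambda>s. s mod c" r c "r * c" by (rule grid_rows)
  have \<phi>': "graded (\<lambda>s. \<phi> (\<pi> s))" using \<phi> by (simp add: graded_def)
  let ?row = "grid.C (\<lambda>s. s div c) (r * c)"
  let ?f = "\<lambda>\<sigma>. \<Sum>\<tau>\<in>?row. of_int (sign \<sigma>) * ev (\<lambda>s. \<phi> (\<pi> (inv_into UNIV \<sigma> (inv_into UNIV \<tau> s)))) x"
  have "sum ?f G.C = (\<Sum>\<sigma>\<in>G.C. ?f (\<sigma> \<circ> \<pi>))"
    by (rule sum.reindex_bij_betw[OF G.bij_C_right[OF \<pi>], symmetric])
  also have "\<dots> = (\<Sum>\<sigma>\<in>G.C. of_int (sign \<pi>) *
      (\<Sum>\<tau>\<in>?row. of_int (sign \<sigma>) * ev (\<lambda>s. \<phi> (inv_into UNIV \<sigma> (inv_into UNIV \<tau> s))) x))"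
  proof (rule sum.cong[OF refl])
    fix \<sigma> assume \<sigma>: "\<sigma> \<in> G.C"
    note p\<sigma> = G.C_permutes[OF \<sigma>] and p\<pi> = G.C_permutes[OF \<pi>]
    have sgn: "sign (\<sigma> \<circ> \<pi>) = sign \<pi> * sign \<sigma>"
      using sign_compose[OF permutes_imp_permutation[OF _ p\<sigma>] permutes_imp_permutation[OF _ p\<pi>]] by (simp add: mult.commute)
    have "\<pi> (inv_into UNIV (\<sigma> \<circ> \<pi>) t) = inv_into UNIV \<sigma> t" for t
      using o_inv_distrib[OF permutes_bij[OF p\<sigma>] permutes_bij[OF p\<pi>]] permutes_inverses(1)[OF p\<pi>] by simp
    then show "?f (\<sigma> \<circ> \<pi>) = of_int (sign \<pi>) *
        (\<Sum>\<tau>\<in>?row. of_int (sign \<sigma>) * ev (\<lambda>s. \<phi> (inv_into UNIV \<sigma> (inv_into UNIV \<tau> s))) x)"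
      by (simp add: sgn sum_distrib_left mult.assoc)
  qed
  finally show ?thesis
    unfolding ev_young_right[OF \<phi> x] ev_young_right[OF \<phi>' x] sum_distrib_left[symmetric] by simp
qed

lemma tlen_filling:
  "tlen (r * c) (tword (map (\<lambda>x. Vec (\<phi> x)) (boxes (replicate r c))))"
  "tlen (r * c) (tword (map (\<lambda>x. Cov (\<phi> x)) (boxes (replicate r c))))"
  using tlen_tword[of "map (\<lambda>x. Vec (\<phi> x)) (boxes (replicate r c))"]
    tlen_tword[of "map (\<lambda>x. Cov (\<phi> x)) (boxes (replicate r c))"] by (simp_all add: boxes_replicate)

lemma EV_b_tilde_product:
  fixes x y :: "nat \<Rightarrow> letter \<Rightarrow> 'k::field_char_0 grassmann"
  assumes xy: "graded x" "cograded y" "odd_params \<theta>"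
  shows "EV (m * (n + 1)) x y \<theta> (b_tilde m n) = (\<Sum>J\<in>Pow {..<m * n}.
    (gconst (1 / alpha m n (hfill m n J) (gfill m n J)) * ev x (filling_tensor (lambda_h m n) (hfill m n J))) *
    (gconst (1 / gbody (pairing (filling_cotensor (lambda_g m n) (gfill m n J)) (filling_tensor (lambda_g m n) (gfill m n J)))) *
      ev (\<lambda>s b. y s b * \<theta> s) (filling_cotensor (lambda_g m n) (gfill m n J))))"
  unfolding b_tilde_expand EV_sum
proof (rule sum.cong[OF refl])
  fix J
  have w: "tlen (m * (n + 1)) (filling_tensor (lambda_h m n) (hfill m n J) :: 'k tensor)"
    unfolding filling_tensor_def lambda_h_def by (rule tlen_young_left[OF tlen_filling(1)])
  show "EV (m * (n + 1)) x y \<theta> (h_scaled m n (hfill m n J) (gfill m n J) * g_dual_scaled m n (gfill m n J)) =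
    (gconst (1 / alpha m n (hfill m n J) (gfill m n J)) * ev x (filling_tensor (lambda_h m n) (hfill m n J))) *
    (gconst (1 / gbody (pairing (filling_cotensor (lambda_g m n) (gfill m n J)) (filling_tensor (lambda_g m n) (gfill m n J)))) *
      ev (\<lambda>s b. y s b * \<theta> s) (filling_cotensor (lambda_g m n) (gfill m n J)))"
    unfolding h_scaled_def g_dual_scaled_def EV_mult[OF xy tlen_scal_mult[OF w]]
      ev_scal_mult[OF xy(1)] ev_scal_mult[OF graded_cograded_mult[OF xy(2,3)]] ..
qed

lemma EV_b_tilde_symmetric_x:
  fixes x y :: "nat \<Rightarrow> letter \<Rightarrow> 'k::field_char_0 grassmann"
  assumes xy: "graded x" "cograded y" "odd_params \<theta>"
    and \<pi>: "\<pi> \<in> grid.C (\<lambda>s. s div (n + 1)) (m * (n + 1))"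
  shows "EV (m * (n + 1)) (\<lambda>s. x (\<pi> s)) y \<theta> (b_tilde m n) = EV (m * (n + 1)) x y \<theta> (b_tilde m n)"
proof -
  have x': "graded (\<lambda>s. x (\<pi> s))" using xy(1) by (simp add: graded_def)
  have "ev (\<lambda>s. x (\<pi> s)) (filling_tensor (lambda_h m n) \<phi>) = ev x (filling_tensor (lambda_h m n) \<phi>)" for \<phi>
    unfolding filling_tensor_def lambda_h_def by (rule ev_young_left_symmetric[OF xy(1) tlen_filling(1) \<pi>])
  then show ?thesis
    unfolding EV_b_tilde_product[OF xy] EV_b_tilde_product[OF x' xy(2,3)] by simp
qed

text \<open>This is the purpose of the odd parameters: permuting coordinates and parameters together
  gives the sign of \<pi>, and permuting the parameters back gives it once more.\<close>

lemma EV_b_tilde_symmetric_y: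
  fixes x y :: "nat \<Rightarrow> letter \<Rightarrow> 'k::field_char_0 grassmann"
  assumes xy: "graded x" "cograded y" "odd_params \<theta>"
    and \<pi>: "\<pi> \<in> grid.C (\<lambda>s. s mod n) ((m + 1) * n)"
  shows "EV (m * (n + 1)) x (\<lambda>s. y (\<pi> s)) \<theta> (b_tilde m n) = EV (m * (n + 1)) x y \<theta> (b_tilde m n)"
proof -
  interpret G: grid "\<lambda>s. s div n" "\<lambda>s. s mod n" "m + 1" n "(m + 1) * n" by (rule grid_rows)
  note p\<pi> = G.C_permutes[OF \<pi>]
  let ?\<rho> = "inv_into UNIV \<pi>"
  have p\<rho>: "?\<rho> permutes {..<(m + 1) * n}" by (rule permutes_inv[OF p\<pi>])
  have y': "cograded (\<lambda>s. y (\<pi> s))" using xy(2) by (simp add: cograded_def)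
  have \<theta>': "odd_params (\<lambda>s. \<theta> (?\<rho> s))" using xy(3) by (simp add: odd_params_def)
  have sgn: "of_int (sign \<pi>) * (of_int (sign ?\<rho>) * e) = e" for e :: "'k grassmann"
  proof -
    have "sign ?\<rho> = sign \<pi>" by (rule sign_inverse[OF permutes_imp_permutation[OF _ p\<pi>]]) simp
    then show ?thesis by (simp add: sign_def)
  qed
  have "ev (\<lambda>s b. y (\<pi> s) b * \<theta> s) (filling_cotensor (lambda_g m n) \<phi>) =
      of_int (sign \<pi>) * ev (\<lambda>s b. y s b * \<theta> (?\<rho> s)) (filling_cotensor (lambda_g m n) \<phi>)" for \<phi>
    using ev_young_right_alternating[OF graded_cograded_mult[OF xy(2) \<theta>'] tlen_filling(2) \<pi>]
    unfolding filling_cotensor_def lambda_g_def by (simp only: permutes_inverses(2)[OF p\<pi>])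
  then have "EV (m * (n + 1)) x (\<lambda>s. y (\<pi> s)) \<theta> (b_tilde m n) =
      of_int (sign \<pi>) * EV (m * (n + 1)) x y (\<lambda>s. \<theta> (?\<rho> s)) (b_tilde m n)"
    unfolding EV_b_tilde_product[OF xy(1) y' xy(3)] EV_b_tilde_product[OF xy(1,2) \<theta>']
    by (simp only: sum_distrib_left mult_of_int_left_commute)
  also have "EV (m * (n + 1)) x y (\<lambda>s. \<theta> (?\<rho> s)) (b_tilde m n) =
      of_int (sign ?\<rho>) * EV (m * (n + 1)) x y \<theta> (b_tilde m n)"
    by (rule EV_permute_params[OF xy(2,3) mixed_tlen[OF b_tilde_mixed] p\<rho>])
  finally show ?thesis unfolding sgn .
qed

section \<open>Multilinearity and separation of mixed tensors\<close>

lemma EV_multilinear_x: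
  assumes t: "tlen (p + q) t" and "finite A"
  shows "EV p (\<lambda>s b. \<Sum>a\<in>A. \<chi> s a b) y \<theta> t = (\<Sum>g\<in>{..<p} \<rightarrow>\<^sub>E A. EV p (\<lambda>s. \<chi> s (g s)) y \<theta> t)"
  unfolding EV_eq[OF t] oprod_sum[OF assms(2)] by (subst sum.swap) (simp only: sum_distrib_right)

lemma EV_multilinear_y:
  assumes t: "tlen (p + q) t" and "finite A"
  shows "EV p x (\<lambda>s b. \<Sum>a\<in>A. \<chi> s a b) \<theta> t = (\<Sum>g\<in>{..<q} \<rightarrow>\<^sub>E A. EV p x (\<lambda>s. \<chi> s (g s)) \<theta> t)"
  unfolding EV_eq[OF t] sum_distrib_right[of _ A] oprod_sum[OF assms(2)]
  by (subst sum.swap) (simp only: sum_distrib_right sum_distrib_left)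

lemma EV_zero:
  assumes t: "tlen (p + q) t"
  shows "s < p \<Longrightarrow> (\<And>b. x s b = 0) \<Longrightarrow> EV p x y \<theta> t = 0"
    and "s < q \<Longrightarrow> (\<And>b. y s b = 0) \<Longrightarrow> EV p x y \<theta> t = 0"
proof -
  show "EV p x y \<theta> t = 0" if "s < p" "\<And>b. x s b = 0"
    unfolding EV_eq[OF t] using oprod_zero[of "\<lambda>s. x s (_ ! s)" s p] that by simp
  show "EV p x y \<theta> t = 0" if "s < q" "\<And>b. y s b = 0"
    unfolding EV_eq[OF t] using oprod_zero[of "\<lambda>s. y s (_ ! (p + s)) * \<theta> s" s q] that by simp
qed

lemma EV_cong:
  assumes t: "tlen (p + q) t" and "\<And>s. s < p \<Longrightarrow> x s = x' s" "\<And>s. s < q \<Longrightarrow> y s = y' s"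
  shows "EV p x y \<theta> t = EV p x' y' \<theta> t"
  unfolding EV_eq[OF t] by (rule sum.cong[OF refl]) (simp add: assms(2,3))

text \<open>Points with body zero already separate tensors, because every test coordinate is a
  nonempty monomial. It is this class of points that a base point with body 1 can be added
  to.\<close>

lemma EV_faithful:
  fixes t :: "'k::comm_ring_1 tensor"
  assumes t: "tlen (p + q) t"
    and zero: "\<And>x y \<theta>. (\<And>s b. x s b \<in> G_grade (of_bool (letter_odd b)) \<and> gbody (x s b) = 0) \<Longrightarrow>
      (\<And>s b. y s b \<in> G_grade (of_bool (\<not> letter_odd b)) \<and> gbody (y s b) = 0) \<Longrightarrow> odd_params \<theta> \<Longrightarrow> EV p x y \<theta> t = 0"
  shows "t = 0"
proof (rule tensor_eqI, rule ccontr)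
  fix w assume "tcoeff t w \<noteq> tcoeff 0 w"
  then have w: "tcoeff t w \<noteq> 0" by simp
  then have l: "length w = p + q" using t by (simp add: tlen_def tsupp_iff)
  obtain N where N: "tcoeff t w \<in> G_sub {..<N}" using G_sub_bound by blast
  \<comment> \<open>Three indices are reserved for each slot, two for the coordinate and the third
    for the odd parameter. Beyond the first \<open>p\<close> slots the parity of the coordinate is
    opposite to that of the letter.\<close>
  define S where "S s = (if letter_odd (w ! s) \<longleftrightarrow> s < p then {|N + 3 * s|} else {|N + 3 * s, N + 3 * s + 1|})" for s
  define T where "T s = (if s < p then {||} else {|N + 3 * s + 2|})" for s
  define x :: "nat \<Rightarrow> letter \<Rightarrow> 'k grassmann" where "x = (\<lambda>s c. if c = w ! s \<and> s < p then gmono (S s) else 0)"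
  define y :: "nat \<Rightarrow> letter \<Rightarrow> 'k grassmann" where "y = (\<lambda>s c. if c = w ! (p + s) then gmono (S (p + s)) else 0)"
  define \<theta> :: "nat \<Rightarrow> 'k grassmann" where "\<theta> = (\<lambda>s. gmono (T (p + s)))"
  have body: "gbody (gmono (S s) :: 'k grassmann) = 0" for s by (rule gbody_gmono) (simp add: S_def)
  have "EV p x y \<theta> t = 0"
  proof (rule zero)
    show "x s b \<in> G_grade (of_bool (letter_odd b)) \<and> gbody (x s b) = 0" for s b
      by (auto simp: x_def body) (auto simp: S_def gmono_grade fcard.rep_eq)
    show "y s b \<in> G_grade (of_bool (\<not> letter_odd b)) \<and> gbody (y s b) = 0" for s b
      by (auto simp: y_def body) (auto simp: S_def gmono_grade fcard.rep_eq)
    show "odd_params \<theta>" by (auto simp: odd_params_def \<theta>_def T_def gmono_grade fcard.rep_eq)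
  qed
  moreover have "EV p x y \<theta> t = ev (\<lambda>s c. if c = w ! s then gmono (S s) * gmono (T s) else 0) t"
    unfolding EV_def
  proof (rule ev_cong[OF t])
    fix s c
    show "(if s < p then x s c else y (s - p) c * \<theta> (s - p)) = (if c = w ! s then gmono (S s) * gmono (T s) else 0)"
    proof (cases "s < p")
      case False
      then have "p + (s - p) = s" by simp
      with False show ?thesis by (simp only: y_def \<theta>_def) simp
    qed (simp add: x_def T_def)
  qed
  ultimately have "oprod (\<lambda>s. gmono (S s) * gmono (T s)) (length w) * tcoeff t w = 0"
    using ev_dual_word[of w t "\<lambda>s. gmono (S s) * gmono (T s)"] t l by simp
  then have "tcoeff t w = 0"
    by (rule oprod_gmono_mult_eq_zero[OF _ N]) (auto simp: S_def T_def)
  with w show False ..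
qed

text \<open>A perturbation of the identity matrix with body zero has body 1, so X is invertible at
  every diagonal point that polarization uses.\<close>

lemma diagonal_graded:
  assumes "\<And>k b. z k b - of_bool (b = Vec (Ev k)) \<in> {e \<in> G_grade (of_bool (letter_odd b)). gbody e = 0}"
  shows "graded z" "det (map_mat gbody (pt_X m z)) \<noteq> 0"
proof -
  show "graded z"
    unfolding graded_def
  proof (intro allI)
    fix s b
    have "z s b - of_bool (b = Vec (Ev s)) \<in> G_grade (of_bool (letter_odd b))" using assms by blast
    moreover have "of_bool (b = Vec (Ev s)) \<in> G_grade (of_bool (letter_odd b))" by (cases "b = Vec (Ev s)") simp_all
    ultimately have "z s b - of_bool (b = Vec (Ev s)) + of_bool (b = Vec (Ev s)) \<in> G_grade (of_bool (letter_odd b))"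
      by (rule G_grade_add)
    then show "z s b \<in> G_grade (of_bool (letter_odd b))" by simp
  qed
  have "gbody (z k b) = of_bool (b = Vec (Ev k))" for k b
    using assms[of k b] by (cases "b = Vec (Ev k)") simp_all
  then have "map_mat gbody (pt_X m z) = 1\<^sub>m m" by (auto intro!: eq_matI simp: pt_X_def)
  then show "det (map_mat gbody (pt_X m z)) \<noteq> 0" by simp
qed

lemma diagonal_cograded:
  assumes "\<And>k b. z k b - of_bool (b = Cov (Od k)) \<in> {e \<in> G_grade (of_bool (\<not> letter_odd b)). gbody e = 0}"
  shows "cograded z" "det (map_mat gbody (pt_Y n z)) \<noteq> 0"
proof -
  show "cograded z"
    unfolding cograded_def
  proof (intro allI)
    fix s b
    have "z s b - of_bool (b = Cov (Od s)) \<in> G_grade (of_bool (\<not> letter_odd b))" using assms by blast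
    moreover have "of_bool (b = Cov (Od s)) \<in> G_grade (of_bool (\<not> letter_odd b))" by (cases "b = Cov (Od s)") simp_all
    ultimately have "z s b - of_bool (b = Cov (Od s)) + of_bool (b = Cov (Od s)) \<in> G_grade (of_bool (\<not> letter_odd b))"
      by (rule G_grade_add)
    then show "z s b \<in> G_grade (of_bool (\<not> letter_odd b))" by simp
  qed
  have "gbody (z k b) = of_bool (b = Cov (Od k))" for k b
    using assms[of k b] by (cases "b = Cov (Od k)") simp_all
  then have "map_mat gbody (pt_Y n z) = 1\<^sub>m n" by (auto intro!: eq_matI simp: pt_Y_def)
  then show "det (map_mat gbody (pt_Y n z)) \<noteq> 0" by simp
qed

section \<open>The module generated by \<open>b_tilde\<close>\<close>

lemma tlen_mult:
  assumes "tlen p x" "tlen q y"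
  shows "tlen (p + q) (x * y)"
proof -
  have "x * y = (\<Sum>u\<in>tsupp x. tword u * scal (tcoeff x u)) * (\<Sum>v\<in>tsupp y. tword v * scal (tcoeff y v))"
    by (simp flip: tensor_expand)
  also have "\<dots> = (\<Sum>u\<in>tsupp x. \<Sum>v\<in>tsupp y. tword (u @ v) * scal ((ginvol ^^ nodd v) (tcoeff x u) * tcoeff y v))"
    by (simp only: sum_product tword_scal_mult)
  also have "tlen (p + q) \<dots>"
  proof (intro tlen_sum tlen_mult_scal)
    fix u v assume "u \<in> tsupp x" "v \<in> tsupp y"
    then have "length (u @ v) = p + q" using assms by (simp add: tlen_def)
    then show "tlen (p + q) (tword (u @ v) :: 'a tensor)" using tlen_tword[of "u @ v"] by simp
  qed
  finally show ?thesis .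
qed

lemma tlen_GL_act:
  assumes \<A>: "\<A> \<in> GL m n" and x: "x \<in> mixed_tensors m n p q"
  shows "tlen (p + q) (GL_act m n \<A> x)"
  unfolding GL_act_def
proof (rule tlen_lin_ext)
  fix w assume "w \<in> tsupp x"
  with x obtain us vs where w: "w = map Vec us @ map Cov vs" "set us \<subseteq> Omega m n" "set vs \<subseteq> Omega m n"
      "length us = p" "length vs = q"
    by (rule mixed_tensors_word)
  have "tlen (length v) (prod_list (map (GL_letter m n \<A>) v))" if "set v \<subseteq> Vec ` Omega m n \<union> Cov ` Omega m n" for v
    using that
  proof (induction v)
    case Nil
    show ?case using tlen_tword[of "[]"] tlen_scal[of 1] by simp
  next
    case (Cons c v)
    then show ?case using tlen_mult[OF tlen_GL_letter[OF \<A>, of c] Cons.IH] by simp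
  qed
  moreover have "set w = Vec ` set us \<union> Cov ` set vs" unfolding w(1) by simp
  moreover have "length w = p + q" using w by simp
  ultimately show "tlen (p + q) (prod_list (map (GL_letter m n \<A>) w))" using w(2,3) by (metis image_mono Un_mono)
qed

lemma b_tilde_semi_invariant:
  fixes \<A> :: "'k::field_char_0 tensor \<Rightarrow> 'k tensor"
  assumes \<A>: "\<A> \<in> GL m n"
  shows "GL_act m n \<A> (b_tilde m n) = scal (Ber m (matrix_of m n \<A>)) * b_tilde m n"
proof -
  let ?p = "m * (n + 1)" and ?q = "(m + 1) * n"
  interpret F: grid "\<lambda>s. s mod (n + 1)" "\<lambda>s. s div (n + 1)" "n + 1" m ?p by (rule grid_columns)
  interpret G: grid "\<lambda>s. s div n" "\<lambda>s. s mod n" "m + 1" n ?q by (rule grid_rows)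
  define b :: "'k tensor" where "b = b_tilde m n"
  define B where "B = Ber m (matrix_of m n \<A>)"
  \<comment> \<open>The difference inherits the symmetries of \<open>b_tilde\<close>, since the
    action of \<A> on points is the same in every slot and commutes with permutations of the
    slots.\<close>
  define t where "t = GL_act m n \<A> b - scal B * b"
  have bm: "b \<in> mixed_tensors m n ?p ?q" unfolding b_def by (rule b_tilde_mixed)
  have t: "tlen (?p + ?q) t"
    unfolding t_def by (intro tlen_diff tlen_GL_act[OF \<A> bm] tlen_scal_mult mixed_tlen[OF bm])
  have EV_t: "EV ?p x y \<theta> t = EV ?p (\<lambda>s. act_x m n \<A> (x s)) (\<lambda>s. act_y m n \<A> (y s)) \<theta> b - B * EV ?p x y \<theta> b"
    if "graded x" "cograded y" "odd_params \<theta>" for x y \<theta>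
    unfolding t_def EV_diff EV_GL_act[OF \<A> bm that] EV_scal_mult[OF that] ..
  have sym_x: "EV ?p (\<lambda>s. x (\<pi> s)) y \<theta> t = EV ?p x y \<theta> t"
    if xy: "graded x" "cograded y" "odd_params \<theta>" and \<pi>: "\<pi> \<in> F.C" for x y \<theta> \<pi>
  proof -
    have x': "graded (\<lambda>s. x (\<pi> s))" using xy(1) by (simp add: graded_def)
    show ?thesis
      unfolding EV_t[OF xy] EV_t[OF x' xy(2,3)] b_def
      using EV_b_tilde_symmetric_x[OF xy \<pi>]
        EV_b_tilde_symmetric_x[OF act_x_graded[OF \<A> xy(1)] act_y_cograded[OF \<A> xy(2)] xy(3) \<pi>] by simp
  qed
  have sym_y: "EV ?p x (\<lambda>s. y (\<pi> s)) \<theta> t = EV ?p x y \<theta> t"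
    if xy: "graded x" "cograded y" "odd_params \<theta>" and \<pi>: "\<pi> \<in> G.C" for x y \<theta> \<pi>
  proof -
    have y': "cograded (\<lambda>s. y (\<pi> s))" using xy(2) by (simp add: cograded_def)
    show ?thesis
      unfolding EV_t[OF xy] EV_t[OF xy(1) y' xy(3)] b_def
      using EV_b_tilde_symmetric_y[OF xy \<pi>]
        EV_b_tilde_symmetric_y[OF act_x_graded[OF \<A> xy(1)] act_y_cograded[OF \<A> xy(2)] xy(3) \<pi>] by simp
  qed
  let ?I = "\<lambda>b. {e \<in> G_grade (of_bool (letter_odd b)). gbody e = 0} :: 'k grassmann set"
  let ?I' = "\<lambda>b. {e \<in> G_grade (of_bool (\<not> letter_odd b)). gbody e = 0} :: 'k grassmann set"
  have diagonal: "EV ?p (\<lambda>s. z (s div (n + 1))) (\<lambda>s. z' (s mod n)) \<theta> t = 0"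
    if "\<And>k b. z k b - of_bool (b = Vec (Ev k)) \<in> ?I b" "\<And>k b. z' k b - of_bool (b = Cov (Od k)) \<in> ?I' b" "odd_params \<theta>"
    for z z' \<theta>
  proof -
    note z = diagonal_graded[OF that(1)] and z' = diagonal_cograded[OF that(2)]
    show ?thesis
      unfolding t_def EV_diff b_def B_def
      using EV_transform[OF \<A> z(1) z'(1) that(3) z(2) z'(2) b_tilde_mixed] by simp
  qed
  \<comment> \<open>The contravariant points are freed from the diagonal while the covariant ones
    still have their diagonal form.\<close>
  have x_polarized: "EV ?p x (\<lambda>s. z' (s mod n)) \<theta> t = 0"
    if x: "\<And>s b. x s b \<in> ?I b" and z': "\<And>k b. z' k b - of_bool (b = Cov (Od k)) \<in> ?I' b" and \<theta>: "odd_params \<theta>"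
    for x z' \<theta>
  proof (rule polarization[where M = "\<lambda>\<chi>. EV ?p \<chi> (\<lambda>s. z' (s mod n)) \<theta> t" and N = ?p and blk = "\<lambda>s. s div (n + 1)"
        and base = "\<lambda>k b. of_bool (b = Vec (Ev k))" and I = ?I])
    fix \<pi> assume "\<pi> permutes {..<?p}" "\<And>s. s < ?p \<Longrightarrow> \<pi> s div (n + 1) = s div (n + 1)"
    then have \<pi>: "\<pi> \<in> F.C" unfolding F.C_def by blast
    have "graded x" using x by (auto simp: graded_def)
    moreover have "cograded (\<lambda>s. z' (s mod n))"
      using diagonal_cograded(1)[OF z'] by (simp add: cograded_def)
    ultimately show "EV ?p (\<lambda>s. x (\<pi> s)) (\<lambda>s. z' (s mod n)) \<theta> t = EV ?p x (\<lambda>s. z' (s mod n)) \<theta> t"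
      by (rule sym_x[OF _ _ \<theta> \<pi>])
  next
    show "EV ?p (\<lambda>s. z (s div (n + 1))) (\<lambda>s. z' (s mod n)) \<theta> t = 0"
      if "\<And>k b. z k b - of_bool (b = Vec (Ev k)) \<in> ?I b" for z
      by (rule diagonal[OF that z' \<theta>])
  next
    show "0 \<in> ?I b" for b by simp
    show "e + e' \<in> ?I b" if "e \<in> ?I b" "e' \<in> ?I b" for b e e'
      using that by (simp add: G_grade_add)
  qed (rule EV_multilinear_x[OF t], assumption, rule EV_zero(1)[OF t], assumption, assumption,
      rule EV_cong[OF t], (blast | rule refl)+, rule x)
  \<comment> \<open>The diagonal values are now supplied by \<open>x_polarized\<close>; afterwards
    all coordinates are arbitrary ones of body zero.\<close>
  have y_polarized: "EV ?p x y \<theta> t = 0"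
    if x: "\<And>s b. x s b \<in> ?I b" and y: "\<And>s b. y s b \<in> ?I' b" and \<theta>: "odd_params \<theta>" for x y \<theta>
  proof (rule polarization[where M = "\<lambda>\<chi>. EV ?p x \<chi> \<theta> t" and N = ?q and blk = "\<lambda>s. s mod n"
        and base = "\<lambda>k b. of_bool (b = Cov (Od k))" and I = ?I'])
    fix \<pi> assume "\<pi> permutes {..<?q}" "\<And>s. s < ?q \<Longrightarrow> \<pi> s mod n = s mod n"
    then have \<pi>: "\<pi> \<in> G.C" unfolding G.C_def by blast
    have "graded x" "cograded y" using x y by (auto simp: graded_def cograded_def)
    then show "EV ?p x (\<lambda>s. y (\<pi> s)) \<theta> t = EV ?p x y \<theta> t"
      by (rule sym_y[OF _ _ \<theta> \<pi>])
  next
    show "EV ?p x (\<lambda>s. z' (s mod n)) \<theta> t = 0"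
      if "\<And>k b. z' k b - of_bool (b = Cov (Od k)) \<in> ?I' b" for z'
      by (rule x_polarized[OF x that \<theta>])
  next
    show "0 \<in> ?I' b" for b by simp
    show "e + e' \<in> ?I' b" if "e \<in> ?I' b" "e' \<in> ?I' b" for b e e'
      using that by (simp add: G_grade_add)
  qed (rule EV_multilinear_y[OF t], assumption, rule EV_zero(2)[OF t], assumption, assumption,
      rule EV_cong[OF t], (blast | rule refl)+, rule y)
  have "t = 0"
    by (rule EV_faithful[OF t]) (rule y_polarized; blast)
  then show ?thesis by (simp add: t_def b_def B_def)
qed

section \<open>Freeness and the generated module\<close>

lemma gconst_inverse: "c \<noteq> 0 \<Longrightarrow> gconst (1 / c) * gconst c = (1 :: 'k::field grassmann)"
  by (metis gconst_simps(2,4) nonzero_divide_eq_eq)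

text \<open>At X = 1, Y = 1, \<xi> = 0 and with distinct generators as entries of y and as odd
  parameters, the value is the nonzero constant \<open>b_const\<close> times a product of distinct
  generators.\<close>

lemma b_tilde_nonzero: "(b_tilde m n :: 'k::field_char_0 tensor) \<noteq> 0"
proof
  assume zero: "b_tilde m n = (0 :: 'k tensor)"
  define z :: "nat \<Rightarrow> letter \<Rightarrow> 'k grassmann" where "z = (\<lambda>k b. of_bool (b = Vec (Ev k)))"
  define z' :: "nat \<Rightarrow> letter \<Rightarrow> 'k grassmann" where "z' = (\<lambda>k b. case b of
      Vec c \<Rightarrow> 0 | Cov c \<Rightarrow> (case c of Od i \<Rightarrow> of_bool (i = k) | Ev i \<Rightarrow> gmono {|i * n + k|}))"
  define \<theta> :: "nat \<Rightarrow> 'k grassmann" where "\<theta> s = gmono {|m * n + s|}" for s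
  have gr: "graded z" "cograded z'" "odd_params \<theta>"
    by (auto simp: graded_def cograded_def odd_params_def z_def z'_def \<theta>_def gmono_grade fcard.rep_eq
        split: letter.splits basis.splits)
  have X: "pt_X m z = 1\<^sub>m m" "pt_Xi m n z = 0\<^sub>m m n" "pt_Y n z' = 1\<^sub>m n"
    by (auto intro!: eq_matI simp: pt_defs z_def z'_def)
  have one: "map_mat gbody (1\<^sub>m k :: 'k grassmann mat) = 1\<^sub>m k" for k by (auto intro!: eq_matI)
  have y: "(pt_X m z * pt_y m n z' + pt_Xi m n z * pt_Y n z') $$ (i, j) = gmono {|i * n + j|}" if "i < m" "j < n" for i j
    unfolding X using that by (simp add: left_mult_one_mat[OF pt_carrier(4)] del: index_mult_mat(1)) (simp add: pt_y_def z'_def)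
  have "0 = gconst (b_const m n) * (det_even (pt_X m z) * det_even (pt_Y n z') *
      oprod (\<lambda>s. (pt_X m z * pt_y m n z' + pt_Xi m n z * pt_Y n z') $$ (s div n, s mod n)) (m * n)) *
      oprod \<theta> ((m + 1) * n)"
    using EV_b_tilde[OF gr, of m n] unfolding zero X one by (simp add: EV_def)
  also have "oprod (\<lambda>s. (pt_X m z * pt_y m n z' + pt_Xi m n z * pt_Y n z') $$ (s div n, s mod n)) (m * n) =
      oprod (\<lambda>s. gmono {|s|}) (m * n)"
    by (rule oprod_cong[OF refl]) (simp only: y slot_coords div_mult_mod_eq)
  finally have "gconst (b_const m n) * oprod (\<lambda>s. gmono {|s|}) (m * n + (m + 1) * n) = (0 :: 'k grassmann)"
    by (simp only: oprod_add X det_even_one mult_1_left \<theta>_def mult.assoc)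
  then have "gconst (1 / b_const m n) * (gconst (b_const m n) * oprod (\<lambda>s. gmono {|s|}) (m * n + (m + 1) * n)) = (0 :: 'k grassmann)"
    by simp
  moreover have "gconst (1 / b_const m n) * gconst (b_const m n) = (1 :: 'k grassmann)"
    by (rule gconst_inverse[OF b_const_nonzero])
  ultimately have "oprod (\<lambda>s. gmono {|s|} * gmono {||}) (m * n + (m + 1) * n) * (1 :: 'k grassmann) = 0"
    by (simp add: mult.assoc[symmetric])
  then have "(1 :: 'k grassmann) = 0"
    by (rule oprod_gmono_mult_eq_zero[OF _ G_sub_one[of "{}"]]) auto
  then show False by simp
qed

text \<open>Passing a constant costs nothing, so only the common parity of the words matters when
  \<open>a\<close> changes sides.\<close>

lemma const_mult_scal:
  assumes b: "b \<in> const_tensors Q" and Q: "\<And>w. Q w \<Longrightarrow> even (nodd w + p)"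
  shows "b * scal a = scal ((ginvol ^^ p) a) * b"
proof (rule tensor_eqI)
  fix w
  show "tcoeff (b * scal a) w = tcoeff (scal ((ginvol ^^ p) a) * b) w"
  proof (cases "tcoeff b w = 0")
    case False
    then obtain c where c: "tcoeff b w = gconst c" "Q w" using b unfolding const_tensors_def by blast
    obtain j where j: "nodd w + p = j + j" using Q[OF c(2)] by (metis evenE mult_2)
    have "(ginvol ^^ nodd w) ((ginvol ^^ p) a) = (ginvol ^^ (nodd w + p)) a" by (simp add: funpow_add)
    also have "\<dots> = a" unfolding j using ginvol_funpow_inverse[of j a] by (simp add: funpow_add)
    finally show ?thesis by (simp add: tcoeff_mult_scal tcoeff_scal_mult c(1) gconst_commute)
  qed (simp add: tcoeff_mult_scal tcoeff_scal_mult)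
qed

text \<open>Some coefficient is a nonzero constant, hence a unit, and the parity automorphism is
  injective.\<close>

lemma const_scal_mult_eq_zero:
  fixes b :: "'k::field tensor"
  assumes b: "b \<in> const_tensors Q" "b \<noteq> 0" and zero: "scal a * b = 0"
  shows "a = 0"
proof -
  obtain w where w: "tcoeff b w \<noteq> 0" using b(2) tensor_eqI[of b 0] by auto
  obtain c where c: "tcoeff b w = gconst c" using b(1) w unfolding const_tensors_def by blast
  have "c \<noteq> 0" using w c by auto
  have inv: "gconst c * gconst (1 / c) = (1 :: 'k grassmann)"
    unfolding gconst_commute[of c] by (rule gconst_inverse[OF \<open>c \<noteq> 0\<close>])
  have "(ginvol ^^ nodd w) a * gconst c = 0"
    using arg_cong[OF zero, of "\<lambda>x. tcoeff x w"] by (simp only: tcoeff_scal_mult c tcoeff_simps)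
  then have "(ginvol ^^ nodd w) a * (gconst c * gconst (1 / c)) = 0" by (simp only: mult.assoc[symmetric] mult_zero_left)
  then have "(ginvol ^^ nodd w) a = 0" by (simp only: inv mult_1_right)
  moreover have "(ginvol ^^ nodd w) 0 = (0 :: 'k grassmann)" by (induction "nodd w") simp_all
  ultimately show "a = 0" using ginvol_funpow_inverse[of "nodd w" a] by simp
qed

text \<open>By semi-invariance the left multiples of \<open>b_tilde\<close> are stable under
  \<open>GL V\<close>; since \<open>b_tilde\<close> is homogeneous they are also its right
  multiples.\<close>

lemma GL_generated_b_tilde:
  "GL_generated m n (m * (n + 1)) ((m + 1) * n) (b_tilde m n) = {scal a * (b_tilde m n :: 'k::field_char_0 tensor) |a. True}"
    (is "?G = ?M")
proof -
  let ?b = "b_tilde m n :: 'k tensor" and ?p = "m * (n + 1)" and ?q = "(m + 1) * n"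
  have right: "?b * scal a = scal ((ginvol ^^ n) a) * ?b" for a
    by (rule const_mult_scal[OF b_tilde_const]) (simp add: b_word_def)
  have left: "scal a * ?b = ?b * scal ((ginvol ^^ n) a)" for a
    unfolding right ginvol_funpow_inverse ..
  have "GL_submodule m n ?p ?q ?M"
    unfolding GL_submodule_def
  proof (intro conjI ballI allI)
    show "?M \<subseteq> mixed_tensors m n ?p ?q" using mixed_scal_mult[OF b_tilde_mixed] by blast
    have "0 = scal 0 * ?b" by simp
    then show "0 \<in> ?M" by blast
    fix x assume "x \<in> ?M"
    then obtain a where x: "x = scal a * ?b" by blast
    show "x + y \<in> ?M" if y: "y \<in> ?M" for y
    proof -
      obtain a' where "y = scal a' * ?b" using y by blast
      then have "x + y = scal (a + a') * ?b" by (simp add: x distrib_right)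
      then show ?thesis by blast
    qed
    show "scal c * x \<in> ?M" for c
    proof -
      have "scal c * x = scal (c * a) * ?b" by (simp add: x scal_mult[symmetric] mult.assoc)
      then show ?thesis by blast
    qed
    show "x * scal c \<in> ?M" for c
    proof -
      have "x * scal c = scal (a * (ginvol ^^ n) c) * ?b" by (simp only: x scal_mult[symmetric] mult.assoc right)
      then show ?thesis by blast
    qed
    show "GL_act m n \<A> x \<in> ?M" if "\<A> \<in> GL m n" for \<A>
    proof -
      \<comment> \<open>The action is right linear, so the coefficient is moved to the right before
        acting and back afterwards.\<close>
      have "GL_act m n \<A> x = GL_act m n \<A> ?b * scal ((ginvol ^^ n) a)"
        unfolding x left GL_act_def by (rule lin_ext_mult_scal)
      also have "\<dots> = scal (Ber m (matrix_of m n \<A>) * a) * ?b"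
        unfolding b_tilde_semi_invariant[OF that] mult.assoc left[symmetric] scal_mult[symmetric] ..
      finally show ?thesis by blast
    qed
  qed
  moreover have "?b \<in> ?M"
  proof -
    have "?b = scal 1 * ?b" by simp
    then show ?thesis by blast
  qed
  moreover have "?M \<subseteq> M" if "GL_submodule m n ?p ?q M" "?b \<in> M" for M
    using that unfolding GL_submodule_def by blast
  ultimately show ?thesis unfolding GL_generated_def by blast
qed

theorem theorem3p1:
  fixes m n :: nat
  defines "b \<equiv> (b_tilde m n :: 'k::field_char_0 tensor)"
  shows "b \<in> mixed_tensors m n (m * (n + 1)) ((m + 1) * n) \<and>
    one_dimensional (GL_generated m n (m * (n + 1)) ((m + 1) * n) b) \<and>
    (\<forall>\<A>\<in>GL m n. GL_act m n \<A> b = scal (Ber m (matrix_of m n \<A>)) * b)"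
proof (intro conjI ballI)
  show "b \<in> mixed_tensors m n (m * (n + 1)) ((m + 1) * n)" unfolding b_def by (rule b_tilde_mixed)
  have "a = 0" if "scal a * b = 0" for a
    using that unfolding b_def by (rule const_scal_mult_eq_zero[OF b_tilde_const b_tilde_nonzero])
  moreover have "b \<in> tensor_grade n" unfolding b_def by (rule b_tilde_grade)
  ultimately show "one_dimensional (GL_generated m n (m * (n + 1)) ((m + 1) * n) b)"
    unfolding one_dimensional_def GL_generated_b_tilde[of m n, where 'k = 'k, folded b_def] by blast
  show "GL_act m n \<A> b = scal (Ber m (matrix_of m n \<A>)) * b" if "\<A> \<in> GL m n" for \<A>
    unfolding b_def by (rule b_tilde_semi_invariant[OF that])
qed

end
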